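(* Let $\mathcal{G}=(\mathcal{E},\mathcal{A},\{Q_a\},\mathbf{m}_0,\{c_a\},\beta)$ be a discrete mean field game and, for each $N\ge1$, let $\mathcal{G}^N$ be the associated stochastic $N$-player game. Assume that for all $i,j\in\mathcal{E}$, $a\in\mathcal{A}$ the function $\mathbf{m}\mapsto Q_{ija}(\mathbf{m})$ is Lipschitz-continuous and $\mathbf{m}\mapsto c_{i,a}(\mathbf{m})$ is continuous on $\mathcal{P}(\mathcal{E})$. Then: (i) Let $\pi$ be a mean field equilibrium of $\mathcal{G}$. For every $\varepsilon>0$ there exists $N_0$ such that for all $N\ge N_0$, $\pi$ is a local $\varepsilon$-equilibrium of the $N$-player game $\mathcal{G}^N$. (ii) Let $(\pi^N)_{N\in\mathbb{N}}$ be a sequence of local strategies such that $\pi^N$ is a local $\varepsilon_N$-equilibrium of the $N$-player game $\mathcal{G}^N$, with $\varepsilon_N\to0$. Then any sub-sequence of $(\pi^N)$ has a sub-sequence that converges weakly to a mean field equilibrium of $\mathcal{G}$.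
   Context: **Mean field game.** $\mathcal{E}=\{1,\dots,E\}$ is a finite state set, $\mathcal{A}=\{1,\dots,A\}$ a finite action set, and $\mathcal{P}(\cdot)$ denotes the set of probability measures on a finite set. $\mathbf{m}_0\in\mathcal{P}(\mathcal{E})$ and $\beta>0$. For each $\mathbf{m}\in\mathcal{P}(\mathcal{E})$ and $a$, $Q_a(\mathbf{m})=(Q_{ija}(\mathbf{m}))_{i,j}$ is a rate matrix: $Q_{ija}(\mathbf{m})\ge0$ for $j\ne i$, $\sum_jQ_{ija}(\mathbf{m})=0$. The costs are functions $c_{i,a}:\mathcal{P}(\mathcal{E})\to\mathbb{R}$. A strategy is a measurable function $\pi:\mathcal{E}\times\mathbb{R}^+\to\mathcal{P}(\mathcal{A})$; $\pi_{i,a}(t)$ is the probability of taking action $a$ in state $i$ at time $t$; $\mathcal{S}$ is the set of strategies. For $\pi\in\mathcal{S}$, $\mathbf{m}^\pi$ is the unique continuous solution (in integral form) of $\dot m^\pi_j(t)=\sum_{i,a}m^\pi_i(t)Q_{ija}(\mathbf{m}^\pi(t))\pi_{i,a}(t)$, $\mathbf{m}^\pi(0)=\mathbf{m}_0$. For $\pi^0\in\mathcal{S}$, $\mathbf{x}=\mathbf{x}^{\pi^0,\mathbf{m}^\pi}$ is the unique solution (in integral form) of $\dot x_j(t)=\sum_{i,a}x_i(t)Q_{ija}(\mathbf{m}^\pi(t))\pi^0_{i,a}(t)$, $\mathbf{x}(0)=\mathbf{m}_0$, and $$V(\pi^0,\pi)=\int_0^\infty\sum_{i,a}x_i(t)\,c_{i,a}(\mathbf{m}^\pi(t))\,\pi^0_{i,a}(t)\,e^{-\beta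 t}\,dt.$$ A mean field equilibrium is $\pi\in\mathcal{S}$ with $V(\pi,\pi)\le V(\pi^0,\pi)$ for all $\pi^0\in\mathcal{S}$. **Weak convergence.** $\pi^n\to\pi$ weakly in $\mathcal{S}$ if $\lim_n\int_0^\infty\pi^n_{i,a}(t)g(t)e^{-\beta t}dt=\int_0^\infty\pi_{i,a}(t)g(t)e^{-\beta t}dt$ for all $i,a$ and every bounded measurable $g:\mathbb{R}^+\to\mathbb{R}$. **$N$-player game $\mathcal{G}^N$.** There are $N$ players with states $X_1(t),\dots,X_N(t)\in\mathcal{E}$; the initial states are i.i.d. with law $\mathbf{m}_0$. Let $M_i(t)=\frac1N\sum_{n=1}^N\mathbf{1}_{\{X_n(t)=i\}}$ and $\mathbf{M}(t)=(M_i(t))_{i\in\mathcal{E}}$. At each time $t$ Player $n$ chooses a (random) action $A_n(t)$. The states form a continuous-time Markov process in which each player jumps separately, with, for $i\ne j$, $\mathbb{P}(X_n(t+dt)=j\mid X_n(t)=i,\mathbf{M}(t)=\mathbf{m},A_n(t)=a,\mathcal{F}_t)=Q_{ija}(\mathbf{m})dt+o(dt)$, where $\mathcal{F}_t$ is the natural filtration. A local strategy is one in which the action depends only on time and on the player's own state: $\mathbb{P}(A_n(t)=a\mid\mathcal{F}_t)=\pi_{X_n(t),a}(t)$; local strategies are thus identified with elements $\pi\in\mathcal{S}$, and under such a strategy a player in state $i$ jumps to $j\neq i$ at rate $\sum_a\pi_{i,a}(t)Q_{ija}(\mathbf{M}(t))$. When Player $n$ uses $\pi^n$ and all other players use $\pi$,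 the expected discounted cost of Player $n$ is $V^N(\pi^n,\pi)=\mathbb{E}\big[\int_0^\infty e^{-\beta t}c_{X_n(t),A_n(t)}(\mathbf{M}(t))\,dt\big]$. For $\varepsilon\ge0$, a local strategy $\pi$ is a local $\varepsilon$-equilibrium of $\mathcal{G}^N$ if $V^N(\pi,\pi)\le V^N(\pi^n,\pi)+\varepsilon$ for every local strategy $\pi^n$. *)

theory Defs
  imports "HOL-Probability.Probability"
begin

section \<open>Mean field games\<close>

definition prob_simplex :: "(real ^ 'n) set" where
  "prob_simplex = {p. (\<forall>i. 0 \<le> p $ i) \<and> (\<Sum>i\<in>UNIV. p $ i) = 1}"

text \<open>
  The state and action sets are finite types; probability measures on them are vectors in
  \<open>prob_simplex\<close>. \<open>rate G i j a m\<close> is the rate of jumping from \<open>i\<close> to \<open>j\<close> under action \<open>a\<close>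
  when the population distribution is \<open>m\<close>, i.e. \<open>Q\<^sub>i\<^sub>j\<^sub>a(m)\<close>; rates and costs are meaningful only for
  \<open>m\<close> in \<open>prob_simplex\<close>.
\<close>

record ('e, 'a) mfg =
  rate :: "'e \<Rightarrow> 'e \<Rightarrow> 'a \<Rightarrow> real ^ 'e \<Rightarrow> real"
  cost :: "'e \<Rightarrow> 'a \<Rightarrow> real ^ 'e \<Rightarrow> real"
  init :: "real ^ 'e"
  discount :: real

definition mean_field_game :: "('e::finite, 'a::finite) mfg \<Rightarrow> bool" where
  "mean_field_game G \<longleftrightarrow>
     init G \<in> prob_simplex \<and> 0 < discount G \<and>
     (\<forall>m\<in>prob_simplex. \<forall>i a.
        (\<forall>j. j \<noteq> i \<longrightarrow> 0 \<le> rate G i j a m) \<and> (\<Sum>j\<in>UNIV. rate G i j a m) = 0)"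

text \<open>Time is a real number; values at negative times are never used.\<close>

type_synonym ('e, 'a) strategy = "'e \<Rightarrow> real \<Rightarrow> real ^ 'a"

definition strategies :: "('e::finite, 'a::finite) strategy set" where
  "strategies =
     {\<pi>. \<forall>i. \<pi> i \<in> borel_measurable (restrict_space borel {0..}) \<and>
          (\<forall>t\<ge>0. \<pi> i t \<in> prob_simplex)}"

text \<open>
  The condition that \<open>m\<close> stays in \<open>prob_simplex\<close> is part of being a solution, since the rates
  are functions on \<open>prob_simplex\<close> only.
\<close>

definition is_population_flow ::
  "('e::finite, 'a::finite) mfg \<Rightarrow> ('e, 'a) strategy \<Rightarrow> (real \<Rightarrow> real ^ 'e) \<Rightarrow> bool" where
  "is_population_flow G \<pi> m \<longleftrightarrow>
     continuous_on {0..} m \<and> (\<forall>t\<ge>0. m t \<in> prob_simplex) \<and>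
     (\<forall>t\<ge>0. \<forall>j.
        ((\<lambda>s. \<Sum>i\<in>UNIV. \<Sum>a\<in>UNIV. m s $ i * rate G i j a (m s) * \<pi> i s $ a)
           has_integral (m t $ j - init G $ j)) {0..t})"

text \<open>The solution is unique on \<open>{0..}\<close>, so the choice only affects negative times.\<close>

definition population_flow ::
  "('e::finite, 'a::finite) mfg \<Rightarrow> ('e, 'a) strategy \<Rightarrow> real \<Rightarrow> real ^ 'e" where
  "population_flow G \<pi> = (SOME m. is_population_flow G \<pi> m)"

definition is_player_flow ::
  "('e::finite, 'a::finite) mfg \<Rightarrow> ('e, 'a) strategy \<Rightarrow> (real \<Rightarrow> real ^ 'e) \<Rightarrow>
   (real \<Rightarrow> real ^ 'e) \<Rightarrow> bool" where
  "is_player_flow G \<pi>0 m x \<longleftrightarrow>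
     continuous_on {0..} x \<and>
     (\<forall>t\<ge>0. \<forall>j.
        ((\<lambda>s. \<Sum>i\<in>UNIV. \<Sum>a\<in>UNIV. x s $ i * rate G i j a (m s) * \<pi>0 i s $ a)
           has_integral (x t $ j - init G $ j)) {0..t})"

definition player_flow ::
  "('e::finite, 'a::finite) mfg \<Rightarrow> ('e, 'a) strategy \<Rightarrow> (real \<Rightarrow> real ^ 'e) \<Rightarrow>
   real \<Rightarrow> real ^ 'e" where
  "player_flow G \<pi>0 m = (SOME x. is_player_flow G \<pi>0 m x)"

definition mf_value ::
  "('e::finite, 'a::finite) mfg \<Rightarrow> ('e, 'a) strategy \<Rightarrow> ('e, 'a) strategy \<Rightarrow> real" where
  "mf_value G \<pi>0 \<pi> =
     (let m = population_flow G \<pi>; x = player_flow G \<pi>0 m in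
      LINT t:{0..}|lborel.
        (\<Sum>i\<in>UNIV. \<Sum>a\<in>UNIV. x t $ i * cost G i a (m t) * \<pi>0 i t $ a) * exp (- discount G * t))"

definition mean_field_equilibrium ::
  "('e::finite, 'a::finite) mfg \<Rightarrow> ('e, 'a) strategy \<Rightarrow> bool" where
  "mean_field_equilibrium G \<pi> \<longleftrightarrow>
     \<pi> \<in> strategies \<and> (\<forall>\<pi>0\<in>strategies. mf_value G \<pi> \<pi> \<le> mf_value G \<pi>0 \<pi>)"

definition weakly_converges ::
  "real \<Rightarrow> (nat \<Rightarrow> ('e::finite, 'a::finite) strategy) \<Rightarrow> ('e, 'a) strategy \<Rightarrow> bool" where
  "weakly_converges \<beta> \<pi>s \<pi> \<longleftrightarrow>
     (\<forall>i a g. g \<in> borel_measurable (restrict_space borel {0..}) \<and> bounded (g ` {0..}) \<longrightarrow>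
        (\<lambda>n. LINT t:{0..}|lborel. \<pi>s n i t $ a * g t * exp (- \<beta> * t))
          \<longlonglongrightarrow> (LINT t:{0..}|lborel. \<pi> i t $ a * g t * exp (- \<beta> * t)))"


section \<open>The \<open>N\<close>-player game\<close>

text \<open>Players are numbered \<open>0, \<dots>, N - 1\<close>.\<close>

definition configs :: "nat \<Rightarrow> (nat \<Rightarrow> 'e) set" where
  "configs N = ({..<N} \<rightarrow>\<^sub>E UNIV)"

definition empirical :: "nat \<Rightarrow> (nat \<Rightarrow> 'e::finite) \<Rightarrow> real ^ 'e" where
  "empirical N x = (\<chi> i. real (card {n. n < N \<and> x n = i}) / real N)"

text \<open>
  Rate at which player \<open>n\<close> jumps to \<open>j\<close> at time \<open>t\<close> in configuration \<open>x\<close>, when each player \<open>k\<close>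
  uses the local strategy \<open>\<sigma> k\<close>: the rates of the actions averaged over the law of the action.
\<close>

definition jump_rate ::
  "('e::finite, 'a::finite) mfg \<Rightarrow> nat \<Rightarrow> (nat \<Rightarrow> ('e, 'a) strategy) \<Rightarrow>
   nat \<Rightarrow> real \<Rightarrow> (nat \<Rightarrow> 'e) \<Rightarrow> 'e \<Rightarrow> real" where
  "jump_rate G N \<sigma> n t x j =
     (\<Sum>a\<in>UNIV. \<sigma> n (x n) t $ a * rate G (x n) j a (empirical N x))"

text \<open>
  Rate matrix of the joint process. Only one player moves at a time, and the diagonal entries
  are minus the total jump rates.
\<close>

definition config_rate ::
  "('e::finite, 'a::finite) mfg \<Rightarrow> nat \<Rightarrow> (nat \<Rightarrow> ('e, 'a) strategy) \<Rightarrow>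
   real \<Rightarrow> (nat \<Rightarrow> 'e) \<Rightarrow> (nat \<Rightarrow> 'e) \<Rightarrow> real" where
  "config_rate G N \<sigma> t x y =
     (\<Sum>n<N. \<Sum>j\<in>UNIV - {x n}.
        jump_rate G N \<sigma> n t x j * (of_bool (y = x(n := j)) - of_bool (y = x)))"

definition natural_filtration ::
  "'w measure \<Rightarrow> (real \<Rightarrow> 'w \<Rightarrow> 'c) \<Rightarrow> real \<Rightarrow> 'w set set" where
  "natural_filtration \<Omega> Z s =
     sigma_sets (space \<Omega>) {Z u -` B \<inter> space \<Omega> | u B. 0 \<le> u \<and> u \<le> s}"

text \<open>
  \<open>Z t \<omega> n\<close> is the state of player \<open>n\<close> at time \<open>t\<close>. Strategies are only measurable in time, so
  the description of the jumps by \<open>P(X(t + dt) = j | F\<^sub>t) = rate dt + o(dt)\<close> is read in integral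
  form, like the differential equations of the mean field game: \<open>Z\<close> is a Markov process with
  respect to its natural filtration, and its transition probabilities \<open>p s t x y\<close> satisfy
  Kolmogorov's forward equation with matrix \<open>config_rate\<close>. As this linear equation has a unique
  solution, the finite-dimensional distributions of \<open>Z\<close> are determined.
\<close>

definition nplayer_process ::
  "('e::finite, 'a::finite) mfg \<Rightarrow> nat \<Rightarrow> (nat \<Rightarrow> ('e, 'a) strategy) \<Rightarrow>
   'w measure \<Rightarrow> (real \<Rightarrow> 'w \<Rightarrow> nat \<Rightarrow> 'e) \<Rightarrow> bool" where
  "nplayer_process G N \<sigma> \<Omega> Z \<longleftrightarrow>
     prob_space \<Omega> \<and>
     (\<forall>t\<ge>0. Z t \<in> \<Omega> \<rightarrow>\<^sub>M count_space (configs N)) \<and>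
     (\<forall>\<omega>\<in>space \<Omega>.
        (\<forall>t\<ge>0. \<forall>\<^sub>F s in at_right t. Z s \<omega> = Z t \<omega>) \<and>
        (\<forall>t>0. \<exists>x. \<forall>\<^sub>F s in at_left t. Z s \<omega> = x)) \<and>
     prob_space.indep_vars \<Omega> (\<lambda>_. count_space UNIV) (\<lambda>n \<omega>. Z 0 \<omega> n) {..<N} \<and>
     (\<forall>n<N. \<forall>i. measure \<Omega> {\<omega>\<in>space \<Omega>. Z 0 \<omega> n = i} = init G $ i) \<and>
     (\<exists>p :: real \<Rightarrow> real \<Rightarrow> (nat \<Rightarrow> 'e) \<Rightarrow> (nat \<Rightarrow> 'e) \<Rightarrow> real.
        (\<forall>s t. 0 \<le> s \<and> s \<le> t \<longrightarrow>
           (\<forall>x\<in>configs N. \<forall>y\<in>configs N.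
              ((\<lambda>u. \<Sum>z\<in>configs N. p s u x z * config_rate G N \<sigma> u z y)
                 has_integral (p s t x y - of_bool (x = y))) {s..t})) \<and>
        (\<forall>s t. 0 \<le> s \<and> s \<le> t \<longrightarrow>
           (\<forall>A\<in>natural_filtration \<Omega> Z s. \<forall>y\<in>configs N.
              measure \<Omega> (A \<inter> {\<omega>\<in>space \<Omega>. Z t \<omega> = y}) =
              (\<Sum>x\<in>configs N. measure \<Omega> (A \<inter> {\<omega>\<in>space \<Omega>. Z s \<omega> = x}) * p s t x y))))"

text \<open>
  The running cost at time \<open>t\<close> is averaged over the action of player \<open>n\<close>, whose law given the
  past is \<open>\<sigma> n (Z t \<omega> n) t\<close>: actions drawn independently at each time are not jointly measurable
  in \<open>(t, \<omega>)\<close>, so the integral over time is only defined after this conditional expectation.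
\<close>

definition nplayer_cost ::
  "('e::finite, 'a::finite) mfg \<Rightarrow> nat \<Rightarrow> (nat \<Rightarrow> ('e, 'a) strategy) \<Rightarrow>
   'w measure \<Rightarrow> (real \<Rightarrow> 'w \<Rightarrow> nat \<Rightarrow> 'e) \<Rightarrow> nat \<Rightarrow> real" where
  "nplayer_cost G N \<sigma> \<Omega> Z n =
     (\<integral>\<omega>. (LINT t:{0..}|lborel. exp (- discount G * t) *
        (\<Sum>a\<in>UNIV. \<sigma> n (Z t \<omega> n) t $ a * cost G (Z t \<omega> n) a (empirical N (Z t \<omega>)))) \<partial>\<Omega>)"

text \<open>
  Expected cost of player \<open>n\<close> when it uses \<open>\<pi>'\<close> and all others use \<open>\<pi>\<close>. It depends only on the
  law of the state process, so the process is realised as the coordinate process on path space.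
\<close>

definition nplayer_value ::
  "('e::finite, 'a::finite) mfg \<Rightarrow> nat \<Rightarrow> nat \<Rightarrow> ('e, 'a) strategy \<Rightarrow> ('e, 'a) strategy \<Rightarrow> real"
  where
  "nplayer_value G N n \<pi>' \<pi> =
     (let \<sigma> = (\<lambda>_. \<pi>)(n := \<pi>') in
      THE v. \<exists>\<Omega> :: (real \<Rightarrow> nat \<Rightarrow> 'e) measure.
        nplayer_process G N \<sigma> \<Omega> (\<lambda>t \<omega>. \<omega> t) \<and> v = nplayer_cost G N \<sigma> \<Omega> (\<lambda>t \<omega>. \<omega> t) n)"

definition local_equilibrium ::
  "('e::finite, 'a::finite) mfg \<Rightarrow> nat \<Rightarrow> real \<Rightarrow> ('e, 'a) strategy \<Rightarrow> bool" where
  "local_equilibrium G N \<epsilon> \<pi> \<longleftrightarrow>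
     \<pi> \<in> strategies \<and>
     (\<forall>n<N. \<forall>\<pi>'\<in>strategies. nplayer_value G N n \<pi> \<pi> \<le> nplayer_value G N n \<pi>' \<pi> + \<epsilon>)"

end

theory Submission
  imports Defs "HOL-Complex_Analysis.Great_Picard" "HOL-Real_Asymp.Real_Asymp"
begin

text \<open>
  Everything follows from one estimate: the value of a player who uses \<open>\<pi>'\<close> against \<open>N - 1\<close> players
  using \<open>\<pi>\<close> converges to the mean field value of \<open>\<pi>'\<close> against \<open>\<pi>\<close>, uniformly in the two strategies
  and in the player (\<open>value_limit\<close>). Two applications of it turn the optimality of a mean field
  equilibrium into approximate optimality in the \<open>N\<close>-player game. For the converse, strategies are
  sequentially compact for weak convergence (\<open>strategies_weakly_compact\<close>) and mean field values are
  continuous along weakly convergent sequences (\<open>mf_value_limit_fixed_player\<close>,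
  \<open>mf_value_limit_self\<close>), so that the inequalities that define local equilibria pass to the limit.

  The estimate concerns the laws of the configuration at single times. These
  solve a linear forward equation on the finite set of configurations, and hence the expectation of
  any function \<open>f\<close> of the configuration changes at the rate given by the expectation of the generator
  applied to \<open>f\<close>. Take for \<open>f\<close> the squared distance of the empirical distribution \<open>M\<close> to the population
  flow \<open>m\<close>. Up to a term of order \<open>1/N\<close> caused by the deviating player, \<open>M\<close> drifts along the vector
  field that \<open>m\<close> follows; each jump moves \<open>M\<close> by a distance of order \<open>1/N\<close>, and jumps occur at rate of
  order \<open>N\<close>, so the fluctuations contribute another term of order \<open>1/N\<close>. The vector field is
  Lipschitz, and Gronwall's inequality bounds the mean squared distance by a multiple of \<open>1/N\<close>
  (\<open>deviation_bound\<close>). The law of the deviating player then solves the equation of the player flow up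
  to an error of order \<open>1/sqrt N\<close> (\<open>marginal_error_bound\<close>), and the discount makes late times harmless.

  The value of the \<open>N\<close>-player game is the common cost of all processes that realise the game, so such a
  process has to exist. It is built by uniformization: a Poisson clock offers every configuration at a
  rate \<open>R\<close> above all jump rates, and the offer to move from \<open>x\<close> to \<open>y\<close> is accepted with probability equal
  to the jump rate divided by \<open>R\<close>. The probability of seeing given states at given times, as a function
  of the starting time and state, solves the backward equation. Pairing it with a solution of the
  forward equation shows that it is a product of transition probabilities, which is the Markov
  property.

  Strategies are merely measurable in time, so all differential equations hold in integral form only.
  A product rule for indefinite integrals (\<open>has_integral_product_rule\<close>) and a form of Gronwall's
  inequality replace differential calculus throughout.
\<close>

section \<open>Calculus of indefinite integrals\<close>

text \<open>
  The class of integrands on bounded time intervals: it contains strategies and continuous functions,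
  is closed under arithmetic, and its members are integrable in the Lebesgue and in the gauge sense.
\<close>

definition bounded_borel_on :: "real set \<Rightarrow> (real \<Rightarrow> real) \<Rightarrow> bool" where
  "bounded_borel_on S f \<longleftrightarrow> f \<in> borel_measurable (restrict_space borel S) \<and> bounded (f ` S)"

lemma bounded_borel_onI:
  assumes "f \<in> borel_measurable (restrict_space borel S)" "\<And>t. t \<in> S \<Longrightarrow> \<bar>f t\<bar> \<le> K"
  shows "bounded_borel_on S f"
  using assms by (auto simp: bounded_borel_on_def bounded_iff)

lemma bounded_borel_on_bound:
  assumes "bounded_borel_on S f"
  obtains K where "K \<ge> 0" "\<And>t. t \<in> S \<Longrightarrow> \<bar>f t\<bar> \<le> K"
proof -
  from assms obtain K where "\<forall>t\<in>S. \<bar>f t\<bar> \<le> K"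
    by (auto simp: bounded_borel_on_def bounded_iff)
  then show ?thesis
    by (intro that[of "max K 0"]) force+
qed

lemma bounded_borel_on_measurable:
  "bounded_borel_on S f \<Longrightarrow> f \<in> borel_measurable (restrict_space borel S)"
  by (simp add: bounded_borel_on_def)

lemma bounded_borel_on_subset:
  assumes "bounded_borel_on S f" "S' \<subseteq> S"
  shows "bounded_borel_on S' f"
  unfolding bounded_borel_on_def
proof
  show "f \<in> borel_measurable (restrict_space borel S')"
    using assms by (intro measurable_restrict_mono[of f borel S borel S']) (simp_all add: bounded_borel_on_def)
  show "bounded (f ` S')"
    using assms by (intro bounded_subset[of "f ` S" "f ` S'"]) (auto simp: bounded_borel_on_def)
qed

lemma bounded_borel_on_const [simp]: "bounded_borel_on S (\<lambda>_. c)"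
  by (rule bounded_borel_onI[of _ _ "\<bar>c\<bar>"]) auto

lemma bounded_borel_on_add:
  assumes "bounded_borel_on S f" "bounded_borel_on S g"
  shows "bounded_borel_on S (\<lambda>t. f t + g t)"
proof -
  obtain K where "\<And>t. t \<in> S \<Longrightarrow> \<bar>f t\<bar> \<le> K"
    by (rule bounded_borel_on_bound[OF assms(1)]) blast
  moreover obtain L where "\<And>t. t \<in> S \<Longrightarrow> \<bar>g t\<bar> \<le> L"
    by (rule bounded_borel_on_bound[OF assms(2)]) blast
  ultimately show ?thesis
    using assms[THEN bounded_borel_on_measurable]
    by (intro bounded_borel_onI[of _ _ "K + L"]) (auto intro!: order_trans[OF abs_triangle_ineq] add_mono)
qed

lemma bounded_borel_on_mult:
  assumes "bounded_borel_on S f" "bounded_borel_on S g"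
  shows "bounded_borel_on S (\<lambda>t. f t * g t)"
proof -
  obtain K where "K \<ge> 0" "\<And>t. t \<in> S \<Longrightarrow> \<bar>f t\<bar> \<le> K"
    by (rule bounded_borel_on_bound[OF assms(1)]) blast
  moreover obtain L where "\<And>t. t \<in> S \<Longrightarrow> \<bar>g t\<bar> \<le> L"
    by (rule bounded_borel_on_bound[OF assms(2)]) blast
  ultimately show ?thesis
    using assms[THEN bounded_borel_on_measurable]
    by (intro bounded_borel_onI[of _ _ "K * L"]) (auto simp: abs_mult intro!: mult_mono)
qed

lemma bounded_borel_on_uminus:
  assumes "bounded_borel_on S f" shows "bounded_borel_on S (\<lambda>t. - f t)"
  using bounded_borel_on_mult[OF bounded_borel_on_const[of S "-1"] assms] by simp

lemma bounded_borel_on_diff: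
  assumes "bounded_borel_on S f" "bounded_borel_on S g"
  shows "bounded_borel_on S (\<lambda>t. f t - g t)"
  using bounded_borel_on_add[OF assms(1) bounded_borel_on_uminus[OF assms(2)]] by simp

lemma bounded_borel_on_sum:
  assumes "\<And>i. i \<in> I \<Longrightarrow> bounded_borel_on S (f i)"
  shows "bounded_borel_on S (\<lambda>t. \<Sum>i\<in>I. f i t)"
  using assms
proof (induction I rule: infinite_finite_induct)
  case (insert i I)
  then show ?case
    using bounded_borel_on_add[of S "f i" "\<lambda>t. \<Sum>j\<in>I. f j t"] by simp
qed simp_all

lemma bounded_borel_on_abs:
  assumes "bounded_borel_on S f"
  shows "bounded_borel_on S (\<lambda>t. \<bar>f t\<bar>)"
proof -
  obtain K where "\<And>t. t \<in> S \<Longrightarrow> \<bar>f t\<bar> \<le> K"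
    by (rule bounded_borel_on_bound[OF assms]) blast
  then show ?thesis
    using assms[THEN bounded_borel_on_measurable] by (intro bounded_borel_onI[of _ _ K]) auto
qed

lemma bounded_borel_on_continuous:
  assumes "continuous_on S f" "compact S"
  shows "bounded_borel_on S f"
  unfolding bounded_borel_on_def
  using assms borel_measurable_continuous_on_restrict compact_continuous_image compact_imp_bounded
  by blast

lemma bounded_borel_on_set_integrable:
  assumes "bounded_borel_on {s..t} f"
  shows "set_integrable lborel {s..t} f"
proof -
  obtain K where K: "\<And>u. u \<in> {s..t} \<Longrightarrow> \<bar>f u\<bar> \<le> K"
    by (rule bounded_borel_on_bound[OF assms]) blast
  have m: "(\<lambda>u. indicator {s..t} u *\<^sub>R f u) \<in> borel_measurable borel"
    using assms borel_measurable_restrict_space_iff[of "{s..t}" borel f]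
    by (simp add: bounded_borel_on_def)
  have c: "integrable lborel (\<lambda>u. indicator {s..t} u *\<^sub>R K)"
    using borel_integrable_atLeastAtMost'[of s t "\<lambda>_. K"] by (simp add: set_integrable_def)
  have n: "norm (indicator {s..t} u *\<^sub>R f u) \<le> norm (indicator {s..t} u *\<^sub>R K)" for u
    using K[of u] by (auto split: split_indicator)
  show ?thesis
    unfolding set_integrable_def
    by (rule Bochner_Integration.integrable_bound[OF c _ AE_I2[OF n]]) (use m in simp)
qed

lemma bounded_borel_on_integrable:
  assumes "bounded_borel_on {s..t} f"
  shows "f integrable_on {s..t}"
  using bounded_borel_on_set_integrable[OF assms] set_borel_integral_eq_integral(1) by blast

lemma bounded_borel_on_LINT:
  assumes "bounded_borel_on {s..t} f"
  shows "(LINT u:{s..t}|lborel. f u) = integral {s..t} f"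
  using bounded_borel_on_set_integrable[OF assms] set_borel_integral_eq_integral(2) by blast

lemma nn_integral_bounded_borel:
  assumes "bounded_borel_on {s..t} f" "\<And>u. 0 \<le> f u"
  shows "(\<integral>\<^sup>+u. ennreal (f u) * indicator {s..t} u \<partial>lborel) = ennreal (integral {s..t} f)"
proof -
  have "(\<integral>\<^sup>+u. ennreal (f u) * indicator {s..t} u \<partial>lborel) = (\<integral>\<^sup>+u. ennreal (indicator {s..t} u *\<^sub>R f u) \<partial>lborel)"
    by (intro nn_integral_cong) (auto split: split_indicator)
  also have "\<dots> = ennreal (LINT u:{s..t}|lborel. f u)"
    unfolding set_lebesgue_integral_def
    using bounded_borel_on_set_integrable[OF assms(1)] assms(2)
    by (intro nn_integral_eq_integral) (auto simp: set_integrable_def)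
  finally show ?thesis
    by (simp add: bounded_borel_on_LINT[OF assms(1)])
qed

lemma integral_nonneg_if:
  fixes f :: "real \<Rightarrow> real"
  assumes "\<And>u. u \<in> S \<Longrightarrow> 0 \<le> f u"
  shows "0 \<le> integral S f"
  using assms Henstock_Kurzweil_Integration.integral_nonneg[of f S] not_integrable_integral[of f S] by fastforce

lemma integral_bound_const:
  fixes f :: "real \<Rightarrow> real"
  assumes "(f has_integral I) {s..t}" "s \<le> t" "\<And>u. u \<in> {s..t} \<Longrightarrow> \<bar>f u\<bar> \<le> K"
  shows "\<bar>I\<bar> \<le> K * (t - s)"
proof -
  have "0 \<le> K"
    using assms(2) assms(3)[of s] by auto
  then show ?thesis
    using has_integral_bound[of K f I s t] assms by auto
qed

text \<open>
  With \<open>f\<close> and \<open>g\<close> only measurable there is no pointwise derivative to multiply. Instead, the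
  difference of both sides changes by at most \<open>C (v - u)\<^sup>2\<close> between \<open>u\<close> and \<open>v\<close>, hence has
  derivative zero everywhere.
\<close>

lemma has_integral_product_rule:
  fixes f g F G :: "real \<Rightarrow> real"
  assumes f: "bounded_borel_on {s..T} f" and g: "bounded_borel_on {s..T} g"
    and F: "\<And>t. t \<in> {s..T} \<Longrightarrow> (f has_integral (F t - F s)) {s..t}"
    and G: "\<And>t. t \<in> {s..T} \<Longrightarrow> (g has_integral (G t - G s)) {s..t}"
    and "s \<le> T"
  shows "((\<lambda>u. f u * G u + F u * g u) has_integral (F T * G T - F s * G s)) {s..T}"
proof -
  obtain A where A: "A \<ge> 0" "\<And>t. t \<in> {s..T} \<Longrightarrow> \<bar>f t\<bar> \<le> A"
    by (rule bounded_borel_on_bound[OF f]) blast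
  obtain B where B: "B \<ge> 0" "\<And>t. t \<in> {s..T} \<Longrightarrow> \<bar>g t\<bar> \<le> B"
    by (rule bounded_borel_on_bound[OF g]) blast
  have incr: "(h has_integral (H v - H u)) {u..v}"
    if h: "\<And>t. t \<in> {s..T} \<Longrightarrow> (h has_integral (H t - H s)) {s..t}" and uv: "s \<le> u" "u \<le> v" "v \<le> T"
    for h H :: "real \<Rightarrow> real" and u v
  proof -
    have i: "h integrable_on {s..v}"
      using h[of v] uv by auto
    then have "integral {s..u} h + integral {u..v} h = integral {s..v} h"
      using Henstock_Kurzweil_Integration.integral_combine[of s u v h] uv by auto
    moreover have "integral {s..u} h = H u - H s" "integral {s..v} h = H v - H s"
      using h[of u] h[of v] uv by (auto intro: integral_unique)
    moreover have "h integrable_on {u..v}"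
      using integrable_on_subinterval[OF i] uv by auto
    ultimately show ?thesis
      by (auto simp: has_integral_iff)
  qed
  have lip: "\<bar>H v - H u\<bar> \<le> K * (v - u)"
    if "\<And>t. t \<in> {s..T} \<Longrightarrow> (h has_integral (H t - H s)) {s..t}" "\<And>t. t \<in> {s..T} \<Longrightarrow> \<bar>h t\<bar> \<le> K"
      and "s \<le> u" "u \<le> v" "v \<le> T"
    for h H :: "real \<Rightarrow> real" and u v K
    using that by (intro integral_bound_const[OF incr[of h H]]) auto
  have contF: "continuous_on {s..T} F"
  proof -
    have "A-lipschitz_on {s..T} F"
      using A lip[of f F A] F by (intro lipschitz_on_leI) (auto simp: dist_real_def abs_minus_commute)
    then show ?thesis by (rule lipschitz_on_continuous_on)
  qed
  have contG: "continuous_on {s..T} G"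
  proof -
    have "B-lipschitz_on {s..T} G"
      using B lip[of g G B] G by (intro lipschitz_on_leI) (auto simp: dist_real_def abs_minus_commute)
    then show ?thesis by (rule lipschitz_on_continuous_on)
  qed
  let ?h = "\<lambda>u. f u * G u + F u * g u"
  have bh: "bounded_borel_on {s..T} ?h"
    using bounded_borel_on_continuous[OF contF] bounded_borel_on_continuous[OF contG] f g
    by (intro bounded_borel_on_add bounded_borel_on_mult) auto
  have ih: "?h integrable_on {u..v}" if "s \<le> u" "v \<le> T" for u v
    using that by (intro bounded_borel_on_integrable bounded_borel_on_subset[OF bh]) auto
  define H where "H t = F t * G t - integral {s..t} ?h" for t
  have quad: "\<bar>H v - H u\<bar> \<le> 2 * A * B * (v - u)\<^sup>2" if uv: "s \<le> u" "u \<le> v" "v \<le> T" for u v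
  proof -
    have f': "(f has_integral (F v - F u)) {u..v}" and g': "(g has_integral (G v - G u)) {u..v}"
      using incr[of f F] incr[of g G] F G uv by auto
    have "integral {s..u} ?h + integral {u..v} ?h = integral {s..v} ?h"
      using Henstock_Kurzweil_Integration.integral_combine[of s u v ?h] uv ih by auto
    moreover have hi: "((\<lambda>w. G v * f w + F u * g w - ?h w) has_integral
        (G v * (F v - F u) + F u * (G v - G u) - integral {u..v} ?h)) {u..v}"
      using uv by (intro has_integral_diff has_integral_add has_integral_mult_right f' g'
          integrable_integral ih) auto
    moreover have hb: "\<bar>G v * f w + F u * g w - ?h w\<bar> \<le> 2 * A * B * (v - u)" if w: "w \<in> {u..v}" for w
    proof -
      have "\<bar>G v - G w\<bar> \<le> B * (v - w)"
        using lip[of g G B w v] G B w uv by auto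
      also have "\<dots> \<le> B * (v - u)"
        using B w by (intro mult_left_mono) auto
      finally have "\<bar>G v - G w\<bar> \<le> B * (v - u)" .
      then have 1: "\<bar>f w * (G v - G w)\<bar> \<le> A * (B * (v - u))"
        unfolding abs_mult using A w uv by (intro mult_mono) auto
      have "\<bar>F u - F w\<bar> \<le> A * (w - u)"
        using lip[of f F A u w] F A w uv by (auto simp: abs_minus_commute)
      also have "\<dots> \<le> A * (v - u)"
        using A w by (intro mult_left_mono) auto
      finally have "\<bar>F u - F w\<bar> \<le> A * (v - u)" .
      then have 2: "\<bar>(F u - F w) * g w\<bar> \<le> (A * (v - u)) * B"
        unfolding abs_mult using B A w uv by (intro mult_mono) auto
      have "G v * f w + F u * g w - ?h w = f w * (G v - G w) + (F u - F w) * g w"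
        by (simp add: algebra_simps)
      then show ?thesis
        using 1 2 by (simp add: algebra_simps)
    qed
    ultimately have "\<bar>G v * (F v - F u) + F u * (G v - G u) - integral {u..v} ?h\<bar>
        \<le> 2 * A * B * (v - u) * (v - u)"
      by (intro integral_bound_const[OF hi uv(2) hb])
    moreover have "H v - H u = G v * (F v - F u) + F u * (G v - G u) - integral {u..v} ?h"
      using \<open>integral {s..u} ?h + integral {u..v} ?h = integral {s..v} ?h\<close>
      by (simp add: H_def algebra_simps)
    ultimately show ?thesis
      by (simp add: power2_eq_square)
  qed
  have "\<exists>c. \<forall>x\<in>{s..T}. H x = c"
  proof (rule has_field_derivative_zero_constant)
    fix x assume x: "x \<in> {s..T}"
    show "(H has_real_derivative 0) (at x within {s..T})"
      unfolding has_field_derivative_iff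
    proof (rule Lim_null_comparison)
      show "\<forall>\<^sub>F y in at x within {s..T}. norm ((H y - H x) / (y - x)) \<le> 2 * A * B * \<bar>y - x\<bar>"
        unfolding eventually_at_filter
      proof (intro eventuallyI impI)
        fix y assume y: "y \<noteq> x" "y \<in> {s..T}"
        have "\<bar>H y - H x\<bar> \<le> 2 * A * B * (y - x)\<^sup>2"
          using quad[of x y] quad[of y x] x y by (cases "x \<le> y") (auto simp: abs_minus_commute power2_commute)
        then have "\<bar>H y - H x\<bar> \<le> 2 * A * B * \<bar>y - x\<bar> * \<bar>y - x\<bar>"
          by (simp add: power2_eq_square)
        then show "norm ((H y - H x) / (y - x)) \<le> 2 * A * B * \<bar>y - x\<bar>"
          using y by (simp add: abs_divide divide_le_eq)
      qed
      show "((\<lambda>y. 2 * A * B * \<bar>y - x\<bar>) \<longlongrightarrow> 0) (at x within {s..T})"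
        by (auto intro!: tendsto_eq_intros)
    qed
  qed simp
  then have "H T = H s"
    using \<open>s \<le> T\<close> by auto
  then have "integral {s..T} ?h = F T * G T - F s * G s"
    by (simp add: H_def)
  then show ?thesis
    using ih[of s T] by (auto simp: has_integral_iff)
qed

text \<open>
  A remainder \<open>r\<close> that tends to zero only pointwise is allowed on the right, which is what weak
  convergence of strategies provides.
\<close>

lemma gronwall:
  fixes u r :: "real \<Rightarrow> real"
  assumes L: "0 \<le> L" and u: "continuous_on {s..T} u" and r: "r integrable_on {s..T}"
    and r0: "\<And>t. t \<in> {s..T} \<Longrightarrow> 0 \<le> r t"
    and le: "\<And>t. t \<in> {s..T} \<Longrightarrow> u t \<le> r t + L * integral {s..t} u"
    and "s \<le> T"
  shows "u T \<le> r T + L * exp (L * (T - s)) * integral {s..T} r"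
proof -
  define v where "v t = integral {s..t} u" for t
  define w where "w t = exp (- L * (t - s)) * v t" for t
  have v': "(v has_real_derivative u t) (at t within {s..T})" if "t \<in> {s..T}" for t
    unfolding v_def has_real_derivative_iff_has_vector_derivative
    by (rule integral_has_vector_derivative[OF u that])
  have w': "(w has_vector_derivative exp (- L * (t - s)) * (u t - L * v t)) (at t within {s..T})"
    if "t \<in> {s..T}" for t
    unfolding w_def has_real_derivative_iff_has_vector_derivative[symmetric]
    by (auto intro!: derivative_eq_intros v' that simp: algebra_simps)
  have "((\<lambda>t. exp (- L * (t - s)) * (u t - L * v t)) has_integral (w T - w s)) {s..T}"
    by (rule fundamental_theorem_of_calculus[OF \<open>s \<le> T\<close> w'])
  then have "w T - w s \<le> integral {s..T} r"
  proof (rule has_integral_le[OF _ integrable_integral[OF r]])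
    fix t assume t: "t \<in> {s..T}"
    have "exp (- L * (t - s)) * (u t - L * v t) \<le> exp (- L * (t - s)) * r t"
      using le[OF t] by (intro mult_left_mono) (auto simp: v_def)
    also have "\<dots> \<le> 1 * r t"
      using r0[OF t] L t by (intro mult_right_mono) auto
    finally show "exp (- L * (t - s)) * (u t - L * v t) \<le> r t" by simp
  qed
  moreover have "w s = 0"
    by (simp add: w_def v_def)
  moreover have "v T = exp (L * (T - s)) * w T"
    unfolding w_def mult.assoc[symmetric] exp_add[symmetric] by simp
  ultimately have "v T \<le> exp (L * (T - s)) * integral {s..T} r"
    by simp
  then have "L * v T \<le> L * (exp (L * (T - s)) * integral {s..T} r)"
    using L by (intro mult_left_mono)
  then show ?thesis
    using le[of T] \<open>s \<le> T\<close> by (simp add: v_def)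
qed

lemma gronwall_zero:
  fixes u :: "real \<Rightarrow> real"
  assumes "0 \<le> L" "continuous_on {s..T} u" "\<And>t. t \<in> {s..T} \<Longrightarrow> u t \<le> L * integral {s..t} u" "s \<le> T"
  shows "u T \<le> 0"
  using gronwall[of L s T u "\<lambda>_. 0"] assms by auto

lemma gronwall_const:
  fixes u :: "real \<Rightarrow> real"
  assumes "0 \<le> L" "continuous_on {0..T} u" "\<And>t. t \<in> {0..T} \<Longrightarrow> u t \<le> a + L * integral {0..t} u"
    "0 \<le> T" "0 \<le> a"
  shows "u T \<le> a * (1 + L * T * exp (L * T))"
  using gronwall[of L 0 T u "\<lambda>_. a"] assms integrable_const_ivl[of a 0 T] by (simp add: algebra_simps)

lemma has_integral_continuous_on:
  fixes f :: "real \<Rightarrow> real"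
  assumes "\<And>t. t \<in> {s..T} \<Longrightarrow> (f has_integral (F t - c)) {s..t}"
  shows "continuous_on {s..T} F"
proof (cases "s \<le> T")
  case True
  have "continuous_on {s..T} (\<lambda>t. integral {s..t} f + c)"
    using assms[of T] True by (intro continuous_intros indefinite_integral_continuous_1) auto
  moreover have "integral {s..t} f + c = F t" if "t \<in> {s..T}" for t
    using assms[OF that] by (simp add: integral_unique)
  ultimately show ?thesis
    using continuous_on_cong[of "{s..T}" "{s..T}" "\<lambda>t. integral {s..t} f + c" F] by auto
qed auto

lemma continuous_on_atLeastI:
  fixes F :: "real \<Rightarrow> 'a::topological_space"
  assumes "\<And>T. T \<ge> s \<Longrightarrow> continuous_on {s..T} F"
  shows "continuous_on {s..} F"
proof (rule continuous_on_eq_continuous_within[THEN iffD2], rule ballI)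
  fix x assume x: "x \<in> {s..}"
  have "continuous (at x within {s..x + 1}) F"
    using assms[of "x + 1"] x by (auto simp: continuous_on_eq_continuous_within)
  moreover have "at x within {s..} = at x within {s..x + 1}"
    by (rule at_within_nhd[of _ "{..<x + 1}"]) auto
  ultimately show "continuous (at x within {s..}) F"
    by simp
qed

section \<open>Forward equations\<close>

definition prob_on :: "'i set \<Rightarrow> ('i \<Rightarrow> real) set" where
  "prob_on I = {p. (\<forall>i\<in>I. 0 \<le> p i) \<and> sum p I = 1}"

lemma prob_on_bounds:
  assumes "p \<in> prob_on I" "finite I" "i \<in> I"
  shows "0 \<le> p i" "p i \<le> 1"
  using assms member_le_sum[of i I p] by (auto simp: prob_on_def)

lemma has_integral_exp_scaled:
  fixes c s t :: real
  assumes "s \<le> t"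
  shows "((\<lambda>r. c * exp (c * (r - s))) has_integral (exp (c * (t - s)) - 1)) {s..t}"
proof -
  have "((\<lambda>r. c * exp (c * (r - s))) has_integral (exp (c * (t - s)) - exp (c * (s - s)))) {s..t}"
    using assms
    by (intro fundamental_theorem_of_calculus)
      (auto simp: has_real_derivative_iff_has_vector_derivative[symmetric] intro!: derivative_eq_intros)
  then show ?thesis by simp
qed

lemma has_integral_power_shifted:
  fixes s t :: real
  assumes "s \<le> t"
  shows "((\<lambda>r. (r - s) ^ k) has_integral ((t - s) ^ Suc k / Suc k)) {s..t}"
proof -
  have "((\<lambda>r. (r - s) ^ k) has_integral ((t - s) ^ Suc k / Suc k - (s - s) ^ Suc k / Suc k)) {s..t}"
    using assms
    by (intro fundamental_theorem_of_calculus)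
      (auto simp: has_real_derivative_iff_has_vector_derivative[symmetric]
        simp del: power_Suc of_nat_Suc intro!: derivative_eq_intros)
  then show ?thesis by simp
qed

text \<open>
  Picard iteration for \<open>p' = c (\<phi>\<^sub>t(p) - p)\<close>, where \<open>\<phi>\<^sub>t\<close> maps probability vectors to probability
  vectors but need not be defined elsewhere. The equation is therefore iterated in the form
  \<open>p(t) = e\<^sup>-\<^sup>c\<^sup>t (p\<^sub>0 + \<integral> c e\<^sup>c\<^sup>r \<phi>\<^sub>r(p(r)) dr)\<close>, a convex combination that never leaves the
  simplex.
\<close>

lemma picard_probability:
  fixes \<phi> :: "real \<Rightarrow> ('i \<Rightarrow> real) \<Rightarrow> 'i \<Rightarrow> real"
  assumes fin: "finite I" and p0: "p0 \<in> prob_on I" and c: "0 < c" and L: "0 \<le> L"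
    and stoch: "\<And>t p. s \<le> t \<Longrightarrow> p \<in> prob_on I \<Longrightarrow> \<phi> t p \<in> prob_on I"
    and lip: "\<And>t p q. s \<le> t \<Longrightarrow> p \<in> prob_on I \<Longrightarrow> q \<in> prob_on I \<Longrightarrow>
      (\<Sum>i\<in>I. \<bar>\<phi> t p i - \<phi> t q i\<bar>) \<le> L * (\<Sum>i\<in>I. \<bar>p i - q i\<bar>)"
    and meas: "\<And>p i. \<lbrakk>\<And>t. s \<le> t \<Longrightarrow> p t \<in> prob_on I;
        \<And>j. j \<in> I \<Longrightarrow> (\<lambda>t. p t j) \<in> borel_measurable (restrict_space borel {s..}); i \<in> I\<rbrakk> \<Longrightarrow>
      (\<lambda>t. \<phi> t (p t) i) \<in> borel_measurable (restrict_space borel {s..})"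
  obtains p where "\<And>t. s \<le> t \<Longrightarrow> p t \<in> prob_on I"
    "\<And>t i. s \<le> t \<Longrightarrow> i \<in> I \<Longrightarrow>
       ((\<lambda>u. c * (\<phi> u (p u) i - p u i)) has_integral (p t i - p0 i)) {s..t}"
proof -
  define w where "w r = c * exp (c * (r - s))" for r
  define step where "step Y t i = exp (- (c * (t - s))) * (p0 i + integral {s..t} (\<lambda>r. w r * \<phi> r (Y r) i))"
    for Y t i
  define good where "good Y \<longleftrightarrow> (\<forall>t\<ge>s. Y t \<in> prob_on I) \<and>
      (\<forall>i\<in>I. (\<lambda>t. Y t i) \<in> borel_measurable (restrict_space borel {s..}))" for Y :: "real \<Rightarrow> 'i \<Rightarrow> real"
  have w0: "0 \<le> w r" for r
    using c by (simp add: w_def)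
  have w_int: "(w has_integral (exp (c * (t - s)) - 1)) {s..t}" if "s \<le> t" for t
    unfolding w_def using has_integral_exp_scaled[OF that] .
  have w_bb: "bounded_borel_on {s..t} w" for t
    unfolding w_def by (intro bounded_borel_on_continuous continuous_intros) auto
  have bb: "bounded_borel_on {s..t} (\<lambda>r. \<phi> r (Y r) i)" if "good Y" "i \<in> I" for Y i t
  proof (rule bounded_borel_onI[of _ _ 1])
    have "(\<lambda>r. \<phi> r (Y r) i) \<in> borel_measurable (restrict_space borel {s..})"
      using that by (intro meas) (auto simp: good_def)
    then show "(\<lambda>r. \<phi> r (Y r) i) \<in> borel_measurable (restrict_space borel {s..t})"
      by (rule measurable_restrict_mono) auto
    fix r assume "r \<in> {s..t}"
    then have "\<phi> r (Y r) \<in> prob_on I"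
      using that by (intro stoch) (auto simp: good_def)
    from prob_on_bounds[OF this fin \<open>i \<in> I\<close>] show "\<bar>\<phi> r (Y r) i\<bar> \<le> 1"
      by simp
  qed
  have int: "((\<lambda>r. w r * \<phi> r (Y r) i) has_integral integral {s..t} (\<lambda>r. w r * \<phi> r (Y r) i)) {s..t}"
    if "good Y" "i \<in> I" for Y i t
    using that by (intro integrable_integral bounded_borel_on_integrable bounded_borel_on_mult w_bb bb)
  have good_step: "good (step Y)" if Y: "good Y" for Y
    unfolding good_def
  proof (intro conjI allI impI ballI)
    fix t assume t: "s \<le> t"
    have "0 \<le> step Y t i" if i: "i \<in> I" for i
    proof -
      have "0 \<le> integral {s..t} (\<lambda>r. w r * \<phi> r (Y r) i)"
      proof (rule integral_nonneg)
        fix r assume "r \<in> {s..t}"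
        then have "\<phi> r (Y r) \<in> prob_on I"
          using Y by (intro stoch) (auto simp: good_def)
        then show "0 \<le> w r * \<phi> r (Y r) i"
          using w0[of r] prob_on_bounds(1)[OF _ fin i] by simp
      qed (use int[OF Y i] in blast)
      then show ?thesis
        using p0 i by (auto simp: step_def prob_on_def)
    qed
    moreover have "(\<Sum>i\<in>I. step Y t i) = 1"
    proof -
      have "((\<lambda>r. \<Sum>i\<in>I. w r * \<phi> r (Y r) i) has_integral
          (\<Sum>i\<in>I. integral {s..t} (\<lambda>r. w r * \<phi> r (Y r) i))) {s..t}"
        by (intro has_integral_sum fin int Y)
      moreover have "(\<Sum>i\<in>I. w r * \<phi> r (Y r) i) = w r" if "r \<in> {s..t}" for r
        using that Y stoch[of r "Y r"]
        by (auto simp: good_def prob_on_def sum_distrib_left[symmetric])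
      ultimately have "(w has_integral (\<Sum>i\<in>I. integral {s..t} (\<lambda>r. w r * \<phi> r (Y r) i))) {s..t}"
        by (rule has_integral_eq[rotated])
      with w_int[OF t] have "(\<Sum>i\<in>I. integral {s..t} (\<lambda>r. w r * \<phi> r (Y r) i)) = exp (c * (t - s)) - 1"
        by (rule has_integral_unique[symmetric])
      then show ?thesis
        using p0 by (simp add: step_def sum_distrib_left[symmetric] sum.distrib prob_on_def exp_minus)
    qed
    ultimately show "step Y t \<in> prob_on I"
      by (auto simp: prob_on_def)
  next
    fix i assume i: "i \<in> I"
    have "continuous_on {s..} (\<lambda>t. step Y t i)"
      unfolding step_def
      by (intro continuous_on_atLeastI continuous_intros indefinite_integral_continuous_1)
        (use int[OF Y i] in blast)
    then show "(\<lambda>t. step Y t i) \<in> borel_measurable (restrict_space borel {s..})"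
      by (rule borel_measurable_continuous_on_restrict)
  qed
  define D where "D Y Z t = (\<Sum>i\<in>I. \<bar>Y t i - Z t i\<bar>)" for Y Z :: "real \<Rightarrow> 'i \<Rightarrow> real" and t
  have D_step: "D (step Y) (step Z) t \<le> c * L * I1"
    if Y: "good Y" and Z: "good Z" and t: "s \<le> t"
      and h: "\<And>r. r \<in> {s..t} \<Longrightarrow> D Y Z r \<le> h r" and I1: "(h has_integral I1) {s..t}" for Y Z t h I1
  proof -
    let ?d = "\<lambda>i r. \<bar>\<phi> r (Y r) i - \<phi> r (Z r) i\<bar>"
    have dint: "((\<lambda>r. c * ?d i r) has_integral integral {s..t} (\<lambda>r. c * ?d i r)) {s..t}" if "i \<in> I" for i
      by (intro integrable_integral bounded_borel_on_integrable bounded_borel_on_mult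
          bounded_borel_on_const bounded_borel_on_abs bounded_borel_on_diff bb Y Z that)
    have 1: "\<bar>step Y t i - step Z t i\<bar> \<le> integral {s..t} (\<lambda>r. c * ?d i r)" if i: "i \<in> I" for i
    proof -
      let ?e = "exp (- (c * (t - s)))"
      have "((\<lambda>r. ?e * (w r * \<phi> r (Y r) i - w r * \<phi> r (Z r) i)) has_integral (step Y t i - step Z t i)) {s..t}"
        using has_integral_mult_right[OF has_integral_diff[OF int[OF Y i] int[OF Z i]], where c = ?e]
        by (simp add: step_def algebra_simps)
      moreover have "norm (?e * (w r * \<phi> r (Y r) i - w r * \<phi> r (Z r) i)) \<le> c * ?d i r" if r: "r \<in> {s..t}" for r
      proof -
        have "?e * w r = c * exp (c * (r - t))"
          unfolding w_def by (simp add: exp_diff[symmetric] exp_minus algebra_simps exp_add[symmetric] divide_simps)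
        also have "\<dots> \<le> c"
          using c r by (simp add: mult_le_0_iff)
        finally have "?e * w r * ?d i r \<le> c * ?d i r"
          by (intro mult_right_mono) auto
        then show ?thesis
          using w0[of r] by (simp add: abs_mult right_diff_distrib[symmetric] mult.assoc)
      qed
      ultimately show ?thesis
        using integral_norm_bound_integral[of "\<lambda>r. ?e * (w r * \<phi> r (Y r) i - w r * \<phi> r (Z r) i)" "{s..t}" "\<lambda>r. c * ?d i r"]
          dint[OF i] by (auto simp: has_integral_iff)
    qed
    have "D (step Y) (step Z) t \<le> (\<Sum>i\<in>I. integral {s..t} (\<lambda>r. c * ?d i r))"
      unfolding D_def by (intro sum_mono 1)
    also have "\<dots> \<le> c * L * I1"
    proof (rule has_integral_le)
      show "((\<lambda>r. \<Sum>i\<in>I. c * ?d i r) has_integral (\<Sum>i\<in>I. integral {s..t} (\<lambda>r. c * ?d i r))) {s..t}"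
        by (intro has_integral_sum fin dint)
      show "((\<lambda>r. c * L * h r) has_integral (c * L * I1)) {s..t}"
        by (intro has_integral_mult_right I1)
      fix r assume r: "r \<in> {s..t}"
      have "(\<Sum>i\<in>I. ?d i r) \<le> L * D Y Z r"
        unfolding D_def using Y Z r by (intro lip) (auto simp: good_def)
      also have "\<dots> \<le> L * h r"
        using h[OF r] L by (intro mult_left_mono) auto
      finally show "(\<Sum>i\<in>I. c * ?d i r) \<le> c * L * h r"
        using c by (simp add: sum_distrib_left[symmetric])
    qed
    finally show ?thesis .
  qed
  define X where "X k = (step ^^ k) (\<lambda>_. p0)" for k
  have X_Suc: "X (Suc k) = step (X k)" for k
    by (simp add: X_def)
  have good_X: "good (X k)" for k
  proof (induction k)
    case 0
    then show ?case using p0 by (simp add: X_def good_def)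
  qed (simp add: X_Suc good_step)
  have D_X: "D (X (Suc k)) (X k) t \<le> 2 * ((c * L * (t - s)) ^ k / fact k)" if "s \<le> t" for k t
    using that
  proof (induction k arbitrary: t)
    case (0 t)
    have "D (X (Suc 0)) (X 0) t \<le> (\<Sum>i\<in>I. X (Suc 0) t i + X 0 t i)"
      unfolding D_def
    proof (rule sum_mono)
      fix i assume "i \<in> I"
      then have "0 \<le> X (Suc 0) t i" "0 \<le> X 0 t i"
        using good_X[of 0] good_X[of "Suc 0"] 0 by (auto simp: good_def prob_on_def)
      then show "\<bar>X (Suc 0) t i - X 0 t i\<bar> \<le> X (Suc 0) t i + X 0 t i" by linarith
    qed
    also have "\<dots> = 2"
      using good_X[of 0] good_X[of "Suc 0"] 0 by (simp add: good_def prob_on_def sum.distrib)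
    finally show ?case by simp
  next
    case (Suc k t)
    have "((\<lambda>r. (r - s) ^ k * (2 * ((c * L) ^ k / fact k))) has_integral
        ((t - s) ^ Suc k / Suc k * (2 * ((c * L) ^ k / fact k)))) {s..t}"
      by (intro has_integral_mult_left has_integral_power_shifted Suc)
    from D_step[OF good_X good_X Suc.prems _ this, of "Suc k" k]
    have "D (X (Suc (Suc k))) (X (Suc k)) t
        \<le> c * L * ((t - s) ^ Suc k / Suc k * (2 * ((c * L) ^ k / fact k)))"
    proof (unfold X_Suc[symmetric], elim meta_mp)
      fix r assume "r \<in> {s..t}"
      then have "D (X (Suc k)) (X k) r \<le> 2 * ((c * L * (r - s)) ^ k / fact k)"
        by (intro Suc.IH) auto
      then show "D (X (Suc k)) (X k) r \<le> (r - s) ^ k * (2 * ((c * L) ^ k / fact k))"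
        by (simp add: power_mult_distrib mult_ac)
    qed
    also have "\<dots> = 2 * ((c * L * (t - s)) ^ Suc k / fact (Suc k))"
      unfolding power_mult_distrib by (simp add: divide_simps)
    finally show ?case .
  qed
  have conv: "convergent (\<lambda>k. X k t i)" if t: "s \<le> t" and i: "i \<in> I" for t i
  proof -
    have "summable (\<lambda>k. X (Suc k) t i - X k t i)"
    proof (rule summable_comparison_test')
      show "summable (\<lambda>k. 2 * ((c * L * (t - s)) ^ k / fact k))"
        using summable_exp[of "c * L * (t - s)"] by (intro summable_mult) (simp add: field_simps)
      fix k
      have "\<bar>X (Suc k) t i - X k t i\<bar> \<le> D (X (Suc k)) (X k) t"
        unfolding D_def using fin i by (intro member_le_sum) auto
      then show "norm (X (Suc k) t i - X k t i) \<le> 2 * ((c * L * (t - s)) ^ k / fact k)"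
        using D_X[OF t, of k] by simp
    qed
    then have "convergent (\<lambda>k. \<Sum>j<k. X (Suc j) t i - X j t i)"
      by (simp add: summable_iff_convergent)
    then have "convergent (\<lambda>k. X k t i - X 0 t i)"
      using sum_lessThan_telescope[of "\<lambda>k. X k t i"] by simp
    then show ?thesis
      using convergent_add[OF _ convergent_const[of "X 0 t i"]] by fastforce
  qed
  define p where "p t i = lim (\<lambda>k. X k t i)" for t i
  have lim: "(\<lambda>k. X k t i) \<longlonglongrightarrow> p t i" if "s \<le> t" "i \<in> I" for t i
    using conv[OF that] by (simp add: p_def convergent_LIMSEQ_iff)
  have good_p: "good p"
    unfolding good_def
  proof (intro conjI allI impI ballI)
    fix t assume t: "s \<le> t"
    have "0 \<le> p t i" if "i \<in> I" for i
      by (rule LIMSEQ_le_const[OF lim[OF t that]])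
        (use good_X t that in \<open>auto simp: good_def prob_on_def\<close>)
    moreover have "(\<lambda>k. \<Sum>i\<in>I. X k t i) \<longlonglongrightarrow> (\<Sum>i\<in>I. p t i)"
      by (intro tendsto_sum lim t)
    then have "(\<Sum>i\<in>I. p t i) = 1"
      using good_X t by (simp add: good_def prob_on_def LIMSEQ_const_iff)
    ultimately show "p t \<in> prob_on I"
      by (simp add: prob_on_def)
  next
    fix i assume i: "i \<in> I"
    show "(\<lambda>t. p t i) \<in> borel_measurable (restrict_space borel {s..})"
    proof (rule borel_measurable_LIMSEQ_real)
      show "(\<lambda>t. X k t i) \<in> borel_measurable (restrict_space borel {s..})" for k
        using good_X[of k] i by (simp add: good_def)
    qed (use lim i in \<open>auto simp: space_restrict_space\<close>)
  qed
  have fix_p: "p t i = step p t i" if t: "s \<le> t" and i: "i \<in> I" for t i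
  proof -
    have "(\<lambda>k. integral {s..t} (\<lambda>r. w r * \<phi> r (X k r) i)) \<longlonglongrightarrow> integral {s..t} (\<lambda>r. w r * \<phi> r (p r) i)"
    proof (rule dominated_convergence(2))
      show "(\<lambda>r. w r * \<phi> r (X k r) i) integrable_on {s..t}" for k
        using int[OF good_X i] by blast
      show "w integrable_on {s..t}"
        using w_int[OF t] by blast
      fix r assume r: "r \<in> {s..t}"
      show "norm (w r * \<phi> r (X k r) i) \<le> w r" for k
      proof -
        have "\<phi> r (X k r) \<in> prob_on I"
          using r good_X by (intro stoch) (auto simp: good_def)
        from prob_on_bounds[OF this fin i] show ?thesis
          using w0[of r] by (simp add: abs_mult mult_left_le)
      qed
      have "(\<lambda>k. \<phi> r (X k r) i - \<phi> r (p r) i) \<longlonglongrightarrow> 0"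
      proof (rule Lim_null_comparison[OF always_eventually], rule allI)
        fix k
        have "\<bar>\<phi> r (X k r) i - \<phi> r (p r) i\<bar> \<le> (\<Sum>i\<in>I. \<bar>\<phi> r (X k r) i - \<phi> r (p r) i\<bar>)"
          using fin i by (intro member_le_sum) auto
        also have "\<dots> \<le> L * (\<Sum>i\<in>I. \<bar>X k r i - p r i\<bar>)"
          using r good_X good_p by (intro lip) (auto simp: good_def)
        finally show "norm (\<phi> r (X k r) i - \<phi> r (p r) i) \<le> L * (\<Sum>i\<in>I. \<bar>X k r i - p r i\<bar>)"
          by simp
      next
        have "(\<lambda>k. L * (\<Sum>i\<in>I. \<bar>X k r i - p r i\<bar>)) \<longlonglongrightarrow> L * (\<Sum>i\<in>I. \<bar>p r i - p r i\<bar>)"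
          using r by (intro tendsto_intros lim) auto
        then show "(\<lambda>k. L * (\<Sum>i\<in>I. \<bar>X k r i - p r i\<bar>)) \<longlonglongrightarrow> 0"
          by simp
      qed
      then have "(\<lambda>k. \<phi> r (X k r) i) \<longlonglongrightarrow> \<phi> r (p r) i"
        by (rule LIM_zero_cancel)
      then show "(\<lambda>k. w r * \<phi> r (X k r) i) \<longlonglongrightarrow> w r * \<phi> r (p r) i"
        by (intro tendsto_intros)
    qed
    then have "(\<lambda>k. X (Suc k) t i) \<longlonglongrightarrow> step p t i"
      unfolding X_Suc step_def by (intro tendsto_intros)
    moreover have "(\<lambda>k. X (Suc k) t i) \<longlonglongrightarrow> p t i"
      using lim[OF t i] by (rule LIMSEQ_Suc)
    ultimately show ?thesis
      by (rule LIMSEQ_unique[symmetric])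
  qed
  show thesis
  proof (rule that[of p])
    show "p t \<in> prob_on I" if "s \<le> t" for t
      using good_p that by (simp add: good_def)
    fix t i assume t: "s \<le> t" and i: "i \<in> I"
    define F where "F u = exp (- c * (u - s))" for u
    define Gi where "Gi u = p0 i + integral {s..u} (\<lambda>r. w r * \<phi> r (p r) i)" for u
    have "((\<lambda>u. (- c * exp (- c * (u - s))) * Gi u + F u * (w u * \<phi> u (p u) i)) has_integral
        (F t * Gi t - F s * Gi s)) {s..t}"
    proof (rule has_integral_product_rule)
      show "bounded_borel_on {s..t} (\<lambda>u. - c * exp (- c * (u - s)))"
        by (intro bounded_borel_on_continuous continuous_intros) auto
      show "bounded_borel_on {s..t} (\<lambda>u. w u * \<phi> u (p u) i)"
        by (intro bounded_borel_on_mult w_bb bb good_p i)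
      show "((\<lambda>u. - c * exp (- c * (u - s))) has_integral (F v - F s)) {s..v}" if "v \<in> {s..t}" for v
        using has_integral_exp_scaled[of s v "- c"] that by (simp add: F_def)
      show "((\<lambda>u. w u * \<phi> u (p u) i) has_integral (Gi v - Gi s)) {s..v}" for v
        using int[OF good_p i, of v] by (simp add: Gi_def)
    qed (rule t)
    moreover have "(- c * exp (- c * (u - s))) * Gi u + F u * (w u * \<phi> u (p u) i) = c * (\<phi> u (p u) i - p u i)"
      if "u \<in> {s..t}" for u
    proof -
      have "p u i = F u * Gi u"
        using fix_p[of u i] that i by (simp add: step_def F_def Gi_def)
      moreover have "F u * w u = c"
        by (simp add: F_def w_def exp_minus)
      ultimately show ?thesis
        by (simp add: F_def algebra_simps)
    qed
    moreover have "F t * Gi t - F s * Gi s = p t i - p0 i"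
      using fix_p[OF t i] by (simp add: step_def F_def Gi_def)
    ultimately show "((\<lambda>u. c * (\<phi> u (p u) i - p u i)) has_integral (p t i - p0 i)) {s..t}"
      using has_integral_eq[of "{s..t}" _ "\<lambda>u. c * (\<phi> u (p u) i - p u i)"] by fastforce
  qed
qed

text \<open>
  A generator \<open>A\<close> with bounded rates turns into a stochastic matrix \<open>1 + A / c\<close> once \<open>c\<close> exceeds the
  rates, so that the forward equation \<open>p' = p A\<close> has the form solved above.
\<close>

lemma forward_equation_exists:
  fixes A :: "real \<Rightarrow> ('i \<Rightarrow> real) \<Rightarrow> 'i \<Rightarrow> 'i \<Rightarrow> real"
  assumes fin: "finite I" and p0: "p0 \<in> prob_on I" and K: "0 \<le> K" and M: "0 \<le> M"
    and nonneg: "\<And>t p i j. \<lbrakk>s \<le> t; p \<in> prob_on I; i \<in> I; j \<in> I; i \<noteq> j\<rbrakk> \<Longrightarrow> 0 \<le> A t p i j"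
    and rows: "\<And>t p i. \<lbrakk>s \<le> t; p \<in> prob_on I; i \<in> I\<rbrakk> \<Longrightarrow> (\<Sum>j\<in>I. A t p i j) = 0"
    and bound: "\<And>t p i j. \<lbrakk>s \<le> t; p \<in> prob_on I; i \<in> I; j \<in> I\<rbrakk> \<Longrightarrow> \<bar>A t p i j\<bar> \<le> K"
    and lip: "\<And>t p q i j. \<lbrakk>s \<le> t; p \<in> prob_on I; q \<in> prob_on I; i \<in> I; j \<in> I\<rbrakk> \<Longrightarrow>
      \<bar>A t p i j - A t q i j\<bar> \<le> M * (\<Sum>i\<in>I. \<bar>p i - q i\<bar>)"
    and meas: "\<And>p i j. \<lbrakk>\<And>t. s \<le> t \<Longrightarrow> p t \<in> prob_on I;
        \<And>j. j \<in> I \<Longrightarrow> (\<lambda>t. p t j) \<in> borel_measurable (restrict_space borel {s..}); i \<in> I; j \<in> I\<rbrakk> \<Longrightarrow>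
      (\<lambda>t. A t (p t) i j) \<in> borel_measurable (restrict_space borel {s..})"
  obtains p where "\<And>t. s \<le> t \<Longrightarrow> p t \<in> prob_on I"
    "\<And>t j. s \<le> t \<Longrightarrow> j \<in> I \<Longrightarrow>
       ((\<lambda>u. \<Sum>i\<in>I. p u i * A u (p u) i j) has_integral (p t j - p0 j)) {s..t}"
proof -
  define c where "c = K + 1"
  have c: "0 < c" "K \<le> c"
    using K by (auto simp: c_def)
  define \<phi> where "\<phi> t p j = p j + (\<Sum>i\<in>I. p i * A t p i j) / c" for t p j
  have stoch: "\<phi> t p \<in> prob_on I" if t: "s \<le> t" and p: "p \<in> prob_on I" for t p
  proof -
    have "0 \<le> \<phi> t p j" if j: "j \<in> I" for j
    proof -
      have "- (p j * K) \<le> p j * A t p j j"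
        using bound[OF t p j j] prob_on_bounds(1)[OF p fin j] mult_left_mono[of "- K" "A t p j j" "p j"]
        by auto
      moreover have "p j * K \<le> p j * c"
        using c prob_on_bounds(1)[OF p fin j] by (intro mult_left_mono)
      moreover have "0 \<le> (\<Sum>i\<in>I - {j}. p i * A t p i j)"
        using nonneg[OF t p _ j] prob_on_bounds(1)[OF p fin] by (intro sum_nonneg mult_nonneg_nonneg) auto
      ultimately have "0 \<le> p j * c + (\<Sum>i\<in>I. p i * A t p i j)"
        using fin j by (simp add: sum.remove[of I j])
      then show ?thesis
        using c by (simp add: \<phi>_def field_simps)
    qed
    moreover have "(\<Sum>j\<in>I. \<Sum>i\<in>I. p i * A t p i j) = 0"
      by (subst sum.swap) (simp add: sum_distrib_left[symmetric] rows[OF t p])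
    then have "(\<Sum>j\<in>I. \<phi> t p j) = 1"
      using p by (simp add: \<phi>_def sum.distrib sum_divide_distrib[symmetric] prob_on_def)
    ultimately show ?thesis
      by (simp add: prob_on_def)
  qed
  define n where "n = real (card I)"
  define L where "L = 1 + n * (K + M) / c"
  have lip': "(\<Sum>j\<in>I. \<bar>\<phi> t p j - \<phi> t q j\<bar>) \<le> L * (\<Sum>i\<in>I. \<bar>p i - q i\<bar>)"
    if t: "s \<le> t" and p: "p \<in> prob_on I" and q: "q \<in> prob_on I" for t p q
  proof -
    define d where "d = (\<Sum>i\<in>I. \<bar>p i - q i\<bar>)"
    have summand: "\<bar>p i * A t p i j - q i * A t q i j\<bar> \<le> K * \<bar>p i - q i\<bar> + q i * (M * d)"
      if "i \<in> I" "j \<in> I" for i j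
    proof -
      have "p i * A t p i j - q i * A t q i j = A t p i j * (p i - q i) + q i * (A t p i j - A t q i j)"
        by (simp add: algebra_simps)
      then have "\<bar>p i * A t p i j - q i * A t q i j\<bar> \<le> \<bar>A t p i j\<bar> * \<bar>p i - q i\<bar> + \<bar>q i\<bar> * \<bar>A t p i j - A t q i j\<bar>"
        by (metis abs_mult abs_triangle_ineq)
      also have "\<dots> \<le> K * \<bar>p i - q i\<bar> + q i * (M * d)"
        using bound[OF t p that] lip[OF t p q that] prob_on_bounds(1)[OF q fin that(1)]
        by (intro add_mono mult_mono) (auto simp: d_def)
      finally show ?thesis .
    qed
    have "\<bar>\<phi> t p j - \<phi> t q j\<bar> \<le> \<bar>p j - q j\<bar> + (K + M) * d / c" if j: "j \<in> I" for j
    proof -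
      have "\<bar>(\<Sum>i\<in>I. p i * A t p i j) - (\<Sum>i\<in>I. q i * A t q i j)\<bar> \<le> (\<Sum>i\<in>I. K * \<bar>p i - q i\<bar> + q i * (M * d))"
        unfolding sum_subtractf[symmetric] by (rule order_trans[OF sum_abs]) (intro sum_mono summand j)
      also have "\<dots> = (K + M) * d"
        using q by (simp add: sum.distrib sum_distrib_left[symmetric] sum_distrib_right[symmetric]
            d_def[symmetric] prob_on_def algebra_simps)
      finally have "\<bar>((\<Sum>i\<in>I. p i * A t p i j) - (\<Sum>i\<in>I. q i * A t q i j)) / c\<bar> \<le> (K + M) * d / c"
        using c by (simp add: abs_divide divide_right_mono)
      moreover have "\<phi> t p j - \<phi> t q j = (p j - q j) + ((\<Sum>i\<in>I. p i * A t p i j) - (\<Sum>i\<in>I. q i * A t q i j)) / c"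
        by (simp add: \<phi>_def diff_divide_distrib)
      ultimately show ?thesis by linarith
    qed
    then have "(\<Sum>j\<in>I. \<bar>\<phi> t p j - \<phi> t q j\<bar>) \<le> (\<Sum>j\<in>I. \<bar>p j - q j\<bar> + (K + M) * d / c)"
      by (intro sum_mono)
    also have "\<dots> = L * d"
      by (simp add: sum.distrib d_def[symmetric] L_def n_def algebra_simps)
    finally show ?thesis
      by (simp add: d_def)
  qed
  have meas': "(\<lambda>t. \<phi> t (p t) j) \<in> borel_measurable (restrict_space borel {s..})"
    if "\<And>t. s \<le> t \<Longrightarrow> p t \<in> prob_on I"
      "\<And>j. j \<in> I \<Longrightarrow> (\<lambda>t. p t j) \<in> borel_measurable (restrict_space borel {s..})" "j \<in> I" for p j
    unfolding \<phi>_def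
    by (intro borel_measurable_add borel_measurable_divide borel_measurable_sum borel_measurable_times
        meas[of p] that borel_measurable_const)
  have "0 \<le> L"
    using K M c by (simp add: L_def n_def)
  obtain p where p: "\<And>t. s \<le> t \<Longrightarrow> p t \<in> prob_on I"
    "\<And>t i. s \<le> t \<Longrightarrow> i \<in> I \<Longrightarrow> ((\<lambda>u. c * (\<phi> u (p u) i - p u i)) has_integral (p t i - p0 i)) {s..t}"
    using picard_probability[OF fin p0 c(1) \<open>0 \<le> L\<close> stoch lip' meas'] by blast
  show thesis
    using p c by (intro that[of p]) (simp_all add: \<phi>_def)
qed

lemma has_integral_abs_le:
  fixes f g :: "real \<Rightarrow> real"
  assumes "(f has_integral I) S" "(g has_integral J) S" "\<And>u. u \<in> S \<Longrightarrow> \<bar>f u\<bar> \<le> g u"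
  shows "\<bar>I\<bar> \<le> J"
  using integral_norm_bound_integral[of f S g] assms by (auto simp: has_integral_iff)

text \<open>
  The distance of two solutions, summed over the components, is bounded by a multiple of its own
  integral.
\<close>

lemma linear_forward_equation_unique:
  fixes A :: "real \<Rightarrow> 'i \<Rightarrow> 'i \<Rightarrow> real"
  assumes fin: "finite I" and K: "0 \<le> K"
    and bound: "\<And>t i j. \<lbrakk>s \<le> t; i \<in> I; j \<in> I\<rbrakk> \<Longrightarrow> \<bar>A t i j\<bar> \<le> K"
    and x: "\<And>t j. s \<le> t \<Longrightarrow> j \<in> I \<Longrightarrow> ((\<lambda>u. \<Sum>i\<in>I. x u i * A u i j) has_integral (x t j - p0 j)) {s..t}"
    and y: "\<And>t j. s \<le> t \<Longrightarrow> j \<in> I \<Longrightarrow> ((\<lambda>u. \<Sum>i\<in>I. y u i * A u i j) has_integral (y t j - p0 j)) {s..t}"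
    and t: "s \<le> t" and j: "j \<in> I"
  shows "x t j = y t j"
proof -
  define d where "d t = (\<Sum>j\<in>I. \<bar>x t j - y t j\<bar>)" for t
  have cont: "continuous_on {s..T} d" for T
    unfolding d_def
    by (intro continuous_intros has_integral_continuous_on[OF x] has_integral_continuous_on[OF y]) auto
  have "d t \<le> 0"
  proof (rule gronwall_zero[of "real (card I) * K" s t d])
    fix v assume v: "v \<in> {s..t}"
    have di: "((\<lambda>u. K * d u) has_integral (K * integral {s..v} d)) {s..v}"
      by (intro has_integral_mult_right integrable_integral integrable_continuous_interval cont)
    have "\<bar>x v j - y v j\<bar> \<le> K * integral {s..v} d" if j: "j \<in> I" for j
    proof -
      have "\<bar>(\<Sum>i\<in>I. x u i * A u i j) - (\<Sum>i\<in>I. y u i * A u i j)\<bar> \<le> K * d u" if u: "u \<in> {s..v}" for u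
      proof -
        have "\<bar>\<Sum>i\<in>I. (x u i - y u i) * A u i j\<bar> \<le> (\<Sum>i\<in>I. \<bar>x u i - y u i\<bar> * K)"
          by (rule order_trans[OF sum_abs])
            (use bound u j in \<open>auto intro!: sum_mono mult_left_mono simp: abs_mult\<close>)
        then show ?thesis
          by (simp add: d_def sum_subtractf[symmetric] left_diff_distrib[symmetric] sum_distrib_left mult.commute)
      qed
      moreover have "((\<lambda>u. (\<Sum>i\<in>I. x u i * A u i j) - (\<Sum>i\<in>I. y u i * A u i j)) has_integral
          ((x v j - p0 j) - (y v j - p0 j))) {s..v}"
        using v j by (intro has_integral_diff x y) auto
      ultimately have "\<bar>(x v j - p0 j) - (y v j - p0 j)\<bar> \<le> K * integral {s..v} d"
        by (intro has_integral_abs_le[OF _ di])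
      then show ?thesis by simp
    qed
    then have "d v \<le> (\<Sum>j\<in>I. K * integral {s..v} d)"
      unfolding d_def by (intro sum_mono)
    then show "d v \<le> real (card I) * K * integral {s..v} d"
      by simp
  qed (use K t cont in auto)
  moreover have "\<bar>x t j - y t j\<bar> \<le> d t"
    unfolding d_def using fin j by (intro member_le_sum) auto
  ultimately show ?thesis by simp
qed

section \<open>Population and player flows\<close>

lemma prob_simplex_bounds:
  fixes m :: "real ^ 'n::finite"
  assumes "m \<in> prob_simplex"
  shows "0 \<le> m $ i" "m $ i \<le> 1"
  using assms member_le_sum[of i UNIV "\<lambda>i. m $ i"] by (auto simp: prob_simplex_def)

lemma vec_lambda_prob_simplex: "(\<chi> i. p i) \<in> prob_simplex \<longleftrightarrow> p \<in> prob_on UNIV"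
  by (simp add: prob_simplex_def prob_on_def)

lemma prob_on_vec_nth: "m \<in> prob_simplex \<Longrightarrow> (\<lambda>i. m $ i) \<in> prob_on UNIV"
  by (simp add: prob_simplex_def prob_on_def)

lemma compact_prob_simplex: "compact (prob_simplex :: (real ^ 'n::finite) set)"
proof -
  have "norm m \<le> real CARD('n)" if "m \<in> prob_simplex" for m :: "real ^ 'n"
  proof -
    have "norm m \<le> (\<Sum>i\<in>UNIV. \<bar>m $ i\<bar>)"
      by (rule norm_le_l1_cart)
    also have "\<dots> \<le> (\<Sum>i\<in>(UNIV :: 'n set). 1)"
      using prob_simplex_bounds[OF that] by (intro sum_mono) simp
    finally show ?thesis by simp
  qed
  then have "bounded (prob_simplex :: (real ^ 'n) set)"
    unfolding bounded_iff by blast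
  moreover have eq: "prob_simplex = (\<Inter>i. {m :: real ^ 'n. 0 \<le> m $ i}) \<inter> {m. (\<Sum>i\<in>UNIV. m $ i) = 1}"
    by (auto simp: prob_simplex_def)
  have "closed (prob_simplex :: (real ^ 'n) set)"
    unfolding eq by (intro closed_Int closed_INT ballI closed_Collect_le closed_Collect_eq continuous_intros)
  ultimately show ?thesis
    by (simp add: compact_eq_bounded_closed)
qed

lemma borel_measurable_vecI:
  fixes f :: "'w \<Rightarrow> real ^ 'n::finite"
  assumes "\<And>i. (\<lambda>w. f w $ i) \<in> borel_measurable M"
  shows "f \<in> borel_measurable M"
  using assms by (subst borel_measurable_euclidean_space) (auto simp: Basis_vec_def inner_axis)

lemma borel_measurable_vec_nth':
  fixes f :: "'w \<Rightarrow> real ^ 'n::finite"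
  assumes "f \<in> borel_measurable M"
  shows "(\<lambda>w. f w $ i) \<in> borel_measurable M"
  using assms borel_measurable_continuous_onI[of "\<lambda>x :: real ^ 'n. x $ i"]
  by (auto intro: measurable_compose continuous_intros)

lemma strategy_bounds:
  assumes "\<pi> \<in> strategies" "0 \<le> t"
  shows "0 \<le> \<pi> i t $ a" "\<pi> i t $ a \<le> 1" "(\<Sum>a\<in>UNIV. \<pi> i t $ a) = 1"
  using assms prob_simplex_bounds[of "\<pi> i t"] by (auto simp: strategies_def) (simp add: prob_simplex_def)

lemma strategy_measurable:
  assumes "\<pi> \<in> strategies"
  shows "(\<lambda>t. \<pi> i t $ a) \<in> borel_measurable (restrict_space borel {0..})"
  using assms by (intro borel_measurable_vec_nth') (simp add: strategies_def)

lemma strategy_bounded_borel: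
  assumes "\<pi> \<in> strategies" "S \<subseteq> {0..}"
  shows "bounded_borel_on S (\<lambda>t. \<pi> i t $ a)"
  using strategy_bounds[OF assms(1)] assms(2)
  by (intro bounded_borel_onI[of _ _ 1] measurable_restrict_mono[OF strategy_measurable[OF assms(1)] assms(2)]) auto

lemma abs_strategy_average_le:
  assumes "\<pi> \<in> strategies" "0 \<le> t" "\<And>a. \<bar>f a\<bar> \<le> K"
  shows "\<bar>\<Sum>a\<in>UNIV. \<pi> i t $ a * f a\<bar> \<le> K"
proof -
  have "\<bar>\<Sum>a\<in>UNIV. \<pi> i t $ a * f a\<bar> \<le> (\<Sum>a\<in>UNIV. \<pi> i t $ a * K)"
    by (rule order_trans[OF sum_abs])
      (use strategy_bounds[OF assms(1,2)] assms(3) in \<open>auto simp: abs_mult intro!: sum_mono mult_left_mono\<close>)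
  also have "\<dots> = K"
    by (simp add: sum_distrib_right[symmetric] strategy_bounds[OF assms(1,2)])
  finally show ?thesis .
qed

text \<open>
  The sum norm is used for all Lipschitz estimates, because the equations are coordinatewise.
\<close>

definition l1_dist :: "real ^ 'n::finite \<Rightarrow> real ^ 'n \<Rightarrow> real" where
  "l1_dist m m' = (\<Sum>i\<in>UNIV. \<bar>m $ i - m' $ i\<bar>)"

lemma l1_dist_nonneg [simp]: "0 \<le> l1_dist m m'"
  by (simp add: l1_dist_def sum_nonneg)

lemma dist_le_l1_dist: "dist m m' \<le> l1_dist m m'"
  unfolding l1_dist_def dist_norm using norm_le_l1_cart[of "m - m'"] by simp

locale lipschitz_mfg =
  fixes G :: "('e::finite, 'a::finite) mfg"
  assumes mfg: "mean_field_game G"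
    and rate_lipschitz: "\<And>i j a. \<exists>L. L-lipschitz_on prob_simplex (rate G i j a)"
    and cost_continuous: "\<And>i a. continuous_on prob_simplex (cost G i a)"
begin

abbreviation \<beta> :: real where "\<beta> \<equiv> discount G"

lemma \<beta>_pos: "0 < \<beta>"
  using mfg by (simp add: mean_field_game_def)

lemma init_simplex: "init G \<in> prob_simplex"
  using mfg by (simp add: mean_field_game_def)

lemma rate_nonneg: "m \<in> prob_simplex \<Longrightarrow> i \<noteq> j \<Longrightarrow> 0 \<le> rate G i j a m"
  using mfg by (auto simp: mean_field_game_def)

lemma rate_row: "m \<in> prob_simplex \<Longrightarrow> (\<Sum>j\<in>UNIV. rate G i j a m) = 0"
  using mfg by (auto simp: mean_field_game_def)

lemma rate_continuous: "continuous_on prob_simplex (rate G i j a)"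
  using rate_lipschitz lipschitz_on_continuous_on by blast

lemma common_bound:
  fixes f :: "'i::finite \<Rightarrow> real ^ 'e \<Rightarrow> real"
  assumes "\<And>i. continuous_on prob_simplex (f i)"
  shows "\<exists>K\<ge>0. \<forall>i. \<forall>m\<in>prob_simplex. \<bar>f i m\<bar> \<le> K"
proof -
  have "\<exists>K. \<forall>m\<in>prob_simplex. \<bar>f i m\<bar> \<le> K" for i
    using compact_imp_bounded[OF compact_continuous_image[OF assms compact_prob_simplex], of i]
    by (auto simp: bounded_iff)
  then obtain K where K: "\<And>i m. m \<in> prob_simplex \<Longrightarrow> \<bar>f i m\<bar> \<le> K i"
    by metis
  have "\<bar>f i m\<bar> \<le> (\<Sum>i\<in>UNIV. \<bar>K i\<bar>)" if "m \<in> prob_simplex" for i m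
    using K[OF that, of i] member_le_sum[of i UNIV "\<lambda>i. \<bar>K i\<bar>"] by auto
  then show ?thesis
    by (intro exI[of _ "\<Sum>i\<in>UNIV. \<bar>K i\<bar>"]) (auto intro: sum_nonneg)
qed

text \<open>
  Bounds that hold for all states and actions at once: there are finitely many of these, and the
  simplex is compact. Every estimate below is uniform in the strategies because it depends only on
  such constants.
\<close>

definition rate_max :: real where
  "rate_max = (SOME K. K \<ge> 0 \<and> (\<forall>i j a. \<forall>m\<in>prob_simplex. \<bar>rate G i j a m\<bar> \<le> K))"

definition cost_max :: real where
  "cost_max = (SOME K. K \<ge> 0 \<and> (\<forall>i a. \<forall>m\<in>prob_simplex. \<bar>cost G i a m\<bar> \<le> K))"

definition rate_lip :: real where
  "rate_lip = (SOME L. L \<ge> 0 \<and> (\<forall>i j a. \<forall>m\<in>prob_simplex. \<forall>m'\<in>prob_simplex.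
     \<bar>rate G i j a m - rate G i j a m'\<bar> \<le> L * l1_dist m m'))"

lemma rate_max: "0 \<le> rate_max" "m \<in> prob_simplex \<Longrightarrow> \<bar>rate G i j a m\<bar> \<le> rate_max"
proof -
  obtain K where "K \<ge> 0" "\<forall>p. \<forall>m\<in>prob_simplex. \<bar>case p of (i, j, a) \<Rightarrow> rate G i j a m\<bar> \<le> K"
    using common_bound[of "\<lambda>p m. case p of (i, j, a) \<Rightarrow> rate G i j a m"] rate_continuous by auto
  then have "\<exists>K. K \<ge> 0 \<and> (\<forall>i j a. \<forall>m\<in>prob_simplex. \<bar>rate G i j a m\<bar> \<le> K)"
    by (intro exI[of _ K]) auto
  from someI_ex[OF this] show "0 \<le> rate_max" "m \<in> prob_simplex \<Longrightarrow> \<bar>rate G i j a m\<bar> \<le> rate_max"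
    by (auto simp: rate_max_def)
qed

lemma cost_max: "0 \<le> cost_max" "m \<in> prob_simplex \<Longrightarrow> \<bar>cost G i a m\<bar> \<le> cost_max"
proof -
  obtain K where "K \<ge> 0" "\<forall>p. \<forall>m\<in>prob_simplex. \<bar>case p of (i, a) \<Rightarrow> cost G i a m\<bar> \<le> K"
    using common_bound[of "\<lambda>p m. case p of (i, a) \<Rightarrow> cost G i a m"] cost_continuous by auto
  then have "\<exists>K. K \<ge> 0 \<and> (\<forall>i a. \<forall>m\<in>prob_simplex. \<bar>cost G i a m\<bar> \<le> K)"
    by (intro exI[of _ K]) auto
  from someI_ex[OF this] show "0 \<le> cost_max" "m \<in> prob_simplex \<Longrightarrow> \<bar>cost G i a m\<bar> \<le> cost_max"
    by (auto simp: cost_max_def)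
qed

lemma rate_lip: "0 \<le> rate_lip"
  "m \<in> prob_simplex \<Longrightarrow> m' \<in> prob_simplex \<Longrightarrow> \<bar>rate G i j a m - rate G i j a m'\<bar> \<le> rate_lip * l1_dist m m'"
proof -
  define L where "L i j a = (SOME L. L-lipschitz_on prob_simplex (rate G i j a))" for i j a
  have L: "(L i j a)-lipschitz_on prob_simplex (rate G i j a)" for i j a
    unfolding L_def by (rule someI_ex[OF rate_lipschitz])
  let ?L = "\<Sum>(i, j, a)\<in>UNIV. L i j a"
  have L0: "0 \<le> L i j a" for i j a
    using L lipschitz_on_nonneg by blast
  have "\<bar>rate G i j a m - rate G i j a m'\<bar> \<le> ?L * l1_dist m m'"
    if "m \<in> prob_simplex" "m' \<in> prob_simplex" for i j a m m'
  proof -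
    have "\<bar>rate G i j a m - rate G i j a m'\<bar> \<le> L i j a * dist m m'"
      using lipschitz_onD[OF L that] by (simp add: dist_real_def)
    also have "\<dots> \<le> ?L * l1_dist m m'"
      using member_le_sum[of "(i, j, a)" UNIV "\<lambda>(i, j, a). L i j a"] L0
      by (intro mult_mono dist_le_l1_dist) (auto intro: sum_nonneg)
    finally show ?thesis .
  qed
  moreover have "0 \<le> ?L"
    using L0 by (auto intro: sum_nonneg)
  ultimately have "\<exists>L. L \<ge> 0 \<and> (\<forall>i j a. \<forall>m\<in>prob_simplex. \<forall>m'\<in>prob_simplex.
     \<bar>rate G i j a m - rate G i j a m'\<bar> \<le> L * l1_dist m m')"
    by blast
  from someI_ex[OF this] show "0 \<le> rate_lip"
    "m \<in> prob_simplex \<Longrightarrow> m' \<in> prob_simplex \<Longrightarrow> \<bar>rate G i j a m - rate G i j a m'\<bar> \<le> rate_lip * l1_dist m m'"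
    by (auto simp: rate_lip_def)
qed

definition drift_rate :: "('e, 'a) strategy \<Rightarrow> real \<Rightarrow> real ^ 'e \<Rightarrow> 'e \<Rightarrow> 'e \<Rightarrow> real" where
  "drift_rate \<pi> t m i j = (\<Sum>a\<in>UNIV. \<pi> i t $ a * rate G i j a m)"

lemma drift_rate_nonneg:
  assumes "\<pi> \<in> strategies" "0 \<le> t" "m \<in> prob_simplex" "i \<noteq> j"
  shows "0 \<le> drift_rate \<pi> t m i j"
  unfolding drift_rate_def using strategy_bounds[OF assms(1,2)] rate_nonneg[OF assms(3,4)]
  by (intro sum_nonneg mult_nonneg_nonneg) auto

lemma drift_rate_row: "m \<in> prob_simplex \<Longrightarrow> (\<Sum>j\<in>UNIV. drift_rate \<pi> t m i j) = 0"
  unfolding drift_rate_def by (subst sum.swap) (simp add: sum_distrib_left[symmetric] rate_row)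

lemma drift_rate_bound:
  assumes "\<pi> \<in> strategies" "0 \<le> t" "m \<in> prob_simplex"
  shows "\<bar>drift_rate \<pi> t m i j\<bar> \<le> rate_max"
  unfolding drift_rate_def by (intro abs_strategy_average_le assms rate_max)

lemma drift_rate_lip:
  assumes "\<pi> \<in> strategies" "0 \<le> t" "m \<in> prob_simplex" "m' \<in> prob_simplex"
  shows "\<bar>drift_rate \<pi> t m i j - drift_rate \<pi> t m' i j\<bar> \<le> rate_lip * l1_dist m m'"
  unfolding drift_rate_def sum_subtractf[symmetric] right_diff_distrib[symmetric]
  by (intro abs_strategy_average_le assms rate_lip)

lemma measurable_along:
  fixes f :: "real ^ 'e \<Rightarrow> real"
  assumes "continuous_on prob_simplex f" "m \<in> borel_measurable (restrict_space borel S)"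
    and "\<And>t. t \<in> S \<Longrightarrow> m t \<in> prob_simplex"
  shows "(\<lambda>t. f (m t)) \<in> borel_measurable (restrict_space borel S)"
proof (rule measurable_compose[of m _ "restrict_space borel prob_simplex" f])
  show "m \<in> restrict_space borel S \<rightarrow>\<^sub>M restrict_space borel prob_simplex"
    using assms by (intro measurable_restrict_space2) (auto simp: space_restrict_space)
  show "f \<in> borel_measurable (restrict_space borel prob_simplex)"
    by (rule borel_measurable_continuous_on_restrict[OF assms(1)])
qed

lemma drift_rate_measurable:
  assumes "\<pi> \<in> strategies" "m \<in> borel_measurable (restrict_space borel {0..})"
    "\<And>t. 0 \<le> t \<Longrightarrow> m t \<in> prob_simplex"
  shows "(\<lambda>t. drift_rate \<pi> t (m t) i j) \<in> borel_measurable (restrict_space borel {0..})"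
  unfolding drift_rate_def
  by (intro borel_measurable_sum borel_measurable_times strategy_measurable measurable_along assms
      rate_continuous) (use assms in auto)

lemma drift_rate_bounded_borel:
  assumes "\<pi> \<in> strategies" "continuous_on {0..} m" "\<And>t. 0 \<le> t \<Longrightarrow> m t \<in> prob_simplex"
    "S \<subseteq> {0..}"
  shows "bounded_borel_on S (\<lambda>t. drift_rate \<pi> t (m t) i j)"
proof (rule bounded_borel_on_subset[OF bounded_borel_onI[of _ _ rate_max] assms(4)])
  show "(\<lambda>t. drift_rate \<pi> t (m t) i j) \<in> borel_measurable (restrict_space borel {0..})"
    using assms by (intro drift_rate_measurable borel_measurable_continuous_on_restrict)
qed (use assms drift_rate_bound in auto)

lemma drift_sum: "(\<Sum>i\<in>UNIV. \<Sum>a\<in>UNIV. x i * rate G i j a m * \<pi> i t $ a) = (\<Sum>i\<in>UNIV. x i * drift_rate \<pi> t m i j)"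
  by (simp add: drift_rate_def sum_distrib_left mult_ac)

text \<open>
  The flow is the solution of a forward equation whose generator depends on the current solution.
\<close>

lemma population_flow:
  assumes \<pi>: "\<pi> \<in> strategies"
  shows "is_population_flow G \<pi> (population_flow G \<pi>)"
proof -
  have "\<exists>m. is_population_flow G \<pi> m"
  proof (rule forward_equation_exists[of UNIV "\<lambda>i. init G $ i" rate_max rate_lip 0
        "\<lambda>t p i j. drift_rate \<pi> t (\<chi> k. p k) i j"])
    show "(\<lambda>i. init G $ i) \<in> prob_on UNIV"
      by (intro prob_on_vec_nth init_simplex)
    show "\<bar>drift_rate \<pi> t (\<chi> k. p k) i j - drift_rate \<pi> t (\<chi> k. q k) i j\<bar> \<le> rate_lip * (\<Sum>i\<in>UNIV. \<bar>p i - q i\<bar>)"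
      if "0 \<le> t" "p \<in> prob_on UNIV" "q \<in> prob_on UNIV" for t p q i j
      using drift_rate_lip[OF \<pi> that(1), of "\<chi> k. p k" "\<chi> k. q k"] that
      by (simp add: vec_lambda_prob_simplex l1_dist_def)
    show "(\<lambda>t. drift_rate \<pi> t (\<chi> k. p t k) i j) \<in> borel_measurable (restrict_space borel {0..})"
      if "\<And>t. 0 \<le> t \<Longrightarrow> p t \<in> prob_on UNIV"
        "\<And>j. j \<in> UNIV \<Longrightarrow> (\<lambda>t. p t j) \<in> borel_measurable (restrict_space borel {0..})" for p i j
      using that by (intro drift_rate_measurable \<pi> borel_measurable_vecI) (simp_all add: vec_lambda_prob_simplex)
    fix p assume p: "\<And>t. 0 \<le> t \<Longrightarrow> p t \<in> prob_on (UNIV :: 'e set)"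
      "\<And>t j. 0 \<le> t \<Longrightarrow> j \<in> UNIV \<Longrightarrow>
        ((\<lambda>u. \<Sum>i\<in>UNIV. p u i * drift_rate \<pi> u (\<chi> k. p u k) i j) has_integral (p t j - init G $ j)) {0..t}"
    have "continuous_on {0..} (\<lambda>t. p t j)" for j
      by (intro continuous_on_atLeastI has_integral_continuous_on[OF p(2)]) auto
    then have "continuous_on {0..} (\<lambda>t. \<chi> j. p t j)"
      by (intro continuous_on_vec_lambda)
    then have "is_population_flow G \<pi> (\<lambda>t. \<chi> j. p t j)"
      using p by (simp add: is_population_flow_def vec_lambda_prob_simplex drift_sum)
    then show ?thesis by blast
  qed (use \<pi> rate_max rate_lip drift_rate_nonneg drift_rate_row drift_rate_bound in
      \<open>auto simp: vec_lambda_prob_simplex\<close>)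
  then show ?thesis
    unfolding population_flow_def by (rule someI_ex)
qed

lemma population_flow_simplex: "\<pi> \<in> strategies \<Longrightarrow> 0 \<le> t \<Longrightarrow> population_flow G \<pi> t \<in> prob_simplex"
  using population_flow by (simp add: is_population_flow_def)

lemma population_flow_continuous: "\<pi> \<in> strategies \<Longrightarrow> continuous_on {0..} (population_flow G \<pi>)"
  using population_flow by (simp add: is_population_flow_def)

lemma population_flow_eq:
  "\<pi> \<in> strategies \<Longrightarrow> 0 \<le> t \<Longrightarrow>
    ((\<lambda>s. \<Sum>i\<in>UNIV. population_flow G \<pi> s $ i * drift_rate \<pi> s (population_flow G \<pi> s) i j)
      has_integral (population_flow G \<pi> t $ j - init G $ j)) {0..t}"
  using population_flow by (simp add: is_population_flow_def drift_sum)

context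
  fixes m :: "real \<Rightarrow> real ^ 'e"
  assumes m_cont: "continuous_on {0..} m" and m_simplex: "\<And>t. 0 \<le> t \<Longrightarrow> m t \<in> prob_simplex"
begin

lemma player_flow_unique:
  assumes \<pi>: "\<pi> \<in> strategies" and x: "is_player_flow G \<pi> m x" and y: "is_player_flow G \<pi> m y"
    and t: "0 \<le> t"
  shows "x t = y t"
proof -
  have "x t $ j = y t $ j" for j
  proof (rule linear_forward_equation_unique[of UNIV rate_max 0 "\<lambda>t i j. drift_rate \<pi> t (m t) i j"
        "\<lambda>t j. x t $ j" "\<lambda>j. init G $ j" "\<lambda>t j. y t $ j"])
    show "\<bar>drift_rate \<pi> t (m t) i j\<bar> \<le> rate_max" if "0 \<le> t" for t i j
      using that by (intro drift_rate_bound \<pi> m_simplex)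
  qed (use x y t rate_max in \<open>auto simp: is_player_flow_def drift_sum\<close>)
  then show ?thesis
    by (simp add: vec_eq_iff)
qed

lemma player_flow_exists:
  assumes \<pi>: "\<pi> \<in> strategies"
  shows "\<exists>x. is_player_flow G \<pi> m x \<and> (\<forall>t\<ge>0. x t \<in> prob_simplex)"
proof (rule forward_equation_exists[of UNIV "\<lambda>i. init G $ i" rate_max 0 0
      "\<lambda>t p i j. drift_rate \<pi> t (m t) i j"])
  show "(\<lambda>i. init G $ i) \<in> prob_on UNIV"
    by (intro prob_on_vec_nth init_simplex)
  show "(\<lambda>t. drift_rate \<pi> t (m t) i j) \<in> borel_measurable (restrict_space borel {0..})" for i j
    using m_simplex m_cont by (intro drift_rate_measurable \<pi> borel_measurable_continuous_on_restrict)
  fix p assume p: "\<And>t. 0 \<le> t \<Longrightarrow> p t \<in> prob_on (UNIV :: 'e set)"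
    "\<And>t j. 0 \<le> t \<Longrightarrow> j \<in> UNIV \<Longrightarrow>
      ((\<lambda>u. \<Sum>i\<in>UNIV. p u i * drift_rate \<pi> u (m u) i j) has_integral (p t j - init G $ j)) {0..t}"
  have "continuous_on {0..} (\<lambda>t. p t j)" for j
    by (intro continuous_on_atLeastI has_integral_continuous_on[OF p(2)]) auto
  then have "continuous_on {0..} (\<lambda>t. \<chi> j. p t j)"
    by (intro continuous_on_vec_lambda)
  then have "is_player_flow G \<pi> m (\<lambda>t. \<chi> j. p t j)"
    using p by (simp add: is_player_flow_def drift_sum)
  moreover have "\<forall>t\<ge>0. (\<chi> j. p t j) \<in> prob_simplex"
    using p by (simp add: vec_lambda_prob_simplex)
  ultimately show ?thesis by blast
qed (use \<pi> m_simplex rate_max drift_rate_nonneg drift_rate_row drift_rate_bound in auto)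

lemma player_flow: "\<pi> \<in> strategies \<Longrightarrow> is_player_flow G \<pi> m (player_flow G \<pi> m)"
  using player_flow_exists unfolding player_flow_def by (metis someI_ex)

lemma player_flow_simplex: "\<pi> \<in> strategies \<Longrightarrow> 0 \<le> t \<Longrightarrow> player_flow G \<pi> m t \<in> prob_simplex"
  using player_flow_exists player_flow_unique player_flow by metis

lemma player_flow_continuous: "\<pi> \<in> strategies \<Longrightarrow> continuous_on {0..} (player_flow G \<pi> m)"
  using player_flow by (simp add: is_player_flow_def)

lemma player_flow_eq:
  "\<pi> \<in> strategies \<Longrightarrow> 0 \<le> t \<Longrightarrow>
    ((\<lambda>s. \<Sum>i\<in>UNIV. player_flow G \<pi> m s $ i * drift_rate \<pi> s (m s) i j)
      has_integral (player_flow G \<pi> m t $ j - init G $ j)) {0..t}"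
  using player_flow by (simp add: is_player_flow_def drift_sum)

end

text \<open>
  A player who follows the crowd is distributed like the crowd.
\<close>

lemma player_flow_population:
  assumes "\<pi> \<in> strategies" "0 \<le> t"
  shows "player_flow G \<pi> (population_flow G \<pi>) t = population_flow G \<pi> t"
proof (rule player_flow_unique[OF population_flow_continuous population_flow_simplex])
  show "is_player_flow G \<pi> (population_flow G \<pi>) (population_flow G \<pi>)"
    using population_flow[OF assms(1)] by (simp add: is_player_flow_def is_population_flow_def)
qed (use assms in \<open>auto intro!: player_flow population_flow_continuous population_flow_simplex\<close>)

end

section \<open>Jump processes with bounded measurable rates\<close>

text \<open>
  Diagonal values \<open>q t x x\<close> stand for jumps that change nothing. The process is built by
  uniformization: a clock offers each state at rate \<open>R\<close>, and the offer to move from \<open>x\<close> to \<open>y\<close> at time \<open>t\<close>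
  is accepted with probability \<open>q t x y / R\<close>.
\<close>

locale bounded_jump_rates =
  fixes C :: "'c set" and q :: "real \<Rightarrow> 'c \<Rightarrow> 'c \<Rightarrow> real" and R :: real
  assumes fin_C: "finite C" and C_ne: "C \<noteq> {}" and R_pos: "0 < R"
    and q_bounds: "\<And>t x y. \<lbrakk>x \<in> C; y \<in> C\<rbrakk> \<Longrightarrow> 0 \<le> q t x y" "\<And>t x y. \<lbrakk>x \<in> C; y \<in> C\<rbrakk> \<Longrightarrow> q t x y \<le> R"
    and q_measurable [measurable]: "\<And>x y. \<lbrakk>x \<in> C; y \<in> C\<rbrakk> \<Longrightarrow> (\<lambda>t. q t x y) \<in> borel_measurable borel"
begin

definition \<Lambda> :: real where "\<Lambda> = R * card C"

lemma card_C_pos: "0 < card C"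
  using fin_C C_ne by (simp add: card_gt_0_iff)

lemma \<Lambda>_pos: "0 < \<Lambda>"
  using R_pos card_C_pos by (simp add: \<Lambda>_def)

definition marks :: "('c \<times> real) measure" where
  "marks = uniform_count_measure C \<Otimes>\<^sub>M uniform_measure lborel {0..1}"

definition gaps :: "real measure" where
  "gaps = density lborel (exponential_density \<Lambda>)"

text \<open>
  The independent input of one ring of the clock: the time since the previous ring, the state that is
  offered, and a uniform variable that decides on acceptance.
\<close>

definition noise :: "(real \<times> 'c \<times> real) measure" where
  "noise = gaps \<Otimes>\<^sub>M marks"

definition \<S> :: "(real \<times> 'c \<times> real) stream measure" where
  "\<S> = stream_space noise"

sublocale uniform01: prob_space "uniform_measure lborel {0..1::real}"
  by (rule prob_space_uniform_measure) auto

sublocale candidates: prob_space "uniform_count_measure C"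
  by (rule prob_space_uniform_count_measure[OF fin_C C_ne])

sublocale marks: pair_prob_space "uniform_count_measure C" "uniform_measure lborel {0..1::real}" ..

sublocale marks: prob_space marks
  unfolding marks_def by (rule marks.prob_space_axioms)

sublocale gaps: prob_space gaps
  unfolding gaps_def by (rule prob_space_exponential_density[OF \<Lambda>_pos])

sublocale noise_pair: pair_prob_space gaps marks ..

sublocale noise: prob_space noise
  unfolding noise_def by (rule noise_pair.prob_space_axioms)

sublocale \<S>: prob_space \<S>
  unfolding \<S>_def by (rule noise.prob_space_stream_space)

lemma sets_marks [measurable_cong]: "sets marks = sets (count_space C \<Otimes>\<^sub>M borel)"
  unfolding marks_def by (intro sets_pair_measure_cong) (auto simp: sets_uniform_count_measure)

lemma sets_gaps [measurable_cong]: "sets gaps = sets borel"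
  by (simp add: gaps_def)

lemma sets_noise [measurable_cong]: "sets noise = sets (borel \<Otimes>\<^sub>M (count_space C \<Otimes>\<^sub>M borel))"
  unfolding noise_def by (intro sets_pair_measure_cong sets_gaps sets_marks)

lemma sets_\<S> [measurable_cong]: "sets \<S> = sets (stream_space (borel \<Otimes>\<^sub>M (count_space C \<Otimes>\<^sub>M borel)))"
  unfolding \<S>_def by (intro sets_stream_space_cong sets_noise)

lemma space_noise: "space noise = UNIV \<times> C \<times> UNIV"
  using sets_eq_imp_space_eq[OF sets_noise] by (simp add: space_pair_measure)

lemma space_marks: "space marks = C \<times> UNIV"
  using sets_eq_imp_space_eq[OF sets_marks] by (simp add: space_pair_measure)

definition jump :: "real \<Rightarrow> 'c \<Rightarrow> 'c \<times> real \<Rightarrow> 'c" where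
  "jump r x m = (if snd m \<le> q r x (fst m) / R then fst m else x)"

lemma jump_in_C: "x \<in> C \<Longrightarrow> m \<in> space marks \<Longrightarrow> jump r x m \<in> C"
  by (auto simp: jump_def space_marks)

lemma measurable_jump [measurable (raw)]:
  assumes [measurable]: "r \<in> M \<rightarrow>\<^sub>M borel" "X \<in> M \<rightarrow>\<^sub>M count_space C" "m \<in> M \<rightarrow>\<^sub>M count_space C \<Otimes>\<^sub>M borel"
  shows "(\<lambda>w. jump (r w) (X w) (m w)) \<in> M \<rightarrow>\<^sub>M count_space C"
proof (rule measurable_compose_countable'[where f = "\<lambda>x w. jump (r w) x (m w)" and g = X and I = C])
  show "countable C"
    using fin_C by (rule countable_finite)
  fix x assume x: "x \<in> C"
  have "(\<lambda>w. if snd (m w) \<le> q (r w) x (fst (m w)) / R then fst (m w) else x) \<in> M \<rightarrow>\<^sub>M count_space C"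
  proof (rule measurable_compose_countable'[where g = "\<lambda>w. fst (m w)" and I = C and
        f = "\<lambda>y w. if snd (m w) \<le> q (r w) x y / R then y else x"])
    fix y assume y: "y \<in> C"
    show "(\<lambda>w. if snd (m w) \<le> q (r w) x y / R then y else x) \<in> M \<rightarrow>\<^sub>M count_space C"
    proof (rule measurable_If)
      show "{w \<in> space M. snd (m w) \<le> q (r w) x y / R} \<in> sets M"
        using q_measurable[OF x y] by measurable
    qed (use x y in auto)
  qed (use fin_C in \<open>auto intro: countable_finite\<close>)
  then show "(\<lambda>w. jump (r w) x (m w)) \<in> M \<rightarrow>\<^sub>M count_space C"
    by (simp add: jump_def)
qed simp

definition arrival :: "real \<Rightarrow> (real \<times> 'c \<times> real) stream \<Rightarrow> nat \<Rightarrow> real" where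
  "arrival s \<omega> k = s + (\<Sum>i<k. fst (\<omega> !! i))"

primrec visited :: "real \<Rightarrow> 'c \<Rightarrow> (real \<times> 'c \<times> real) stream \<Rightarrow> nat \<Rightarrow> 'c" where
  "visited s x \<omega> 0 = x"
| "visited s x \<omega> (Suc k) = jump (arrival s \<omega> (Suc k)) (visited s x \<omega> k) (snd (\<omega> !! k))"

text \<open>
  The index is the number of rings up to time \<open>t\<close>. It is meaningful when the rings do not accumulate,
  that is, for \<open>regular\<close> inputs.
\<close>

definition path :: "real \<Rightarrow> 'c \<Rightarrow> (real \<times> 'c \<times> real) stream \<Rightarrow> real \<Rightarrow> 'c" where
  "path s x \<omega> t = visited s x \<omega> (LEAST k. t < arrival s \<omega> (Suc k))"

definition regular :: "(real \<times> 'c \<times> real) stream \<Rightarrow> bool" where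
  "regular \<omega> \<longleftrightarrow> (\<forall>i. 0 < fst (\<omega> !! i)) \<and> (\<forall>B :: nat. \<exists>k. real B < (\<Sum>i<k. fst (\<omega> !! i)))"

lemma arrival_Suc: "arrival s (a ## \<omega>) (Suc k) = arrival (s + fst a) \<omega> k"
  unfolding arrival_def by (subst sum.lessThan_Suc_shift) (simp add: add.assoc)

lemma visited_Suc:
  "visited s x (a ## \<omega>) (Suc k) = visited (s + fst a) (jump (s + fst a) x (snd a)) \<omega> k"
proof (induction k)
  case 0
  then show ?case by (simp add: arrival_def)
next
  case (Suc k)
  have "visited s x (a ## \<omega>) (Suc (Suc k)) =
      jump (arrival s (a ## \<omega>) (Suc (Suc k))) (visited s x (a ## \<omega>) (Suc k)) (snd (\<omega> !! k))"
    by (subst visited.simps(2)) simp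
  also have "\<dots> = visited (s + fst a) (jump (s + fst a) x (snd a)) \<omega> (Suc k)"
    unfolding Suc.IH arrival_Suc by simp
  finally show ?case .
qed

lemma regular_Stream: "regular (a ## \<omega>) \<longleftrightarrow> 0 < fst a \<and> regular \<omega>"
proof
  assume l: "regular (a ## \<omega>)"
  have pos: "0 < fst (\<omega> !! i)" for i
    using l unfolding regular_def by (metis Stream_snth nat.case(2))
  have a: "0 < fst a"
    using l unfolding regular_def by (metis Stream_snth nat.case(1))
  have "\<exists>k. real B < (\<Sum>i<k. fst (\<omega> !! i))" for B :: nat
  proof -
    obtain B' :: nat where B': "real B + fst a < real B'"
      using reals_Archimedean2 by blast
    obtain k where k: "real B' < (\<Sum>i<k. fst ((a ## \<omega>) !! i))"
      using l unfolding regular_def by blast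
    then obtain k' where "k = Suc k'"
      by (cases k) auto
    then show ?thesis
      using k B' by (intro exI[of _ k']) (simp add: sum.lessThan_Suc_shift del: sum.lessThan_Suc)
  qed
  then show "0 < fst a \<and> regular \<omega>"
    using pos a by (auto simp: regular_def)
next
  assume r: "0 < fst a \<and> regular \<omega>"
  have "0 < fst ((a ## \<omega>) !! i)" for i
    using r by (cases i) (auto simp: regular_def)
  moreover have "\<exists>k. real B < (\<Sum>i<k. fst ((a ## \<omega>) !! i))" for B :: nat
  proof -
    obtain k where "real B < (\<Sum>i<k. fst (\<omega> !! i))"
      using r unfolding regular_def by blast
    then show ?thesis
      using r by (intro exI[of _ "Suc k"]) (simp add: sum.lessThan_Suc_shift del: sum.lessThan_Suc)
  qed
  ultimately show "regular (a ## \<omega>)"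
    by (simp add: regular_def)
qed

lemma regular_arrival:
  assumes "regular \<omega>"
  shows "\<exists>k. t < arrival s \<omega> k"
proof -
  obtain B :: nat where "t - s < real B"
    using reals_Archimedean2 by blast
  moreover obtain k where "real B < (\<Sum>i<k. fst (\<omega> !! i))"
    using assms unfolding regular_def by blast
  ultimately show ?thesis
    by (intro exI[of _ k]) (simp add: arrival_def)
qed

text \<open>
  The first ring restarts the construction at a new time and state. This recursion is the source of
  all later facts about paths.
\<close>

lemma path_Stream:
  assumes "regular (a ## \<omega>)"
  shows "path s x (a ## \<omega>) t =
    (if t < s + fst a then x else path (s + fst a) (jump (s + fst a) x (snd a)) \<omega> t)"
proof (cases "t < s + fst a")
  case True
  have "(LEAST k. t < arrival s (a ## \<omega>) (Suc k)) = 0"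
    using True by (intro Least_eq_0) (simp add: arrival_Suc arrival_def)
  then show ?thesis
    using True by (simp add: path_def)
next
  case False
  let ?P = "\<lambda>k. t < arrival s (a ## \<omega>) (Suc k)"
  have "regular \<omega>"
    using assms by (simp add: regular_Stream)
  from regular_arrival[OF this] obtain k where "?P k"
    unfolding arrival_Suc by blast
  moreover have "\<not> ?P 0"
    using False by (simp add: arrival_Suc arrival_def)
  ultimately have "(LEAST k. ?P k) = Suc (LEAST k. ?P (Suc k))"
    by (rule Least_Suc)
  then show ?thesis
    using False by (simp add: path_def visited_Suc arrival_Suc del: visited.simps(2))
qed

lemma path_right_constant:
  assumes "regular \<omega>" "s \<le> t"
  shows "\<forall>\<^sub>F u in at_right t. path s x \<omega> u = path s x \<omega> t"
proof -
  obtain k where "t < arrival s \<omega> k"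
    using regular_arrival[OF assms(1)] by blast
  with assms show ?thesis
  proof (induction k arbitrary: s x \<omega>)
    case 0
    then show ?case by (simp add: arrival_def)
  next
    case (Suc k)
    obtain a \<omega>' where \<omega>: "\<omega> = a ## \<omega>'"
      by (cases \<omega>)
    note rec = path_Stream[OF Suc.prems(1)[unfolded \<omega>], of s x, folded \<omega>]
    show ?case
    proof (cases "t < s + fst a")
      case True
      have "\<forall>\<^sub>F u in at_right t. u < s + fst a"
        by (rule order_tendstoD(2)[OF tendsto_ident_at True])
      then show ?thesis
        using True by (auto simp: rec elim!: eventually_mono)
    next
      case False
      have "\<forall>\<^sub>F u in at_right t. path (s + fst a) (jump (s + fst a) x (snd a)) \<omega>' u =
          path (s + fst a) (jump (s + fst a) x (snd a)) \<omega>' t"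
        using Suc.prems False by (intro Suc.IH) (auto simp: \<omega> regular_Stream arrival_Suc)
      moreover have "\<forall>\<^sub>F u in at_right t. t < u"
        by (simp add: eventually_at_filter)
      ultimately show ?thesis
        by eventually_elim (use False in \<open>simp add: rec\<close>)
    qed
  qed
qed

lemma path_left_limit:
  assumes "regular \<omega>" "s < t"
  shows "\<exists>y. \<forall>\<^sub>F u in at_left t. path s x \<omega> u = y"
proof -
  obtain k where "t < arrival s \<omega> k"
    using regular_arrival[OF assms(1)] by blast
  with assms show ?thesis
  proof (induction k arbitrary: s x \<omega>)
    case 0
    then show ?case by (simp add: arrival_def)
  next
    case (Suc k)
    obtain a \<omega>' where \<omega>: "\<omega> = a ## \<omega>'"
      by (cases \<omega>)
    note rec = path_Stream[OF Suc.prems(1)[unfolded \<omega>], of s x, folded \<omega>]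
    show ?case
    proof (cases "t \<le> s + fst a")
      case True
      have "\<forall>\<^sub>F u in at_left t. u < t"
        by (simp add: eventually_at_filter)
      then have "\<forall>\<^sub>F u in at_left t. path s x \<omega> u = x"
        by eventually_elim (use True in \<open>simp add: rec\<close>)
      then show ?thesis by blast
    next
      case False
      have "\<exists>y. \<forall>\<^sub>F u in at_left t. path (s + fst a) (jump (s + fst a) x (snd a)) \<omega>' u = y"
        using Suc.prems False by (intro Suc.IH) (auto simp: \<omega> regular_Stream arrival_Suc)
      then obtain y where "\<forall>\<^sub>F u in at_left t. path (s + fst a) (jump (s + fst a) x (snd a)) \<omega>' u = y"
        by blast
      moreover have "\<forall>\<^sub>F u in at_left t. s + fst a < u"
        by (rule order_tendstoD(1)[OF tendsto_ident_at]) (use False in simp)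
      ultimately have "\<forall>\<^sub>F u in at_left t. path s x \<omega> u = y"
        by eventually_elim (simp add: rec)
      then show ?thesis by blast
    qed
  qed
qed

lemma path_start: "regular \<omega> \<Longrightarrow> path s x \<omega> s = x"
  by (cases \<omega>) (simp add: path_Stream regular_Stream)

lemma measurable_snth_\<S>: "(\<lambda>\<omega>. \<omega> !! i) \<in> \<S> \<rightarrow>\<^sub>M borel \<Otimes>\<^sub>M (count_space C \<Otimes>\<^sub>M borel)"
  unfolding \<S>_def using measurable_snth[of i noise] measurable_cong_sets[OF refl sets_noise] by blast

lemma measurable_gap [measurable (raw)]:
  assumes "W \<in> M \<rightarrow>\<^sub>M \<S>"
  shows "(\<lambda>w. fst (W w !! i)) \<in> borel_measurable M"
  by (rule measurable_compose[OF measurable_compose[OF assms measurable_snth_\<S>] measurable_fst])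

lemma measurable_mark:
  assumes "W \<in> M \<rightarrow>\<^sub>M \<S>"
  shows "(\<lambda>w. snd (W w !! i)) \<in> M \<rightarrow>\<^sub>M count_space C \<Otimes>\<^sub>M borel"
  by (rule measurable_compose[OF measurable_compose[OF assms measurable_snth_\<S>] measurable_snd])

lemma measurable_arrival [measurable (raw)]:
  assumes [measurable]: "s \<in> M \<rightarrow>\<^sub>M borel" "W \<in> M \<rightarrow>\<^sub>M \<S>"
  shows "(\<lambda>w. arrival (s w) (W w) k) \<in> borel_measurable M"
  unfolding arrival_def by measurable

lemma measurable_visited:
  assumes [measurable]: "s \<in> M \<rightarrow>\<^sub>M borel" "W \<in> M \<rightarrow>\<^sub>M \<S>" and x: "x \<in> C"
  shows "(\<lambda>w. visited (s w) x (W w) k) \<in> M \<rightarrow>\<^sub>M count_space C"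
proof (induction k)
  case 0
  then show ?case using x by simp
next
  case (Suc k)
  show ?case
    by (simp only: visited.simps) (intro measurable_jump measurable_arrival measurable_mark Suc assms)
qed

lemma measurable_path [measurable (raw)]:
  assumes [measurable]: "s \<in> M \<rightarrow>\<^sub>M borel" "X \<in> M \<rightarrow>\<^sub>M count_space C" "W \<in> M \<rightarrow>\<^sub>M \<S>"
  shows "(\<lambda>w. path (s w) (X w) (W w) t) \<in> M \<rightarrow>\<^sub>M count_space C"
proof (rule measurable_compose_countable'[where f = "\<lambda>x w. path (s w) x (W w) t" and g = X and I = C])
  fix x assume x: "x \<in> C"
  have "(\<lambda>w. visited (s w) x (W w) (LEAST k. t < arrival (s w) (W w) (Suc k))) \<in> M \<rightarrow>\<^sub>M count_space C"
    by (rule measurable_compose_countable[where f = "\<lambda>k w. visited (s w) x (W w) k"])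
      (use x measurable_visited in \<open>measurable\<close>)
  then show "(\<lambda>w. path (s w) x (W w) t) \<in> M \<rightarrow>\<^sub>M count_space C"
    by (simp add: path_def)
qed (use fin_C in \<open>auto intro: countable_finite\<close>)

lemma measurable_regular [measurable]: "Measurable.pred \<S> regular"
  unfolding regular_def by measurable

lemma noise_gap_positive: "AE a in noise. 0 < fst a"
proof -
  have "AE e in gaps. 0 < e"
  proof -
    have "AE e in lborel. e \<noteq> (0 :: real)"
      by (rule AE_lborel_singleton)
    then show ?thesis
      unfolding gaps_def by (subst AE_density) (auto simp: exponential_density_def elim!: eventually_mono)
  qed
  then show ?thesis
    unfolding noise_def by (intro noise_pair.AE_pair_measure) auto
qed

lemma gap_exp_moment: "(\<integral>\<^sup>+a. ennreal (exp (- fst a)) \<partial>noise) = ennreal (\<Lambda> / (\<Lambda> + 1))"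
proof -
  have "(\<integral>\<^sup>+a. ennreal (exp (- fst a)) \<partial>noise) = (\<integral>\<^sup>+e. \<integral>\<^sup>+m. ennreal (exp (- e)) \<partial>marks \<partial>gaps)"
    unfolding noise_def by (subst marks.nn_integral_fst[symmetric]) simp_all
  also have "\<dots> = (\<integral>\<^sup>+e. ennreal (exp (- e)) \<partial>gaps)"
    by (simp add: marks.emeasure_space_1)
  also have "\<dots> = (\<integral>\<^sup>+e. ennreal (exponential_density \<Lambda> e) * ennreal (exp (- e)) \<partial>lborel)"
    unfolding gaps_def by (subst nn_integral_density) simp_all
  also have "\<dots> = (\<integral>\<^sup>+e. ennreal (\<Lambda> / (\<Lambda> + 1)) * ennreal (exponential_density (\<Lambda> + 1) e) \<partial>lborel)"
    using \<Lambda>_pos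
    by (intro nn_integral_cong)
      (auto simp: exponential_density_def ennreal_mult'[symmetric] exp_add[symmetric] field_simps)
  also have "\<dots> = ennreal (\<Lambda> / (\<Lambda> + 1)) * (\<integral>\<^sup>+e. ennreal (exponential_density (\<Lambda> + 1) e) \<partial>lborel)"
    by (rule nn_integral_cmult) simp
  also have "(\<integral>\<^sup>+e. ennreal (exponential_density (\<Lambda> + 1) e) \<partial>lborel) = 1"
    using prob_space.emeasure_space_1[OF prob_space_exponential_density[of "\<Lambda> + 1"]] \<Lambda>_pos
    by (simp add: emeasure_density)
  finally show ?thesis by simp
qed

text \<open>
  The Laplace transform of the \<open>k\<close>-th ring decays geometrically in \<open>k\<close>, so that the rings cannot
  accumulate at a finite time.
\<close>

lemma arrivals_exp_moment:
  "(\<integral>\<^sup>+\<omega>. ennreal (exp (- (\<Sum>i<k. fst (\<omega> !! i)))) \<partial>\<S>) = ennreal ((\<Lambda> / (\<Lambda> + 1)) ^ k)"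
proof (induction k)
  case 0
  then show ?case by (simp add: \<S>.emeasure_space_1)
next
  case (Suc k)
  have "(\<integral>\<^sup>+\<omega>. ennreal (exp (- (\<Sum>i<Suc k. fst (\<omega> !! i)))) \<partial>\<S>) =
      (\<integral>\<^sup>+a. \<integral>\<^sup>+\<omega>. ennreal (exp (- (\<Sum>i<Suc k. fst ((a ## \<omega>) !! i)))) \<partial>\<S> \<partial>noise)"
    unfolding \<S>_def by (subst noise.nn_integral_stream_space) simp_all
  also have "\<dots> = (\<integral>\<^sup>+a. \<integral>\<^sup>+\<omega>. ennreal (exp (- fst a)) * ennreal (exp (- (\<Sum>i<k. fst (\<omega> !! i)))) \<partial>\<S> \<partial>noise)"
    by (simp add: sum.lessThan_Suc_shift ennreal_mult[symmetric] exp_add[symmetric] add.commute del: sum.lessThan_Suc)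
  also have "\<dots> = (\<integral>\<^sup>+a. ennreal (exp (- fst a)) * ennreal ((\<Lambda> / (\<Lambda> + 1)) ^ k) \<partial>noise)"
    by (subst nn_integral_cmult) (simp_all add: Suc)
  also have "\<dots> = (\<integral>\<^sup>+a. ennreal (exp (- fst a)) \<partial>noise) * ennreal ((\<Lambda> / (\<Lambda> + 1)) ^ k)"
    by (rule nn_integral_multc) simp
  finally show ?case
    using \<Lambda>_pos by (simp add: gap_exp_moment ennreal_mult[symmetric])
qed

lemma AE_regular: "AE \<omega> in \<S>. regular \<omega>"
proof -
  have "Measurable.pred noise (\<lambda>a. 0 < fst a)"
    by measurable
  from noise.AE_stream_all[OF this noise_gap_positive] have "AE \<omega> in \<S>. \<forall>i. 0 < fst (\<omega> !! i)"
    unfolding \<S>_def by (auto simp: stream_all_def elim!: eventually_mono)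
  moreover have "AE \<omega> in \<S>. \<exists>k. real B < (\<Sum>i<k. fst (\<omega> !! i))" for B :: nat
  proof -
    let ?N = "{\<omega> \<in> space \<S>. \<not> (\<exists>k. real B < (\<Sum>i<k. fst (\<omega> !! i)))}"
    have N [measurable]: "?N \<in> sets \<S>"
      by measurable
    have "emeasure \<S> ?N \<le> ennreal (exp B * (\<Lambda> / (\<Lambda> + 1)) ^ k)" for k
    proof -
      have "emeasure \<S> ?N = (\<integral>\<^sup>+\<omega>. indicator ?N \<omega> \<partial>\<S>)"
        by simp
      also have "\<dots> \<le> (\<integral>\<^sup>+\<omega>. ennreal (exp B) * ennreal (exp (- (\<Sum>i<k. fst (\<omega> !! i)))) \<partial>\<S>)"
      proof (rule nn_integral_mono)
        fix \<omega>
        show "indicator ?N \<omega> \<le> ennreal (exp B) * ennreal (exp (- (\<Sum>i<k. fst (\<omega> !! i))))"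
        proof (cases "\<omega> \<in> ?N")
          case True
          then have "(\<Sum>i<k. fst (\<omega> !! i)) \<le> real B"
            by (auto simp: not_less)
          then have "1 \<le> exp (real B - (\<Sum>i<k. fst (\<omega> !! i)))"
            by simp
          then show ?thesis
            using True by (simp add: ennreal_mult[symmetric] exp_add[symmetric])
        qed simp
      qed
      also have "\<dots> = ennreal (exp B) * ennreal ((\<Lambda> / (\<Lambda> + 1)) ^ k)"
        by (subst nn_integral_cmult) (simp_all add: arrivals_exp_moment)
      finally show ?thesis
        using \<Lambda>_pos by (simp add: ennreal_mult)
    qed
    moreover have "(\<lambda>k. ennreal (exp B * (\<Lambda> / (\<Lambda> + 1)) ^ k)) \<longlonglongrightarrow> ennreal (exp B * 0)"
      using \<Lambda>_pos by (intro tendsto_intros LIMSEQ_realpow_zero) auto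
    ultimately have "emeasure \<S> ?N \<le> ennreal (exp B * 0)"
      by (intro LIMSEQ_le_const) auto
    then have "emeasure \<S> ?N = 0"
      by simp
    then have "AE \<omega> in \<S>. \<omega> \<notin> ?N"
      using N by (intro AE_not_in) (auto simp: null_sets_def)
    then show ?thesis
      by (rule AE_mp) (auto intro!: AE_I2)
  qed
  ultimately show ?thesis
    unfolding regular_def by (simp add: AE_all_countable)
qed

definition hit :: "(real \<times> 'c set) list \<Rightarrow> real \<Rightarrow> 'c \<Rightarrow> (real \<times> 'c \<times> real) stream \<Rightarrow> bool" where
  "hit L s x \<omega> \<longleftrightarrow> (\<forall>p\<in>set L. path s x \<omega> (fst p) \<in> snd p)"

text \<open>
  The probability that the path started in \<open>x\<close> at time \<open>s\<close> is found in the prescribed sets at the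
  prescribed times.
\<close>

definition \<Psi> :: "(real \<times> 'c set) list \<Rightarrow> real \<Rightarrow> 'c \<Rightarrow> real" where
  "\<Psi> L s x = measure \<S> {\<omega> \<in> space \<S>. hit L s x \<omega>}"

lemma \<Psi>_bounds: "0 \<le> \<Psi> L s x" "\<Psi> L s x \<le> 1"
  by (simp_all add: \<Psi>_def)

lemma measurable_hit [measurable (raw)]:
  assumes "s \<in> M \<rightarrow>\<^sub>M borel" "X \<in> M \<rightarrow>\<^sub>M count_space C" "W \<in> M \<rightarrow>\<^sub>M \<S>"
  shows "Measurable.pred M (\<lambda>w. hit L (s w) (X w) (W w))"
  unfolding hit_def
  by (intro pred_intros_finite(3) measurable_compose[OF measurable_path[OF assms]]) simp_all

lemma pred_hit [measurable]:
  assumes "x \<in> C"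
  shows "Measurable.pred \<S> (hit L s x)"
  using assms by (intro measurable_hit[of "\<lambda>_. s" \<S> "\<lambda>_. x" "\<lambda>w. w"]) simp_all

lemma ennreal_\<Psi>:
  assumes "x \<in> C"
  shows "ennreal (\<Psi> L s x) = (\<integral>\<^sup>+\<omega>. indicator {\<omega>. hit L s x \<omega>} \<omega> \<partial>\<S>)"
proof -
  have [measurable]: "{\<omega> \<in> space \<S>. hit L s x \<omega>} \<in> sets \<S>"
    using pred_hit[OF assms] by (simp add: pred_def)
  have "(\<integral>\<^sup>+\<omega>. indicator {\<omega>. hit L s x \<omega>} \<omega> \<partial>\<S>) = (\<integral>\<^sup>+\<omega>. indicator {\<omega> \<in> space \<S>. hit L s x \<omega>} \<omega> \<partial>\<S>)"
    by (intro nn_integral_cong) (auto split: split_indicator)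
  then show ?thesis
    by (simp add: \<Psi>_def \<S>.emeasure_eq_measure)
qed

text \<open>
  The probability of the same event for a path that stays in \<open>x\<close> until the clock rings at time \<open>r\<close>.
\<close>

definition after_jump :: "(real \<times> 'c set) list \<Rightarrow> 'c \<Rightarrow> real \<Rightarrow> ennreal" where
  "after_jump L x r = (\<integral>\<^sup>+m. \<integral>\<^sup>+\<omega>. indicator {\<omega>. \<forall>p\<in>set L.
     (if fst p < r then x else path r (jump r x m) \<omega> (fst p)) \<in> snd p} \<omega> \<partial>\<S> \<partial>marks)"

lemma measurable_after_jump_event:
  assumes x: "x \<in> C" and r: "r \<in> M \<rightarrow>\<^sub>M borel" and m: "m \<in> M \<rightarrow>\<^sub>M marks" and W: "W \<in> M \<rightarrow>\<^sub>M \<S>"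
  shows "(\<lambda>w. indicator {\<omega>. \<forall>p\<in>set L.
     (if fst p < r w then x else path (r w) (jump (r w) x (m w)) \<omega> (fst p)) \<in> snd p} (W w) :: ennreal)
     \<in> borel_measurable M"
proof -
  have m': "m \<in> M \<rightarrow>\<^sub>M count_space C \<Otimes>\<^sub>M borel"
    using m measurable_cong_sets[OF refl sets_marks] by blast
  have p: "Measurable.pred M (\<lambda>w. \<forall>p\<in>set L.
      (if fst p < r w then x else path (r w) (jump (r w) x (m w)) (W w) (fst p)) \<in> snd p)"
  proof (intro pred_intros_finite(3))
    fix p assume "p \<in> set L"
    have "(\<lambda>w. if fst p < r w then x else path (r w) (jump (r w) x (m w)) (W w) (fst p)) \<in> M \<rightarrow>\<^sub>M count_space C"
      using r x by (intro measurable_If measurable_path measurable_jump r m' W) (auto intro: measurable_const)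
    then show "Measurable.pred M (\<lambda>w.
      (if fst p < r w then x else path (r w) (jump (r w) x (m w)) (W w) (fst p)) \<in> snd p)"
      by (rule measurable_compose) simp
  qed simp
  have "(\<lambda>w. indicator {w. \<forall>p\<in>set L.
      (if fst p < r w then x else path (r w) (jump (r w) x (m w)) (W w) (fst p)) \<in> snd p} w :: ennreal) \<in> borel_measurable M"
    using p by measurable
  then show ?thesis
    by (simp add: indicator_def)
qed

lemma measurable_after_jump [measurable]:
  assumes "x \<in> C"
  shows "after_jump L x \<in> borel_measurable borel"
  unfolding after_jump_def
proof (rule marks.borel_measurable_nn_integral)
  let ?E = "\<lambda>r m. {\<omega>. \<forall>p\<in>set L. (if fst p < r then x else path r (jump r x m) \<omega> (fst p)) \<in> snd p}"
  have "(\<lambda>w. \<integral>\<^sup>+\<omega>. indicator (?E (fst w) (snd w)) \<omega> \<partial>\<S>) \<in> borel_measurable (borel \<Otimes>\<^sub>M marks)"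
  proof (rule \<S>.borel_measurable_nn_integral)
    show "(\<lambda>(w, \<omega>). indicator (?E (fst w) (snd w)) \<omega> :: ennreal) \<in> borel_measurable ((borel \<Otimes>\<^sub>M marks) \<Otimes>\<^sub>M \<S>)"
      unfolding split_beta' by (intro measurable_after_jump_event assms) simp_all
  qed
  then show "(\<lambda>(r, m). \<integral>\<^sup>+\<omega>. indicator (?E r m) \<omega> \<partial>\<S>) \<in> borel_measurable (borel \<Otimes>\<^sub>M marks)"
    by (simp only: split_beta')
qed

text \<open>
  Conditioning on the first arrival time \<open>r\<close> of the clock.
\<close>

lemma \<Psi>_renewal:
  assumes x: "x \<in> C"
  shows "ennreal (\<Psi> L s x) = (\<integral>\<^sup>+e. ennreal (exponential_density \<Lambda> e) * after_jump L x (s + e) \<partial>lborel)"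
proof -
  let ?f = "\<lambda>a \<omega>. indicator {\<omega>. \<forall>p\<in>set L. (if fst p < s + fst a then x
      else path (s + fst a) (jump (s + fst a) x (snd a)) \<omega> (fst p)) \<in> snd p} \<omega> :: ennreal"
  have "ennreal (\<Psi> L s x) = (\<integral>\<^sup>+\<omega>. indicator {\<omega>. hit L s x \<omega>} \<omega> \<partial>\<S>)"
    by (rule ennreal_\<Psi>[OF x])
  also have "\<dots> = (\<integral>\<^sup>+a. \<integral>\<^sup>+\<omega>. indicator {\<omega>. hit L s x \<omega>} (a ## \<omega>) \<partial>\<S> \<partial>noise)"
  proof -
    have "(\<lambda>\<omega>. indicator {\<omega>. hit L s x \<omega>} \<omega> :: ennreal) \<in> borel_measurable \<S>"
      using pred_hit[OF x] by measurable
    then show ?thesis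
      unfolding \<S>_def by (rule noise.nn_integral_stream_space)
  qed
  also have "\<dots> = (\<integral>\<^sup>+a. \<integral>\<^sup>+\<omega>. ?f a \<omega> \<partial>\<S> \<partial>noise)"
  proof (intro nn_integral_cong_AE, rule AE_mp[OF noise_gap_positive], rule AE_I2, rule impI)
    fix a :: "real \<times> 'c \<times> real" assume "0 < fst a"
    then have "AE \<omega> in \<S>. regular (a ## \<omega>)"
      using AE_regular by (simp add: regular_Stream)
    then have "AE \<omega> in \<S>. indicator {\<omega>. hit L s x \<omega>} (a ## \<omega>) = ?f a \<omega>"
      by (rule AE_mp) (auto intro!: AE_I2 simp: hit_def path_Stream indicator_def)
    then show "(\<integral>\<^sup>+\<omega>. indicator {\<omega>. hit L s x \<omega>} (a ## \<omega>) \<partial>\<S>) = (\<integral>\<^sup>+\<omega>. ?f a \<omega> \<partial>\<S>)"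
      by (rule nn_integral_cong_AE)
  qed
  also have "\<dots> = (\<integral>\<^sup>+e. after_jump L x (s + e) \<partial>gaps)"
  proof -
    have "(\<lambda>a. \<integral>\<^sup>+\<omega>. ?f a \<omega> \<partial>\<S>) \<in> borel_measurable (gaps \<Otimes>\<^sub>M marks)"
    proof (rule \<S>.borel_measurable_nn_integral)
      show "(\<lambda>(a, \<omega>). ?f a \<omega>) \<in> borel_measurable ((gaps \<Otimes>\<^sub>M marks) \<Otimes>\<^sub>M \<S>)"
        unfolding split_beta' by (intro measurable_after_jump_event x) simp_all
    qed
    from marks.nn_integral_fst[OF this, symmetric] show ?thesis
      by (simp only: noise_def after_jump_def fst_conv snd_conv)
  qed
  also have "\<dots> = (\<integral>\<^sup>+e. ennreal (exponential_density \<Lambda> e) * after_jump L x (s + e) \<partial>lborel)"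
    unfolding gaps_def using x by (subst nn_integral_density) auto
  finally show ?thesis .
qed

text \<open>
  After multiplication by \<open>e\<^sup>-\<^sup>\<Lambda>\<^sup>s\<close> the starting time enters only through the domain of integration.
  This is the memorylessness of the clock.
\<close>

lemma \<Psi>_renewal_shifted:
  assumes x: "x \<in> C"
  shows "ennreal (exp (- \<Lambda> * s) * \<Psi> L s x) =
    (\<integral>\<^sup>+r. ennreal (\<Lambda> * exp (- \<Lambda> * r)) * after_jump L x r * indicator {s..} r \<partial>lborel)"
proof -
  have "(\<integral>\<^sup>+r. ennreal (\<Lambda> * exp (- \<Lambda> * r)) * after_jump L x r * indicator {s..} r \<partial>lborel) =
      (\<integral>\<^sup>+e. ennreal (\<Lambda> * exp (- \<Lambda> * (s + e))) * after_jump L x (s + e) * indicator {s..} (s + e) \<partial>lborel)"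
    using x by (subst nn_integral_real_affine[where c = 1 and t = s]) auto
  also have "\<dots> = (\<integral>\<^sup>+e. ennreal (exp (- \<Lambda> * s)) * (ennreal (exponential_density \<Lambda> e) * after_jump L x (s + e)) \<partial>lborel)"
  proof (rule nn_integral_cong)
    fix e :: real
    show "ennreal (\<Lambda> * exp (- \<Lambda> * (s + e))) * after_jump L x (s + e) * indicator {s..} (s + e) =
        ennreal (exp (- \<Lambda> * s)) * (ennreal (exponential_density \<Lambda> e) * after_jump L x (s + e))"
    proof (cases "0 \<le> e")
      case True
      have "exp (- \<Lambda> * (s + e)) = exp (- \<Lambda> * s) * exp (- e * \<Lambda>)"
        unfolding exp_add[symmetric] by (simp add: algebra_simps)
      then have "\<Lambda> * exp (- \<Lambda> * (s + e)) = exp (- \<Lambda> * s) * exponential_density \<Lambda> e"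
        using True by (simp add: exponential_density_def)
      then have "ennreal (\<Lambda> * exp (- \<Lambda> * (s + e))) =
          ennreal (exp (- \<Lambda> * s)) * ennreal (exponential_density \<Lambda> e)"
        using \<Lambda>_pos by (simp add: ennreal_mult exponential_density_nonneg)
      then show ?thesis
        using True by (simp add: mult.assoc)
    qed (simp add: exponential_density_def)
  qed
  also have "\<dots> = ennreal (exp (- \<Lambda> * s)) * ennreal (\<Psi> L s x)"
    unfolding \<Psi>_renewal[OF x] using x by (intro nn_integral_cmult) measurable
  finally show ?thesis
    by (simp add: ennreal_mult \<Psi>_bounds)
qed

definition mean_after_jump :: "(real \<times> 'c set) list \<Rightarrow> 'c \<Rightarrow> real \<Rightarrow> real" where
  "mean_after_jump L x r =
     (\<Sum>y\<in>C. q r x y / R * \<Psi> L r y + (1 - q r x y / R) * \<Psi> L r x) / card C"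

lemma nn_integral_uniform01_If:
  assumes "0 \<le> \<rho>" "\<rho> \<le> 1" "0 \<le> a" "0 \<le> b"
  shows "(\<integral>\<^sup>+u. ennreal (if u \<le> \<rho> then a else b) \<partial>uniform_measure lborel {0..1}) = ennreal (\<rho> * a + (1 - \<rho>) * b)"
proof -
  have "(\<integral>\<^sup>+u. ennreal (if u \<le> \<rho> then a else b) \<partial>uniform_measure lborel {0..1}) =
      (\<integral>\<^sup>+u. ennreal (if u \<le> \<rho> then a else b) * indicator {0..1} u \<partial>lborel)"
    by (subst nn_integral_uniform_measure) (simp_all add: divide_ennreal_def)
  also have "\<dots> = (\<integral>\<^sup>+u. ennreal a * indicator {0..\<rho>} u + ennreal b * indicator {\<rho><..1} u \<partial>lborel)"
    using assms by (intro nn_integral_cong) (auto split: split_indicator)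
  also have "\<dots> = ennreal a * ennreal \<rho> + ennreal b * ennreal (1 - \<rho>)"
    using assms by (subst nn_integral_add) (simp_all add: nn_integral_cmult_indicator)
  also have "\<dots> = ennreal (\<rho> * a + (1 - \<rho>) * b)"
    using assms by (simp add: ennreal_mult[symmetric] ennreal_plus[symmetric] mult.commute del: ennreal_plus)
  finally show ?thesis .
qed

lemma mean_after_jump_nonneg: "x \<in> C \<Longrightarrow> 0 \<le> mean_after_jump L x r"
  unfolding mean_after_jump_def using q_bounds[of x _ r] R_pos \<Psi>_bounds
  by (intro divide_nonneg_nonneg sum_nonneg add_nonneg_nonneg mult_nonneg_nonneg) (auto simp: field_simps)

text \<open>
  As long as no observation lies before the ring, the path only has to be restarted there.
\<close>

lemma after_jump_eq:
  assumes x: "x \<in> C" and r: "\<And>p. p \<in> set L \<Longrightarrow> r \<le> fst p"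
  shows "after_jump L x r = ennreal (mean_after_jump L x r)"
proof -
  have ev: "(\<forall>p\<in>set L. (if fst p < r then x else path r y \<omega> (fst p)) \<in> snd p) \<longleftrightarrow> hit L r y \<omega>" for y \<omega>
    using r by (force simp: hit_def)
  have "after_jump L x r = (\<integral>\<^sup>+m. ennreal (\<Psi> L r (jump r x m)) \<partial>marks)"
    unfolding after_jump_def ev
    by (intro nn_integral_cong ennreal_\<Psi>[symmetric] jump_in_C x)
  also have "\<dots> = (\<integral>\<^sup>+y. \<integral>\<^sup>+u. ennreal (\<Psi> L r (jump r x (y, u))) \<partial>uniform_measure lborel {0..1} \<partial>uniform_count_measure C)"
  proof -
    have "(\<lambda>m. jump r x m) \<in> marks \<rightarrow>\<^sub>M count_space C"
      using x measurable_cong_sets[OF sets_marks refl] by (intro measurable_jump) (auto intro: measurable_const)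
    then have "(\<lambda>m. ennreal (\<Psi> L r (jump r x m))) \<in> borel_measurable marks"
      by (rule measurable_compose) simp
    then show ?thesis
      unfolding marks_def by (rule uniform01.nn_integral_fst[symmetric])
  qed
  also have "\<dots> = (\<Sum>y\<in>C. ennreal (1 / card C) *
      (\<integral>\<^sup>+u. ennreal (\<Psi> L r (jump r x (y, u))) \<partial>uniform_measure lborel {0..1}))"
    unfolding uniform_count_measure_def by (subst nn_integral_point_measure_finite) (simp_all add: fin_C)
  also have "\<dots> = (\<Sum>y\<in>C. ennreal (1 / card C * (q r x y / R * \<Psi> L r y + (1 - q r x y / R) * \<Psi> L r x)))"
  proof (intro sum.cong refl)
    fix y assume y: "y \<in> C"
    have "(\<integral>\<^sup>+u. ennreal (\<Psi> L r (jump r x (y, u))) \<partial>uniform_measure lborel {0..1}) =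
        (\<integral>\<^sup>+u. ennreal (if u \<le> q r x y / R then \<Psi> L r y else \<Psi> L r x) \<partial>uniform_measure lborel {0..1})"
      by (intro nn_integral_cong) (simp add: jump_def)
    also have "\<dots> = ennreal (q r x y / R * \<Psi> L r y + (1 - q r x y / R) * \<Psi> L r x)"
      using q_bounds[OF x y, of r] R_pos \<Psi>_bounds by (intro nn_integral_uniform01_If) auto
    finally show "ennreal (1 / card C) * (\<integral>\<^sup>+u. ennreal (\<Psi> L r (jump r x (y, u))) \<partial>uniform_measure lborel {0..1}) =
        ennreal (1 / card C * (q r x y / R * \<Psi> L r y + (1 - q r x y / R) * \<Psi> L r x))"
      by (simp add: ennreal_mult'[symmetric])
  qed
  also have "\<dots> = ennreal (\<Sum>y\<in>C. 1 / card C * (q r x y / R * \<Psi> L r y + (1 - q r x y / R) * \<Psi> L r x))"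
  proof (rule sum_ennreal)
    fix y assume y: "y \<in> C"
    show "0 \<le> 1 / card C * (q r x y / R * \<Psi> L r y + (1 - q r x y / R) * \<Psi> L r x)"
      using q_bounds[OF x y, of r] R_pos \<Psi>_bounds
      by (intro mult_nonneg_nonneg add_nonneg_nonneg) (auto simp: field_simps)
  qed
  also have "\<dots> = ennreal (mean_after_jump L x r)"
    by (simp add: mean_after_jump_def sum_divide_distrib)
  finally show ?thesis .
qed

lemma \<Psi>_measurable:
  assumes x: "x \<in> C"
  shows "(\<lambda>r. \<Psi> L r x) \<in> borel_measurable borel"
proof -
  have "(\<lambda>r. \<integral>\<^sup>+\<omega>. indicator {\<omega>. hit L r x \<omega>} \<omega> \<partial>\<S>) \<in> borel_measurable borel"
  proof (rule \<S>.borel_measurable_nn_integral)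
    have "Measurable.pred (borel \<Otimes>\<^sub>M \<S>) (\<lambda>w. hit L (fst w) x (snd w))"
      using x by (intro measurable_hit) (auto intro: measurable_const)
    then have "(\<lambda>w. indicator {w. hit L (fst w) x (snd w)} w :: ennreal) \<in> borel_measurable (borel \<Otimes>\<^sub>M \<S>)"
      by measurable
    then show "(\<lambda>(r, \<omega>). indicator {\<omega>. hit L r x \<omega>} \<omega> :: ennreal) \<in> borel_measurable (borel \<Otimes>\<^sub>M \<S>)"
      by (simp add: indicator_def split_beta')
  qed
  then have "(\<lambda>r. enn2real (ennreal (\<Psi> L r x))) \<in> borel_measurable borel"
    unfolding ennreal_\<Psi>[OF x] by (rule measurable_compose) simp
  then show ?thesis
    by (simp add: \<Psi>_bounds)
qed

lemma bounded_borel_\<Psi>: "x \<in> C \<Longrightarrow> bounded_borel_on S (\<lambda>r. \<Psi> L r x)"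
  using \<Psi>_bounds by (intro bounded_borel_onI[of _ _ 1] measurable_restrict_space1 \<Psi>_measurable) auto

lemma bounded_borel_q: "x \<in> C \<Longrightarrow> y \<in> C \<Longrightarrow> bounded_borel_on S (\<lambda>r. q r x y)"
  using q_bounds by (intro bounded_borel_onI[of _ _ R] measurable_restrict_space1 q_measurable) auto

lemma bounded_borel_mean_after_jump:
  assumes "x \<in> C" shows "bounded_borel_on S (mean_after_jump L x)"
proof -
  have "bounded_borel_on S (\<lambda>r. \<Sum>y\<in>C. 1 / R * q r x y * \<Psi> L r y + (1 - 1 / R * q r x y) * \<Psi> L r x)"
    using assms
    by (intro bounded_borel_on_sum bounded_borel_on_add bounded_borel_on_mult bounded_borel_on_diff
        bounded_borel_on_const bounded_borel_\<Psi> bounded_borel_q)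
  from bounded_borel_on_mult[OF bounded_borel_on_const[of S "1 / card C"] this] show ?thesis
    by (simp add: mean_after_jump_def[abs_def])
qed

lemma \<Psi>_increment:
  assumes x: "x \<in> C" and L: "\<And>p. p \<in> set L \<Longrightarrow> t \<le> fst p" and st: "s \<le> t"
  shows "exp (- \<Lambda> * s) * \<Psi> L s x - exp (- \<Lambda> * t) * \<Psi> L t x =
    integral {s..t} (\<lambda>r. \<Lambda> * exp (- \<Lambda> * r) * mean_after_jump L x r)"
proof -
  let ?f = "\<lambda>r. \<Lambda> * exp (- \<Lambda> * r) * mean_after_jump L x r"
  let ?g = "\<lambda>r. ennreal (\<Lambda> * exp (- \<Lambda> * r)) * after_jump L x r"
  have f0: "0 \<le> ?f r" for r
    using \<Lambda>_pos mean_after_jump_nonneg[OF x] by simp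
  have [measurable]: "?g \<in> borel_measurable lborel"
    using x by measurable
  have "ennreal (exp (- \<Lambda> * s) * \<Psi> L s x) = (\<integral>\<^sup>+r. ?g r * indicator {s..} r \<partial>lborel)"
    by (rule \<Psi>_renewal_shifted[OF x])
  also have "\<dots> = (\<integral>\<^sup>+r. ?g r * indicator {s..t} r + ?g r * indicator {t..} r \<partial>lborel)"
    by (intro nn_integral_cong_AE, rule AE_mp[OF AE_lborel_singleton[of t]])
      (use st in \<open>auto intro!: AE_I2 split: split_indicator\<close>)
  also have "\<dots> = (\<integral>\<^sup>+r. ?g r * indicator {s..t} r \<partial>lborel) + (\<integral>\<^sup>+r. ?g r * indicator {t..} r \<partial>lborel)"
    by (rule nn_integral_add) measurable
  also have "(\<integral>\<^sup>+r. ?g r * indicator {t..} r \<partial>lborel) = ennreal (exp (- \<Lambda> * t) * \<Psi> L t x)"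
    by (rule \<Psi>_renewal_shifted[OF x, symmetric])
  also have "(\<integral>\<^sup>+r. ?g r * indicator {s..t} r \<partial>lborel) = (\<integral>\<^sup>+r. ennreal (?f r) * indicator {s..t} r \<partial>lborel)"
  proof (rule nn_integral_cong)
    fix r
    have "after_jump L x r = ennreal (mean_after_jump L x r)" if "r \<in> {s..t}"
      using that L by (intro after_jump_eq x) force
    then show "?g r * indicator {s..t} r = ennreal (?f r) * indicator {s..t} r"
      using \<Lambda>_pos by (auto split: split_indicator simp: ennreal_mult')
  qed
  also have "\<dots> = ennreal (integral {s..t} ?f)"
  proof (rule nn_integral_bounded_borel[OF _ f0])
    have "bounded_borel_on {s..t} (\<lambda>r. \<Lambda> * exp (- \<Lambda> * r))"
      by (intro bounded_borel_on_continuous continuous_intros) auto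
    then show "bounded_borel_on {s..t} ?f"
      by (rule bounded_borel_on_mult[OF _ bounded_borel_mean_after_jump[OF x]])
  qed
  also have "ennreal (integral {s..t} ?f) + ennreal (exp (- \<Lambda> * t) * \<Psi> L t x) =
      ennreal (integral {s..t} ?f + exp (- \<Lambda> * t) * \<Psi> L t x)"
    using \<Psi>_bounds integral_nonneg_if[of "{s..t}" ?f] f0 by (intro ennreal_plus[symmetric]) auto
  finally have "exp (- \<Lambda> * s) * \<Psi> L s x = integral {s..t} ?f + exp (- \<Lambda> * t) * \<Psi> L t x"
    using \<Psi>_bounds integral_nonneg_if[of "{s..t}" ?f] f0 by (subst (asm) ennreal_inj) auto
  then show ?thesis
    by simp
qed

text \<open>
  Kolmogorov's backward equation: multiplying the increment formula by \<open>e\<^sup>\<Lambda>\<^sup>t\<close> turns the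
  exponentially distributed clock into the generator.
\<close>

lemma \<Psi>_backward:
  assumes x: "x \<in> C" and L: "\<And>p. p \<in> set L \<Longrightarrow> t \<le> fst p" and st: "s \<le> t"
  shows "((\<lambda>r. - (\<Sum>y\<in>C. q r x y * (\<Psi> L r y - \<Psi> L r x))) has_integral (\<Psi> L t x - \<Psi> L s x)) {s..t}"
proof -
  define g where "g r = exp (- \<Lambda> * r) * \<Psi> L r x" for r
  define g' where "g' r = - (\<Lambda> * exp (- \<Lambda> * r) * mean_after_jump L x r)" for r
  have bb: "bounded_borel_on {s..t} (\<lambda>r. \<Lambda> * exp (- \<Lambda> * r) * mean_after_jump L x r)" for s t
    by (rule bounded_borel_on_mult[OF bounded_borel_on_continuous bounded_borel_mean_after_jump[OF x]])
      (auto intro!: continuous_intros)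
  have "((\<lambda>r. \<Lambda> * exp (\<Lambda> * r) * g r + exp (\<Lambda> * r) * g' r) has_integral
      (exp (\<Lambda> * t) * g t - exp (\<Lambda> * s) * g s)) {s..t}"
  proof (rule has_integral_product_rule)
    show "bounded_borel_on {s..t} (\<lambda>r. \<Lambda> * exp (\<Lambda> * r))"
      by (intro bounded_borel_on_continuous continuous_intros) auto
    show "bounded_borel_on {s..t} g'"
      unfolding g'_def by (intro bounded_borel_on_uminus bb)
    fix v assume v: "v \<in> {s..t}"
    show "((\<lambda>r. \<Lambda> * exp (\<Lambda> * r)) has_integral (exp (\<Lambda> * v) - exp (\<Lambda> * s))) {s..v}"
      using v by (intro fundamental_theorem_of_calculus)
        (auto simp: has_real_derivative_iff_has_vector_derivative[symmetric] intro!: derivative_eq_intros)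
    have "g v - g s = - integral {s..v} (\<lambda>r. \<Lambda> * exp (- \<Lambda> * r) * mean_after_jump L x r)"
      using \<Psi>_increment[OF x, of L v s] L v by (force simp: g_def)
    then show "(g' has_integral (g v - g s)) {s..v}"
      unfolding g'_def using bounded_borel_on_integrable[OF bb[of s v]]
      by (auto intro!: has_integral_neg integrable_integral)
  qed (rule st)
  moreover have "exp (\<Lambda> * r) * g r = \<Psi> L r x" for r
    by (simp add: g_def mult.assoc[symmetric] exp_add[symmetric])
  moreover have "\<Lambda> * exp (\<Lambda> * r) * g r + exp (\<Lambda> * r) * g' r = - (\<Sum>y\<in>C. q r x y * (\<Psi> L r y - \<Psi> L r x))" for r
  proof -
    have "\<Lambda> * mean_after_jump L x r = (\<Sum>y\<in>C. R * (q r x y / R * \<Psi> L r y + (1 - q r x y / R) * \<Psi> L r x))"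
      using card_C_pos by (simp add: mean_after_jump_def \<Lambda>_def sum_distrib_left[symmetric])
    also have "\<dots> = (\<Sum>y\<in>C. q r x y * (\<Psi> L r y - \<Psi> L r x) + R * \<Psi> L r x)"
      using R_pos by (intro sum.cong) (auto simp: field_simps)
    also have "\<dots> = (\<Sum>y\<in>C. q r x y * (\<Psi> L r y - \<Psi> L r x)) + \<Lambda> * \<Psi> L r x"
      by (simp add: sum.distrib \<Lambda>_def)
    finally have "\<Lambda> * mean_after_jump L x r = (\<Sum>y\<in>C. q r x y * (\<Psi> L r y - \<Psi> L r x)) + \<Lambda> * \<Psi> L r x" .
    moreover have "exp (\<Lambda> * r) * g' r = - (\<Lambda> * mean_after_jump L x r)"
      by (simp add: g'_def mult.assoc[symmetric] mult.commute[of "exp _" \<Lambda>])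
        (simp add: mult.assoc exp_add[symmetric] mult.left_commute[of _ "exp _"])
    moreover have "\<Lambda> * exp (\<Lambda> * r) * g r = \<Lambda> * \<Psi> L r x"
      using \<open>exp (\<Lambda> * r) * g r = \<Psi> L r x\<close> by (simp add: mult.assoc)
    ultimately show ?thesis by simp
  qed
  ultimately show ?thesis by simp
qed

definition generator :: "real \<Rightarrow> 'c \<Rightarrow> 'c \<Rightarrow> real" where
  "generator t x y = q t x y - of_bool (x = y) * (\<Sum>z\<in>C. q t x z)"

text \<open>
  Pairing a solution \<open>T\<close> of the forward equation with the solution \<open>\<Psi>\<close> of the backward equation
  gives a function of time with derivative zero.
\<close>

lemma forward_backward_duality:
  assumes x: "x \<in> C" and L: "\<And>p. p \<in> set L \<Longrightarrow> t \<le> fst p" and st: "s \<le> t"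
    and T: "\<And>v z. v \<in> {s..t} \<Longrightarrow> z \<in> C \<Longrightarrow>
      ((\<lambda>u. \<Sum>w\<in>C. T u w * generator u w z) has_integral (T v z - of_bool (x = z))) {s..v}"
  shows "\<Psi> L s x = (\<Sum>z\<in>C. T t z * \<Psi> L t z)"
proof -
  have T0: "T s z = of_bool (x = z)" if "z \<in> C" for z
    using has_integral_unique[OF T[of s z, simplified] has_integral_refl(2)] st that by simp
  have bbT: "bounded_borel_on {s..t} (\<lambda>u. T u z)" if "z \<in> C" for z
    by (intro bounded_borel_on_continuous has_integral_continuous_on[OF T] that) auto
  have bbg: "bounded_borel_on {s..t} (\<lambda>u. \<Sum>w\<in>C. T u w * generator u w z)" if "z \<in> C" for z
    unfolding generator_def using that
    by (intro bounded_borel_on_sum bounded_borel_on_mult bounded_borel_on_diff bounded_borel_on_const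
        bounded_borel_q bbT)
  have bbb: "bounded_borel_on {s..t} (\<lambda>r. - (\<Sum>y\<in>C. q r z y * (\<Psi> L r y - \<Psi> L r z)))" if "z \<in> C" for z
    using that
    by (intro bounded_borel_on_uminus bounded_borel_on_sum bounded_borel_on_mult bounded_borel_on_diff
        bounded_borel_q bounded_borel_\<Psi>)
  have "((\<lambda>u. \<Sum>z\<in>C. (\<Sum>w\<in>C. T u w * generator u w z) * \<Psi> L u z +
        T u z * (- (\<Sum>y\<in>C. q u z y * (\<Psi> L u y - \<Psi> L u z)))) has_integral
      (\<Sum>z\<in>C. T t z * \<Psi> L t z - T s z * \<Psi> L s z)) {s..t}"
  proof (intro has_integral_sum fin_C has_integral_product_rule bbg bbb st)
    fix z v assume z: "z \<in> C" and v: "v \<in> {s..t}"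
    show "((\<lambda>u. \<Sum>w\<in>C. T u w * generator u w z) has_integral (T v z - T s z)) {s..v}"
      using T[OF v z] T0[OF z] by simp
    show "((\<lambda>r. - (\<Sum>y\<in>C. q r z y * (\<Psi> L r y - \<Psi> L r z))) has_integral (\<Psi> L v z - \<Psi> L s z)) {s..v}"
      using v L by (intro \<Psi>_backward z) force+
  qed
  moreover have "(\<Sum>z\<in>C. (\<Sum>w\<in>C. T u w * generator u w z) * \<Psi> L u z +
        T u z * (- (\<Sum>y\<in>C. q u z y * (\<Psi> L u y - \<Psi> L u z)))) = 0" for u
  proof -
    have gen: "(\<Sum>z\<in>C. generator u w z * \<Psi> L u z) = (\<Sum>y\<in>C. q u w y * (\<Psi> L u y - \<Psi> L u w))" if "w \<in> C" for w
    proof -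
      have "(\<Sum>z\<in>C. generator u w z * \<Psi> L u z) =
          (\<Sum>z\<in>C. q u w z * \<Psi> L u z) - (\<Sum>z\<in>C. if w = z then (\<Sum>y\<in>C. q u w y) * \<Psi> L u z else 0)"
        unfolding sum_subtractf[symmetric] by (intro sum.cong) (auto simp: generator_def algebra_simps)
      also have "(\<Sum>z\<in>C. if w = z then (\<Sum>y\<in>C. q u w y) * \<Psi> L u z else 0) = (\<Sum>y\<in>C. q u w y) * \<Psi> L u w"
        using fin_C that by (simp add: sum.delta)
      finally show ?thesis
        by (simp add: right_diff_distrib sum_subtractf sum_distrib_right)
    qed
    have "(\<Sum>z\<in>C. (\<Sum>w\<in>C. T u w * generator u w z) * \<Psi> L u z) =
        (\<Sum>w\<in>C. T u w * (\<Sum>z\<in>C. generator u w z * \<Psi> L u z))"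
      unfolding sum_distrib_right sum_distrib_left by (subst sum.swap) (simp add: mult_ac)
    also have "\<dots> = (\<Sum>w\<in>C. T u w * (\<Sum>y\<in>C. q u w y * (\<Psi> L u y - \<Psi> L u w)))"
      using gen by simp
    finally show ?thesis
      by (simp add: sum_subtractf)
  qed
  ultimately have "(\<Sum>z\<in>C. T t z * \<Psi> L t z - T s z * \<Psi> L s z) = 0"
    by simp
  then have "(\<Sum>z\<in>C. T t z * \<Psi> L t z) = (\<Sum>z\<in>C. of_bool (x = z) * \<Psi> L s z)"
    using T0 by (simp add: sum_subtractf)
  also have "\<dots> = (\<Sum>z\<in>C. if x = z then \<Psi> L s z else 0)"
    by (intro sum.cong) auto
  also have "\<dots> = \<Psi> L s x"
    using fin_C x by simp
  finally show ?thesis by simp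
qed

lemma \<Psi>_at_start:
  assumes x: "x \<in> C"
  shows "\<Psi> ((t, B) # L) t x = of_bool (x \<in> B) * \<Psi> L t x"
proof -
  have "\<Psi> ((t, B) # L) t x = measure \<S> {\<omega> \<in> space \<S>. x \<in> B \<and> hit L t x \<omega>}"
    unfolding \<Psi>_def
  proof (rule \<S>.finite_measure_eq_AE)
    show "AE \<omega> in \<S>. \<omega> \<in> {\<omega> \<in> space \<S>. hit ((t, B) # L) t x \<omega>} \<longleftrightarrow>
        \<omega> \<in> {\<omega> \<in> space \<S>. x \<in> B \<and> hit L t x \<omega>}"
      by (rule AE_mp[OF AE_regular]) (auto intro!: AE_I2 simp: hit_def path_start)
    show "{\<omega> \<in> space \<S>. hit ((t, B) # L) t x \<omega>} \<in> sets \<S>"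
      using pred_hit[OF x] by (simp add: pred_def)
    show "{\<omega> \<in> space \<S>. x \<in> B \<and> hit L t x \<omega>} \<in> sets \<S>"
      using pred_hit[OF x] by measurable
  qed
  then show ?thesis
    by (cases "x \<in> B") (simp_all add: \<Psi>_def)
qed

text \<open>
  At the first time of observation the probability splits into a transition up to that time and the
  remaining observations.
\<close>

lemma \<Psi>_Cons:
  assumes x: "x \<in> C" and L: "\<And>p. p \<in> set L \<Longrightarrow> t \<le> fst p" and st: "s \<le> t"
    and T: "\<And>v z. v \<in> {s..t} \<Longrightarrow> z \<in> C \<Longrightarrow>
      ((\<lambda>u. \<Sum>w\<in>C. T u w * generator u w z) has_integral (T v z - of_bool (x = z))) {s..v}"
  shows "\<Psi> ((t, B) # L) s x = (\<Sum>z\<in>C. T t z * (of_bool (z \<in> B) * \<Psi> L t z))"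
proof -
  have "\<Psi> ((t, B) # L) s x = (\<Sum>z\<in>C. T t z * \<Psi> ((t, B) # L) t z)"
    using L by (intro forward_backward_duality x st T) auto
  then show ?thesis
    by (simp add: \<Psi>_at_start)
qed

end

section \<open>Markov processes on path space\<close>

text \<open>
  Cylinder events form an intersection-stable generator of the past, so the Markov property need
  only be known for them.
\<close>

lemma markov_property_from_cylinders:
  fixes Z :: "real \<Rightarrow> 'w \<Rightarrow> 'c" and K :: "'c \<Rightarrow> 'c \<Rightarrow> real"
  assumes ps: "prob_space \<Omega>" and fin: "finite C"
    and Z: "\<And>u. 0 \<le> u \<Longrightarrow> Z u \<in> \<Omega> \<rightarrow>\<^sub>M count_space C" and st: "0 \<le> s" "0 \<le> t"
    and cyl: "\<And>U B x. finite U \<Longrightarrow> U \<subseteq> {0..s} \<Longrightarrow> x \<in> C \<Longrightarrow>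
      measure \<Omega> {\<omega> \<in> space \<Omega>. (\<forall>u\<in>U. Z u \<omega> \<in> B u) \<and> Z s \<omega> = x \<and> Z t \<omega> = y} =
      measure \<Omega> {\<omega> \<in> space \<Omega>. (\<forall>u\<in>U. Z u \<omega> \<in> B u) \<and> Z s \<omega> = x} * K x y"
    and y: "y \<in> C" and A: "A \<in> natural_filtration \<Omega> Z s"
  shows "measure \<Omega> (A \<inter> {\<omega> \<in> space \<Omega>. Z t \<omega> = y}) =
    (\<Sum>x\<in>C. measure \<Omega> (A \<inter> {\<omega> \<in> space \<Omega>. Z s \<omega> = x}) * K x y)"
proof -
  interpret prob_space \<Omega> by (rule ps)
  define E where "E U B = {\<omega> \<in> space \<Omega>. \<forall>u\<in>U. Z u \<omega> \<in> B u}" for U B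
  define \<E> where "\<E> = {E U B | U B. finite U \<and> U \<subseteq> {0..s}}"
  have ev [measurable]: "{\<omega> \<in> space \<Omega>. Z u \<omega> \<in> B} \<in> sets \<Omega>" if "0 \<le> u" for u B
  proof -
    have "Z u -` (B \<inter> C) \<inter> space \<Omega> \<in> sets \<Omega>"
      by (rule measurable_sets[OF Z[OF that]]) simp
    moreover have "Z u -` (B \<inter> C) \<inter> space \<Omega> = {\<omega> \<in> space \<Omega>. Z u \<omega> \<in> B}"
      using measurable_space[OF Z[OF that]] by auto
    ultimately show ?thesis by simp
  qed
  have ev1: "{\<omega> \<in> space \<Omega>. Z u \<omega> = x} \<in> sets \<Omega>" if "0 \<le> u" for u x
    using ev[OF that, of "{x}"] by simp
  have E_sets: "E U B \<in> sets \<Omega>" if "finite U" "U \<subseteq> {0..s}" for U B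
  proof -
    have "E U B = space \<Omega> \<inter> (\<Inter>u\<in>U. {\<omega> \<in> space \<Omega>. Z u \<omega> \<in> B u})" if "U \<noteq> {}"
      using that by (auto simp: E_def)
    moreover have "(\<Inter>u\<in>U. {\<omega> \<in> space \<Omega>. Z u \<omega> \<in> B u}) \<in> sets \<Omega>" if "U \<noteq> {}"
      using that \<open>finite U\<close> \<open>U \<subseteq> {0..s}\<close> by (intro sets.finite_INT ev) auto
    ultimately show ?thesis
      by (cases "U = {}") (auto simp: E_def)
  qed
  have stable: "Int_stable \<E>"
  proof (rule Int_stableI)
    fix a b assume "a \<in> \<E>" "b \<in> \<E>"
    then obtain U B V D where ab: "a = E U B" "b = E V D" "finite U" "U \<subseteq> {0..s}" "finite V" "V \<subseteq> {0..s}"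
      by (auto simp: \<E>_def)
    have "a \<inter> b = E (U \<union> V) (\<lambda>u. (if u \<in> U then B u else UNIV) \<inter> (if u \<in> V then D u else UNIV))"
      unfolding ab E_def by auto
    then show "a \<inter> b \<in> \<E>"
      using ab unfolding \<E>_def by blast
  qed
  have pow: "\<E> \<subseteq> Pow (space \<Omega>)"
    by (auto simp: \<E>_def E_def)
  have gen: "natural_filtration \<Omega> Z s \<subseteq> sigma_sets (space \<Omega>) \<E>"
    unfolding natural_filtration_def
  proof (rule sigma_sets_mono, rule subsetI)
    fix a assume "a \<in> {Z u -` B \<inter> space \<Omega> |u B. 0 \<le> u \<and> u \<le> s}"
    then obtain u B where "a = Z u -` B \<inter> space \<Omega>" "0 \<le> u" "u \<le> s"
      by blast
    then have "a = E {u} (\<lambda>_. B)" "finite {u}" "{u} \<subseteq> {0..s}"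
      by (auto simp: E_def)
    then show "a \<in> sigma_sets (space \<Omega>) \<E>"
      unfolding \<E>_def by blast
  qed
  have split: "measure \<Omega> D = (\<Sum>x\<in>C. measure \<Omega> (D \<inter> {\<omega> \<in> space \<Omega>. Z s \<omega> = x}))" if D: "D \<in> sets \<Omega>" for D
  proof -
    have "D = (\<Union>x\<in>C. D \<inter> {\<omega> \<in> space \<Omega>. Z s \<omega> = x})"
      using measurable_space[OF Z[OF st(1)]] sets.sets_into_space[OF D] by auto
    then have "measure \<Omega> D = measure \<Omega> (\<Union>x\<in>C. D \<inter> {\<omega> \<in> space \<Omega>. Z s \<omega> = x})"
      by simp
    also have "\<dots> = (\<Sum>x\<in>C. measure \<Omega> (D \<inter> {\<omega> \<in> space \<Omega>. Z s \<omega> = x}))"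
      by (intro finite_measure_finite_Union fin) (use D ev1 st in \<open>auto simp: disjoint_family_on_def\<close>)
    finally show ?thesis .
  qed
  define P where "P D \<longleftrightarrow> D \<in> sets \<Omega> \<and> measure \<Omega> (D \<inter> {\<omega> \<in> space \<Omega>. Z t \<omega> = y}) =
    (\<Sum>x\<in>C. measure \<Omega> (D \<inter> {\<omega> \<in> space \<Omega>. Z s \<omega> = x}) * K x y)" for D
  have PE: "P (E U B)" if U: "finite U" "U \<subseteq> {0..s}" for U B
  proof -
    have "measure \<Omega> (E U B \<inter> {\<omega> \<in> space \<Omega>. Z t \<omega> = y}) =
        (\<Sum>x\<in>C. measure \<Omega> (E U B \<inter> {\<omega> \<in> space \<Omega>. Z t \<omega> = y} \<inter> {\<omega> \<in> space \<Omega>. Z s \<omega> = x}))"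
      by (intro split sets.Int E_sets U ev1 st)
    also have "\<dots> = (\<Sum>x\<in>C. measure \<Omega> (E U B \<inter> {\<omega> \<in> space \<Omega>. Z s \<omega> = x}) * K x y)"
    proof (intro sum.cong refl)
      fix x assume x: "x \<in> C"
      have 1: "E U B \<inter> {\<omega> \<in> space \<Omega>. Z t \<omega> = y} \<inter> {\<omega> \<in> space \<Omega>. Z s \<omega> = x} =
          {\<omega> \<in> space \<Omega>. (\<forall>u\<in>U. Z u \<omega> \<in> B u) \<and> Z s \<omega> = x \<and> Z t \<omega> = y}"
        by (auto simp: E_def)
      have 2: "E U B \<inter> {\<omega> \<in> space \<Omega>. Z s \<omega> = x} = {\<omega> \<in> space \<Omega>. (\<forall>u\<in>U. Z u \<omega> \<in> B u) \<and> Z s \<omega> = x}"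
        by (auto simp: E_def)
      show "measure \<Omega> (E U B \<inter> {\<omega> \<in> space \<Omega>. Z t \<omega> = y} \<inter> {\<omega> \<in> space \<Omega>. Z s \<omega> = x}) =
          measure \<Omega> (E U B \<inter> {\<omega> \<in> space \<Omega>. Z s \<omega> = x}) * K x y"
        unfolding 1 2 by (rule cyl[OF U x])
    qed
    finally show ?thesis
      using E_sets[OF U] by (simp add: P_def)
  qed
  have "P A"
    using stable pow subsetD[OF gen A]
  proof (induction rule: sigma_sets_induct_disjoint)
    case (basic D)
    then show ?case
      using PE by (auto simp: \<E>_def)
  next
    case empty
    then show ?case by (simp add: P_def)
  next
    case (compl D)
    have diff: "measure \<Omega> ((space \<Omega> - D) \<inter> {\<omega> \<in> space \<Omega>. Z u \<omega> = x}) =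
        measure \<Omega> {\<omega> \<in> space \<Omega>. Z u \<omega> = x} - measure \<Omega> (D \<inter> {\<omega> \<in> space \<Omega>. Z u \<omega> = x})" if "0 \<le> u" for u x
    proof -
      have "(space \<Omega> - D) \<inter> {\<omega> \<in> space \<Omega>. Z u \<omega> = x} =
          {\<omega> \<in> space \<Omega>. Z u \<omega> = x} - (D \<inter> {\<omega> \<in> space \<Omega>. Z u \<omega> = x})"
        by auto
      then show ?thesis
        using compl ev1[OF that] by (simp add: P_def finite_measure_Diff sets.Int)
    qed
    have "P (space \<Omega>)"
      using PE[of "{}" "\<lambda>_. UNIV"] by (simp add: E_def)
    moreover have "space \<Omega> \<inter> {\<omega> \<in> space \<Omega>. Z u \<omega> = x} = {\<omega> \<in> space \<Omega>. Z u \<omega> = x}" for u x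
      by auto
    ultimately show ?case
      using compl by (auto simp: P_def diff st left_diff_distrib sum_subtractf)
  next
    case (union D)
    have sms: "(\<lambda>i. measure \<Omega> (D i \<inter> {\<omega> \<in> space \<Omega>. Z u \<omega> = x})) sums
        measure \<Omega> ((\<Union>i. D i) \<inter> {\<omega> \<in> space \<Omega>. Z u \<omega> = x})" if "0 \<le> u" for u x
    proof -
      have "(\<lambda>i. measure \<Omega> (D i \<inter> {\<omega> \<in> space \<Omega>. Z u \<omega> = x})) sums
          measure \<Omega> (\<Union>i. D i \<inter> {\<omega> \<in> space \<Omega>. Z u \<omega> = x})"
      proof (rule finite_measure_UNION)
        show "range (\<lambda>i. D i \<inter> {\<omega> \<in> space \<Omega>. Z u \<omega> = x}) \<subseteq> sets \<Omega>"
          using union.IH ev1[OF that, of x] by (auto simp: P_def)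
        show "disjoint_family (\<lambda>i. D i \<inter> {\<omega> \<in> space \<Omega>. Z u \<omega> = x})"
          using union.hyps(1) unfolding disjoint_family_on_def by blast
      qed
      then show ?thesis
        by (simp add: Int_UN_distrib2)
    qed
    have "(\<lambda>i. \<Sum>x\<in>C. measure \<Omega> (D i \<inter> {\<omega> \<in> space \<Omega>. Z s \<omega> = x}) * K x y) sums
        (\<Sum>x\<in>C. measure \<Omega> ((\<Union>i. D i) \<inter> {\<omega> \<in> space \<Omega>. Z s \<omega> = x}) * K x y)"
      by (intro sums_sum sums_mult2 sms st)
    moreover have "(\<lambda>i. \<Sum>x\<in>C. measure \<Omega> (D i \<inter> {\<omega> \<in> space \<Omega>. Z s \<omega> = x}) * K x y) =
        (\<lambda>i. measure \<Omega> (D i \<inter> {\<omega> \<in> space \<Omega>. Z t \<omega> = y}))"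
      using union by (auto simp: P_def)
    ultimately have "(\<lambda>i. measure \<Omega> (D i \<inter> {\<omega> \<in> space \<Omega>. Z t \<omega> = y})) sums
        (\<Sum>x\<in>C. measure \<Omega> ((\<Union>i. D i) \<inter> {\<omega> \<in> space \<Omega>. Z s \<omega> = x}) * K x y)"
      by simp
    from sums_unique2[OF sms[OF st(2), of y] this]
    have "measure \<Omega> ((\<Union>i. D i) \<inter> {\<omega> \<in> space \<Omega>. Z t \<omega> = y}) =
        (\<Sum>x\<in>C. measure \<Omega> ((\<Union>i. D i) \<inter> {\<omega> \<in> space \<Omega>. Z s \<omega> = x}) * K x y)" .
    then show ?case
      using union by (auto simp: P_def)
  qed
  then show ?thesis
    by (simp add: P_def)
qed

definition jump_paths :: "(real \<Rightarrow> 'c) set" where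
  "jump_paths = {\<omega>. (\<forall>t\<ge>0. \<forall>\<^sub>F s in at_right t. \<omega> s = \<omega> t) \<and> (\<forall>t>0. \<exists>x. \<forall>\<^sub>F s in at_left t. \<omega> s = x)}"

context bounded_jump_rates
begin

definition path_space :: "(real \<Rightarrow> 'c) measure" where
  "path_space = restrict_space (PiM {0..} (\<lambda>_. count_space C)) jump_paths"

text \<open>
  Irregular inputs have probability zero; they are sent to constant paths, so that every path of the
  process has the required regularity.
\<close>

definition trajectory :: "'c \<times> (real \<times> 'c \<times> real) stream \<Rightarrow> real \<Rightarrow> 'c" where
  "trajectory w = (\<lambda>t\<in>{0..}. if regular (snd w) then path 0 (fst w) (snd w) t else fst w)"

definition process_measure :: "('c \<Rightarrow> real) \<Rightarrow> (real \<Rightarrow> 'c) measure" where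
  "process_measure \<mu>0 = distr (point_measure C (\<lambda>x. ennreal (\<mu>0 x)) \<Otimes>\<^sub>M \<S>) path_space trajectory"

context
  fixes \<mu>0 :: "'c \<Rightarrow> real"
  assumes \<mu>0: "\<mu>0 \<in> prob_on C"
begin

interpretation init: prob_space "point_measure C (\<lambda>x. ennreal (\<mu>0 x))"
proof (rule prob_spaceI)
  have "emeasure (point_measure C (\<lambda>x. ennreal (\<mu>0 x))) (space (point_measure C (\<lambda>x. ennreal (\<mu>0 x)))) =
      (\<Sum>x\<in>C. ennreal (\<mu>0 x))"
    using fin_C by (simp add: space_point_measure emeasure_point_measure_finite)
  also have "\<dots> = ennreal (\<Sum>x\<in>C. \<mu>0 x)"
    using \<mu>0 by (intro sum_ennreal) (auto simp: prob_on_def)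
  finally show "emeasure (point_measure C (\<lambda>x. ennreal (\<mu>0 x))) (space (point_measure C (\<lambda>x. ennreal (\<mu>0 x)))) = 1"
    using \<mu>0 by (simp add: prob_on_def)
qed

interpretation source: pair_prob_space "point_measure C (\<lambda>x. ennreal (\<mu>0 x))" \<S> ..

lemma measurable_trajectory:
  "trajectory \<in> (point_measure C (\<lambda>x. ennreal (\<mu>0 x)) \<Otimes>\<^sub>M \<S>) \<rightarrow>\<^sub>M path_space"
  unfolding path_space_def
proof (rule measurable_restrict_space2)
  let ?M = "point_measure C (\<lambda>x. ennreal (\<mu>0 x)) \<Otimes>\<^sub>M \<S>"
  have fst': "fst \<in> ?M \<rightarrow>\<^sub>M count_space C"
    using measurable_fst[of "point_measure C (\<lambda>x. ennreal (\<mu>0 x))" \<S>]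
      measurable_cong_sets[OF refl sets_point_measure[unfolded sets_count_space[symmetric]]] by blast
  show "trajectory \<in> ?M \<rightarrow>\<^sub>M PiM {0..} (\<lambda>_. count_space C)"
    unfolding trajectory_def
  proof (rule measurable_restrict)
    fix t :: real assume "t \<in> {0..}"
    show "(\<lambda>w. if regular (snd w) then path 0 (fst w) (snd w) t else fst w) \<in> ?M \<rightarrow>\<^sub>M count_space C"
    proof (rule measurable_If)
      show "(\<lambda>w. path 0 (fst w) (snd w) t) \<in> ?M \<rightarrow>\<^sub>M count_space C"
        by (intro measurable_path fst') simp_all
      show "{w \<in> space ?M. regular (snd w)} \<in> sets ?M"
        by measurable
    qed (rule fst')
  qed
  show "trajectory \<in> space ?M \<rightarrow> jump_paths"
  proof
    fix w assume "w \<in> space ?M"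
    show "trajectory w \<in> jump_paths"
    proof (cases "regular (snd w)")
      case True
      have tr: "trajectory w u = path 0 (fst w) (snd w) u" if "0 \<le> u" for u
        using that True by (simp add: trajectory_def)
      have "\<forall>\<^sub>F s in at_right t. trajectory w s = trajectory w t" if t: "0 \<le> t" for t
      proof -
        have "\<forall>\<^sub>F s in at_right t. t < s"
          by (simp add: eventually_at_filter)
        with path_right_constant[OF True t, of "fst w"] show ?thesis
          by eventually_elim (use t in \<open>simp add: tr\<close>)
      qed
      moreover have "\<exists>x. \<forall>\<^sub>F s in at_left t. trajectory w s = x" if t: "0 < t" for t
      proof -
        obtain x where "\<forall>\<^sub>F s in at_left t. path 0 (fst w) (snd w) s = x"
          using path_left_limit[OF True t, of "fst w"] by blast
        moreover have "\<forall>\<^sub>F s in at_left t. 0 < s"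
          by (rule order_tendstoD(1)[OF tendsto_ident_at t])
        ultimately have "\<forall>\<^sub>F s in at_left t. trajectory w s = x"
          by eventually_elim (simp add: tr)
        then show ?thesis by blast
      qed
      ultimately show ?thesis
        by (simp add: jump_paths_def)
    next
      case False
      have tr: "trajectory w u = fst w" if "0 \<le> u" for u
        using that False by (simp add: trajectory_def)
      have "\<forall>\<^sub>F s in at_right t. trajectory w s = trajectory w t" if t: "0 \<le> t" for t
      proof -
        have "\<forall>\<^sub>F s in at_right t. t < s"
          by (simp add: eventually_at_filter)
        then show ?thesis
          by eventually_elim (use t in \<open>simp add: tr\<close>)
      qed
      moreover have "\<exists>x. \<forall>\<^sub>F s in at_left t. trajectory w s = x" if t: "0 < t" for t
      proof -
        have "\<forall>\<^sub>F s in at_left t. 0 < s"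
          by (rule order_tendstoD(1)[OF tendsto_ident_at t])
        then have "\<forall>\<^sub>F s in at_left t. trajectory w s = fst w"
          by eventually_elim (simp add: tr)
        then show ?thesis by blast
      qed
      ultimately show ?thesis
        by (simp add: jump_paths_def)
    qed
  qed
qed

lemma prob_space_process_measure: "prob_space (process_measure \<mu>0)"
  unfolding process_measure_def by (rule source.prob_space_distr[OF measurable_trajectory])

lemma measurable_coordinate:
  assumes "0 \<le> t"
  shows "(\<lambda>\<omega>. \<omega> t) \<in> process_measure \<mu>0 \<rightarrow>\<^sub>M count_space C"
proof -
  have "(\<lambda>\<omega>. \<omega> t) \<in> path_space \<rightarrow>\<^sub>M count_space C"
    unfolding path_space_def using assms
    by (intro measurable_restrict_space1 measurable_component_singleton) simp
  then show ?thesis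
    by (simp add: process_measure_def)
qed

lemma space_process_measure: "space (process_measure \<mu>0) \<subseteq> jump_paths"
  by (auto simp: process_measure_def path_space_def space_restrict_space)

lemma process_measure_cylinder:
  assumes L: "\<And>p. p \<in> set L \<Longrightarrow> 0 \<le> fst p"
  shows "measure (process_measure \<mu>0) {\<omega> \<in> space (process_measure \<mu>0). \<forall>p\<in>set L. \<omega> (fst p) \<in> snd p} =
    (\<Sum>x\<in>C. \<mu>0 x * \<Psi> L 0 x)"
proof -
  let ?I = "point_measure C (\<lambda>x. ennreal (\<mu>0 x))"
  let ?P = "process_measure \<mu>0"
  interpret P: prob_space ?P by (rule prob_space_process_measure)
  have ev: "{\<omega> \<in> space ?P. \<forall>p\<in>set L. \<omega> (fst p) \<in> snd p} \<in> sets ?P"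
  proof -
    have "Measurable.pred ?P (\<lambda>\<omega>. \<forall>p\<in>set L. \<omega> (fst p) \<in> snd p)"
      by (intro pred_intros_finite(3) measurable_compose[OF measurable_coordinate] L) simp_all
    then show ?thesis by (simp add: pred_def)
  qed
  have fst': "fst \<in> (?I \<Otimes>\<^sub>M \<S>) \<rightarrow>\<^sub>M count_space C"
    using measurable_fst[of ?I \<S>]
      measurable_cong_sets[OF refl sets_point_measure[unfolded sets_count_space[symmetric]]] by blast
  have "emeasure ?P {\<omega> \<in> space ?P. \<forall>p\<in>set L. \<omega> (fst p) \<in> snd p} =
      emeasure (?I \<Otimes>\<^sub>M \<S>) {w \<in> space (?I \<Otimes>\<^sub>M \<S>). \<forall>p\<in>set L. trajectory w (fst p) \<in> snd p}"
  proof -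
    have "trajectory -` {\<omega> \<in> space ?P. \<forall>p\<in>set L. \<omega> (fst p) \<in> snd p} \<inter> space (?I \<Otimes>\<^sub>M \<S>) =
        {w \<in> space (?I \<Otimes>\<^sub>M \<S>). \<forall>p\<in>set L. trajectory w (fst p) \<in> snd p}"
      using measurable_space[OF measurable_trajectory] by (auto simp: process_measure_def)
    then show ?thesis
      unfolding process_measure_def using ev
      by (subst emeasure_distr[OF measurable_trajectory]) (simp_all add: process_measure_def)
  qed
  also have "\<dots> = (\<integral>\<^sup>+w. indicator {w. \<forall>p\<in>set L. trajectory w (fst p) \<in> snd p} w \<partial>(?I \<Otimes>\<^sub>M \<S>))"
  proof -
    have "{w \<in> space (?I \<Otimes>\<^sub>M \<S>). \<forall>p\<in>set L. trajectory w (fst p) \<in> snd p} \<in> sets (?I \<Otimes>\<^sub>M \<S>)"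
    proof -
      have "trajectory -` {\<omega> \<in> space ?P. \<forall>p\<in>set L. \<omega> (fst p) \<in> snd p} \<inter> space (?I \<Otimes>\<^sub>M \<S>) \<in> sets (?I \<Otimes>\<^sub>M \<S>)"
        using ev by (intro measurable_sets[OF measurable_trajectory]) (simp add: process_measure_def)
      also have "trajectory -` {\<omega> \<in> space ?P. \<forall>p\<in>set L. \<omega> (fst p) \<in> snd p} \<inter> space (?I \<Otimes>\<^sub>M \<S>) =
        {w \<in> space (?I \<Otimes>\<^sub>M \<S>). \<forall>p\<in>set L. trajectory w (fst p) \<in> snd p}"
        using measurable_space[OF measurable_trajectory] by (auto simp: process_measure_def)
      finally show ?thesis .
    qed
    from nn_integral_indicator[OF this, symmetric] show ?thesis
      by (rule trans) (auto intro!: nn_integral_cong split: split_indicator)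
  qed
  also have "\<dots> = (\<integral>\<^sup>+w. indicator {w. hit L 0 (fst w) (snd w)} w \<partial>(?I \<Otimes>\<^sub>M \<S>))"
  proof (rule nn_integral_cong_AE)
    have "AE w in ?I \<Otimes>\<^sub>M \<S>. regular (snd w)"
      using AE_regular by (intro source.AE_pair_measure) auto
    then show "AE w in ?I \<Otimes>\<^sub>M \<S>. (indicator {w. \<forall>p\<in>set L. trajectory w (fst p) \<in> snd p} w :: ennreal) =
        indicator {w. hit L 0 (fst w) (snd w)} w"
      by (rule AE_mp) (use L in \<open>auto intro!: AE_I2 simp: hit_def trajectory_def indicator_def\<close>)
  qed
  also have "\<dots> = (\<integral>\<^sup>+x. \<integral>\<^sup>+\<omega>. indicator {\<omega>. hit L 0 x \<omega>} \<omega> \<partial>\<S> \<partial>?I)"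
  proof -
    have "Measurable.pred (?I \<Otimes>\<^sub>M \<S>) (\<lambda>w. hit L 0 (fst w) (snd w))"
      by (intro measurable_hit fst') simp_all
    then have "(\<lambda>w. indicator {w. hit L 0 (fst w) (snd w)} w :: ennreal) \<in> borel_measurable (?I \<Otimes>\<^sub>M \<S>)"
      by measurable
    from \<S>.nn_integral_fst[OF this, symmetric] show ?thesis
      by (simp add: indicator_def)
  qed
  also have "\<dots> = (\<integral>\<^sup>+x. ennreal (\<Psi> L 0 x) \<partial>?I)"
    by (intro nn_integral_cong) (simp add: ennreal_\<Psi> space_point_measure)
  also have "\<dots> = (\<Sum>x\<in>C. ennreal (\<mu>0 x) * ennreal (\<Psi> L 0 x))"
    using fin_C by (simp add: nn_integral_point_measure_finite)
  also have "\<dots> = ennreal (\<Sum>x\<in>C. \<mu>0 x * \<Psi> L 0 x)"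
    using \<mu>0 \<Psi>_bounds by (subst sum_ennreal[symmetric]) (auto simp: prob_on_def ennreal_mult)
  finally show ?thesis
    using \<mu>0 \<Psi>_bounds by (simp add: P.emeasure_eq_measure ennreal_inj sum_nonneg prob_on_def)
qed

lemma process_measure_initial:
  assumes "x \<in> C"
  shows "measure (process_measure \<mu>0) {\<omega> \<in> space (process_measure \<mu>0). \<omega> 0 = x} = \<mu>0 x"
proof -
  have "measure (process_measure \<mu>0) {\<omega> \<in> space (process_measure \<mu>0). \<omega> 0 = x} =
      (\<Sum>z\<in>C. \<mu>0 z * (of_bool (z \<in> {x}) * \<Psi> [] 0 z))"
    using process_measure_cylinder[of "[(0, {x})]"] by (simp add: \<Psi>_at_start)
  also have "\<dots> = (\<Sum>z\<in>C. if z = x then \<mu>0 z else 0)"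
    by (intro sum.cong) (auto simp: \<Psi>_def hit_def \<S>.prob_space)
  finally show ?thesis
    using fin_C assms by simp
qed

context
  fixes p :: "real \<Rightarrow> real \<Rightarrow> 'c \<Rightarrow> 'c \<Rightarrow> real"
  assumes p: "\<And>s t x y. \<lbrakk>0 \<le> s; s \<le> t; x \<in> C; y \<in> C\<rbrakk> \<Longrightarrow>
    ((\<lambda>u. \<Sum>z\<in>C. p s u x z * generator u z y) has_integral (p s t x y - of_bool (x = y))) {s..t}"
begin

lemma \<Psi>_Cons_transition:
  assumes "x \<in> C" "\<And>q. q \<in> set L \<Longrightarrow> t \<le> fst q" "0 \<le> s" "s \<le> t"
  shows "\<Psi> ((t, B) # L) s x = (\<Sum>z\<in>C. p s t x z * (of_bool (z \<in> B) * \<Psi> L t z))"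
  by (rule \<Psi>_Cons) (use assms p in auto)

lemma \<Psi>_singleton:
  assumes "x \<in> C" "y \<in> C" "0 \<le> s" "s \<le> t" "\<And>q. q \<in> set L \<Longrightarrow> t \<le> fst q"
  shows "\<Psi> ((t, {y}) # L) s x = p s t x y * \<Psi> L t y"
proof -
  have "(\<Sum>z\<in>C. p s t x z * (of_bool (z \<in> {y}) * \<Psi> L t z)) = (\<Sum>z\<in>C. if z = y then p s t x z * \<Psi> L t z else 0)"
    by (intro sum.cong) auto
  also have "\<dots> = p s t x y * \<Psi> L t y"
    using fin_C assms by simp
  finally show ?thesis
    using \<Psi>_Cons_transition[of x L t s "{y}"] assms by simp
qed

text \<open>
  Appending an observation at a later time multiplies the probability by a transition probability.
  The induction removes the earliest observation.
\<close>

lemma \<Psi>_append_transition: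
  assumes "sorted (map fst L)" "\<And>q. q \<in> set L \<Longrightarrow> r \<le> fst q \<and> fst q \<le> s" "0 \<le> r" "r \<le> s" "s \<le> t"
    and "x \<in> C" "y \<in> C" "z \<in> C"
  shows "\<Psi> (L @ [(s, {x}), (t, {y})]) r z = \<Psi> (L @ [(s, {x})]) r z * p s t x y"
  using assms
proof (induction L arbitrary: r z)
  case Nil
  have "\<Psi> [] u v = 1" for u v
    by (simp add: \<Psi>_def hit_def \<S>.prob_space)
  then show ?case
    using Nil \<Psi>_singleton[of z x r s "[(t, {y})]"] \<Psi>_singleton[of z x r s "[]"] \<Psi>_singleton[of x y s t "[]"]
    by simp
next
  case (Cons q L)
  obtain t1 B where q: "q = (t1, B)"
    by (cases q)
  have t1: "r \<le> t1" "t1 \<le> s"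
    using Cons.prems(2)[of q] by (auto simp: q)
  have le: "t1 \<le> fst q'" if "q' \<in> set L" for q'
    using Cons.prems(1) that by (auto simp: q)
  have IH: "\<Psi> (L @ [(s, {x}), (t, {y})]) t1 w = \<Psi> (L @ [(s, {x})]) t1 w * p s t x y" if "w \<in> C" for w
    using Cons.prems le t1 that by (intro Cons.IH) auto
  have "\<Psi> ((q # L) @ [(s, {x}), (t, {y})]) r z =
      (\<Sum>w\<in>C. p r t1 z w * (of_bool (w \<in> B) * \<Psi> (L @ [(s, {x}), (t, {y})]) t1 w))"
    unfolding q append_Cons using Cons.prems le t1 by (intro \<Psi>_Cons_transition) auto
  also have "\<dots> = (\<Sum>w\<in>C. p r t1 z w * (of_bool (w \<in> B) * \<Psi> (L @ [(s, {x})]) t1 w)) * p s t x y"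
    by (simp add: IH sum_distrib_right sum_distrib_left mult_ac)
  also have "(\<Sum>w\<in>C. p r t1 z w * (of_bool (w \<in> B) * \<Psi> (L @ [(s, {x})]) t1 w)) = \<Psi> ((q # L) @ [(s, {x})]) r z"
    unfolding q append_Cons using Cons.prems le t1 by (intro \<Psi>_Cons_transition[symmetric]) auto
  finally show ?case .
qed

lemma process_measure_markov:
  assumes st: "0 \<le> s" "s \<le> t" and y: "y \<in> C"
    and A: "A \<in> natural_filtration (process_measure \<mu>0) (\<lambda>t \<omega>. \<omega> t) s"
  shows "measure (process_measure \<mu>0) (A \<inter> {\<omega> \<in> space (process_measure \<mu>0). \<omega> t = y}) =
    (\<Sum>x\<in>C. measure (process_measure \<mu>0) (A \<inter> {\<omega> \<in> space (process_measure \<mu>0). \<omega> s = x}) * p s t x y)"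
proof (rule markov_property_from_cylinders[OF prob_space_process_measure fin_C measurable_coordinate _ _ _ y A])
  fix U :: "real set" and B :: "real \<Rightarrow> 'c set" and x
  assume U: "finite U" "U \<subseteq> {0..s}" and x: "x \<in> C"
  define L where "L = map (\<lambda>u. (u, B u)) (sorted_list_of_set U)"
  have L: "sorted (map fst L)" "set L = (\<lambda>u. (u, B u)) ` U"
    using U by (auto simp: L_def comp_def)
  let ?P = "process_measure \<mu>0"
  have "measure ?P {\<omega> \<in> space ?P. \<forall>q\<in>set (L @ [(s, {x}), (t, {y})]). \<omega> (fst q) \<in> snd q} =
      (\<Sum>z\<in>C. \<mu>0 z * \<Psi> (L @ [(s, {x}), (t, {y})]) 0 z)"
    by (rule process_measure_cylinder) (use L U st in auto)
  also have "\<dots> = (\<Sum>z\<in>C. \<mu>0 z * \<Psi> (L @ [(s, {x})]) 0 z) * p s t x y"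
    unfolding sum_distrib_right mult.assoc
    by (intro sum.cong refl arg_cong2[where f = "(*)"] \<Psi>_append_transition) (use L U st x y in auto)
  also have "(\<Sum>z\<in>C. \<mu>0 z * \<Psi> (L @ [(s, {x})]) 0 z) =
      measure ?P {\<omega> \<in> space ?P. \<forall>q\<in>set (L @ [(s, {x})]). \<omega> (fst q) \<in> snd q}"
    by (rule process_measure_cylinder[symmetric]) (use L U st in auto)
  finally show "measure ?P {\<omega> \<in> space ?P. (\<forall>u\<in>U. \<omega> u \<in> B u) \<and> \<omega> s = x \<and> \<omega> t = y} =
      measure ?P {\<omega> \<in> space ?P. (\<forall>u\<in>U. \<omega> u \<in> B u) \<and> \<omega> s = x} * p s t x y"
    using L(2) by (simp add: conj_ac)
qed (use st in auto)

end

end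

end

section \<open>The N-player game\<close>

lemma finite_configs [simp]: "finite (configs N :: (nat \<Rightarrow> 'e::finite) set)"
  by (simp add: configs_def finite_PiE)

lemma configs_nonempty: "configs N \<noteq> {}"
  by (simp add: configs_def PiE_eq_empty_iff)

lemma config_update: "x \<in> configs N \<Longrightarrow> n < N \<Longrightarrow> x(n := j) \<in> configs N"
  by (auto simp: configs_def PiE_iff extensional_def)

text \<open>
  Sums of products over configurations factor; this is how independence of the players enters
  computations.
\<close>

lemma configs_sum_prod:
  fixes c :: "nat \<Rightarrow> 'e::finite \<Rightarrow> real"
  shows "(\<Sum>x\<in>configs N. \<Prod>n<N. c n (x n)) = (\<Prod>n<N. \<Sum>j\<in>UNIV. c n j)"
  unfolding configs_def by (subst prod_sum_PiE) simp_all

lemma empirical_component: "empirical N x $ i = (\<Sum>n<N. of_bool (x n = i)) / real N"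
proof -
  have "(\<Sum>n<N. of_bool (x n = i) :: real) = real (card {n. n < N \<and> x n = i})"
    by (simp add: sum.If_cases of_bool_def Int_def lessThan_def)
  then show ?thesis
    by (simp add: empirical_def)
qed

lemma empirical_sum:
  "(\<Sum>i\<in>UNIV. empirical N x $ i * f i) = (\<Sum>n<N. f (x n)) / real N"
proof -
  have "(\<Sum>i\<in>UNIV. empirical N x $ i * f i) = (\<Sum>i\<in>UNIV. \<Sum>n<N. of_bool (x n = i) * f i) / real N"
    by (simp add: empirical_component sum_divide_distrib sum_distrib_right)
  also have "(\<Sum>i\<in>UNIV. \<Sum>n<N. of_bool (x n = i) * f i) = (\<Sum>n<N. \<Sum>i\<in>UNIV. of_bool (x n = i) * f i)"
    by (rule sum.swap)
  also have "\<dots> = (\<Sum>n<N. f (x n))"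
  proof (rule sum.cong[OF refl])
    fix n
    have "(\<Sum>i\<in>UNIV. of_bool (x n = i) * f i) = (\<Sum>i\<in>UNIV. if x n = i then f i else 0)"
      by (intro sum.cong) auto
    then show "(\<Sum>i\<in>UNIV. of_bool (x n = i) * f i) = f (x n)"
      by simp
  qed
  finally show ?thesis .
qed

lemma empirical_simplex:
  assumes "1 \<le> N" shows "empirical N x \<in> prob_simplex"
  using assms empirical_sum[of N x "\<lambda>_. 1"] by (auto simp: prob_simplex_def empirical_component intro!: sum_nonneg divide_nonneg_nonneg)

context lipschitz_mfg
begin

lemma jump_rate_eq: "jump_rate G N \<sigma> n t x j = drift_rate (\<sigma> n) t (empirical N x) (x n) j"
  by (simp add: jump_rate_def drift_rate_def)

definition initial_law :: "nat \<Rightarrow> (nat \<Rightarrow> 'e) \<Rightarrow> real" where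
  "initial_law N x = (\<Prod>n<N. init G $ (x n))"

lemma initial_law_prob: "initial_law N \<in> prob_on (configs N)"
  using init_simplex configs_sum_prod[of "\<lambda>_ j. init G $ j" N]
  by (auto simp: prob_on_def initial_law_def prob_simplex_def intro: prod_nonneg)

text \<open>
  The part of an \<open>N\<close>-player process on which its costs depend.
\<close>

definition config_law :: "nat \<Rightarrow> (nat \<Rightarrow> ('e, 'a) strategy) \<Rightarrow> (real \<Rightarrow> (nat \<Rightarrow> 'e) \<Rightarrow> real) \<Rightarrow> bool" where
  "config_law N \<sigma> \<mu> \<longleftrightarrow> (\<forall>x\<in>configs N. \<mu> 0 x = initial_law N x) \<and>
     (\<forall>t\<ge>0. \<mu> t \<in> prob_on (configs N)) \<and>
     (\<forall>t\<ge>0. \<forall>y\<in>configs N.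
        ((\<lambda>u. \<Sum>z\<in>configs N. \<mu> u z * config_rate G N \<sigma> u z y) has_integral (\<mu> t y - initial_law N y)) {0..t})"

definition running_cost :: "nat \<Rightarrow> (nat \<Rightarrow> ('e, 'a) strategy) \<Rightarrow> nat \<Rightarrow> real \<Rightarrow> (nat \<Rightarrow> 'e) \<Rightarrow> real" where
  "running_cost N \<sigma> n t x = (\<Sum>a\<in>UNIV. \<sigma> n (x n) t $ a * cost G (x n) a (empirical N x))"

lemma initial_cylinder:
  assumes ps: "prob_space \<Omega>" and Z: "Z \<in> \<Omega> \<rightarrow>\<^sub>M count_space (configs N)"
    and law: "\<And>x. x \<in> configs N \<Longrightarrow> measure \<Omega> {\<omega> \<in> space \<Omega>. Z \<omega> = x} = initial_law N x"
    and J: "J \<subseteq> {..<N}"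
  shows "measure \<Omega> {\<omega> \<in> space \<Omega>. \<forall>n\<in>J. Z \<omega> n \<in> B n} = (\<Prod>n\<in>J. \<Sum>i\<in>UNIV. init G $ i * of_bool (i \<in> B n))"
proof -
  interpret prob_space \<Omega> by (rule ps)
  define D where "D = {x \<in> configs N. \<forall>n\<in>J. x n \<in> B n}"
  have ev: "{\<omega> \<in> space \<Omega>. Z \<omega> = x} \<in> sets \<Omega>" if "x \<in> configs N" for x
  proof -
    have "Z -` {x} \<inter> space \<Omega> \<in> sets \<Omega>"
      by (rule measurable_sets[OF Z]) (use that in simp)
    moreover have "Z -` {x} \<inter> space \<Omega> = {\<omega> \<in> space \<Omega>. Z \<omega> = x}"
      by auto
    ultimately show ?thesis by simp
  qed
  have "{\<omega> \<in> space \<Omega>. \<forall>n\<in>J. Z \<omega> n \<in> B n} = (\<Union>x\<in>D. {\<omega> \<in> space \<Omega>. Z \<omega> = x})"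
    using measurable_space[OF Z] by (auto simp: D_def)
  then have "measure \<Omega> {\<omega> \<in> space \<Omega>. \<forall>n\<in>J. Z \<omega> n \<in> B n} = (\<Sum>x\<in>D. measure \<Omega> {\<omega> \<in> space \<Omega>. Z \<omega> = x})"
    using ev by (simp, intro finite_measure_finite_Union) (auto simp: D_def disjoint_family_on_def)
  also have "\<dots> = (\<Sum>x\<in>D. initial_law N x)"
    by (intro sum.cong law) (auto simp: D_def)
  also have "\<dots> = (\<Sum>x\<in>configs N. \<Prod>n<N. init G $ (x n) * (if n \<in> J then of_bool (x n \<in> B n) else 1))"
  proof (rule sum.mono_neutral_cong_left, goal_cases)
    case 3
    show ?case
    proof
      fix x assume "x \<in> configs N - D"
      then obtain n where n: "n \<in> J" "x n \<notin> B n"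
        by (auto simp: D_def)
      then have "n < N" using J by auto
      then show "(\<Prod>n<N. init G $ (x n) * (if n \<in> J then of_bool (x n \<in> B n) else 1)) = 0"
        using n by (intro prod_zero) auto
    qed
  next
    case (4 x)
    then show "initial_law N x = (\<Prod>n<N. init G $ (x n) * (if n \<in> J then of_bool (x n \<in> B n) else 1))"
      unfolding initial_law_def by (intro prod.cong) (auto simp: D_def)
  qed (auto simp: D_def)
  also have "\<dots> = (\<Prod>n<N. \<Sum>i\<in>UNIV. init G $ i * (if n \<in> J then of_bool (i \<in> B n) else 1))"
    using configs_sum_prod[of "\<lambda>n i. init G $ i * (if n \<in> J then of_bool (i \<in> B n) else 1)" N] .
  also have "\<dots> = (\<Prod>n\<in>J. \<Sum>i\<in>UNIV. init G $ i * (if n \<in> J then of_bool (i \<in> B n) else 1))"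
    using J init_simplex by (intro prod.mono_neutral_right) (auto simp: prob_simplex_def)
  also have "\<dots> = (\<Prod>n\<in>J. \<Sum>i\<in>UNIV. init G $ i * of_bool (i \<in> B n))"
    by (intro prod.cong) auto
  finally show ?thesis .
qed

lemma indep_initial_law:
  assumes ps: "prob_space \<Omega>" and Z: "Z \<in> \<Omega> \<rightarrow>\<^sub>M count_space (configs N)"
    and law: "\<And>x. x \<in> configs N \<Longrightarrow> measure \<Omega> {\<omega> \<in> space \<Omega>. Z \<omega> = x} = initial_law N x"
  shows "prob_space.indep_vars \<Omega> (\<lambda>_. count_space UNIV) (\<lambda>n \<omega>. Z \<omega> n) {..<N}"
proof -
  interpret prob_space \<Omega> by (rule ps)
  have meas: "(\<lambda>\<omega>. Z \<omega> n) \<in> \<Omega> \<rightarrow>\<^sub>M count_space UNIV" for n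
    by (rule measurable_compose[OF Z]) simp
  show ?thesis
    unfolding indep_vars_def2
  proof (intro conjI ballI meas indep_setsI)
    fix n show "{(\<lambda>\<omega>. Z \<omega> n) -` A \<inter> space \<Omega> |A. A \<in> sets (count_space UNIV)} \<subseteq> events"
      using measurable_sets[OF meas] by auto
  next
    fix A J assume J: "J \<noteq> {}" "J \<subseteq> {..<N}" "finite J"
      and "\<forall>n\<in>J. A n \<in> {(\<lambda>\<omega>. Z \<omega> n) -` A \<inter> space \<Omega> |A. A \<in> sets (count_space UNIV)}"
    then have "\<forall>n\<in>J. \<exists>B. A n = {\<omega> \<in> space \<Omega>. Z \<omega> n \<in> B}"
      by fastforce
    then obtain B where B: "\<And>n. n \<in> J \<Longrightarrow> A n = {\<omega> \<in> space \<Omega>. Z \<omega> n \<in> B n}"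
      by metis
    have "(\<Inter>n\<in>J. A n) = {\<omega> \<in> space \<Omega>. \<forall>n\<in>J. Z \<omega> n \<in> B n}"
      using B J by auto
    then have "prob (\<Inter>n\<in>J. A n) = (\<Prod>n\<in>J. \<Sum>i\<in>UNIV. init G $ i * of_bool (i \<in> B n))"
      using initial_cylinder[OF ps Z law J(2), of B] by simp
    also have "\<dots> = (\<Prod>n\<in>J. prob (A n))"
    proof (rule prod.cong[OF refl])
      fix n assume n: "n \<in> J"
      have "prob (A n) = prob {\<omega> \<in> space \<Omega>. \<forall>k\<in>{n}. Z \<omega> k \<in> B k}"
        using B[OF n] by simp
      also have "\<dots> = (\<Sum>i\<in>UNIV. init G $ i * of_bool (i \<in> B n))"
        using J n by (subst initial_cylinder[OF ps Z law]) auto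
      finally show "(\<Sum>i\<in>UNIV. init G $ i * of_bool (i \<in> B n)) = prob (A n)" by simp
    qed
    finally show "prob (\<Inter>n\<in>J. A n) = (\<Prod>n\<in>J. prob (A n))" .
  qed
qed

context
  fixes N :: nat and \<sigma> :: "nat \<Rightarrow> ('e, 'a) strategy"
  assumes N: "1 \<le> N" and \<sigma>: "\<And>n. n < N \<Longrightarrow> \<sigma> n \<in> strategies"
begin

text \<open>
  The generator of the joint process, acting on a function of the configuration.
\<close>

lemma config_rate_apply:
  assumes x: "x \<in> configs N"
  shows "(\<Sum>y\<in>configs N. config_rate G N \<sigma> t x y * f y) =
    (\<Sum>n<N. \<Sum>j\<in>UNIV - {x n}. jump_rate G N \<sigma> n t x j * (f (x(n := j)) - f x))"
proof -
  have pick: "(\<Sum>y\<in>configs N. of_bool (y = z) * f y) = f z" if "z \<in> configs N" for z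
  proof -
    have "(\<Sum>y\<in>configs N. of_bool (y = z) * f y) = (\<Sum>y\<in>configs N. if y = z then f y else 0)"
      by (intro sum.cong) auto
    then show ?thesis
      using that by simp
  qed
  have "(\<Sum>y\<in>configs N. config_rate G N \<sigma> t x y * f y) =
      (\<Sum>y\<in>configs N. \<Sum>n<N. \<Sum>j\<in>UNIV - {x n}. jump_rate G N \<sigma> n t x j * (of_bool (y = x(n := j)) * f y - of_bool (y = x) * f y))"
    unfolding config_rate_def sum_distrib_right by (simp add: algebra_simps)
  also have "\<dots> = (\<Sum>n<N. \<Sum>j\<in>UNIV - {x n}. \<Sum>y\<in>configs N. jump_rate G N \<sigma> n t x j * (of_bool (y = x(n := j)) * f y - of_bool (y = x) * f y))"
    by (subst sum.swap) (intro sum.cong refl sum.swap)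
  also have "\<dots> = (\<Sum>n<N. \<Sum>j\<in>UNIV - {x n}. jump_rate G N \<sigma> n t x j * (f (x(n := j)) - f x))"
    by (intro sum.cong refl)
      (simp add: sum_distrib_left[symmetric] sum_subtractf pick x config_update)
  finally show ?thesis .
qed

lemma config_rate_row: "x \<in> configs N \<Longrightarrow> (\<Sum>y\<in>configs N. config_rate G N \<sigma> t x y) = 0"
  using config_rate_apply[of x t "\<lambda>_. 1"] by simp

lemma jump_rate_bounds:
  assumes "0 \<le> t" "n < N"
  shows "\<bar>jump_rate G N \<sigma> n t x j\<bar> \<le> rate_max" "j \<noteq> x n \<Longrightarrow> 0 \<le> jump_rate G N \<sigma> n t x j"
proof -
  show "\<bar>jump_rate G N \<sigma> n t x j\<bar> \<le> rate_max"
    unfolding jump_rate_eq by (intro drift_rate_bound \<sigma> assms empirical_simplex N)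
  show "0 \<le> jump_rate G N \<sigma> n t x j" if "j \<noteq> x n"
    unfolding jump_rate_eq using that by (intro drift_rate_nonneg \<sigma> assms empirical_simplex N) auto
qed

lemma config_rate_nonneg: "0 \<le> t \<Longrightarrow> x \<noteq> y \<Longrightarrow> 0 \<le> config_rate G N \<sigma> t x y"
  unfolding config_rate_def using jump_rate_bounds(2)
  by (intro sum_nonneg mult_nonneg_nonneg) auto

lemma config_rate_bound:
  assumes t: "0 \<le> t"
  shows "\<bar>config_rate G N \<sigma> t x y\<bar> \<le> real N * real CARD('e) * rate_max"
proof -
  have "\<bar>config_rate G N \<sigma> t x y\<bar> \<le> (\<Sum>n<N. \<Sum>j\<in>UNIV - {x n}. rate_max)"
    unfolding config_rate_def
  proof (rule order_trans[OF sum_abs], rule sum_mono, rule order_trans[OF sum_abs], rule sum_mono)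
    fix n j assume "n \<in> {..<N}"
    then have "\<bar>jump_rate G N \<sigma> n t x j\<bar> * \<bar>of_bool (y = x(n := j)) - of_bool (y = x)\<bar> \<le> rate_max * 1"
      using jump_rate_bounds(1)[OF t, of n x j] by (intro mult_mono) auto
    then show "\<bar>jump_rate G N \<sigma> n t x j * (of_bool (y = x(n := j)) - of_bool (y = x))\<bar> \<le> rate_max"
      by (simp add: abs_mult)
  qed
  also have "\<dots> \<le> (\<Sum>n<N. \<Sum>j\<in>(UNIV :: 'e set). rate_max)"
    using rate_max(1) by (intro sum_mono sum_mono2) auto
  finally show ?thesis by (simp add: mult.assoc)
qed

lemma config_rate_measurable: "(\<lambda>t. config_rate G N \<sigma> t x y) \<in> borel_measurable (restrict_space borel {0..})"
  unfolding config_rate_def jump_rate_def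
  by (intro borel_measurable_sum borel_measurable_times borel_measurable_const strategy_measurable \<sigma>) simp

lemma config_transitions:
  "\<exists>p. \<forall>s t x y. 0 \<le> s \<and> s \<le> t \<and> x \<in> configs N \<and> y \<in> configs N \<longrightarrow>
    ((\<lambda>u. \<Sum>z\<in>configs N. p s u x z * config_rate G N \<sigma> u z y) has_integral (p s t x y - of_bool (x = y))) {s..t}"
proof -
  have "\<exists>T. \<forall>t y. s \<le> t \<and> y \<in> configs N \<longrightarrow>
      ((\<lambda>u. \<Sum>z\<in>configs N. T u z * config_rate G N \<sigma> u z y) has_integral (T t y - of_bool (x = y))) {s..t}"
    if s: "0 \<le> s" and x: "x \<in> configs N" for s x
  proof (rule forward_equation_exists[of "configs N" "\<lambda>y. of_bool (x = y)" "real N * real CARD('e) * rate_max" 0 s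
        "\<lambda>t p. config_rate G N \<sigma> t"])
    have "(\<Sum>y\<in>configs N. of_bool (x = y) :: real) = (\<Sum>y\<in>configs N. if x = y then 1 else 0)"
      by (intro sum.cong) auto
    then show "(\<lambda>y. of_bool (x = y)) \<in> prob_on (configs N)"
      using x by (simp add: prob_on_def)
    show "(\<lambda>t. config_rate G N \<sigma> t y z) \<in> borel_measurable (restrict_space borel {s..})" for y z
      by (rule measurable_restrict_mono[OF config_rate_measurable]) (use s in auto)
    fix p assume "\<And>t j. \<lbrakk>s \<le> t; j \<in> configs N\<rbrakk> \<Longrightarrow>
      ((\<lambda>u. \<Sum>i\<in>configs N. p u i * config_rate G N \<sigma> u i j) has_integral (p t j - of_bool (x = j))) {s..t}"
    then show ?thesis
      by (intro exI[of _ p]) blast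
  qed (use s rate_max config_rate_nonneg config_rate_row config_rate_bound in auto)
  note ex = this
  define P where "P s x T \<longleftrightarrow> (\<forall>t y. s \<le> t \<and> y \<in> configs N \<longrightarrow>
      ((\<lambda>u. \<Sum>z\<in>configs N. T u z * config_rate G N \<sigma> u z y) has_integral (T t y - of_bool (x = y))) {s..t})"
    for s x and T :: "real \<Rightarrow> (nat \<Rightarrow> 'e) \<Rightarrow> real"
  define T where "T s x = (SOME T. P s x T)" for s x
  have T: "P s x (T s x)" if "0 \<le> s" "x \<in> configs N" for s x
    unfolding T_def using ex[OF that] unfolding P_def[symmetric] by (rule someI_ex)
  show ?thesis
  proof (intro exI[of _ "\<lambda>s u x. T s x u"] allI impI, elim conjE)
    fix s t :: real and x y :: "nat \<Rightarrow> 'e" assume "0 \<le> s" "s \<le> t" "x \<in> configs N" "y \<in> configs N"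
    then show "((\<lambda>u. \<Sum>z\<in>configs N. T s x u z * config_rate G N \<sigma> u z y) has_integral
        (T s x t y - of_bool (x = y))) {s..t}"
      using T[of s x] unfolding P_def by blast
  qed
qed

lemma nplayer_process_exists:
  "\<exists>\<Omega> :: (real \<Rightarrow> nat \<Rightarrow> 'e) measure. nplayer_process G N \<sigma> \<Omega> (\<lambda>t \<omega>. \<omega> t)"
proof -
  define R where "R = real N * real CARD('e) * rate_max + 1"
  define q where "q t x y = (if 0 \<le> t \<and> x \<noteq> y then config_rate G N \<sigma> t x y else 0)" for t x y
  interpret bounded_jump_rates "configs N" q R
  proof
    show "0 < R"
      using rate_max(1) by (simp add: R_def add_nonneg_pos)
    fix x y :: "nat \<Rightarrow> 'e" and t :: real
    show "0 \<le> q t x y"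
      using config_rate_nonneg by (simp add: q_def)
    show "q t x y \<le> R"
      using config_rate_bound[of t x y] rate_max(1) by (auto simp: q_def R_def)
    have "(\<lambda>t. indicator {0..} t *\<^sub>R config_rate G N \<sigma> t x y) \<in> borel_measurable borel"
      using config_rate_measurable borel_measurable_restrict_space_iff[of "{0..}" borel "\<lambda>t. config_rate G N \<sigma> t x y"]
      by simp
    moreover have "(\<lambda>t. q t x y) = (\<lambda>t. if x = y then 0 else indicator {0..} t *\<^sub>R config_rate G N \<sigma> t x y)"
      by (auto simp: q_def indicator_def)
    ultimately show "(\<lambda>t. q t x y) \<in> borel_measurable borel"
      by (cases "x = y") auto
  qed (simp_all add: configs_nonempty)
  have gen: "generator t x y = config_rate G N \<sigma> t x y" if "0 \<le> t" "x \<in> configs N" "y \<in> configs N" for t x y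
  proof (cases "x = y")
    case True
    have "(\<Sum>z\<in>configs N. q t x z) = (\<Sum>z\<in>configs N - {x}. config_rate G N \<sigma> t x z)"
      by (rule sum.mono_neutral_cong_right) (use that in \<open>auto simp: q_def\<close>)
    also have "\<dots> = - config_rate G N \<sigma> t x x"
      using config_rate_row[OF that(2), of t] that by (simp add: sum_diff1)
    finally show ?thesis
      using True by (simp add: generator_def q_def)
  qed (use that in \<open>simp add: generator_def q_def\<close>)
  obtain p where p: "\<And>s t x y. \<lbrakk>0 \<le> s; s \<le> t; x \<in> configs N; y \<in> configs N\<rbrakk> \<Longrightarrow>
    ((\<lambda>u. \<Sum>z\<in>configs N. p s u x z * config_rate G N \<sigma> u z y) has_integral (p s t x y - of_bool (x = y))) {s..t}"
    using config_transitions by blast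
  have p': "((\<lambda>u. \<Sum>z\<in>configs N. p s u x z * generator u z y) has_integral (p s t x y - of_bool (x = y))) {s..t}"
    if "0 \<le> s" "s \<le> t" "x \<in> configs N" "y \<in> configs N" for s t x y
    by (rule has_integral_eq[OF _ p[OF that]]) (use that gen in auto)
  let ?P = "process_measure (initial_law N)"
  have ps: "prob_space ?P"
    by (rule prob_space_process_measure[OF initial_law_prob])
  have law: "measure ?P {\<omega> \<in> space ?P. \<omega> 0 = x} = initial_law N x" if "x \<in> configs N" for x
    by (rule process_measure_initial[OF initial_law_prob that])
  have "nplayer_process G N \<sigma> ?P (\<lambda>t \<omega>. \<omega> t)"
    unfolding nplayer_process_def
  proof (intro conjI allI impI ballI)
    show "prob_space ?P"
      by (rule ps)
    show "(\<lambda>\<omega>. \<omega> t) \<in> ?P \<rightarrow>\<^sub>M count_space (configs N)" if "0 \<le> t" for t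
      by (rule measurable_coordinate[OF initial_law_prob that])
    show "\<forall>\<^sub>F s in at_right t. \<omega> s = \<omega> t" if "\<omega> \<in> space ?P" "0 \<le> t" for \<omega> t
      using space_process_measure[OF initial_law_prob] that by (auto simp: jump_paths_def)
    show "\<exists>x. \<forall>\<^sub>F s in at_left t. \<omega> s = x" if "\<omega> \<in> space ?P" "0 < t" for \<omega> t
      using space_process_measure[OF initial_law_prob] that by (auto simp: jump_paths_def)
    show "prob_space.indep_vars ?P (\<lambda>_. count_space UNIV) (\<lambda>n \<omega>. \<omega> 0 n) {..<N}"
      by (rule indep_initial_law[OF ps measurable_coordinate[OF initial_law_prob] law]) auto
    show "measure ?P {\<omega> \<in> space ?P. \<omega> 0 n = i} = init G $ i" if "n < N" for n i
    proof -
      have "measure ?P {\<omega> \<in> space ?P. \<forall>k\<in>{n}. \<omega> 0 k \<in> {i}} = (\<Prod>k\<in>{n}. \<Sum>j\<in>UNIV. init G $ j * of_bool (j \<in> {i}))"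
        using that by (intro initial_cylinder[OF ps measurable_coordinate[OF initial_law_prob] law]) auto
      also have "\<dots> = (\<Sum>j\<in>UNIV. if j = i then init G $ j else 0)"
        by simp
      finally show ?thesis by simp
    qed
    show "\<exists>p. (\<forall>s t. 0 \<le> s \<and> s \<le> t \<longrightarrow> (\<forall>x\<in>configs N. \<forall>y\<in>configs N.
              ((\<lambda>u. \<Sum>z\<in>configs N. p s u x z * config_rate G N \<sigma> u z y)
                 has_integral (p s t x y - of_bool (x = y))) {s..t})) \<and>
        (\<forall>s t. 0 \<le> s \<and> s \<le> t \<longrightarrow> (\<forall>A\<in>natural_filtration ?P (\<lambda>t \<omega>. \<omega> t) s. \<forall>y\<in>configs N.
              measure ?P (A \<inter> {\<omega>\<in>space ?P. \<omega> t = y}) =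
              (\<Sum>x\<in>configs N. measure ?P (A \<inter> {\<omega>\<in>space ?P. \<omega> s = x}) * p s t x y)))"
    proof (intro exI[of _ p] conjI allI impI ballI)
      fix s t :: real and y :: "nat \<Rightarrow> 'e" and A assume "0 \<le> s \<and> s \<le> t" "y \<in> configs N" "A \<in> natural_filtration ?P (\<lambda>t \<omega>. \<omega> t) s"
      then show "measure ?P (A \<inter> {\<omega>\<in>space ?P. \<omega> t = y}) =
          (\<Sum>x\<in>configs N. measure ?P (A \<inter> {\<omega>\<in>space ?P. \<omega> s = x}) * p s t x y)"
        using p' by (intro process_measure_markov[OF initial_law_prob, of p]) auto
    qed (use p in auto)
  qed
  then show ?thesis by blast
qed

text \<open>
  The Markov property from time zero on, applied to the certain event, expresses the law at time \<open>t\<close> by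
  the initial law and the transition probabilities.
\<close>

lemma process_config_law:
  assumes "nplayer_process G N \<sigma> \<Omega> Z"
  shows "config_law N \<sigma> (\<lambda>t x. measure \<Omega> {\<omega> \<in> space \<Omega>. Z t \<omega> = x})"
proof -
  let ?\<mu> = "\<lambda>t x. measure \<Omega> {\<omega> \<in> space \<Omega>. Z t \<omega> = x}"
  have ps: "prob_space \<Omega>"
    and Z: "\<And>t. 0 \<le> t \<Longrightarrow> Z t \<in> \<Omega> \<rightarrow>\<^sub>M count_space (configs N)"
    and ind: "prob_space.indep_vars \<Omega> (\<lambda>_. count_space UNIV) (\<lambda>n \<omega>. Z 0 \<omega> n) {..<N}"
    and i0: "\<And>n i. n < N \<Longrightarrow> measure \<Omega> {\<omega>\<in>space \<Omega>. Z 0 \<omega> n = i} = init G $ i"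
    using assms by (auto simp: nplayer_process_def)
  have "\<exists>p. (\<forall>s t. 0 \<le> s \<and> s \<le> t \<longrightarrow> (\<forall>x\<in>configs N. \<forall>y\<in>configs N.
              ((\<lambda>u. \<Sum>z\<in>configs N. p s u x z * config_rate G N \<sigma> u z y)
                 has_integral (p s t x y - of_bool (x = y))) {s..t})) \<and>
        (\<forall>s t. 0 \<le> s \<and> s \<le> t \<longrightarrow> (\<forall>A\<in>natural_filtration \<Omega> Z s. \<forall>y\<in>configs N.
              measure \<Omega> (A \<inter> {\<omega>\<in>space \<Omega>. Z t \<omega> = y}) =
              (\<Sum>x\<in>configs N. measure \<Omega> (A \<inter> {\<omega>\<in>space \<Omega>. Z s \<omega> = x}) * p s t x y)))"
    (is "\<exists>p. ?A p \<and> ?B p")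
    using assms unfolding nplayer_process_def by (elim conjE)
  then obtain p where A: "?A p" and B: "?B p"
    by (elim exE conjE) (rule that)
  have p: "((\<lambda>u. \<Sum>z\<in>configs N. p 0 u x z * config_rate G N \<sigma> u z y) has_integral (p 0 t x y - of_bool (x = y))) {0..t}"
    if "0 \<le> t" "x \<in> configs N" "y \<in> configs N" for t x y
    using A[rule_format, of 0 t x y] that by simp
  have mk: "measure \<Omega> (A \<inter> {\<omega>\<in>space \<Omega>. Z t \<omega> = y}) =
      (\<Sum>x\<in>configs N. measure \<Omega> (A \<inter> {\<omega>\<in>space \<Omega>. Z 0 \<omega> = x}) * p 0 t x y)"
    if "0 \<le> t" "A \<in> natural_filtration \<Omega> Z 0" "y \<in> configs N" for t A y
    using B[rule_format, of 0 t A y] that by simp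
  interpret prob_space \<Omega> by (rule ps)
  have mu0: "?\<mu> 0 x = initial_law N x" if x: "x \<in> configs N" for x
  proof -
    have "{\<omega> \<in> space \<Omega>. Z 0 \<omega> = x} = (\<Inter>n\<in>{..<N}. (\<lambda>\<omega>. Z 0 \<omega> n) -` {x n} \<inter> space \<Omega>)"
    proof (intro equalityI subsetI)
      fix \<omega> assume \<omega>: "\<omega> \<in> (\<Inter>n\<in>{..<N}. (\<lambda>\<omega>. Z 0 \<omega> n) -` {x n} \<inter> space \<Omega>)"
      then have *: "\<omega> \<in> space \<Omega> \<and> Z 0 \<omega> n = x n" if "n < N" for n
        using that by blast
      have sp: "\<omega> \<in> space \<Omega>" and eq: "\<And>n. n < N \<Longrightarrow> Z 0 \<omega> n = x n"
        using * *[of 0] N by auto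
      have "Z 0 \<omega> \<in> configs N"
        using measurable_space[OF Z[of 0] sp] by simp
      then have "Z 0 \<omega> = x"
        using x eq unfolding configs_def by (intro PiE_ext) auto
      then show "\<omega> \<in> {\<omega> \<in> space \<Omega>. Z 0 \<omega> = x}"
        using sp by simp
    qed (use N in auto)
    moreover have "prob (\<Inter>n\<in>{..<N}. (\<lambda>\<omega>. Z 0 \<omega> n) -` {x n} \<inter> space \<Omega>) =
        (\<Prod>n<N. prob ((\<lambda>\<omega>. Z 0 \<omega> n) -` {x n} \<inter> space \<Omega>))"
      by (rule indep_varsD[OF ind]) (use N in \<open>auto simp: lessThan_empty_iff\<close>)
    moreover have "(\<lambda>\<omega>. Z 0 \<omega> n) -` {x n} \<inter> space \<Omega> = {\<omega> \<in> space \<Omega>. Z 0 \<omega> n = x n}" for n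
      by auto
    ultimately show ?thesis
      using i0 by (simp add: initial_law_def)
  qed
  have mut: "?\<mu> t y = (\<Sum>x\<in>configs N. initial_law N x * p 0 t x y)" if "0 \<le> t" "y \<in> configs N" for t y
  proof -
    have nf: "space \<Omega> \<in> natural_filtration \<Omega> Z 0"
      unfolding natural_filtration_def by (rule sigma_sets_top)
    have sp: "space \<Omega> \<inter> {\<omega> \<in> space \<Omega>. Z u \<omega> = x} = {\<omega> \<in> space \<Omega>. Z u \<omega> = x}" for u x
      by auto
    have "?\<mu> t y = (\<Sum>x\<in>configs N. ?\<mu> 0 x * p 0 t x y)"
      using mk[OF that(1) nf that(2)] unfolding sp .
    then show ?thesis
      using mu0 by simp
  qed
  have prob: "?\<mu> t \<in> prob_on (configs N)" if t: "0 \<le> t" for t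
  proof -
    have ev: "{\<omega> \<in> space \<Omega>. Z t \<omega> = x} \<in> events" if "x \<in> configs N" for x
    proof -
      have "Z t -` {x} \<inter> space \<Omega> \<in> events"
        by (rule measurable_sets[OF Z[OF t]]) (use that in simp)
      moreover have "Z t -` {x} \<inter> space \<Omega> = {\<omega> \<in> space \<Omega>. Z t \<omega> = x}"
        by auto
      ultimately show ?thesis by simp
    qed
    have "(\<Sum>x\<in>configs N. ?\<mu> t x) = prob (\<Union>x\<in>configs N. {\<omega> \<in> space \<Omega>. Z t \<omega> = x})"
      using ev by (intro finite_measure_finite_Union[symmetric]) (auto simp: disjoint_family_on_def)
    also have "(\<Union>x\<in>configs N. {\<omega> \<in> space \<Omega>. Z t \<omega> = x}) = space \<Omega>"
      using measurable_space[OF Z[OF t]] by auto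
    finally show ?thesis
      by (simp add: prob_on_def prob_space)
  qed
  have forward: "((\<lambda>u. \<Sum>z\<in>configs N. ?\<mu> u z * config_rate G N \<sigma> u z y) has_integral (?\<mu> t y - initial_law N y)) {0..t}"
    if t: "0 \<le> t" and y: "y \<in> configs N" for t y
  proof -
    have "((\<lambda>u. \<Sum>x\<in>configs N. initial_law N x * (\<Sum>z\<in>configs N. p 0 u x z * config_rate G N \<sigma> u z y)) has_integral
        (\<Sum>x\<in>configs N. initial_law N x * (p 0 t x y - of_bool (x = y)))) {0..t}"
      using t y by (intro has_integral_sum has_integral_mult_right p) auto
    moreover have "(\<Sum>x\<in>configs N. initial_law N x * (p 0 t x y - of_bool (x = y))) = ?\<mu> t y - initial_law N y"
    proof -
      have "(\<Sum>x\<in>configs N. initial_law N x * of_bool (x = y)) = (\<Sum>x\<in>configs N. if x = y then initial_law N x else 0)"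
        by (intro sum.cong) auto
      then show ?thesis
        using y by (simp add: mut[OF t y] right_diff_distrib sum_subtractf)
    qed
    moreover have "(\<Sum>x\<in>configs N. initial_law N x * (\<Sum>z\<in>configs N. p 0 u x z * config_rate G N \<sigma> u z y)) =
        (\<Sum>z\<in>configs N. ?\<mu> u z * config_rate G N \<sigma> u z y)" if "u \<in> {0..t}" for u
    proof -
      have "(\<Sum>x\<in>configs N. initial_law N x * (\<Sum>z\<in>configs N. p 0 u x z * config_rate G N \<sigma> u z y)) =
          (\<Sum>z\<in>configs N. \<Sum>x\<in>configs N. initial_law N x * p 0 u x z * config_rate G N \<sigma> u z y)"
        unfolding sum_distrib_left by (subst sum.swap) (simp add: mult.assoc)
      then show ?thesis
        using that by (simp add: mut sum_distrib_right)
    qed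
    ultimately show ?thesis
      using has_integral_eq[of "{0..t}" _ "\<lambda>u. \<Sum>z\<in>configs N. ?\<mu> u z * config_rate G N \<sigma> u z y"] by fastforce
  qed
  show ?thesis
    unfolding config_law_def using mu0 prob forward by blast
qed

lemma config_law_unique:
  assumes "config_law N \<sigma> \<mu>" "config_law N \<sigma> \<mu>'" "0 \<le> t" "x \<in> configs N"
  shows "\<mu> t x = \<mu>' t x"
proof (rule linear_forward_equation_unique[of "configs N" "real N * real CARD('e) * rate_max" 0 "config_rate G N \<sigma>"
      \<mu> "initial_law N" \<mu>'])
qed (use assms rate_max config_rate_bound in \<open>auto simp: config_law_def\<close>)

lemma running_cost_bound:
  assumes "0 \<le> t" "n < N"
  shows "\<bar>running_cost N \<sigma> n t x\<bar> \<le> cost_max"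
  unfolding running_cost_def using assms
  by (intro abs_strategy_average_le \<sigma> cost_max empirical_simplex N)

lemma running_cost_measurable:
  assumes "n < N"
  shows "(\<lambda>t. running_cost N \<sigma> n t x) \<in> borel_measurable (restrict_space borel {0..})"
  unfolding running_cost_def
  by (intro borel_measurable_sum borel_measurable_times borel_measurable_const strategy_measurable \<sigma> assms)

end

end

section \<open>Values as time integrals\<close>

lemma integrable_exp_discount:
  assumes "0 < (b :: real)"
  shows "integrable lborel (\<lambda>t. indicator {0..} t * exp (- b * t))"
proof -
  have "(\<integral>\<^sup>+t. ennreal (exponential_density b t) \<partial>lborel) = 1"
    using prob_space.emeasure_space_1[OF prob_space_exponential_density[OF assms]]
    by (simp add: emeasure_density)
  then have "integrable lborel (exponential_density b)"
    using assms by (intro integrableI_nonneg) (auto simp: exponential_density_nonneg)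
  then have "integrable lborel (\<lambda>t. 1 / b * exponential_density b t)"
    by (rule integrable_mult_right)
  moreover have "(\<lambda>t. 1 / b * exponential_density b t) = (\<lambda>t. indicator {0..} t * exp (- b * t))"
    using assms by (auto simp: exponential_density_def fun_eq_iff mult.commute)
  ultimately show ?thesis by simp
qed

lemma borel_measurable_indicator_times:
  fixes f :: "real \<Rightarrow> real"
  assumes "f \<in> borel_measurable (restrict_space borel {0..})"
  shows "(\<lambda>t. indicator {0..} t * f t) \<in> borel_measurable borel"
  using assms borel_measurable_restrict_space_iff[of "{0..}" borel f] by simp

text \<open>
  Right-constant paths are sampled on grids that approach each time strictly from the right, so
  the process is jointly measurable in time and randomness.
\<close>

lemma measurable_right_constant_process:
  fixes Z :: "real \<Rightarrow> 'w \<Rightarrow> 'c"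
  assumes fin: "finite C" and Z: "\<And>t. 0 \<le> t \<Longrightarrow> Z t \<in> \<Omega> \<rightarrow>\<^sub>M count_space C"
    and rc: "\<And>\<omega> t. \<omega> \<in> space \<Omega> \<Longrightarrow> 0 \<le> t \<Longrightarrow> \<forall>\<^sub>F s in at_right t. Z s \<omega> = Z t \<omega>"
  shows "(\<lambda>w. Z (max 0 (fst w)) (snd w)) \<in> lborel \<Otimes>\<^sub>M \<Omega> \<rightarrow>\<^sub>M count_space C"
proof -
  let ?M = "lborel \<Otimes>\<^sub>M \<Omega> :: (real \<times> 'w) measure"
  define g where "g k t = (real (nat \<lfloor>real (Suc k) * max 0 t\<rfloor>) + 1) / real (Suc k)" for k t
  have grid: "(\<lambda>w. Z (g k (fst w)) (snd w)) \<in> ?M \<rightarrow>\<^sub>M count_space C" for k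
  proof -
    have "(\<lambda>w. Z ((real (nat \<lfloor>real (Suc k) * max 0 (fst w)\<rfloor>) + 1) / real (Suc k)) (snd w)) \<in> ?M \<rightarrow>\<^sub>M count_space C"
    proof (rule measurable_compose_countable[where f = "\<lambda>i w. Z ((real i + 1) / real (Suc k)) (snd w)"])
      show "(\<lambda>w. Z ((real i + 1) / real (Suc k)) (snd w)) \<in> ?M \<rightarrow>\<^sub>M count_space C" for i
        by (rule measurable_compose[OF measurable_snd Z]) simp
      show "(\<lambda>w. nat \<lfloor>real (Suc k) * max 0 (fst w)\<rfloor>) \<in> ?M \<rightarrow>\<^sub>M count_space UNIV"
        by measurable
    qed
    then show ?thesis
      by (simp add: g_def)
  qed
  have g_gt: "max 0 t < g k t" for k t
  proof -
    have "0 \<le> real (Suc k) * max 0 t"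
      by simp
    then have "real (Suc k) * max 0 t < real (nat \<lfloor>real (Suc k) * max 0 t\<rfloor>) + 1"
      by linarith
    then show ?thesis
      by (simp add: g_def pos_less_divide_eq mult.commute del: of_nat_Suc max_less_iff_conj)
  qed
  have g_le: "g k t \<le> max 0 t + 1 / real (Suc k)" for k t
  proof -
    have "0 \<le> real (Suc k) * max 0 t"
      by simp
    then have "real (nat \<lfloor>real (Suc k) * max 0 t\<rfloor>) \<le> real (Suc k) * max 0 t"
      by linarith
    then show ?thesis
      by (simp add: g_def field_simps del: of_nat_Suc)
  qed
  have g_lim: "(\<lambda>k. g k t) \<longlonglongrightarrow> max 0 t" for t
  proof (rule tendsto_sandwich[of "\<lambda>_. max 0 t" "\<lambda>k. g k t" sequentially "\<lambda>k. max 0 t + 1 / real (Suc k)"])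
    show "(\<lambda>k. max 0 t + 1 / real (Suc k)) \<longlonglongrightarrow> max 0 t"
      using tendsto_add[OF tendsto_const LIMSEQ_inverse_real_of_nat, of "max 0 t"]
      by (simp add: inverse_eq_divide)
  qed (use g_le less_imp_le[OF g_gt] in \<open>simp_all only: always_eventually tendsto_const simp_thms\<close>)
  have ev: "\<forall>\<^sub>F k in sequentially. Z (g k t) \<omega> = Z (max 0 t) \<omega>" if "\<omega> \<in> space \<Omega>" for t \<omega>
  proof -
    have "filterlim (\<lambda>k. g k t) (at_right (max 0 t)) sequentially"
      unfolding filterlim_at using g_lim[of t] g_gt[of t] less_imp_neq[OF g_gt[of t], symmetric]
      by (auto intro!: always_eventually simp del: max_less_iff_conj)
    then show ?thesis
      using rc[OF that, of "max 0 t"] by (auto simp: filterlim_iff)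
  qed
  have eq: "(Z (max 0 (fst w)) (snd w) = y) \<longleftrightarrow> (\<exists>K. \<forall>k\<ge>K. Z (g k (fst w)) (snd w) = y)" if "w \<in> space ?M" for w y
  proof -
    have e: "\<forall>\<^sub>F k in sequentially. Z (g k (fst w)) (snd w) = Z (max 0 (fst w)) (snd w)"
      using that by (intro ev) (auto simp: space_pair_measure)
    have "(\<exists>K. \<forall>k\<ge>K. Z (g k (fst w)) (snd w) = y) \<longleftrightarrow> (\<forall>\<^sub>F k in sequentially. Z (g k (fst w)) (snd w) = y)"
      by (simp add: eventually_sequentially)
    also have "\<dots> \<longleftrightarrow> (\<forall>\<^sub>F k in sequentially. Z (max 0 (fst w)) (snd w) = y)"
      by (rule eventually_cong[OF e]) auto
    finally show ?thesis by simp
  qed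
  show ?thesis
    unfolding measurable_count_space_eq2[OF fin]
  proof (intro conjI ballI)
    show "(\<lambda>w. Z (max 0 (fst w)) (snd w)) \<in> space ?M \<rightarrow> C"
      using measurable_space[OF Z] by (auto simp: space_pair_measure)
    fix y assume "y \<in> C"
    have [measurable]: "Measurable.pred ?M (\<lambda>w. Z (g k (fst w)) (snd w) = y)" for k
      by (rule measurable_compose[OF grid]) simp
    have "{w \<in> space ?M. \<exists>K. \<forall>k\<ge>K. Z (g k (fst w)) (snd w) = y} \<in> sets ?M"
      by measurable
    also have "{w \<in> space ?M. \<exists>K. \<forall>k\<ge>K. Z (g k (fst w)) (snd w) = y} =
        (\<lambda>w. Z (max 0 (fst w)) (snd w)) -` {y} \<inter> space ?M"
      using eq by blast
    finally show "(\<lambda>w. Z (max 0 (fst w)) (snd w)) -` {y} \<inter> space ?M \<in> sets ?M" .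
  qed
qed

context lipschitz_mfg
begin

definition law_value :: "nat \<Rightarrow> (nat \<Rightarrow> ('e, 'a) strategy) \<Rightarrow> nat \<Rightarrow> (real \<Rightarrow> (nat \<Rightarrow> 'e) \<Rightarrow> real) \<Rightarrow> real" where
  "law_value N \<sigma> n \<mu> =
     (LINT t:{0..}|lborel. (\<Sum>x\<in>configs N. \<mu> t x * running_cost N \<sigma> n t x) * exp (- \<beta> * t))"

lemma law_value_cong:
  assumes "\<And>t x. 0 \<le> t \<Longrightarrow> x \<in> configs N \<Longrightarrow> \<mu> t x = \<mu>' t x"
  shows "law_value N \<sigma> n \<mu> = law_value N \<sigma> n \<mu>'"
  unfolding law_value_def set_lebesgue_integral_def
  by (intro Bochner_Integration.integral_cong) (auto simp: assms split: split_indicator)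

text \<open>
  Fubini's theorem moves the expectation inside the integral over time.
\<close>

lemma nplayer_cost_eq:
  fixes \<Omega> :: "'w measure"
  assumes N: "1 \<le> N" and \<sigma>: "\<And>n. n < N \<Longrightarrow> \<sigma> n \<in> strategies" and n: "n < N"
    and Z: "nplayer_process G N \<sigma> \<Omega> Z"
  shows "nplayer_cost G N \<sigma> \<Omega> Z n = law_value N \<sigma> n (\<lambda>t x. measure \<Omega> {\<omega> \<in> space \<Omega>. Z t \<omega> = x})"
proof -
  let ?C = "configs N :: (nat \<Rightarrow> 'e) set"
  have ps: "prob_space \<Omega>"
    and Zm: "\<And>t. 0 \<le> t \<Longrightarrow> Z t \<in> \<Omega> \<rightarrow>\<^sub>M count_space ?C"
    and rc: "\<And>\<omega> t. \<omega> \<in> space \<Omega> \<Longrightarrow> 0 \<le> t \<Longrightarrow> \<forall>\<^sub>F s in at_right t. Z s \<omega> = Z t \<omega>"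
    using Z by (auto simp: nplayer_process_def)
  interpret prob_space \<Omega> by (rule ps)
  interpret LP: pair_sigma_finite lborel \<Omega> ..
  define h where "h x t = indicator {0..} t * (exp (- \<beta> * t) * running_cost N \<sigma> n t x)" for x t
  define f where "f t \<omega> = (\<Sum>x\<in>?C. of_bool (Z (max 0 t) \<omega> = x) * h x t)" for t \<omega>
  have f_eq: "f t \<omega> = indicator {0..} t *\<^sub>R (exp (- \<beta> * t) * running_cost N \<sigma> n t (Z t \<omega>))"
    if "\<omega> \<in> space \<Omega>" for t \<omega>
  proof (cases "0 \<le> t")
    case True
    have "f t \<omega> = (\<Sum>x\<in>?C. if Z t \<omega> = x then h x t else 0)"
      unfolding f_def using True by (intro sum.cong) auto
    also have "\<dots> = h (Z t \<omega>) t"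
      using measurable_space[OF Zm[OF True] that] by simp
    finally show ?thesis
      by (simp add: h_def)
  qed (simp add: f_def h_def)
  have hm [measurable]: "h x \<in> borel_measurable lborel" for x
  proof -
    have "(\<lambda>t. exp (- \<beta> * t) * running_cost N \<sigma> n t x) \<in> borel_measurable (restrict_space borel {0..})"
      by (intro borel_measurable_times running_cost_measurable[OF N \<sigma> n] borel_measurable_continuous_on_restrict
          continuous_intros) auto
    from borel_measurable_indicator_times[OF this] show ?thesis
      by (simp add: h_def[abs_def])
  qed
  have hb: "\<bar>h x t\<bar> \<le> cost_max * (indicator {0..} t * exp (- \<beta> * t))" for x t
  proof (cases "0 \<le> t")
    case True
    then have "\<bar>running_cost N \<sigma> n t x\<bar> \<le> cost_max"
      by (intro running_cost_bound N \<sigma> n)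
    then show ?thesis
      using True by (simp add: h_def abs_mult mult.commute mult_right_mono)
  qed (simp add: h_def)
  have bi: "integrable lborel (\<lambda>t. cost_max * (indicator {0..} t * exp (- \<beta> * t)))"
    by (intro integrable_mult_right integrable_exp_discount \<beta>_pos)
  have hi: "integrable lborel (h x)" for x
    by (rule Bochner_Integration.integrable_bound[OF bi]) (use hb in \<open>auto intro!: AE_I2 order_trans[OF hb] abs_ge_self\<close>)
  have ev: "{\<omega> \<in> space \<Omega>. Z t \<omega> = x} \<in> events" if "0 \<le> t" for t x
  proof -
    have "Z t -` ({x} \<inter> ?C) \<inter> space \<Omega> \<in> events"
      by (rule measurable_sets[OF Zm[OF that]]) simp
    moreover have "Z t -` ({x} \<inter> ?C) \<inter> space \<Omega> = {\<omega> \<in> space \<Omega>. Z t \<omega> = x}"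
      using measurable_space[OF Zm[OF that]] by auto
    ultimately show ?thesis by simp
  qed
  have joint: "(\<lambda>w. Z (max 0 (fst w)) (snd w)) \<in> lborel \<Otimes>\<^sub>M \<Omega> \<rightarrow>\<^sub>M count_space ?C"
    by (rule measurable_right_constant_process[OF _ Zm rc]) simp_all
  have fint: "integrable (lborel \<Otimes>\<^sub>M \<Omega>) (case_prod f)"
    unfolding f_def split_beta'
  proof (intro Bochner_Integration.integrable_sum)
    fix x
    have pm: "(\<lambda>w. of_bool (Z (max 0 (fst w)) (snd w) = x) :: real) \<in> borel_measurable (lborel \<Otimes>\<^sub>M \<Omega>)"
      by (rule measurable_compose[OF joint]) simp
    have inner: "(\<integral>\<omega>. norm (of_bool (Z (max 0 t) \<omega> = x) * h x t) \<partial>\<Omega>) =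
        \<bar>h x t\<bar> * prob {\<omega> \<in> space \<Omega>. Z (max 0 t) \<omega> = x}" for t
    proof -
      have "(\<integral>\<omega>. norm (of_bool (Z (max 0 t) \<omega> = x) * h x t) \<partial>\<Omega>) =
          (\<integral>\<omega>. \<bar>h x t\<bar> * indicator {\<omega> \<in> space \<Omega>. Z (max 0 t) \<omega> = x} \<omega> \<partial>\<Omega>)"
        by (intro Bochner_Integration.integral_cong) (auto simp: abs_mult)
      then show ?thesis
        using ev[of "max 0 t" x] by simp
    qed
    show "integrable (lborel \<Otimes>\<^sub>M \<Omega>) (\<lambda>w. of_bool (Z (max 0 (fst w)) (snd w) = x) * h x (fst w))"
    proof (rule LP.Fubini_integrable)
      show m: "(\<lambda>w. of_bool (Z (max 0 (fst w)) (snd w) = x) * h x (fst w)) \<in> borel_measurable (lborel \<Otimes>\<^sub>M \<Omega>)"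
        by (intro borel_measurable_times pm measurable_compose[OF measurable_fst hm])
      show "integrable lborel (\<lambda>t. \<integral>\<omega>. norm (of_bool (Z (max 0 (fst (t, \<omega>))) (snd (t, \<omega>)) = x) * h x (fst (t, \<omega>))) \<partial>\<Omega>)"
      proof (rule Bochner_Integration.integrable_bound[OF hi[of x]])
        have "(\<lambda>w. norm (of_bool (Z (max 0 (fst w)) (snd w) = x) * h x (fst w))) \<in> borel_measurable (lborel \<Otimes>\<^sub>M \<Omega>)"
          by (rule measurable_compose[OF m]) measurable
        then show "(\<lambda>t. \<integral>\<omega>. norm (of_bool (Z (max 0 (fst (t, \<omega>))) (snd (t, \<omega>)) = x) * h x (fst (t, \<omega>))) \<partial>\<Omega>) \<in> borel_measurable lborel"
          by (intro borel_measurable_lebesgue_integral) (simp add: split_beta')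
        show "AE t in lborel. norm (\<integral>\<omega>. norm (of_bool (Z (max 0 (fst (t, \<omega>))) (snd (t, \<omega>)) = x) * h x (fst (t, \<omega>))) \<partial>\<Omega>) \<le> norm (h x t)"
          unfolding fst_conv snd_conv inner by (intro AE_I2) (simp add: abs_mult mult_left_le)
      qed
      show "AE t in lborel. integrable \<Omega> (\<lambda>\<omega>. of_bool (Z (max 0 (fst (t, \<omega>))) (snd (t, \<omega>)) = x) * h x (fst (t, \<omega>)))"
      proof (rule AE_I2)
        fix t
        have "integrable \<Omega> (\<lambda>\<omega>. h x t * indicator {\<omega> \<in> space \<Omega>. Z (max 0 t) \<omega> = x} \<omega>)"
          by (intro integrable_mult_right integrable_real_indicator ev) (auto simp: less_top[symmetric])
        then show "integrable \<Omega> (\<lambda>\<omega>. of_bool (Z (max 0 (fst (t, \<omega>))) (snd (t, \<omega>)) = x) * h x (fst (t, \<omega>)))"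
          by (rule Bochner_Integration.integrable_cong[THEN iffD1, rotated 2]) (auto simp: indicator_def)
      qed
    qed
  qed
  have "nplayer_cost G N \<sigma> \<Omega> Z n = (\<integral>\<omega>. (\<integral>t. f t \<omega> \<partial>lborel) \<partial>\<Omega>)"
    unfolding nplayer_cost_def set_lebesgue_integral_def running_cost_def[symmetric]
    by (intro Bochner_Integration.integral_cong refl) (simp_all add: f_eq)
  also have "\<dots> = (\<integral>t. (\<integral>\<omega>. f t \<omega> \<partial>\<Omega>) \<partial>lborel)"
    by (rule LP.Fubini_integral[OF fint])
  also have "\<dots> = law_value N \<sigma> n (\<lambda>t x. prob {\<omega> \<in> space \<Omega>. Z t \<omega> = x})"
    unfolding law_value_def set_lebesgue_integral_def
  proof (rule Bochner_Integration.integral_cong[OF refl])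
    fix t :: real
    have "(\<integral>\<omega>. f t \<omega> \<partial>\<Omega>) = (\<integral>\<omega>. (\<Sum>x\<in>?C. h x t * indicator {\<omega> \<in> space \<Omega>. Z (max 0 t) \<omega> = x} \<omega>) \<partial>\<Omega>)"
      unfolding f_def by (intro Bochner_Integration.integral_cong sum.cong refl) (auto simp: indicator_def)
    also have "\<dots> = (\<Sum>x\<in>?C. h x t * prob {\<omega> \<in> space \<Omega>. Z (max 0 t) \<omega> = x})"
    proof (subst Bochner_Integration.integral_sum)
      show "integrable \<Omega> (\<lambda>\<omega>. h x t * indicator {\<omega> \<in> space \<Omega>. Z (max 0 t) \<omega> = x} \<omega>)" for x
        by (intro integrable_mult_right integrable_real_indicator ev) (auto simp: less_top[symmetric])
    qed (use ev[of "max 0 t"] in simp)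
    finally show "(\<integral>\<omega>. f t \<omega> \<partial>\<Omega>) = indicator {0..} t *\<^sub>R
        ((\<Sum>x\<in>?C. prob {\<omega> \<in> space \<Omega>. Z t \<omega> = x} * running_cost N \<sigma> n t x) * exp (- \<beta> * t))"
      by (simp add: h_def sum_distrib_left sum_distrib_right mult_ac indicator_def)
  qed
  finally show ?thesis .
qed

text \<open>
  A process exists, and all processes have the same one-time laws, hence the same cost.
\<close>

lemma nplayer_value_eq:
  assumes N: "1 \<le> N" and n: "n < N" and \<pi>: "\<pi> \<in> strategies" and \<pi>': "\<pi>' \<in> strategies"
  shows "\<exists>\<mu>. config_law N ((\<lambda>_. \<pi>)(n := \<pi>')) \<mu> \<and>
    nplayer_value G N n \<pi>' \<pi> = law_value N ((\<lambda>_. \<pi>)(n := \<pi>')) n \<mu>"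
proof -
  let ?\<sigma> = "(\<lambda>_. \<pi>)(n := \<pi>')"
  have \<sigma>: "?\<sigma> k \<in> strategies" if "k < N" for k
    using \<pi> \<pi>' by simp
  obtain \<Omega> :: "(real \<Rightarrow> nat \<Rightarrow> 'e) measure" where \<Omega>: "nplayer_process G N ?\<sigma> \<Omega> (\<lambda>t \<omega>. \<omega> t)"
    using nplayer_process_exists[of N ?\<sigma>, OF N \<sigma>] by blast
  define \<mu> where "\<mu> t x = measure \<Omega> {\<omega> \<in> space \<Omega>. \<omega> t = x}" for t x
  have law: "config_law N ?\<sigma> \<mu>"
    unfolding \<mu>_def by (rule process_config_law[of N ?\<sigma>, OF N \<sigma> \<Omega>])
  have "nplayer_value G N n \<pi>' \<pi> = law_value N ?\<sigma> n \<mu>"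
    unfolding nplayer_value_def Let_def
  proof (rule the_equality)
    show "\<exists>\<Omega> :: (real \<Rightarrow> nat \<Rightarrow> 'e) measure. nplayer_process G N ?\<sigma> \<Omega> (\<lambda>t \<omega>. \<omega> t) \<and>
        law_value N ?\<sigma> n \<mu> = nplayer_cost G N ?\<sigma> \<Omega> (\<lambda>t \<omega>. \<omega> t) n"
      using \<Omega> nplayer_cost_eq[of N ?\<sigma>, OF N \<sigma> n \<Omega>] unfolding \<mu>_def[abs_def] by (intro exI[of _ \<Omega>]) simp
    fix v assume "\<exists>\<Omega> :: (real \<Rightarrow> nat \<Rightarrow> 'e) measure. nplayer_process G N ?\<sigma> \<Omega> (\<lambda>t \<omega>. \<omega> t) \<and>
        v = nplayer_cost G N ?\<sigma> \<Omega> (\<lambda>t \<omega>. \<omega> t) n"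
    then obtain \<Omega>' :: "(real \<Rightarrow> nat \<Rightarrow> 'e) measure" where \<Omega>': "nplayer_process G N ?\<sigma> \<Omega>' (\<lambda>t \<omega>. \<omega> t)"
      and v: "v = nplayer_cost G N ?\<sigma> \<Omega>' (\<lambda>t \<omega>. \<omega> t) n"
      by blast
    show "v = law_value N ?\<sigma> n \<mu>"
    proof -
      have "v = law_value N ?\<sigma> n (\<lambda>t x. measure \<Omega>' {\<omega> \<in> space \<Omega>'. \<omega> t = x})"
        unfolding v by (rule nplayer_cost_eq[of N ?\<sigma>, OF N \<sigma> n \<Omega>'])
      also have "\<dots> = law_value N ?\<sigma> n \<mu>"
        by (intro law_value_cong config_law_unique[of N ?\<sigma>, OF N \<sigma> process_config_law[of N ?\<sigma>, OF N \<sigma> \<Omega>'] law])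
      finally show ?thesis .
    qed
  qed
  then show ?thesis
    using law by blast
qed

end

section \<open>Propagation of chaos\<close>

lemma abs_sum_weighted_le:
  fixes w f :: "'i \<Rightarrow> real"
  assumes "w \<in> prob_on I" "\<And>i. i \<in> I \<Longrightarrow> \<bar>f i\<bar> \<le> K"
  shows "\<bar>\<Sum>i\<in>I. w i * f i\<bar> \<le> K"
proof -
  have "\<bar>\<Sum>i\<in>I. w i * f i\<bar> \<le> (\<Sum>i\<in>I. w i * K)"
    by (rule order_trans[OF sum_abs])
      (use assms in \<open>auto simp: abs_mult prob_on_def intro!: sum_mono mult_left_mono\<close>)
  then show ?thesis
    using assms(1) by (simp add: sum_distrib_right[symmetric] prob_on_def)
qed

lemma sum_weighted_mono:
  fixes w f g :: "'i \<Rightarrow> real"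
  assumes "w \<in> prob_on I" "\<And>i. i \<in> I \<Longrightarrow> f i \<le> g i"
  shows "(\<Sum>i\<in>I. w i * f i) \<le> (\<Sum>i\<in>I. w i * g i)"
  using assms by (auto simp: prob_on_def intro!: sum_mono mult_left_mono)

lemma sum_prob_on_const: "w \<in> prob_on I \<Longrightarrow> (\<Sum>i\<in>I. w i * c) = c"
  by (simp add: sum_distrib_right[symmetric] prob_on_def)

lemma l1_dist_le_2:
  assumes "m \<in> prob_simplex" "m' \<in> prob_simplex"
  shows "l1_dist m m' \<le> 2"
proof -
  have "l1_dist m m' \<le> (\<Sum>i\<in>UNIV. m $ i + m' $ i)"
    unfolding l1_dist_def
  proof (rule sum_mono)
    fix i show "\<bar>m $ i - m' $ i\<bar> \<le> m $ i + m' $ i"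
      using prob_simplex_bounds(1)[OF assms(1), of i] prob_simplex_bounds(1)[OF assms(2), of i] by linarith
  qed
  also have "\<dots> = 2"
    using assms by (simp add: sum.distrib prob_simplex_def)
  finally show ?thesis .
qed

lemma l1_dist_square_le:
  "(l1_dist m m')\<^sup>2 \<le> real CARD('n) * (\<Sum>i\<in>UNIV. (m $ i - m' $ i)\<^sup>2)" for m m' :: "real ^ 'n::finite"
  using Cauchy_Schwarz_ineq_sum[of "\<lambda>_. 1" "\<lambda>i. \<bar>m $ i - m' $ i\<bar>" "UNIV :: 'n set"]
  by (simp add: l1_dist_def)

text \<open>
  Bounds the first moment of a distance by its second moment, with a free parameter \<open>\<eta>\<close> in place of
  the Cauchy-Schwarz inequality.
\<close>

lemma l1_dist_le_young:
  fixes m m' :: "real ^ 'n::finite"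
  assumes "0 < \<eta>"
  shows "l1_dist m m' \<le> real CARD('n) * \<eta> + (\<Sum>i\<in>UNIV. (m $ i - m' $ i)\<^sup>2) / \<eta>"
proof -
  have "\<bar>m $ i - m' $ i\<bar> \<le> \<eta> + (m $ i - m' $ i)\<^sup>2 / \<eta>" for i
  proof (cases "\<bar>m $ i - m' $ i\<bar> \<le> \<eta>")
    case True
    moreover have "0 \<le> (m $ i - m' $ i)\<^sup>2 / \<eta>"
      using assms by simp
    ultimately show ?thesis by linarith
  next
    case False
    then have "\<bar>m $ i - m' $ i\<bar> * \<eta> \<le> \<bar>m $ i - m' $ i\<bar> * \<bar>m $ i - m' $ i\<bar>"
      by (intro mult_left_mono) auto
    then have "\<bar>m $ i - m' $ i\<bar> \<le> (m $ i - m' $ i)\<^sup>2 / \<eta>"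
      using assms by (simp add: pos_le_divide_eq power2_eq_square)
    then show ?thesis
      using assms by linarith
  qed
  then have "l1_dist m m' \<le> (\<Sum>i\<in>UNIV. \<eta> + (m $ i - m' $ i)\<^sup>2 / \<eta>)"
    unfolding l1_dist_def by (intro sum_mono)
  then show ?thesis
    by (simp add: sum.distrib sum_divide_distrib)
qed

context lipschitz_mfg
begin

text \<open>
  The vector field of the population flow.
\<close>

definition drift :: "('e, 'a) strategy \<Rightarrow> real \<Rightarrow> real ^ 'e \<Rightarrow> 'e \<Rightarrow> real" where
  "drift \<pi> t p i = (\<Sum>l\<in>UNIV. p $ l * drift_rate \<pi> t p l i)"

lemma drift_lip:
  assumes "\<pi> \<in> strategies" "0 \<le> t" "p \<in> prob_simplex" "p' \<in> prob_simplex"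
  shows "\<bar>drift \<pi> t p i - drift \<pi> t p' i\<bar> \<le> (rate_max + rate_lip) * l1_dist p p'"
proof -
  have "drift \<pi> t p i - drift \<pi> t p' i =
      (\<Sum>l\<in>UNIV. (p $ l - p' $ l) * drift_rate \<pi> t p l i) +
      (\<Sum>l\<in>UNIV. p' $ l * (drift_rate \<pi> t p l i - drift_rate \<pi> t p' l i))"
    unfolding drift_def sum.distrib[symmetric] sum_subtractf[symmetric]
    by (intro sum.cong) (auto simp: algebra_simps)
  moreover have "\<bar>\<Sum>l\<in>UNIV. (p $ l - p' $ l) * drift_rate \<pi> t p l i\<bar> \<le> rate_max * l1_dist p p'"
  proof -
    have "\<bar>\<Sum>l\<in>UNIV. (p $ l - p' $ l) * drift_rate \<pi> t p l i\<bar> \<le> (\<Sum>l\<in>UNIV. \<bar>p $ l - p' $ l\<bar> * rate_max)"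
      by (rule order_trans[OF sum_abs])
        (use drift_rate_bound[OF assms(1-3)] in \<open>auto simp: abs_mult intro!: sum_mono mult_left_mono\<close>)
    then show ?thesis
      by (simp add: l1_dist_def sum_distrib_left mult.commute)
  qed
  moreover have "\<bar>\<Sum>l\<in>UNIV. p' $ l * (drift_rate \<pi> t p l i - drift_rate \<pi> t p' l i)\<bar> \<le> rate_lip * l1_dist p p'"
    by (rule abs_sum_weighted_le[OF prob_on_vec_nth[OF assms(4)] drift_rate_lip[OF assms]])
  ultimately show ?thesis
    by (simp add: algebra_simps)
qed

lemma drift_bounded_borel:
  assumes "\<pi> \<in> strategies" "continuous_on {0..} m" "\<And>t. 0 \<le> t \<Longrightarrow> m t \<in> prob_simplex"
  shows "bounded_borel_on {0..T} (\<lambda>t. drift \<pi> t (m t) i)"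
  unfolding drift_def
proof (intro bounded_borel_on_sum bounded_borel_on_mult drift_rate_bounded_borel assms)
  show "bounded_borel_on {0..T} (\<lambda>t. m t $ l)" for l
    by (intro bounded_borel_on_continuous continuous_on_component continuous_on_subset[OF assms(2)]) auto
qed auto

lemma initial_expectation_prod:
  assumes J: "J \<subseteq> {..<N}"
  shows "(\<Sum>x\<in>configs N. initial_law N x * (\<Prod>n\<in>J. g n (x n))) = (\<Prod>n\<in>J. \<Sum>j\<in>UNIV. init G $ j * g n j)"
proof -
  have "initial_law N x * (\<Prod>n\<in>J. g n (x n)) = (\<Prod>n<N. init G $ (x n) * (if n \<in> J then g n (x n) else 1))" for x
  proof -
    have "(\<Prod>n\<in>J. g n (x n)) = (\<Prod>n<N. if n \<in> J then g n (x n) else 1)"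
      using J by (intro prod.mono_neutral_cong_left) auto
    then show ?thesis
      by (simp add: initial_law_def prod.distrib)
  qed
  then have "(\<Sum>x\<in>configs N. initial_law N x * (\<Prod>n\<in>J. g n (x n))) =
      (\<Prod>n<N. \<Sum>j\<in>UNIV. init G $ j * (if n \<in> J then g n j else 1))"
    using configs_sum_prod[of "\<lambda>n j. init G $ j * (if n \<in> J then g n j else 1)" N] by simp
  also have "\<dots> = (\<Prod>n\<in>J. \<Sum>j\<in>UNIV. init G $ j * g n j)"
    using J init_simplex by (intro prod.mono_neutral_cong_right) (auto simp: prob_simplex_def)
  finally show ?thesis .
qed

text \<open>
  The initial states are independent, so only the diagonal terms of the squared sum survive.
\<close>

lemma initial_empirical_variance:
  assumes N: "1 \<le> N"
  shows "(\<Sum>x\<in>configs N. initial_law N x * (empirical N x $ i - init G $ i)\<^sup>2) \<le> init G $ i / real N"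
proof -
  define p where "p = init G $ i"
  have p: "0 \<le> p" "p \<le> 1"
    using prob_simplex_bounds[OF init_simplex] by (auto simp: p_def)
  define Y where "Y j = of_bool (j = i) - p" for j :: 'e
  have pick: "(\<Sum>j\<in>UNIV. init G $ j * of_bool (j = i)) = p"
  proof -
    have "(\<Sum>j\<in>UNIV. init G $ j * of_bool (j = i)) = (\<Sum>j\<in>UNIV. if j = i then init G $ j else 0)"
      by (intro sum.cong) auto
    then show ?thesis by (simp add: p_def)
  qed
  have one: "(\<Sum>j\<in>UNIV. init G $ j) = 1"
    using init_simplex by (simp add: prob_simplex_def)
  have EY: "(\<Sum>j\<in>UNIV. init G $ j * Y j) = 0"
    by (simp add: Y_def right_diff_distrib sum_subtractf pick sum_distrib_right[symmetric] one)
  have EY2: "(\<Sum>j\<in>UNIV. init G $ j * (Y j * Y j)) = p * (1 - p)"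
  proof -
    have "init G $ j * (Y j * Y j) = init G $ j * of_bool (j = i) * (1 - 2 * p) + init G $ j * p\<^sup>2" for j
      by (cases "j = i") (simp_all add: Y_def power2_eq_square algebra_simps)
    then have "(\<Sum>j\<in>UNIV. init G $ j * (Y j * Y j)) = p * (1 - 2 * p) + p\<^sup>2"
      by (simp add: sum.distrib sum_distrib_right[symmetric] pick one)
    then show ?thesis
      by (simp add: power2_eq_square algebra_simps)
  qed
  have emp: "empirical N x $ i - p = (\<Sum>n<N. Y (x n)) / real N" for x
    using N by (simp add: empirical_component Y_def sum_subtractf field_simps)
  have "(\<Sum>x\<in>configs N. initial_law N x * (empirical N x $ i - p)\<^sup>2) =
      (\<Sum>x\<in>configs N. \<Sum>k<N. \<Sum>l<N. initial_law N x * (Y (x k) * Y (x l))) / (real N)\<^sup>2"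
    unfolding emp power_divide power2_eq_square[of "sum _ _"] sum_product
    by (simp add: sum_distrib_left sum_divide_distrib)
  also have "(\<Sum>x\<in>configs N. \<Sum>k<N. \<Sum>l<N. initial_law N x * (Y (x k) * Y (x l))) =
      (\<Sum>k<N. \<Sum>l<N. \<Sum>x\<in>configs N. initial_law N x * (Y (x k) * Y (x l)))"
    by (subst sum.swap) (intro sum.cong refl sum.swap)
  also have "\<dots> = (\<Sum>k<N. \<Sum>l<N. if k = l then p * (1 - p) else 0)"
  proof (intro sum.cong refl)
    fix k l assume kl: "k \<in> {..<N}" "l \<in> {..<N}"
    show "(\<Sum>x\<in>configs N. initial_law N x * (Y (x k) * Y (x l))) = (if k = l then p * (1 - p) else 0)"
    proof (cases "k = l")
      case True
      then show ?thesis
        using initial_expectation_prod[of "{k}" N "\<lambda>_ j. Y j * Y j"] kl EY2 by simp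
    next
      case False
      then show ?thesis
        using initial_expectation_prod[of "{k, l}" N "\<lambda>_ j. Y j"] kl EY by simp
    qed
  qed
  also have "\<dots> = real N * (p * (1 - p))"
    by simp
  finally have "(\<Sum>x\<in>configs N. initial_law N x * (empirical N x $ i - p)\<^sup>2) = p * (1 - p) / real N"
    using N by (simp add: power2_eq_square)
  also have "\<dots> \<le> p / real N"
    using p by (intro divide_right_mono) (auto simp: mult_left_le)
  finally show ?thesis
    by (simp add: p_def)
qed

text \<open>
  The constants of the differential inequality \<open>W' \<le> growth W + noise_level / N\<close> for the mean squared
  distance \<open>W\<close> of the empirical distribution to the population flow, and the bound \<open>W \<le> spread T / N\<close>
  on \<open>[0, T]\<close> that Gronwall's inequality deduces from it.
\<close>

definition growth :: real where
  "growth = 2 * (rate_max + rate_lip) * CARD('e)"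

definition noise_level :: real where
  "noise_level = (8 + CARD('e) * CARD('e)) * rate_max"

definition spread :: "real \<Rightarrow> real" where
  "spread T = (1 + noise_level * T) * (1 + growth * T * exp (growth * T))"

definition gap :: "nat \<Rightarrow> real \<Rightarrow> real" where
  "gap N T = (CARD('e) + spread T) / sqrt N"

lemma growth_nonneg: "0 \<le> growth" and noise_level_nonneg: "0 \<le> noise_level"
  using rate_max(1) rate_lip(1) by (simp_all add: growth_def noise_level_def)

lemma spread_mono: "0 \<le> t \<Longrightarrow> t \<le> T \<Longrightarrow> spread t \<le> spread T"
  unfolding spread_def using growth_nonneg noise_level_nonneg
  by (intro mult_mono add_mono order_refl mult_left_mono) (auto intro!: mult_mono mult_left_mono)

context
  fixes N n :: nat and \<pi> \<pi>' :: "('e, 'a) strategy" and \<mu> :: "real \<Rightarrow> (nat \<Rightarrow> 'e) \<Rightarrow> real"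
  assumes n: "n < N" and \<pi>: "\<pi> \<in> strategies" and \<pi>': "\<pi>' \<in> strategies"
    and \<mu>: "config_law N ((\<lambda>_. \<pi>)(n := \<pi>')) \<mu>"
begin

private abbreviation (input) "\<sigma> \<equiv> (\<lambda>_. \<pi>)(n := \<pi>')"
private abbreviation (input) "m \<equiv> population_flow G \<pi>"
private abbreviation (input) "pos \<equiv> player_flow G \<pi>' (population_flow G \<pi>)"
private abbreviation (input) "M \<equiv> empirical N"

lemma N_pos: "1 \<le> N" "0 < N"
  using n by auto

lemma \<sigma>_strategies: "\<sigma> k \<in> strategies"
  using \<pi> \<pi>' by simp

lemma \<mu>_prob: "0 \<le> t \<Longrightarrow> \<mu> t \<in> prob_on (configs N)"
  using \<mu> by (simp add: config_law_def)

lemma \<mu>_init: "x \<in> configs N \<Longrightarrow> \<mu> 0 x = initial_law N x"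
  using \<mu> by (simp add: config_law_def)

lemma \<mu>_continuous: "x \<in> configs N \<Longrightarrow> continuous_on {0..T} (\<lambda>t. \<mu> t x)"
  using \<mu> by (intro has_integral_continuous_on[where c = "initial_law N x"]) (auto simp: config_law_def)

lemma M_simplex: "M x \<in> prob_simplex"
  by (rule empirical_simplex[OF N_pos(1)])

lemma m_simplex: "0 \<le> t \<Longrightarrow> m t \<in> prob_simplex"
  by (rule population_flow_simplex[OF \<pi>])

definition expect :: "real \<Rightarrow> ((nat \<Rightarrow> 'e) \<Rightarrow> real) \<Rightarrow> real" where
  "expect t f = (\<Sum>x\<in>configs N. \<mu> t x * f x)"

definition gen :: "real \<Rightarrow> ((nat \<Rightarrow> 'e) \<Rightarrow> real) \<Rightarrow> (nat \<Rightarrow> 'e) \<Rightarrow> real" where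
  "gen t f x = (\<Sum>k<N. \<Sum>j\<in>UNIV - {x k}. jump_rate G N \<sigma> k t x j * (f (x(k := j)) - f x))"

lemma expect_increment:
  assumes "0 \<le> t"
  shows "((\<lambda>u. expect u (gen u f)) has_integral (expect t f - expect 0 f)) {0..t}"
proof -
  have "((\<lambda>u. \<Sum>y\<in>configs N. (\<Sum>z\<in>configs N. \<mu> u z * config_rate G N \<sigma> u z y) * f y) has_integral
      (\<Sum>y\<in>configs N. (\<mu> t y - initial_law N y) * f y)) {0..t}"
    using \<mu> assms by (intro has_integral_sum has_integral_mult_left) (auto simp: config_law_def)
  moreover have "(\<Sum>y\<in>configs N. (\<mu> t y - initial_law N y) * f y) = expect t f - expect 0 f"
    by (simp add: expect_def left_diff_distrib sum_subtractf \<mu>_init)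
  moreover have "(\<Sum>y\<in>configs N. (\<Sum>z\<in>configs N. \<mu> u z * config_rate G N \<sigma> u z y) * f y) = expect u (gen u f)" for u
  proof -
    have "(\<Sum>y\<in>configs N. (\<Sum>z\<in>configs N. \<mu> u z * config_rate G N \<sigma> u z y) * f y) =
        (\<Sum>z\<in>configs N. \<mu> u z * (\<Sum>y\<in>configs N. config_rate G N \<sigma> u z y * f y))"
      unfolding sum_distrib_right sum_distrib_left by (subst sum.swap) (simp add: mult.assoc)
    also have "\<dots> = expect u (gen u f)"
      unfolding expect_def gen_def
      by (intro sum.cong refl arg_cong2[where f = "(*)"] config_rate_apply[of N \<sigma>] N_pos \<sigma>_strategies)
    finally show ?thesis .
  qed
  ultimately show ?thesis by simp
qed

lemma bounded_borel_\<mu>: "x \<in> configs N \<Longrightarrow> bounded_borel_on {0..T} (\<lambda>t. \<mu> t x)"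
  by (intro bounded_borel_on_continuous \<mu>_continuous) auto

lemma bounded_borel_gen: "bounded_borel_on {0..T} (\<lambda>u. gen u f x)"
proof -
  have "bounded_borel_on {0..T} (\<lambda>u. drift_rate (\<sigma> k) u (M x) (x k) j)" for k j
    by (rule drift_rate_bounded_borel[OF \<sigma>_strategies]) (use M_simplex in auto)
  then show ?thesis
    unfolding gen_def jump_rate_eq
    by (intro bounded_borel_on_sum bounded_borel_on_mult bounded_borel_on_const)
qed

lemma bounded_borel_expect:
  assumes "\<And>x. x \<in> configs N \<Longrightarrow> bounded_borel_on {0..T} (\<lambda>u. f u x)"
  shows "bounded_borel_on {0..T} (\<lambda>u. expect u (f u))"
  unfolding expect_def using assms by (intro bounded_borel_on_sum bounded_borel_on_mult bounded_borel_\<mu>)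

lemma expect_continuous: "continuous_on {0..T} (\<lambda>u. expect u f)"
  unfolding expect_def by (intro continuous_intros \<mu>_continuous)

lemma expect_mono: "0 \<le> t \<Longrightarrow> (\<And>x. x \<in> configs N \<Longrightarrow> f x \<le> g x) \<Longrightarrow> expect t f \<le> expect t g"
  unfolding expect_def by (rule sum_weighted_mono[OF \<mu>_prob])

lemma expect_const: "0 \<le> t \<Longrightarrow> expect t (\<lambda>_. c) = c"
  unfolding expect_def by (rule sum_prob_on_const[OF \<mu>_prob])

lemma expect_add: "expect t (\<lambda>x. f x + g x) = expect t f + expect t g"
  by (simp add: expect_def distrib_left sum.distrib)

lemma expect_diff: "expect t (\<lambda>x. f x - g x) = expect t f - expect t g"
  by (simp add: expect_def right_diff_distrib sum_subtractf)

lemma expect_cmult: "expect t (\<lambda>x. c * f x) = c * expect t f"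
  by (simp add: expect_def sum_distrib_left mult_ac)

lemma expect_sum: "expect t (\<lambda>x. \<Sum>i\<in>I. f i x) = (\<Sum>i\<in>I. expect t (f i))"
  unfolding expect_def sum_distrib_left by (rule sum.swap)

lemma abs_expect_le:
  assumes "0 \<le> t" "\<And>x. x \<in> configs N \<Longrightarrow> \<bar>f x\<bar> \<le> g x"
  shows "\<bar>expect t f\<bar> \<le> expect t g"
proof -
  have "expect t f \<le> expect t g"
    by (rule expect_mono[OF assms(1)]) (use assms(2) in \<open>force simp: abs_le_iff\<close>)
  moreover have "expect t (\<lambda>x. - 1 * f x) \<le> expect t g"
    by (rule expect_mono[OF assms(1)]) (use assms(2) in \<open>force simp: abs_le_iff\<close>)
  ultimately show ?thesis
    unfolding expect_cmult by linarith
qed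

text \<open>
  Including the diagonal term costs nothing, and the rows of the rate matrix sum to zero.
\<close>

lemma sum_jump_rate_indicator:
  "(\<Sum>j\<in>UNIV - {x k}. jump_rate G N \<sigma> k t x j * (of_bool (j = i) - of_bool (x k = i))) =
    drift_rate (\<sigma> k) t (M x) (x k) i"
proof -
  let ?r = "\<lambda>j. drift_rate (\<sigma> k) t (M x) (x k) j"
  have "(\<Sum>j\<in>UNIV - {x k}. ?r j * (of_bool (j = i) - of_bool (x k = i))) =
      (\<Sum>j\<in>UNIV. ?r j * (of_bool (j = i) - of_bool (x k = i)))"
    by (rule sum.mono_neutral_left) auto
  also have "\<dots> = (\<Sum>j\<in>UNIV. ?r j * of_bool (j = i)) - (\<Sum>j\<in>UNIV. ?r j) * of_bool (x k = i)"
    by (simp add: right_diff_distrib sum_subtractf sum_distrib_right)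
  also have "(\<Sum>j\<in>UNIV. ?r j * of_bool (j = i)) = (\<Sum>j\<in>UNIV. if j = i then ?r j else 0)"
    by (intro sum.cong) auto
  finally show ?thesis
    by (simp add: jump_rate_eq drift_rate_row[OF M_simplex])
qed

lemma M_update:
  assumes "k < N"
  shows "M (x(k := j)) $ i - M x $ i = (of_bool (j = i) - of_bool (x k = i)) / N"
proof -
  have "(\<Sum>l<N. of_bool ((x(k := j)) l = i) - of_bool (x l = i) :: real) =
      (\<Sum>l<N. if l = k then of_bool (j = i) - of_bool (x k = i) else 0)"
    by (intro sum.cong) auto
  also have "\<dots> = of_bool (j = i) - of_bool (x k = i)"
    using assms by simp
  finally show ?thesis
    by (simp add: empirical_component sum_subtractf diff_divide_distrib[symmetric])
qed

text \<open>
  The second-order part of the generator applied to the square of a component of the empirical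
  distribution.
\<close>

definition fluctuation :: "real \<Rightarrow> 'e \<Rightarrow> (nat \<Rightarrow> 'e) \<Rightarrow> real" where
  "fluctuation t i x =
     (\<Sum>k<N. \<Sum>j\<in>UNIV - {x k}. jump_rate G N \<sigma> k t x j * (M (x(k := j)) $ i - M x $ i)\<^sup>2)"

lemma gen_M: "gen t (\<lambda>x. M x $ i) x = (\<Sum>k<N. drift_rate (\<sigma> k) t (M x) (x k) i) / N"
proof -
  have "gen t (\<lambda>x. M x $ i) x =
      (\<Sum>k<N. (\<Sum>j\<in>UNIV - {x k}. jump_rate G N \<sigma> k t x j * (of_bool (j = i) - of_bool (x k = i))) / N)"
    unfolding gen_def by (intro sum.cong refl) (simp add: M_update sum_divide_distrib)
  then show ?thesis
    by (simp only: sum_jump_rate_indicator sum_divide_distrib)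
qed

lemma gen_M_square:
  "gen t (\<lambda>x. (M x $ i)\<^sup>2) x = 2 * M x $ i * gen t (\<lambda>x. M x $ i) x + fluctuation t i x"
proof -
  have "jump_rate G N \<sigma> k t x j * ((M (x(k := j)) $ i)\<^sup>2 - (M x $ i)\<^sup>2) =
      2 * M x $ i * (jump_rate G N \<sigma> k t x j * (M (x(k := j)) $ i - M x $ i)) +
      jump_rate G N \<sigma> k t x j * (M (x(k := j)) $ i - M x $ i)\<^sup>2" for k j
    by (simp add: power2_eq_square algebra_simps)
  then show ?thesis
    by (simp add: gen_def fluctuation_def sum.distrib sum_distrib_left)
qed

text \<open>
  Only the summand of the deviating player differs from the drift of the population, and it has weight
  \<open>1/N\<close>.
\<close>

lemma gen_M_close:
  assumes t: "0 \<le> t"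
  shows "\<bar>gen t (\<lambda>x. M x $ i) x - drift \<pi> t (M x) i\<bar> \<le> 2 * rate_max / N"
proof -
  let ?r = "\<lambda>\<tau>. drift_rate \<tau> t (M x) (x n) i"
  have "drift \<pi> t (M x) i = (\<Sum>k<N. drift_rate \<pi> t (M x) (x k) i) / N"
    unfolding drift_def by (rule empirical_sum)
  then have "gen t (\<lambda>x. M x $ i) x - drift \<pi> t (M x) i =
      (\<Sum>k<N. drift_rate (\<sigma> k) t (M x) (x k) i - drift_rate \<pi> t (M x) (x k) i) / N"
    by (simp add: gen_M sum_subtractf diff_divide_distrib)
  also have "(\<Sum>k<N. drift_rate (\<sigma> k) t (M x) (x k) i - drift_rate \<pi> t (M x) (x k) i) =
      (\<Sum>k<N. if k = n then ?r \<pi>' - ?r \<pi> else 0)"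
    by (intro sum.cong) auto
  also have "\<dots> = ?r \<pi>' - ?r \<pi>"
    using n by simp
  finally have eq: "gen t (\<lambda>x. M x $ i) x - drift \<pi> t (M x) i = (?r \<pi>' - ?r \<pi>) / real N" .
  have "\<bar>?r \<pi>' - ?r \<pi>\<bar> \<le> rate_max + rate_max"
    by (intro order_trans[OF abs_triangle_ineq4] add_mono drift_rate_bound \<pi> \<pi>' t M_simplex)
  then show ?thesis
    unfolding eq by (simp add: abs_divide divide_right_mono)
qed

text \<open>
  There are \<open>N\<close> players, and each jump contributes a square of order \<open>1/N\<^sup>2\<close>.
\<close>

lemma fluctuation_bound:
  assumes t: "0 \<le> t"
  shows "fluctuation t i x \<le> CARD('e) * rate_max / N"
proof -
  have "fluctuation t i x \<le> (\<Sum>k<N. \<Sum>j\<in>UNIV - {x k}. rate_max * (1 / (real N)\<^sup>2))"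
    unfolding fluctuation_def
  proof (intro sum_mono)
    fix k j assume k: "k \<in> {..<N}" and j: "j \<in> UNIV - {x k}"
    have "\<bar>jump_rate G N \<sigma> k t x j\<bar> \<le> rate_max"
      by (rule jump_rate_bounds(1)) (use N_pos \<sigma>_strategies t k in auto)
    then have "jump_rate G N \<sigma> k t x j \<le> rate_max"
      by simp
    moreover have "0 \<le> jump_rate G N \<sigma> k t x j"
      by (rule jump_rate_bounds(2)) (use N_pos \<sigma>_strategies t k j in auto)
    moreover have "(M (x(k := j)) $ i - M x $ i)\<^sup>2 \<le> 1 / (real N)\<^sup>2"
      using k by (auto simp: M_update power_divide intro!: divide_right_mono)
    ultimately show "jump_rate G N \<sigma> k t x j * (M (x(k := j)) $ i - M x $ i)\<^sup>2 \<le> rate_max * (1 / (real N)\<^sup>2)"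
      by (intro mult_mono) (auto simp: rate_max)
  qed
  also have "\<dots> \<le> (\<Sum>k<N. \<Sum>j\<in>(UNIV :: 'e set). rate_max * (1 / (real N)\<^sup>2))"
    using rate_max(1) by (intro sum_mono sum_mono2) auto
  also have "\<dots> = CARD('e) * rate_max / N"
    using N_pos by (simp add: power2_eq_square)
  finally show ?thesis .
qed

definition deviation :: "real \<Rightarrow> real" where
  "deviation t = (\<Sum>i\<in>UNIV. expect t (\<lambda>x. (M x $ i - m t $ i)\<^sup>2))"

lemma deviation_expand:
  assumes "0 \<le> t"
  shows "expect t (\<lambda>x. (M x $ i - m t $ i)\<^sup>2) =
    expect t (\<lambda>x. (M x $ i)\<^sup>2) - 2 * (m t $ i * expect t (\<lambda>x. M x $ i)) + m t $ i * m t $ i"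
proof -
  have "(\<lambda>x. (M x $ i - m t $ i)\<^sup>2) = (\<lambda>x. ((M x $ i)\<^sup>2 - (2 * m t $ i) * M x $ i) + m t $ i * m t $ i)"
    by (simp add: power2_eq_square algebra_simps)
  then show ?thesis
    by (simp only: expect_add expect_diff expect_cmult expect_const[OF assms] mult.assoc)
qed

lemma m_init: "m 0 $ i = init G $ i"
  using has_integral_unique[OF population_flow_eq[OF \<pi>, of 0 i, simplified] has_integral_refl(2)] by simp

lemma m_eq: "0 \<le> t \<Longrightarrow> ((\<lambda>u. drift \<pi> u (m u) i) has_integral (m t $ i - m 0 $ i)) {0..t}"
  using population_flow_eq[OF \<pi>, of t i] by (simp add: drift_def m_init)

lemma m_component_continuous: "continuous_on {0..T} (\<lambda>u. m u $ i)"
  by (intro continuous_on_component continuous_on_subset[OF population_flow_continuous[OF \<pi>]]) auto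

lemma bounded_borel_m: "bounded_borel_on {0..T} (\<lambda>u. m u $ i)"
  by (intro bounded_borel_on_continuous m_component_continuous) auto

lemma bounded_borel_drift: "bounded_borel_on {0..T} (\<lambda>u. drift \<pi> u (m u) i)"
  by (rule drift_bounded_borel[OF \<pi> population_flow_continuous[OF \<pi>] m_simplex])

text \<open>
  The generator applied to the squared distance, including the motion of the population flow.
\<close>

definition deviation_rate :: "real \<Rightarrow> 'e \<Rightarrow> (nat \<Rightarrow> 'e) \<Rightarrow> real" where
  "deviation_rate t i x =
     2 * (M x $ i - m t $ i) * (gen t (\<lambda>x. M x $ i) x - drift \<pi> t (m t) i) + fluctuation t i x"

lemma deviation_component_increment:
  assumes T: "0 \<le> T"
  shows "((\<lambda>u. expect u (deviation_rate u i)) has_integral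
    (expect T (\<lambda>x. (M x $ i - m T $ i)\<^sup>2) - expect 0 (\<lambda>x. (M x $ i - m 0 $ i)\<^sup>2))) {0..T}"
proof -
  let ?A = "\<lambda>u. expect u (\<lambda>x. (M x $ i)\<^sup>2)" and ?B = "\<lambda>u. expect u (\<lambda>x. M x $ i)"
  let ?d = "\<lambda>u. drift \<pi> u (m u) i" and ?b = "\<lambda>u. expect u (gen u (\<lambda>x. M x $ i))"
  have mB: "((\<lambda>u. ?d u * ?B u + m u $ i * ?b u) has_integral (m T $ i * ?B T - m 0 $ i * ?B 0)) {0..T}"
    by (rule has_integral_product_rule[OF bounded_borel_drift bounded_borel_expect[OF bounded_borel_gen]])
      (use T in \<open>auto intro!: m_eq expect_increment\<close>)
  have mm: "((\<lambda>u. ?d u * m u $ i + m u $ i * ?d u) has_integral (m T $ i * m T $ i - m 0 $ i * m 0 $ i)) {0..T}"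
    by (rule has_integral_product_rule[OF bounded_borel_drift bounded_borel_drift])
      (use T in \<open>auto intro!: m_eq\<close>)
  have "((\<lambda>u. expect u (gen u (\<lambda>x. (M x $ i)\<^sup>2)) - 2 * (?d u * ?B u + m u $ i * ?b u) +
        (?d u * m u $ i + m u $ i * ?d u)) has_integral
      ((?A T - ?A 0) - 2 * (m T $ i * ?B T - m 0 $ i * ?B 0) + (m T $ i * m T $ i - m 0 $ i * m 0 $ i))) {0..T}"
    by (intro has_integral_add has_integral_diff has_integral_mult_right mB mm expect_increment T)
  moreover have "expect u (gen u (\<lambda>x. (M x $ i)\<^sup>2)) - 2 * (?d u * ?B u + m u $ i * ?b u) +
      (?d u * m u $ i + m u $ i * ?d u) = expect u (deviation_rate u i)" if "u \<in> {0..T}" for u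
  proof -
    have "deviation_rate u i = (\<lambda>x. (gen u (\<lambda>x. (M x $ i)\<^sup>2) x - 2 * (?d u * M x $ i + m u $ i * gen u (\<lambda>x. M x $ i) x)) +
        (?d u * m u $ i + m u $ i * ?d u))"
      by (simp add: deviation_rate_def fun_eq_iff gen_M_square algebra_simps)
    then show ?thesis
      using that by (simp only: expect_add expect_diff expect_cmult expect_const atLeastAtMost_iff)
  qed
  ultimately have "((\<lambda>u. expect u (deviation_rate u i)) has_integral
      ((?A T - ?A 0) - 2 * (m T $ i * ?B T - m 0 $ i * ?B 0) + (m T $ i * m T $ i - m 0 $ i * m 0 $ i))) {0..T}"
    by (rule has_integral_eq[rotated])
  then show ?thesis
    using T by (simp add: deviation_expand algebra_simps)
qed

lemma deviation_rate_sum_bound: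
  assumes t: "0 \<le> t"
  shows "(\<Sum>i\<in>UNIV. deviation_rate t i x) \<le> growth * (\<Sum>i\<in>UNIV. (M x $ i - m t $ i)\<^sup>2) + noise_level / N"
proof -
  let ?l = "l1_dist (M x) (m t)"
  let ?\<kappa> = "rate_max + rate_lip"
  have 1: "deviation_rate t i x \<le> 2 * \<bar>M x $ i - m t $ i\<bar> * (?\<kappa> * ?l + 2 * rate_max / N) + CARD('e) * rate_max / N" for i
  proof -
    have "\<bar>gen t (\<lambda>x. M x $ i) x - drift \<pi> t (m t) i\<bar> \<le> ?\<kappa> * ?l + 2 * rate_max / N"
      using gen_M_close[OF t, of i x] drift_lip[OF \<pi> t M_simplex[of x] m_simplex[OF t], of i] by linarith
    then have "2 * \<bar>M x $ i - m t $ i\<bar> * \<bar>gen t (\<lambda>x. M x $ i) x - drift \<pi> t (m t) i\<bar>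
        \<le> 2 * \<bar>M x $ i - m t $ i\<bar> * (?\<kappa> * ?l + 2 * rate_max / N)"
      by (intro mult_left_mono) auto
    then have "\<bar>2 * (M x $ i - m t $ i) * (gen t (\<lambda>x. M x $ i) x - drift \<pi> t (m t) i)\<bar>
        \<le> 2 * \<bar>M x $ i - m t $ i\<bar> * (?\<kappa> * ?l + 2 * rate_max / N)"
      unfolding abs_mult abs_numeral .
    then show ?thesis
      using fluctuation_bound[OF t, of i x] by (simp add: deviation_rate_def)
  qed
  have "(\<Sum>i\<in>UNIV. deviation_rate t i x) \<le>
      (\<Sum>i\<in>UNIV. 2 * \<bar>M x $ i - m t $ i\<bar> * (?\<kappa> * ?l + 2 * rate_max / N) + CARD('e) * rate_max / N)"
    by (intro sum_mono 1)
  also have "\<dots> = 2 * ?\<kappa> * ?l\<^sup>2 + 4 * rate_max / N * ?l + CARD('e) * (CARD('e) * rate_max / N)"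
  proof -
    have "(\<Sum>i\<in>UNIV. 2 * \<bar>M x $ i - m t $ i\<bar> * (?\<kappa> * ?l + 2 * rate_max / N)) = 2 * ?l * (?\<kappa> * ?l + 2 * rate_max / N)"
      by (simp add: l1_dist_def sum_distrib_left sum_distrib_right)
    then show ?thesis
      by (simp add: sum.distrib power2_eq_square algebra_simps)
  qed
  also have "\<dots> \<le> 2 * ?\<kappa> * (CARD('e) * (\<Sum>i\<in>UNIV. (M x $ i - m t $ i)\<^sup>2)) + 4 * rate_max / N * 2 +
      CARD('e) * (CARD('e) * rate_max / N)"
    using l1_dist_square_le[of "M x" "m t"] l1_dist_le_2[OF M_simplex[of x] m_simplex[OF t]] rate_max(1) rate_lip(1)
    by (intro add_mono mult_left_mono order_refl) auto
  also have "\<dots> = growth * (\<Sum>i\<in>UNIV. (M x $ i - m t $ i)\<^sup>2) + noise_level / N"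
    using N_pos by (simp add: growth_def noise_level_def field_simps)
  finally show ?thesis .
qed

lemma deviation_continuous: "continuous_on {0..T} deviation"
proof -
  have "continuous_on {0..T} (\<lambda>t. \<Sum>i\<in>UNIV. \<Sum>x\<in>configs N. \<mu> t x * (M x $ i - m t $ i)\<^sup>2)"
    by (intro continuous_intros \<mu>_continuous m_component_continuous)
  then show ?thesis
    by (simp add: deviation_def[abs_def] expect_def)
qed

lemma deviation_init: "deviation 0 \<le> 1 / N"
proof -
  have "deviation 0 \<le> (\<Sum>i\<in>UNIV. init G $ i / N)"
    unfolding deviation_def expect_def m_init
    by (intro sum_mono) (use initial_empirical_variance[OF N_pos(1)] in \<open>simp add: \<mu>_init\<close>)
  then show ?thesis
    using init_simplex by (simp add: sum_divide_distrib[symmetric] prob_simplex_def)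
qed

lemma deviation_bound:
  assumes t: "0 \<le> t"
  shows "deviation t \<le> spread t / N"
proof -
  have inc: "((\<lambda>u. expect u (\<lambda>x. \<Sum>i\<in>UNIV. deviation_rate u i x)) has_integral (deviation v - deviation 0)) {0..v}"
    if "0 \<le> v" for v
    unfolding expect_sum deviation_def sum_subtractf[symmetric]
    by (intro has_integral_sum deviation_component_increment that) simp
  have "deviation t \<le> (1 / N + noise_level / N * t) * (1 + growth * t * exp (growth * t))"
  proof (rule gronwall_const[OF growth_nonneg deviation_continuous _ t])
    fix v assume v: "v \<in> {0..t}"
    have "((\<lambda>u. growth * deviation u + noise_level / N) has_integral
        (growth * integral {0..v} deviation + noise_level / N * v)) {0..v}"
    proof (intro has_integral_add has_integral_mult_right integrable_integral
        integrable_continuous_interval deviation_continuous)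
      show "((\<lambda>u. noise_level / N) has_integral (noise_level / N * v)) {0..v}"
        using has_integral_const_real[of "noise_level / N" 0 v] v by (simp add: mult.commute)
    qed
    then have "deviation v - deviation 0 \<le> growth * integral {0..v} deviation + noise_level / N * v"
    proof (rule has_integral_le[OF inc, rotated])
      show "0 \<le> v"
        using v by simp
      fix u assume "u \<in> {0..v}"
      then have u: "0 \<le> u" by simp
      have "expect u (\<lambda>x. \<Sum>i\<in>UNIV. deviation_rate u i x) \<le>
          expect u (\<lambda>x. growth * (\<Sum>i\<in>UNIV. (M x $ i - m u $ i)\<^sup>2) + noise_level / N)"
        by (intro expect_mono u deviation_rate_sum_bound)
      also have "\<dots> = growth * deviation u + noise_level / N"
        by (simp only: expect_add expect_cmult expect_const[OF u] expect_sum deviation_def)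
      finally show "expect u (\<lambda>x. \<Sum>i\<in>UNIV. deviation_rate u i x) \<le> growth * deviation u + noise_level / N" .
    qed
    moreover have "noise_level / N * v \<le> noise_level / N * t"
      using v noise_level_nonneg by (intro mult_left_mono) auto
    ultimately show "deviation v \<le> 1 / N + noise_level / N * t + growth * integral {0..v} deviation"
      using deviation_init by linarith
  next
    show "0 \<le> 1 / N + noise_level / N * t"
      using noise_level_nonneg t by simp
  qed
  also have "\<dots> = spread t / N"
    by (simp add: spread_def add_divide_distrib[symmetric])
  finally show ?thesis .
qed

text \<open>
  The choice \<open>\<eta> = 1 / sqrt N\<close> balances the two terms of the moment inequality.
\<close>

lemma expect_l1_bound:
  assumes t: "0 \<le> t" "t \<le> T"
  shows "expect t (\<lambda>x. l1_dist (M x) (m t)) \<le> gap N T"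
proof -
  define \<eta> where "\<eta> = 1 / sqrt N"
  have \<eta>: "0 < \<eta>"
    using N_pos by (simp add: \<eta>_def)
  have "expect t (\<lambda>x. l1_dist (M x) (m t)) \<le>
      expect t (\<lambda>x. CARD('e) * \<eta> + 1 / \<eta> * (\<Sum>i\<in>UNIV. (M x $ i - m t $ i)\<^sup>2))"
    using l1_dist_le_young[OF \<eta>] by (intro expect_mono t) simp
  also have "\<dots> = CARD('e) * \<eta> + deviation t / \<eta>"
    by (simp only: expect_add expect_cmult expect_const[OF t(1)] expect_sum deviation_def) simp
  also have "\<dots> \<le> CARD('e) * \<eta> + (spread T / N) / \<eta>"
  proof -
    have "deviation t \<le> spread T / N"
      using deviation_bound[OF t(1)] spread_mono[OF t] N_pos
      by (meson divide_right_mono of_nat_0_le_iff order_trans)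
    then show ?thesis
      using \<eta> by (intro add_left_mono divide_right_mono) auto
  qed
  also have "\<dots> = gap N T"
  proof -
    define r where "r = sqrt N"
    have r: "0 < r" "real N = r * r"
      using N_pos by (simp_all add: r_def)
    have "spread T / real N / (1 / r) = spread T / r"
      unfolding r(2) using r(1) by simp
    then show ?thesis
      unfolding \<eta>_def gap_def r_def[symmetric] by (simp only: add_divide_distrib mult_1_right times_divide_eq_right)
  qed
  finally show ?thesis .
qed

definition marginal :: "real \<Rightarrow> 'e \<Rightarrow> real" where
  "marginal t j = expect t (\<lambda>x. of_bool (x n = j))"

lemma gen_marginal: "gen t (\<lambda>x. of_bool (x n = j)) x = drift_rate \<pi>' t (M x) (x n) j"
proof -
  have "gen t (\<lambda>x. of_bool (x n = j)) x =
      (\<Sum>k<N. if k = n then \<Sum>i\<in>UNIV - {x n}. jump_rate G N \<sigma> n t x i * (of_bool (i = j) - of_bool (x n = j)) else 0)"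
    unfolding gen_def by (intro sum.cong refl) auto
  also have "\<dots> = drift_rate \<pi>' t (M x) (x n) j"
    using n sum_jump_rate_indicator[where k = n and x = x and t = t and i = j] by simp
  finally show ?thesis .
qed

lemma marginal_init: "marginal 0 j = init G $ j"
proof -
  have "marginal 0 j = (\<Sum>x\<in>configs N. initial_law N x * (\<Prod>k\<in>{n}. of_bool (x k = j)))"
    by (simp add: marginal_def expect_def \<mu>_init)
  also have "\<dots> = (\<Sum>i\<in>UNIV. init G $ i * of_bool (i = j))"
    using n by (subst initial_expectation_prod) auto
  also have "\<dots> = (\<Sum>i\<in>UNIV. if i = j then init G $ i else 0)"
    by (intro sum.cong) auto
  finally show ?thesis by simp
qed

lemma expect_of_state: "expect t (\<lambda>x. f (x n)) = (\<Sum>i\<in>UNIV. marginal t i * f i)"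
proof -
  have "f (x n) = (\<Sum>i\<in>UNIV. f i * of_bool (x n = i))" for x :: "nat \<Rightarrow> 'e"
  proof -
    have "(\<Sum>i\<in>UNIV. f i * of_bool (x n = i)) = (\<Sum>i\<in>UNIV. if x n = i then f i else 0)"
      by (intro sum.cong) auto
    then show ?thesis by simp
  qed
  then have "expect t (\<lambda>x. f (x n)) = expect t (\<lambda>x. \<Sum>i\<in>UNIV. f i * of_bool (x n = i))"
    by simp
  also have "\<dots> = (\<Sum>i\<in>UNIV. f i * marginal t i)"
    by (simp only: expect_sum expect_cmult marginal_def)
  finally show ?thesis
    by (simp add: mult.commute)
qed

lemma pos_continuous: "continuous_on {0..} pos"
  by (rule player_flow_continuous[OF population_flow_continuous[OF \<pi>] m_simplex \<pi>'])

definition marginal_error :: "real \<Rightarrow> real" where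
  "marginal_error t = (\<Sum>j\<in>UNIV. \<bar>marginal t j - pos t $ j\<bar>)"

text \<open>
  The marginal law of the deviating player solves the equation of the player flow with \<open>m\<close> replaced by
  the empirical distribution inside the expectation. The replacement costs at most a multiple of
  \<open>gap N T\<close>.
\<close>

lemma marginal_error_bound:
  assumes T: "0 \<le> T"
  shows "marginal_error T \<le> CARD('e) * rate_lip * gap N T * T * (1 + CARD('e) * rate_max * T * exp (CARD('e) * rate_max * T))"
proof (rule gronwall_const[of "CARD('e) * rate_max" T marginal_error])
  show cont: "continuous_on {0..T} marginal_error"
    unfolding marginal_error_def marginal_def
    by (intro continuous_intros expect_continuous continuous_on_component continuous_on_subset[OF pos_continuous]) auto
  have gap0: "0 \<le> gap N T"
    using expect_l1_bound[OF order_refl T] expect_mono[OF order_refl, of "\<lambda>_. 0" "\<lambda>x. l1_dist (M x) (m 0)"]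
      expect_const[of 0 0] by simp
  then show "0 \<le> CARD('e) * rate_lip * gap N T * T"
    using rate_lip(1) T by simp
  show "0 \<le> CARD('e) * rate_max"
    using rate_max(1) by simp
  fix v assume v: "v \<in> {0..T}"
  have "\<bar>marginal v j - pos v $ j\<bar> \<le> rate_max * integral {0..v} marginal_error + rate_lip * gap N T * T" for j
  proof -
    have 1: "((\<lambda>u. expect u (\<lambda>x. drift_rate \<pi>' u (M x) (x n) j)) has_integral (marginal v j - init G $ j)) {0..v}"
      using expect_increment[of v "\<lambda>x. of_bool (x n = j)"] v
      by (simp add: gen_marginal[abs_def] marginal_def[symmetric] marginal_init)
    have 2: "((\<lambda>u. \<Sum>i\<in>UNIV. pos u $ i * drift_rate \<pi>' u (m u) i j) has_integral (pos v $ j - init G $ j)) {0..v}"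
      by (rule player_flow_eq[OF population_flow_continuous[OF \<pi>] m_simplex \<pi>']) (use v in auto)
    have "\<bar>(marginal v j - init G $ j) - (pos v $ j - init G $ j)\<bar> \<le>
        rate_max * integral {0..v} marginal_error + rate_lip * gap N T * v"
    proof (rule has_integral_abs_le[OF has_integral_diff[OF 1 2]])
      show "((\<lambda>u. rate_max * marginal_error u + rate_lip * gap N T) has_integral
          (rate_max * integral {0..v} marginal_error + rate_lip * gap N T * v)) {0..v}"
      proof (intro has_integral_add has_integral_mult_right integrable_integral
          integrable_continuous_interval continuous_on_subset[OF cont])
        show "((\<lambda>u. rate_lip * gap N T) has_integral (rate_lip * gap N T * v)) {0..v}"
          using has_integral_const_real[of "rate_lip * gap N T" 0 v] v by (simp add: mult.commute)
      qed (use v in auto)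
      fix u assume "u \<in> {0..v}"
      then have u: "0 \<le> u" "u \<le> T"
        using v by auto
      have "expect u (\<lambda>x. drift_rate \<pi>' u (M x) (x n) j) - (\<Sum>i\<in>UNIV. pos u $ i * drift_rate \<pi>' u (m u) i j) =
          expect u (\<lambda>x. drift_rate \<pi>' u (M x) (x n) j - drift_rate \<pi>' u (m u) (x n) j) +
          (\<Sum>i\<in>UNIV. (marginal u i - pos u $ i) * drift_rate \<pi>' u (m u) i j)"
        by (simp add: expect_diff expect_of_state[of u "\<lambda>i. drift_rate \<pi>' u (m u) i j"] left_diff_distrib sum_subtractf)
      moreover have "\<bar>expect u (\<lambda>x. drift_rate \<pi>' u (M x) (x n) j - drift_rate \<pi>' u (m u) (x n) j)\<bar> \<le> rate_lip * gap N T"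
      proof -
        have "\<bar>expect u (\<lambda>x. drift_rate \<pi>' u (M x) (x n) j - drift_rate \<pi>' u (m u) (x n) j)\<bar> \<le>
            expect u (\<lambda>x. rate_lip * l1_dist (M x) (m u))"
          by (intro abs_expect_le u drift_rate_lip \<pi>' M_simplex m_simplex)
        also have "\<dots> \<le> rate_lip * gap N T"
          unfolding expect_cmult by (intro mult_left_mono expect_l1_bound u rate_lip(1))
        finally show ?thesis .
      qed
      moreover have "\<bar>\<Sum>i\<in>UNIV. (marginal u i - pos u $ i) * drift_rate \<pi>' u (m u) i j\<bar> \<le> rate_max * marginal_error u"
      proof -
        have "\<bar>\<Sum>i\<in>UNIV. (marginal u i - pos u $ i) * drift_rate \<pi>' u (m u) i j\<bar> \<le>
            (\<Sum>i\<in>UNIV. \<bar>marginal u i - pos u $ i\<bar> * rate_max)"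
          by (rule order_trans[OF sum_abs])
            (use drift_rate_bound[OF \<pi>' u(1) m_simplex[OF u(1)]] in \<open>auto simp: abs_mult intro!: sum_mono mult_left_mono\<close>)
        then show ?thesis
          by (simp add: marginal_error_def sum_distrib_left mult.commute)
      qed
      ultimately show "\<bar>expect u (\<lambda>x. drift_rate \<pi>' u (M x) (x n) j) - (\<Sum>i\<in>UNIV. pos u $ i * drift_rate \<pi>' u (m u) i j)\<bar>
          \<le> rate_max * marginal_error u + rate_lip * gap N T"
        by linarith
    qed
    moreover have "rate_lip * gap N T * v \<le> rate_lip * gap N T * T"
      using v rate_lip(1) gap0 by (intro mult_left_mono) auto
    ultimately show ?thesis by linarith
  qed
  then have "marginal_error v \<le> (\<Sum>j\<in>(UNIV :: 'e set). rate_max * integral {0..v} marginal_error + rate_lip * gap N T * T)"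
    unfolding marginal_error_def[of v] by (intro sum_mono)
  then show "marginal_error v \<le> CARD('e) * rate_lip * gap N T * T + CARD('e) * rate_max * integral {0..v} marginal_error"
    by (simp add: algebra_simps)
qed (rule T)

lemma running_cost_error:
  assumes t: "0 \<le> t" "t \<le> T"
    and mod: "\<And>i a p p'. p \<in> prob_simplex \<Longrightarrow> p' \<in> prob_simplex \<Longrightarrow> \<bar>cost G i a p - cost G i a p'\<bar> \<le> \<epsilon> + K * l1_dist p p'"
    and K: "0 \<le> K"
  shows "\<bar>(\<Sum>x\<in>configs N. \<mu> t x * running_cost N \<sigma> n t x) -
      (\<Sum>i\<in>UNIV. \<Sum>a\<in>UNIV. pos t $ i * cost G i a (m t) * \<pi>' i t $ a)\<bar> \<le> \<epsilon> + K * gap N T + cost_max * marginal_error t"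
proof -
  define c where "c p i = (\<Sum>a\<in>UNIV. \<pi>' i t $ a * cost G i a p)" for p i
  have "(\<Sum>x\<in>configs N. \<mu> t x * running_cost N \<sigma> n t x) = expect t (\<lambda>x. c (M x) (x n))"
    by (simp add: expect_def running_cost_def c_def)
  moreover have "(\<Sum>i\<in>UNIV. \<Sum>a\<in>UNIV. pos t $ i * cost G i a (m t) * \<pi>' i t $ a) = (\<Sum>i\<in>UNIV. pos t $ i * c (m t) i)"
    by (simp add: c_def sum_distrib_left mult_ac)
  moreover have "expect t (\<lambda>x. c (M x) (x n)) - (\<Sum>i\<in>UNIV. pos t $ i * c (m t) i) =
      expect t (\<lambda>x. c (M x) (x n) - c (m t) (x n)) + (\<Sum>i\<in>UNIV. (marginal t i - pos t $ i) * c (m t) i)"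
    by (simp add: expect_diff expect_of_state[of t "c (m t)"] left_diff_distrib sum_subtractf)
  moreover have "\<bar>expect t (\<lambda>x. c (M x) (x n) - c (m t) (x n))\<bar> \<le> \<epsilon> + K * gap N T"
  proof -
    have "\<bar>c (M x) (x n) - c (m t) (x n)\<bar> \<le> \<epsilon> + K * l1_dist (M x) (m t)" for x
      unfolding c_def sum_subtractf[symmetric] right_diff_distrib[symmetric]
      by (intro abs_strategy_average_le \<pi>' t mod M_simplex m_simplex)
    then have "\<bar>expect t (\<lambda>x. c (M x) (x n) - c (m t) (x n))\<bar> \<le> expect t (\<lambda>x. \<epsilon> + K * l1_dist (M x) (m t))"
      by (intro abs_expect_le t)
    also have "\<dots> \<le> \<epsilon> + K * gap N T"
      unfolding expect_add expect_cmult expect_const[OF t(1)]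
      by (intro add_left_mono mult_left_mono expect_l1_bound t K)
    finally show ?thesis .
  qed
  moreover have "\<bar>\<Sum>i\<in>UNIV. (marginal t i - pos t $ i) * c (m t) i\<bar> \<le> cost_max * marginal_error t"
  proof -
    have "\<bar>c (m t) i\<bar> \<le> cost_max" for i
      unfolding c_def by (intro abs_strategy_average_le \<pi>' t cost_max m_simplex)
    then have "\<bar>\<Sum>i\<in>UNIV. (marginal t i - pos t $ i) * c (m t) i\<bar> \<le> (\<Sum>i\<in>UNIV. \<bar>marginal t i - pos t $ i\<bar> * cost_max)"
      by (intro order_trans[OF sum_abs] sum_mono) (simp add: abs_mult mult_left_mono)
    then show ?thesis
      by (simp add: marginal_error_def sum_distrib_left mult.commute)
  qed
  ultimately show ?thesis by linarith
qed

end

end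

section \<open>Uniform convergence of the values\<close>

context lipschitz_mfg
begin

text \<open>
  Costs are only continuous. Uniform continuity and boundedness still give a Lipschitz bound up to an
  arbitrarily small additive error, and such a bound can be integrated.
\<close>

lemma cost_modulus:
  assumes "0 < \<epsilon>"
  shows "\<exists>K\<ge>0. \<forall>i a. \<forall>p\<in>prob_simplex. \<forall>p'\<in>prob_simplex. \<bar>cost G i a p - cost G i a p'\<bar> \<le> \<epsilon> + K * l1_dist p p'"
proof -
  have "\<exists>\<delta>>0. \<forall>p\<in>prob_simplex. \<forall>p'\<in>prob_simplex. dist p' p < \<delta> \<longrightarrow> dist (cost G i a p') (cost G i a p) < \<epsilon>" for i a
    using compact_uniformly_continuous[OF cost_continuous compact_prob_simplex] assms
    unfolding uniformly_continuous_on_def by blast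
  then obtain \<delta> where \<delta>: "\<And>i a. 0 < \<delta> i a"
    "\<And>i a p p'. p \<in> prob_simplex \<Longrightarrow> p' \<in> prob_simplex \<Longrightarrow> dist p' p < \<delta> i a \<Longrightarrow> dist (cost G i a p') (cost G i a p) < \<epsilon>"
    by metis
  let ?K = "\<Sum>i\<in>UNIV. \<Sum>a\<in>UNIV. 2 * cost_max / \<delta> i a"
  have term_nonneg: "0 \<le> 2 * cost_max / \<delta> i a" for i a
    using \<delta>(1)[of i a] cost_max(1) by simp
  have "\<bar>cost G i a p - cost G i a p'\<bar> \<le> \<epsilon> + ?K * l1_dist p p'"
    if p: "p \<in> prob_simplex" "p' \<in> prob_simplex" for i a p p'
  proof (cases "dist p p' < \<delta> i a")
    case True
    have "0 \<le> ?K * l1_dist p p'"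
      using term_nonneg by (intro mult_nonneg_nonneg sum_nonneg) auto
    then show ?thesis
      using \<delta>(2)[OF p(2) p(1) True] by (simp add: dist_real_def)
  next
    case False
    have "\<bar>cost G i a p - cost G i a p'\<bar> \<le> 2 * cost_max"
      using cost_max(2)[OF p(1), of i a] cost_max(2)[OF p(2), of i a] by linarith
    also have "\<dots> \<le> 2 * cost_max / \<delta> i a * l1_dist p p'"
    proof -
      have "\<delta> i a \<le> l1_dist p p'"
        using False dist_le_l1_dist[of p p'] by linarith
      then have "2 * cost_max * \<delta> i a \<le> 2 * cost_max * l1_dist p p'"
        using cost_max(1) by (intro mult_left_mono) auto
      then show ?thesis
        using \<delta>(1)[of i a] by (simp add: pos_le_divide_eq)
    qed
    also have "\<dots> \<le> ?K * l1_dist p p'"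
    proof (rule mult_right_mono)
      have "2 * cost_max / \<delta> i a \<le> (\<Sum>a\<in>UNIV. 2 * cost_max / \<delta> i a)"
        using term_nonneg by (intro member_le_sum) auto
      also have "\<dots> \<le> ?K"
        using term_nonneg by (intro member_le_sum[of i UNIV "\<lambda>i. \<Sum>a\<in>UNIV. 2 * cost_max / \<delta> i a"]) (auto intro: sum_nonneg)
      finally show "2 * cost_max / \<delta> i a \<le> ?K" .
    qed simp
    finally show ?thesis
      using assms by linarith
  qed
  moreover have "0 \<le> ?K"
    using term_nonneg by (intro sum_nonneg) auto
  ultimately show ?thesis
    by blast
qed

text \<open>
  The integrand of the mean field value without the discount factor.
\<close>

definition flow_cost :: "('e, 'a) strategy \<Rightarrow> (real \<Rightarrow> real ^ 'e) \<Rightarrow> (real \<Rightarrow> real ^ 'e) \<Rightarrow> real \<Rightarrow> real" where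
  "flow_cost \<pi> m x t = (\<Sum>i\<in>UNIV. \<Sum>a\<in>UNIV. x t $ i * cost G i a (m t) * \<pi> i t $ a)"

lemma mf_value_eq:
  "mf_value G \<pi>0 \<pi> = (LINT t:{0..}|lborel.
     flow_cost \<pi>0 (population_flow G \<pi>) (player_flow G \<pi>0 (population_flow G \<pi>)) t * exp (- \<beta> * t))"
  by (simp add: mf_value_def Let_def flow_cost_def)

lemma flow_cost_bound:
  assumes "\<pi> \<in> strategies" "0 \<le> t" "m t \<in> prob_simplex" "x t \<in> prob_simplex"
  shows "\<bar>flow_cost \<pi> m x t\<bar> \<le> cost_max"
proof -
  have "flow_cost \<pi> m x t = (\<Sum>i\<in>UNIV. x t $ i * (\<Sum>a\<in>UNIV. \<pi> i t $ a * cost G i a (m t)))"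
    by (simp add: flow_cost_def sum_distrib_left mult_ac)
  also have "\<bar>\<dots>\<bar> \<le> cost_max"
    by (intro abs_sum_weighted_le[OF prob_on_vec_nth] abs_strategy_average_le assms cost_max)
  finally show ?thesis .
qed

lemma flow_cost_measurable:
  assumes "\<pi> \<in> strategies" "continuous_on {0..} m" "continuous_on {0..} x" "\<And>t. 0 \<le> t \<Longrightarrow> m t \<in> prob_simplex"
  shows "flow_cost \<pi> m x \<in> borel_measurable (restrict_space borel {0..})"
  unfolding flow_cost_def[abs_def]
  by (intro borel_measurable_sum borel_measurable_times strategy_measurable measurable_along
      borel_measurable_continuous_on_restrict continuous_on_component assms cost_continuous) (use assms in auto)

lemma discounted_integrable:
  assumes f: "f \<in> borel_measurable (restrict_space borel {0..})" and K: "\<And>t. 0 \<le> t \<Longrightarrow> \<bar>f t\<bar> \<le> K"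
  shows "set_integrable lborel {0..} (\<lambda>t. f t * exp (- \<beta> * t))"
  unfolding set_integrable_def
proof (rule Bochner_Integration.integrable_bound)
  show "integrable lborel (\<lambda>t. K * (indicator {0..} t * exp (- \<beta> * t)))"
    by (intro integrable_mult_right integrable_exp_discount \<beta>_pos)
  have "(\<lambda>t. f t * exp (- \<beta> * t)) \<in> borel_measurable (restrict_space borel {0..})"
    by (intro borel_measurable_times f borel_measurable_continuous_on_restrict continuous_intros)
  from borel_measurable_indicator_times[OF this]
  show "(\<lambda>t. indicator {0..} t *\<^sub>R (f t * exp (- \<beta> * t))) \<in> borel_measurable lborel"
    by simp
  have "norm (indicator {0..} t *\<^sub>R (f t * exp (- \<beta> * t))) \<le> norm (K * (indicator {0..} t * exp (- \<beta> * t)))" for t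
    using K[of t] by (auto simp: abs_mult indicator_def intro!: mult_right_mono)
  then show "AE t in lborel. norm (indicator {0..} t *\<^sub>R (f t * exp (- \<beta> * t))) \<le> norm (K * (indicator {0..} t * exp (- \<beta> * t)))"
    by simp
qed

lemma running_cost_limit:
  assumes T: "0 \<le> T" and \<epsilon>: "0 < \<epsilon>"
  shows "\<exists>N0. \<forall>N\<ge>N0. \<forall>n<N. \<forall>\<pi>\<in>strategies. \<forall>\<pi>'\<in>strategies. \<forall>\<mu> t.
    config_law N ((\<lambda>_. \<pi>)(n := \<pi>')) \<mu> \<and> 0 \<le> t \<and> t \<le> T \<longrightarrow>
    \<bar>(\<Sum>x\<in>configs N. \<mu> t x * running_cost N ((\<lambda>_. \<pi>)(n := \<pi>')) n t x) -
      flow_cost \<pi>' (population_flow G \<pi>) (player_flow G \<pi>' (population_flow G \<pi>)) t\<bar> \<le> \<epsilon>"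
proof -
  obtain K where K: "0 \<le> K" and
    mod: "\<And>i a p p'. p \<in> prob_simplex \<Longrightarrow> p' \<in> prob_simplex \<Longrightarrow> \<bar>cost G i a p - cost G i a p'\<bar> \<le> \<epsilon> / 2 + K * l1_dist p p'"
    using cost_modulus[of "\<epsilon> / 2"] \<epsilon> by auto
  define c where "c = real CARD('e)"
  have c: "0 \<le> c"
    by (simp add: c_def)
  define F where "F t = t * (1 + c * rate_max * t * exp (c * rate_max * t))" for t
  (* the total error at times up to T is at most eps/2 + h * gap N T *)
  define h where "h = K + cost_max * (c * rate_lip * F T)"
  have F: "0 \<le> F t" "F t \<le> F T" if "0 \<le> t" "t \<le> T" for t
  proof -
    have nn: "0 \<le> c * rate_max"
      using c rate_max(1) by simp
    show "0 \<le> F t"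
      using that nn by (simp add: F_def)
    have "c * rate_max * t \<le> c * rate_max * T"
      using that nn by (intro mult_left_mono)
    moreover from this have "exp (c * rate_max * t) \<le> exp (c * rate_max * T)"
      by simp
    ultimately have "c * rate_max * t * exp (c * rate_max * t) \<le> c * rate_max * T * exp (c * rate_max * T)"
      using that nn c rate_max(1) by (intro mult_mono) auto
    then show "F t \<le> F T"
      unfolding F_def using that nn by (intro mult_mono) auto
  qed
  have h: "0 \<le> h"
    using K cost_max(1) c rate_lip(1) F(1)[OF T order_refl] by (simp add: h_def)
  have gap_nonneg: "0 \<le> gap N t" if "0 \<le> t" for N t
    unfolding gap_def spread_def using that noise_level_nonneg growth_nonneg
    by (intro divide_nonneg_nonneg add_nonneg_nonneg mult_nonneg_nonneg) auto
  have "(\<lambda>N. h * gap N T) \<longlonglongrightarrow> 0"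
    unfolding gap_def by real_asymp
  then have "\<forall>\<^sub>F N in sequentially. h * gap N T < \<epsilon> / 2"
    by (rule order_tendstoD(2)) (use \<epsilon> in simp)
  then obtain N0 where N0: "\<And>N. N \<ge> N0 \<Longrightarrow> h * gap N T < \<epsilon> / 2"
    by (auto simp: eventually_sequentially)
  show ?thesis
  proof (intro exI[of _ N0] allI impI ballI, elim conjE)
    fix N n :: nat and \<pi> \<pi>' :: "('e, 'a) strategy" and \<mu> t
    assume N: "N0 \<le> N" and n: "n < N" and \<pi>: "\<pi> \<in> strategies" "\<pi>' \<in> strategies"
      and \<mu>: "config_law N ((\<lambda>_. \<pi>)(n := \<pi>')) \<mu>" and t: "0 \<le> t" "t \<le> T"
    have gap_mono: "gap N t \<le> gap N T"
      unfolding gap_def using spread_mono[OF t] by (intro divide_right_mono) auto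
    have "marginal_error N n \<pi> \<pi>' \<mu> t \<le> c * rate_lip * gap N t * F t"
      using marginal_error_bound[OF n \<pi> \<mu> t(1)] by (simp add: c_def F_def mult.assoc)
    also have "\<dots> \<le> c * rate_lip * gap N T * F T"
      using F[OF t] gap_mono gap_nonneg[OF t(1), of N] c rate_lip(1) by (intro mult_mono) auto
    finally have "cost_max * marginal_error N n \<pi> \<pi>' \<mu> t \<le> cost_max * (c * rate_lip * gap N T * F T)"
      using cost_max(1) by (intro mult_left_mono)
    moreover have "\<bar>(\<Sum>x\<in>configs N. \<mu> t x * running_cost N ((\<lambda>_. \<pi>)(n := \<pi>')) n t x) -
      flow_cost \<pi>' (population_flow G \<pi>) (player_flow G \<pi>' (population_flow G \<pi>)) t\<bar>
        \<le> \<epsilon> / 2 + K * gap N T + cost_max * marginal_error N n \<pi> \<pi>' \<mu> t"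
      unfolding flow_cost_def by (rule running_cost_error[OF n \<pi> \<mu> t mod K])
    moreover have "K * gap N T + cost_max * (c * rate_lip * gap N T * F T) = h * gap N T"
      by (simp add: h_def algebra_simps)
    ultimately show "\<bar>(\<Sum>x\<in>configs N. \<mu> t x * running_cost N ((\<lambda>_. \<pi>)(n := \<pi>')) n t x) -
      flow_cost \<pi>' (population_flow G \<pi>) (player_flow G \<pi>' (population_flow G \<pi>)) t\<bar> \<le> \<epsilon>"
      using N0[OF N] by linarith
  qed
qed

text \<open>
  Beyond a late time the discount factor makes the contribution of the running cost small,
  whatever the strategies are.
\<close>

theorem value_limit:
  assumes \<epsilon>: "0 < \<epsilon>"
  shows "\<exists>N0\<ge>1. \<forall>N\<ge>N0. \<forall>n<N. \<forall>\<pi>\<in>strategies. \<forall>\<pi>'\<in>strategies.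
    \<bar>nplayer_value G N n \<pi>' \<pi> - mf_value G \<pi>' \<pi>\<bar> \<le> \<epsilon>"
proof -
  define J where "J b = (\<integral>t. indicator {0..} t * exp (- b * t) \<partial>lborel)" for b :: real
  have J: "0 \<le> J b" for b
    unfolding J_def by (intro integral_nonneg_AE) auto
  define \<epsilon>' where "\<epsilon>' = \<epsilon> / (2 * (J \<beta> + 1))"
  have \<epsilon>': "0 < \<epsilon>'"
    using \<epsilon> J[of \<beta>] by (simp add: \<epsilon>'_def)
  (* after time T half of the discount rate makes the tail small, the other half keeps it integrable *)
  have "(\<lambda>T. 2 * cost_max * exp (- (\<beta> / 2) * T) * J (\<beta> / 2)) \<longlonglongrightarrow> 0"
    using \<beta>_pos by real_asymp
  then have "\<forall>\<^sub>F T in sequentially. 2 * cost_max * exp (- (\<beta> / 2) * real T) * J (\<beta> / 2) < \<epsilon> / 2"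
    by (rule order_tendstoD(2)) (use \<epsilon> in simp)
  then obtain T where T: "2 * cost_max * exp (- (\<beta> / 2) * real T) * J (\<beta> / 2) < \<epsilon> / 2"
    by (auto simp: eventually_sequentially)
  from running_cost_limit[of "real T" \<epsilon>', OF of_nat_0_le_iff \<epsilon>']
  obtain N0 where N0: "\<forall>N\<ge>N0. \<forall>n<N. \<forall>\<pi>\<in>strategies. \<forall>\<pi>'\<in>strategies. \<forall>\<mu> t.
    config_law N ((\<lambda>_. \<pi>)(n := \<pi>')) \<mu> \<and> 0 \<le> t \<and> t \<le> real T \<longrightarrow>
    \<bar>(\<Sum>x\<in>configs N. \<mu> t x * running_cost N ((\<lambda>_. \<pi>)(n := \<pi>')) n t x) -
      flow_cost \<pi>' (population_flow G \<pi>) (player_flow G \<pi>' (population_flow G \<pi>)) t\<bar> \<le> \<epsilon>'" ..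
  show ?thesis
  proof (intro exI[of _ "max 1 N0"] conjI allI impI ballI)
    fix N n :: nat and \<pi> \<pi>' :: "('e, 'a) strategy"
    assume N: "max 1 N0 \<le> N" and n: "n < N" and \<pi>: "\<pi> \<in> strategies" "\<pi>' \<in> strategies"
    let ?\<sigma> = "(\<lambda>_. \<pi>)(n := \<pi>')"
    have \<sigma>: "?\<sigma> k \<in> strategies" if "k < N" for k
      using \<pi> by simp
    have N1: "1 \<le> N"
      using N by simp
    obtain \<mu> where \<mu>: "config_law N ?\<sigma> \<mu>" and v: "nplayer_value G N n \<pi>' \<pi> = law_value N ?\<sigma> n \<mu>"
      using nplayer_value_eq[OF N1 n \<pi>] by blast
    define f where "f t = (\<Sum>x\<in>configs N. \<mu> t x * running_cost N ?\<sigma> n t x)" for t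
    define g where "g = flow_cost \<pi>' (population_flow G \<pi>) (player_flow G \<pi>' (population_flow G \<pi>))"
    note flows = population_flow_continuous[OF \<pi>(1)] population_flow_simplex[OF \<pi>(1)]
    have fb: "\<bar>f t\<bar> \<le> cost_max" if "0 \<le> t" for t
      unfolding f_def using \<mu> that running_cost_bound[of N ?\<sigma> t n, OF N1 \<sigma> that n]
      by (intro abs_sum_weighted_le[of _ "configs N"]) (auto simp: config_law_def)
    have gb: "\<bar>g t\<bar> \<le> cost_max" if "0 \<le> t" for t
      unfolding g_def using that by (intro flow_cost_bound \<pi> flows player_flow_simplex)
    have fm: "f \<in> borel_measurable (restrict_space borel {0..})"
      unfolding f_def[abs_def]
      by (intro borel_measurable_sum borel_measurable_times running_cost_measurable[of N ?\<sigma>, OF N1 \<sigma> n]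
          borel_measurable_continuous_on_restrict continuous_on_atLeastI \<mu>_continuous[OF n \<pi> \<mu>])
    have gm: "g \<in> borel_measurable (restrict_space borel {0..})"
      unfolding g_def by (intro flow_cost_measurable \<pi> flows player_flow_continuous)
    have fi: "set_integrable lborel {0..} (\<lambda>t. f t * exp (- \<beta> * t))"
      by (rule discounted_integrable[OF fm fb])
    have gi: "set_integrable lborel {0..} (\<lambda>t. g t * exp (- \<beta> * t))"
      by (rule discounted_integrable[OF gm gb])
    define B where "B t = \<epsilon>' * (indicator {0..} t * exp (- \<beta> * t)) +
      2 * cost_max * exp (- (\<beta> / 2) * real T) * (indicator {0..} t * exp (- (\<beta> / 2) * t))" for t
    have Bi: "integrable lborel B"
      unfolding B_def using \<beta>_pos
      by (intro Bochner_Integration.integrable_add integrable_mult_right integrable_exp_discount) auto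
    have "\<bar>nplayer_value G N n \<pi>' \<pi> - mf_value G \<pi>' \<pi>\<bar> =
        \<bar>\<integral>t. indicator {0..} t *\<^sub>R (f t * exp (- \<beta> * t)) - indicator {0..} t *\<^sub>R (g t * exp (- \<beta> * t)) \<partial>lborel\<bar>"
      unfolding v law_value_def mf_value_eq f_def[symmetric] g_def[symmetric] set_lebesgue_integral_def
      by (subst Bochner_Integration.integral_diff) (use fi gi in \<open>auto simp: set_integrable_def\<close>)
    also have "\<dots> \<le> (\<integral>t. B t \<partial>lborel)"
    proof (rule order_trans[OF integral_abs_bound], rule integral_mono[OF _ Bi])
      show "integrable lborel (\<lambda>t. \<bar>indicator {0..} t *\<^sub>R (f t * exp (- \<beta> * t)) - indicator {0..} t *\<^sub>R (g t * exp (- \<beta> * t))\<bar>)"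
        using fi gi unfolding set_integrable_def by (intro integrable_abs Bochner_Integration.integrable_diff)
      fix t :: real
      show "\<bar>indicator {0..} t *\<^sub>R (f t * exp (- \<beta> * t)) - indicator {0..} t *\<^sub>R (g t * exp (- \<beta> * t))\<bar> \<le> B t"
      proof (cases "0 \<le> t")
        case True
        have eq: "\<bar>indicator {0..} t *\<^sub>R (f t * exp (- \<beta> * t)) - indicator {0..} t *\<^sub>R (g t * exp (- \<beta> * t))\<bar> =
            \<bar>f t - g t\<bar> * exp (- \<beta> * t)"
          using True by (simp add: left_diff_distrib[symmetric] abs_mult)
        show ?thesis
        proof (cases "t \<le> real T")
          case le: True
          have "\<bar>f t - g t\<bar> \<le> \<epsilon>'"
            unfolding f_def g_def using N0[rule_format, OF _ n \<pi> conjI[OF \<mu> conjI[OF True le]]] N by simp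
          then have "\<bar>f t - g t\<bar> * exp (- \<beta> * t) \<le> \<epsilon>' * exp (- \<beta> * t)"
            by (intro mult_right_mono) auto
          moreover have "0 \<le> 2 * cost_max * exp (- (\<beta> / 2) * real T) * exp (- (\<beta> / 2) * t)"
            using cost_max(1) by simp
          ultimately have "\<bar>f t - g t\<bar> * exp (- \<beta> * t) \<le>
              \<epsilon>' * exp (- \<beta> * t) + 2 * cost_max * exp (- (\<beta> / 2) * real T) * exp (- (\<beta> / 2) * t)"
            by linarith
          then show ?thesis
            unfolding eq using True by (simp add: B_def)
        next
          case False
          have "exp (- \<beta> * t) \<le> exp (- (\<beta> / 2) * real T) * exp (- (\<beta> / 2) * t)"
            unfolding exp_add[symmetric] exp_le_cancel_iff
            using False \<beta>_pos mult_left_mono[of "real T" t "\<beta> / 2"] by (simp add: algebra_simps)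
          then have "\<bar>f t - g t\<bar> * exp (- \<beta> * t) \<le> 2 * cost_max * (exp (- (\<beta> / 2) * real T) * exp (- (\<beta> / 2) * t))"
            using fb[OF True] gb[OF True] by (intro mult_mono) auto
          moreover have "0 \<le> \<epsilon>' * exp (- \<beta> * t)"
            using \<epsilon>' by simp
          ultimately have "\<bar>f t - g t\<bar> * exp (- \<beta> * t) \<le>
              \<epsilon>' * exp (- \<beta> * t) + 2 * cost_max * exp (- (\<beta> / 2) * real T) * exp (- (\<beta> / 2) * t)"
            by (simp only: mult.assoc)
          then show ?thesis
            unfolding eq using True by (simp add: B_def)
        qed
      qed (simp add: B_def)
    qed
    also have "(\<integral>t. B t \<partial>lborel) = \<epsilon>' * J \<beta> + 2 * cost_max * exp (- (\<beta> / 2) * real T) * J (\<beta> / 2)"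
    proof -
      have i: "integrable lborel (\<lambda>t. w * (indicator {0..} t * exp (- b * t)))" if "0 < b" for w b :: real
        by (intro integrable_mult_right integrable_exp_discount that)
      have "0 < \<beta> / 2"
        using \<beta>_pos by simp
      show ?thesis
        unfolding B_def J_def Bochner_Integration.integral_add[OF i[OF \<beta>_pos] i[OF \<open>0 < \<beta> / 2\<close>]]
        by (simp only: integral_mult_right_zero)
    qed
    also have "\<dots> \<le> \<epsilon> / 2 + \<epsilon> / 2"
    proof (rule add_mono)
      have "\<epsilon>' * J \<beta> \<le> \<epsilon>' * (J \<beta> + 1)"
        using \<epsilon>' by (intro mult_left_mono) auto
      also have "\<dots> = \<epsilon> / 2"
      proof -
        have "\<epsilon> / (2 * j) * j = \<epsilon> / 2" if "0 < j" for j :: real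
          using that by simp
        then show ?thesis
          unfolding \<epsilon>'_def using J[of \<beta>] by (metis add_nonneg_pos zero_less_one)
      qed
      finally show "\<epsilon>' * J \<beta> \<le> \<epsilon> / 2" .
    qed (use T in simp)
    finally show "\<bar>nplayer_value G N n \<pi>' \<pi> - mf_value G \<pi>' \<pi>\<bar> \<le> \<epsilon>"
      by simp
  qed simp
qed

end

section \<open>Weak compactness\<close>

text \<open>
  Rational half-lines generate the Borel sets and are closed under intersection.
\<close>

definition rational_halflines :: "real set set" where
  "rational_halflines = insert UNIV (atMost ` \<rat>)"

lemma countable_rational_halflines: "countable rational_halflines"
  by (simp add: rational_halflines_def countable_rat)

lemma Int_stable_rational_halflines: "Int_stable rational_halflines"
  by (rule Int_stableI) (auto simp: rational_halflines_def Int_atMost min_def split: if_splits)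

lemma sigma_sets_rational_halflines: "sigma_sets UNIV rational_halflines = sets borel"
proof
  show "sigma_sets UNIV rational_halflines \<subseteq> sets borel"
    by (rule sets.sigma_sets_subset'[of _ borel, simplified]) (auto simp: rational_halflines_def)
  interpret sigma_algebra UNIV "sigma_sets UNIV rational_halflines"
    by (rule sigma_algebra_sigma_sets) auto
  have half: "{..x} \<in> sigma_sets UNIV rational_halflines" for x :: real
  proof -
    have "{..x} = (\<Inter>q\<in>{q \<in> \<rat>. x < q}. {..q})"
    proof (intro equalityI subsetI)
      fix y assume y: "y \<in> (\<Inter>q\<in>{q \<in> \<rat>. x < q}. {..q})"
      show "y \<in> {..x}"
      proof (rule ccontr)
        assume "y \<notin> {..x}"
        then obtain q where "q \<in> \<rat>" "x < q" "q < y"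
          using Rats_dense_in_real[of x y] by auto
        then show False
          using y by force
      qed
    qed auto
    moreover have "(\<Inter>q\<in>{q \<in> \<rat>. x < q}. {..q}) \<in> sigma_sets UNIV rational_halflines"
    proof (rule countable_INT')
      show "countable {q \<in> \<rat>. x < q}"
        using countable_rat by (rule countable_subset[rotated]) auto
      show "{q \<in> \<rat>. x < q} \<noteq> {}"
        using Rats_dense_in_real[of x "x + 1"] by auto
      show "atMost ` {q \<in> \<rat>. x < q} \<subseteq> sigma_sets UNIV rational_halflines"
        by (auto simp: rational_halflines_def)
    qed
    ultimately show ?thesis by simp
  qed
  have "sets (borel :: real measure) = sigma_sets UNIV (range atMost)"
    unfolding borel_eq_atMost by simp
  also have "\<dots> \<subseteq> sigma_sets UNIV rational_halflines"
    by (rule sigma_sets_mono) (use half in auto)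
  finally show "sets borel \<subseteq> sigma_sets UNIV rational_halflines" .
qed

text \<open>
  The measures with densities \<open>f\<^sub>n\<close> are all dominated by \<open>M\<close>. A diagonal subsequence converges on
  the generator; domination makes the class of sets of convergence a Dynkin system and the limit
  countably additive, and the limit has a density by Radon-Nikodym.
\<close>

lemma dominated_densities_subsequence:
  fixes M :: "real measure" and f :: "nat \<Rightarrow> 'k::finite \<Rightarrow> real \<Rightarrow> real"
  assumes "finite_measure M" and sets_M: "sets M = sets borel"
    and f: "\<And>n k. f n k \<in> borel_measurable borel" and f01: "\<And>n k x. 0 \<le> f n k x" "\<And>n k x. f n k x \<le> 1"
  shows "\<exists>r g. strict_mono (r :: nat \<Rightarrow> nat) \<and> (\<forall>k. g k \<in> borel_measurable borel \<and> (\<forall>x. 0 \<le> g k x) \<and>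
    integrable M (g k) \<and>
    (\<forall>A\<in>sets borel. (\<lambda>n. \<integral>x. indicator A x * f (r n) k x \<partial>M) \<longlonglongrightarrow> (\<integral>x. indicator A x * g k x \<partial>M)))"
proof -
  interpret finite_measure M by fact
  have space_M: "space M = UNIV"
    using sets_eq_imp_space_eq[OF sets_M] by simp
  have f_M: "f n k \<in> borel_measurable M" for n k
    using f measurable_cong_sets[OF sets_M refl] by blast
  define D where "D n k = density M (\<lambda>x. ennreal (f n k x))" for n k
  define a where "a n k A = measure (D n k) A" for n k A
  have ind_M: "indicator A \<in> borel_measurable M" if "A \<in> sets borel" for A :: "real set"
    using that sets_M by (intro borel_measurable_indicator) simp
  have int: "integrable M (\<lambda>x. indicator A x * f n k x)" if "A \<in> sets borel" for n k A
  proof (rule integrable_const_bound[of _ 1])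
    show "(\<lambda>x. indicator A x * f n k x) \<in> borel_measurable M"
      by (intro borel_measurable_times f_M ind_M that)
  qed (use f01 in \<open>auto simp: abs_mult indicator_def\<close>)
  have emeasure_D: "emeasure (D n k) A = ennreal (\<integral>x. indicator A x * f n k x \<partial>M)" if "A \<in> sets borel" for n k A
  proof -
    have "emeasure (D n k) A = (\<integral>\<^sup>+x. ennreal (f n k x) * indicator A x \<partial>M)"
      unfolding D_def using that f_M by (intro emeasure_density) (auto simp: sets_M)
    also have "\<dots> = (\<integral>\<^sup>+x. ennreal (indicator A x * f n k x) \<partial>M)"
      by (intro nn_integral_cong) (auto simp: indicator_def)
    also have "\<dots> = ennreal (\<integral>x. indicator A x * f n k x \<partial>M)"
      using f01 by (intro nn_integral_eq_integral int that) auto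
    finally show ?thesis .
  qed
  have a_eq: "a n k A = (\<integral>x. indicator A x * f n k x \<partial>M)" if "A \<in> sets borel" for n k A
    unfolding a_def measure_def emeasure_D[OF that] using f01 by (intro enn2real_ennreal integral_nonneg_AE) auto
  have sets_D: "sets (D n k) = sets borel" for n k
    by (simp add: D_def sets_M)
  have fin_D: "finite_measure (D n k)" for n k
    using emeasure_D[of UNIV n k] sets_eq_imp_space_eq[OF sets_D] by (intro finite_measureI) auto
  have a_nonneg: "0 \<le> a n k A" for n k A
    by (simp add: a_def)
  have a_le: "a n k A \<le> measure M A" if A: "A \<in> sets borel" for n k A
  proof -
    have "a n k A \<le> (\<integral>x. indicator A x \<partial>M)"
      unfolding a_eq[OF A]
    proof (rule integral_mono[OF int[OF A]])
      show "integrable M (indicator A :: real \<Rightarrow> real)"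
        using A by (intro integrable_real_indicator) (auto simp: sets_M less_top[symmetric])
    qed (use f01 in \<open>auto simp: indicator_def\<close>)
    then show ?thesis
      using A by (simp add: sets_M space_M)
  qed
  have bnd: "norm (a n (fst p) (snd p)) \<le> measure M (space M)" if "p \<in> UNIV \<times> rational_halflines" for n p
  proof -
    have "snd p \<in> sets borel"
      using that by (auto simp: rational_halflines_def)
    then show ?thesis
      using a_nonneg[of n "fst p" "snd p"] a_le[of "snd p" n "fst p"] bounded_measure[of "snd p"] by simp
  qed
  have cnt: "countable ((UNIV :: 'k set) \<times> rational_halflines)"
    by (intro countable_SIGMA countable_rational_halflines) (simp add: countable_finite)
  obtain r where r: "strict_mono (r :: nat \<Rightarrow> nat)"
    and conv0: "\<And>p. p \<in> UNIV \<times> rational_halflines \<Longrightarrow> \<exists>l. (\<lambda>n. a (r n) (fst p) (snd p)) \<longlonglongrightarrow> l"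
    using function_convergent_subsequence[of "UNIV \<times> rational_halflines" "\<lambda>n p. a n (fst p) (snd p)" "measure M (space M)", OF cnt bnd]
    by blast
  have a_UN: "a n k (\<Union>i. A i) = (\<Sum>i. a n k (A i))"
    if "range A \<subseteq> sets borel" "disjoint_family A" for n k and A :: "nat \<Rightarrow> real set"
    unfolding a_def using finite_measure.finite_measure_UNION[OF fin_D, of A n k] that
    by (simp add: sets_D sums_iff)
  have M_sum: "summable (\<lambda>i. measure M (A i))" if "range A \<subseteq> sets borel" "disjoint_family A" for A :: "nat \<Rightarrow> real set"
    using finite_measure_UNION[of A] that by (simp add: sets_M sums_iff)
  have tannery: "summable b \<and> (\<lambda>n. a (r n) k (\<Union>i. A i)) \<longlonglongrightarrow> (\<Sum>i. b i)"
    if A: "range A \<subseteq> sets borel" "disjoint_family A" and b: "\<And>i. (\<lambda>n. a (r n) k (A i)) \<longlonglongrightarrow> b i"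
    for k b and A :: "nat \<Rightarrow> real set"
  proof -
    have "\<forall>\<^sub>F p in at_top \<times>\<^sub>F sequentially. norm (a (r (snd p)) k (A (fst p))) \<le> measure M (A (fst p))"
      using a_nonneg a_le A(1) by (intro always_eventually allI) auto
    then have "\<forall>\<^sub>F (i, n) in at_top \<times>\<^sub>F sequentially. norm (a (r n) k (A i)) \<le> measure M (A i)"
      by (simp add: split_beta')
    from tannerys_theorem[of "\<lambda>i n. a (r n) k (A i)" b sequentially, OF b this M_sum[OF A]]
    have "summable (\<lambda>i. norm (b i))" "(\<lambda>n. \<Sum>i. a (r n) k (A i)) \<longlonglongrightarrow> (\<Sum>i. b i)"
      by auto
    then show ?thesis
      unfolding a_UN[OF A] by (auto intro: summable_norm_cancel)
  qed
  have conv: "convergent (\<lambda>n. a (r n) k A)" if "A \<in> sets borel" for k A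
  proof -
    have "A \<in> sigma_sets UNIV rational_halflines"
      using that by (simp add: sigma_sets_rational_halflines)
    with Int_stable_rational_halflines subset_UNIV[of rational_halflines, folded Pow_UNIV]
    have "\<forall>k. convergent (\<lambda>n. a (r n) k A)"
    proof (induction rule: sigma_sets_induct_disjoint)
      case (basic A)
      then show ?case
        using conv0 by (force simp: convergent_def)
    next
      case empty
      then show ?case by (simp add: a_def convergent_const)
    next
      case (compl A)
      have "a n k (UNIV - A) = a n k UNIV - a n k A" for n k
        unfolding a_def using compl finite_measure.finite_measure_compl[OF fin_D, of A n k]
        by (simp add: sets_D sigma_sets_rational_halflines sets_eq_imp_space_eq[OF sets_D])
      moreover have "convergent (\<lambda>n. a (r n) k UNIV)" for k
        using conv0[of "(k, UNIV)"] by (auto simp: convergent_def rational_halflines_def)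
      ultimately show ?case
        using compl by (auto intro: convergent_diff)
    next
      case (union A)
      show ?case
      proof
        fix k
        have "\<And>i. \<exists>l. (\<lambda>n. a (r n) k (A i)) \<longlonglongrightarrow> l"
          using union.IH by (auto simp: convergent_def)
        then obtain b where "\<And>i. (\<lambda>n. a (r n) k (A i)) \<longlonglongrightarrow> b i"
          by metis
        then show "convergent (\<lambda>n. a (r n) k (\<Union>i. A i))"
          using tannery[of A k b] union.hyps unfolding sigma_sets_rational_halflines by (auto simp: convergent_def)
      qed
    qed
    then show ?thesis by blast
  qed
  define l where "l k A = lim (\<lambda>n. a (r n) k A)" for k A
  have l: "(\<lambda>n. a (r n) k A) \<longlonglongrightarrow> l k A" if "A \<in> sets borel" for k A
    using conv[OF that] by (simp add: l_def convergent_LIMSEQ_iff)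
  have l_nonneg: "0 \<le> l k A" if "A \<in> sets borel" for k A
    by (rule LIMSEQ_le_const[OF l[OF that]]) (use a_nonneg in auto)
  have l_le: "l k A \<le> measure M A" if "A \<in> sets borel" for k A
    by (rule LIMSEQ_le_const2[OF l[OF that]]) (use a_le that in auto)
  have l_UN: "summable (\<lambda>i. l k (A i)) \<and> l k (\<Union>i. A i) = (\<Sum>i. l k (A i))"
    if A: "range A \<subseteq> sets borel" "disjoint_family A" for k and A :: "nat \<Rightarrow> real set"
  proof -
    have "\<And>i. (\<lambda>n. a (r n) k (A i)) \<longlonglongrightarrow> l k (A i)"
      using A by (intro l) auto
    from tannery[OF A this] have "summable (\<lambda>i. l k (A i))" "(\<lambda>n. a (r n) k (\<Union>i. A i)) \<longlonglongrightarrow> (\<Sum>i. l k (A i))"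
      by auto
    moreover have "(\<lambda>n. a (r n) k (\<Union>i. A i)) \<longlonglongrightarrow> l k (\<Union>i. A i)"
      using A by (intro l sets.countable_UN) auto
    ultimately show ?thesis
      using LIMSEQ_unique by blast
  qed
  define Lm where "Lm k = measure_of UNIV (sets borel) (\<lambda>A. ennreal (l k A))" for k
  have emeasure_Lm: "emeasure (Lm k) A = ennreal (l k A)" if "A \<in> sets borel" for k A
    unfolding Lm_def
  proof (rule emeasure_measure_of_sigma[OF _ _ _ that])
    show "sigma_algebra UNIV (sets (borel :: real measure))"
      using sets.sigma_algebra_axioms[of "borel :: real measure"] by simp
    show "positive (sets borel) (\<lambda>A. ennreal (l k A))"
      by (simp add: positive_def l_def a_def)
    show "countably_additive (sets borel) (\<lambda>A. ennreal (l k A))"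
    proof (rule countably_additiveI)
      fix A :: "nat \<Rightarrow> real set" assume A: "range A \<subseteq> sets borel" "disjoint_family A"
      have "(\<Sum>i. ennreal (l k (A i))) = ennreal (\<Sum>i. l k (A i))"
        using A l_UN[OF A] by (intro suminf_ennreal2 l_nonneg) auto
      then show "(\<Sum>i. ennreal (l k (A i))) = ennreal (l k (\<Union>i. A i))"
        using l_UN[OF A] by simp
    qed
  qed
  have sets_Lm: "sets (Lm k) = sets borel" for k
    unfolding Lm_def by (simp add: sets.sigma_sets_eq[of "borel :: real measure", simplified])
  have "\<exists>h. h \<in> borel_measurable M \<and> density M h = Lm k" for k
  proof -
    have "absolutely_continuous M (Lm k)"
      unfolding absolutely_continuous_def
    proof
      fix A assume A: "A \<in> null_sets M"
      then have "A \<in> sets borel" "measure M A = 0"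
        by (auto simp: null_sets_def sets_M measure_def)
      then show "A \<in> null_sets (Lm k)"
        using l_le[of A k] l_nonneg[of A k] by (auto simp: null_sets_def sets_Lm emeasure_Lm)
    qed
    from Radon_Nikodym[OF this] show ?thesis
      by (auto simp: sets_Lm sets_M)
  qed
  then obtain h where h: "\<And>k. h k \<in> borel_measurable M" "\<And>k. density M (h k) = Lm k"
    by metis
  define g where "g k x = enn2real (h k x)" for k x
  have h_int: "(\<integral>\<^sup>+x. h k x * indicator A x \<partial>M) = ennreal (l k A)" if "A \<in> sets borel" for k A
    using emeasure_density[OF h(1), of A k] that by (simp add: h(2) emeasure_Lm sets_M)
  have h_fin: "AE x in M. ennreal (g k x) = h k x" for k
  proof -
    have "(\<integral>\<^sup>+x. h k x \<partial>M) \<noteq> \<infinity>"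
      using h_int[of UNIV k] by simp
    then have "AE x in M. h k x \<noteq> \<infinity>"
      by (intro nn_integral_PInf_AE h)
    then show ?thesis
      by (rule AE_mp) (auto simp: g_def less_top intro!: AE_I2)
  qed
  have g_M: "g k \<in> borel_measurable M" for k
    unfolding g_def using h(1)[of k] by measurable
  have g_nn: "(\<integral>\<^sup>+x. ennreal (indicator A x * g k x) \<partial>M) = ennreal (l k A)" if "A \<in> sets borel" for k A
  proof -
    have "(\<integral>\<^sup>+x. ennreal (indicator A x * g k x) \<partial>M) = (\<integral>\<^sup>+x. h k x * indicator A x \<partial>M)"
      by (rule nn_integral_cong_AE, rule AE_mp[OF h_fin[of k]]) (auto intro!: AE_I2 simp: indicator_def)
    then show ?thesis
      by (simp add: h_int[OF that])
  qed
  have g_nonneg: "0 \<le> g k x" for k x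
    by (simp add: g_def)
  have "g k \<in> borel_measurable borel \<and> (\<forall>x. 0 \<le> g k x) \<and> integrable M (g k) \<and>
    (\<forall>A\<in>sets borel. (\<lambda>n. \<integral>x. indicator A x * f (r n) k x \<partial>M) \<longlonglongrightarrow> (\<integral>x. indicator A x * g k x \<partial>M))" for k
  proof (intro conjI allI ballI)
    show "g k \<in> borel_measurable borel"
      using g_M measurable_cong_sets[OF sets_M refl] by blast
    show "integrable M (g k)"
      using g_M g_nn[of UNIV k] g_nonneg by (intro integrableI_nonneg) auto
    fix A :: "real set" assume A: "A \<in> sets borel"
    have "(\<integral>x. indicator A x * g k x \<partial>M) = enn2real (\<integral>\<^sup>+x. ennreal (indicator A x * g k x) \<partial>M)"
      using g_nonneg by (intro integral_eq_nn_integral borel_measurable_times g_M ind_M A) auto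
    also have "\<dots> = l k A"
      using l_nonneg[OF A] by (simp add: g_nn[OF A])
    finally show "(\<lambda>n. \<integral>x. indicator A x * f (r n) k x \<partial>M) \<longlonglongrightarrow> (\<integral>x. indicator A x * g k x \<partial>M)"
      using l[OF A, of k] by (simp add: a_eq[OF A])
  qed (rule g_nonneg)
  with r show ?thesis by blast
qed

text \<open>
  Bounded functions are uniform limits of functions with finitely many values, which reduces
  convergence of integrals to convergence on sets.
\<close>

lemma weak_limit_bounded_function:
  fixes M :: "real measure" and f :: "nat \<Rightarrow> real \<Rightarrow> real"
  assumes "finite_measure M" and sets_M: "sets M = sets borel"
    and f: "\<And>n. f n \<in> borel_measurable borel" and f01: "\<And>n x. 0 \<le> f n x" "\<And>n x. f n x \<le> 1"
    and g: "integrable M g" "\<And>x. 0 \<le> g x"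
    and lim: "\<And>A. A \<in> sets borel \<Longrightarrow> (\<lambda>n. \<integral>x. indicator A x * f n x \<partial>M) \<longlonglongrightarrow> (\<integral>x. indicator A x * g x \<partial>M)"
    and G: "G \<in> borel_measurable borel" and B: "\<And>x. \<bar>G x\<bar> \<le> B"
  shows "(\<lambda>n. \<integral>x. G x * f n x \<partial>M) \<longlonglongrightarrow> (\<integral>x. G x * g x \<partial>M)"
proof -
  interpret finite_measure M by fact
  have bM: "h \<in> borel_measurable M" if "h \<in> borel_measurable borel" for h :: "real \<Rightarrow> real"
    using that measurable_cong_sets[OF sets_M refl] by blast
  have fi: "integrable M (f n)" for n
    by (rule integrable_const_bound[of _ 1]) (use f01 bM[OF f] in auto)
  (* bounds the total mass of all the densities, including the limit *)
  define c where "c = measure M (space M) + (\<integral>x. g x \<partial>M) + 1"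
  have c: "0 < c"
    using g by (simp add: c_def add_nonneg_pos integral_nonneg_AE)
  have f_le: "(\<integral>x. f n x \<partial>M) \<le> measure M (space M)" for n
    using integral_mono[OF fi[of n], of "\<lambda>_. 1"] f01 by simp
  have mult_int: "integrable M (\<lambda>x. H x * w x)"
    if "integrable M w" "H \<in> borel_measurable borel" "\<And>x. \<bar>H x\<bar> \<le> K" for H w :: "real \<Rightarrow> real" and K
  proof (rule Bochner_Integration.integrable_bound[OF integrable_mult_right[OF that(1), of K]])
    show "(\<lambda>x. H x * w x) \<in> borel_measurable M"
      by (intro borel_measurable_times bM that borel_measurable_integrable)
    have "\<bar>H x\<bar> * \<bar>w x\<bar> \<le> \<bar>K\<bar> * \<bar>w x\<bar>" for x
      using that(3)[of x] by (intro mult_right_mono) auto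
    then show "AE x in M. norm (H x * w x) \<le> norm (K * w x)"
      by (simp add: abs_mult)
  qed
  show ?thesis
  proof (rule LIMSEQ_I)
    fix e :: real assume e: "0 < e"
    obtain k :: nat where k: "2 * c / e < real k"
      using reals_Archimedean2 by blast
    have k0: "0 < real k"
      using k c e by (meson divide_pos_pos less_trans mult_pos_pos zero_less_numeral)
    (* the function G, rounded down to multiples of 1/k, takes its values in the range -J/k, ..., J/k *)
    define J :: int where "J = \<lceil>B * k\<rceil> + 1"
    define A where "A j = {x. \<lfloor>G x * k\<rfloor> = j}" for j :: int
    define H where "H x = real_of_int \<lfloor>G x * k\<rfloor> / k" for x
    have A: "A j \<in> sets borel" for j
    proof -
      have "Measurable.pred borel (\<lambda>x. \<lfloor>G x * k\<rfloor> = j)"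
        using G by measurable
      then show ?thesis
        by (simp add: A_def pred_def)
    qed
    have H_sum: "H x = (\<Sum>j\<in>{-J..J}. real_of_int j / k * indicator (A j) x)" for x
    proof -
      have "\<lfloor>G x * k\<rfloor> \<in> {-J..J}"
      proof -
        have "\<bar>G x * k\<bar> \<le> B * k"
          using B[of x] k0 by (simp add: abs_mult mult_right_mono)
        then show ?thesis
          unfolding J_def by (simp add: abs_le_iff) linarith
      qed
      then have "H x = (\<Sum>j\<in>{-J..J}. if j = \<lfloor>G x * k\<rfloor> then real_of_int j / k else 0)"
        by (simp add: H_def)
      also have "\<dots> = (\<Sum>j\<in>{-J..J}. real_of_int j / k * indicator (A j) x)"
        by (intro sum.cong) (auto simp: A_def)
      finally show ?thesis .
    qed
    have H_close: "\<bar>G x - H x\<bar> \<le> 1 / k" for x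
    proof -
      have "\<bar>G x * k - real_of_int \<lfloor>G x * k\<rfloor>\<bar> \<le> 1"
        by linarith
      moreover have "G x - H x = (G x * k - real_of_int \<lfloor>G x * k\<rfloor>) / k"
        using k0 by (simp add: H_def field_simps)
      ultimately show ?thesis
        using k0 by (simp add: abs_divide divide_right_mono)
    qed
    have H_borel: "H \<in> borel_measurable borel"
      unfolding H_def using G by measurable
    have H_bound: "\<bar>H x\<bar> \<le> B + 1 / k" for x
      using H_close[of x] B[of x] by linarith
    have int_ind: "integrable M (\<lambda>x. indicator (A j) x * w x)" if "integrable M w" for j and w :: "real \<Rightarrow> real"
      using that A by (intro mult_int[of _ _ 1]) (auto simp: indicator_def)
    have H_int: "(\<integral>x. H x * w x \<partial>M) = (\<Sum>j\<in>{-J..J}. real_of_int j / k * (\<integral>x. indicator (A j) x * w x \<partial>M))"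
      if "integrable M w" for w
    proof -
      have "(\<integral>x. H x * w x \<partial>M) = (\<integral>x. (\<Sum>j\<in>{-J..J}. real_of_int j / k * (indicator (A j) x * w x)) \<partial>M)"
        unfolding H_sum sum_distrib_right mult.assoc ..
      also have "\<dots> = (\<Sum>j\<in>{-J..J}. \<integral>x. real_of_int j / k * (indicator (A j) x * w x) \<partial>M)"
        by (intro Bochner_Integration.integral_sum integrable_mult_right int_ind that)
      finally show ?thesis
        by (simp only: integral_mult_right_zero)
    qed
    have "(\<lambda>n. \<integral>x. H x * f n x \<partial>M) \<longlonglongrightarrow> (\<integral>x. H x * g x \<partial>M)"
      unfolding H_int[OF fi] H_int[OF g(1)] by (intro tendsto_intros lim A)
    from LIMSEQ_D[OF this half_gt_zero[OF e]]
    obtain n0 where n0: "\<forall>n\<ge>n0. norm ((\<integral>x. H x * f n x \<partial>M) - (\<integral>x. H x * g x \<partial>M)) < e / 2" ..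
    have close: "\<bar>(\<integral>x. G x * w x \<partial>M) - (\<integral>x. H x * w x \<partial>M)\<bar> \<le> 1 / k * (\<integral>x. w x \<partial>M)"
      if w: "integrable M w" "\<And>x. 0 \<le> w x" for w
    proof -
      have "(\<integral>x. G x * w x \<partial>M) - (\<integral>x. H x * w x \<partial>M) = (\<integral>x. G x * w x - H x * w x \<partial>M)"
        by (intro Bochner_Integration.integral_diff[symmetric] mult_int[OF w(1) G B] mult_int[OF w(1) H_borel H_bound])
      also have "\<bar>\<dots>\<bar> \<le> (\<integral>x. 1 / k * w x \<partial>M)"
      proof (rule order_trans[OF integral_abs_bound integral_mono])
        show "integrable M (\<lambda>x. \<bar>G x * w x - H x * w x\<bar>)"
          by (intro integrable_abs Bochner_Integration.integrable_diff mult_int[OF w(1) G B] mult_int[OF w(1) H_borel H_bound])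
        show "\<bar>G x * w x - H x * w x\<bar> \<le> 1 / k * w x" for x
          using mult_right_mono[OF H_close[of x] w(2)[of x]] w(2)[of x]
          by (simp add: left_diff_distrib[symmetric] abs_mult)
      qed (use w in simp)
      finally show ?thesis by simp
    qed
    show "\<exists>n0. \<forall>n\<ge>n0. norm ((\<integral>x. G x * f n x \<partial>M) - (\<integral>x. G x * g x \<partial>M)) < e"
    proof (intro exI[of _ n0] allI impI)
      fix n assume n: "n0 \<le> n"
      have "1 / k * (\<integral>x. f n x \<partial>M) + 1 / k * (\<integral>x. g x \<partial>M) \<le> c / k"
        using f_le[of n] k0 unfolding c_def by (simp add: add_divide_distrib[symmetric] divide_right_mono)
      also have "\<dots> < e / 2"
        using k k0 e by (simp add: field_simps)
      finally have "1 / k * (\<integral>x. f n x \<partial>M) + 1 / k * (\<integral>x. g x \<partial>M) < e / 2" .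
      then show "norm ((\<integral>x. G x * f n x \<partial>M) - (\<integral>x. G x * g x \<partial>M)) < e"
        using close[OF fi[of n] f01(1)] close[OF g] n0[rule_format, OF n] unfolding real_norm_def by linarith
    qed
  qed
qed

context lipschitz_mfg
begin

text \<open>
  Weak convergence of strategies is convergence of their integrals with respect to this finite
  measure.
\<close>

definition discount_measure :: "real measure" where
  "discount_measure = density lborel (\<lambda>t. ennreal (indicator {0..} t * exp (- \<beta> * t)))"

lemma sets_discount_measure: "sets discount_measure = sets borel"
  by (simp add: discount_measure_def)

lemma finite_discount_measure: "finite_measure discount_measure"
proof
  have "emeasure discount_measure (space discount_measure) =
      (\<integral>\<^sup>+t. ennreal (indicator {0..} t * exp (- \<beta> * t)) \<partial>lborel)"
    unfolding discount_measure_def by (subst emeasure_density) auto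
  also have "\<dots> = ennreal (\<integral>t. indicator {0..} t * exp (- \<beta> * t) \<partial>lborel)"
    by (intro nn_integral_eq_integral integrable_exp_discount \<beta>_pos) auto
  finally show "emeasure discount_measure (space discount_measure) \<noteq> \<infinity>"
    by simp
qed

lemma integral_discount_measure:
  assumes "F \<in> borel_measurable borel"
  shows "(\<integral>t. F t \<partial>discount_measure) = (LINT t:{0..}|lborel. F t * exp (- \<beta> * t))"
  unfolding discount_measure_def set_lebesgue_integral_def using assms
  by (subst integral_real_density) (auto simp: mult_ac intro!: Bochner_Integration.integral_cong)

lemma AE_discount_measure_nonneg: "AE t in discount_measure. 0 \<le> t"
  unfolding discount_measure_def by (subst AE_density) (auto simp: indicator_def)

text \<open>
  The limit densities are nonnegative, and for each state they sum to one almost everywhere, because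
  this holds along the sequence on every set. On the exceptional null set the limit strategy plays a
  fixed action.
\<close>

lemma strategies_weakly_compact:
  fixes \<pi>s :: "nat \<Rightarrow> ('e, 'a) strategy"
  assumes \<pi>s: "\<And>n. \<pi>s n \<in> strategies"
  shows "\<exists>r \<pi>. strict_mono (r :: nat \<Rightarrow> nat) \<and> \<pi> \<in> strategies \<and> weakly_converges \<beta> (\<pi>s \<circ> r) \<pi>"
proof -
  let ?M = discount_measure
  interpret M: finite_measure ?M
    by (rule finite_discount_measure)
  have bM: "h \<in> borel_measurable ?M" if "h \<in> borel_measurable borel" for h :: "real \<Rightarrow> real"
    using that measurable_cong_sets[OF sets_discount_measure refl] by blast
  define f where "f n p t = indicator {0..} t * (\<pi>s n (fst p) t $ snd p)" for n :: nat and p :: "'e \<times> 'a" and t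
  have f: "f n p \<in> borel_measurable borel" for n p
    unfolding f_def[abs_def] by (intro borel_measurable_indicator_times strategy_measurable \<pi>s)
  have f01: "0 \<le> f n p t" "f n p t \<le> 1" for n p t
    using strategy_bounds(1,2)[OF \<pi>s[of n], of t "fst p" "snd p"] by (auto simp: f_def indicator_def)
  obtain r g where r: "strict_mono (r :: nat \<Rightarrow> nat)" and g: "\<And>p. g p \<in> borel_measurable borel"
    "\<And>p t. 0 \<le> (g p t :: real)" "\<And>p. integrable ?M (g p)"
    "\<And>p A. A \<in> sets borel \<Longrightarrow> (\<lambda>n. \<integral>t. indicator A t * f (r n) p t \<partial>?M) \<longlonglongrightarrow> (\<integral>t. indicator A t * g p t \<partial>?M)"
    using dominated_densities_subsequence[of ?M f, OF finite_discount_measure sets_discount_measure f f01] by blast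
  have sum_g: "AE t in ?M. (\<Sum>a\<in>UNIV. g (i, a) t) = 1" for i
  proof (rule density_unique_real)
    show "integrable ?M (\<lambda>t. \<Sum>a\<in>UNIV. g (i, a) t)"
      by (intro Bochner_Integration.integrable_sum g)
    fix A assume "A \<in> sets ?M"
    then have A: "A \<in> sets borel"
      by (simp add: sets_discount_measure)
    have ind: "integrable ?M (\<lambda>t. indicator A t * h t)" if "integrable ?M h" for h :: "real \<Rightarrow> real"
      using integrable_mult_indicator[OF \<open>A \<in> sets ?M\<close> that] by simp
    have fi: "integrable ?M (f n p)" for n p
      by (rule M.integrable_const_bound[of _ 1]) (use f01 bM[OF f] in auto)
    have "(\<lambda>n. \<Sum>a\<in>UNIV. \<integral>t. indicator A t * f (r n) (i, a) t \<partial>?M) \<longlonglongrightarrow> (\<Sum>a\<in>UNIV. \<integral>t. indicator A t * g (i, a) t \<partial>?M)"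
      by (intro tendsto_sum g A)
    moreover have "(\<Sum>a\<in>UNIV. \<integral>t. indicator A t * f (r n) (i, a) t \<partial>?M) = (\<integral>t. indicator A t * 1 \<partial>?M)" for n
    proof -
      have "(\<Sum>a\<in>UNIV. \<integral>t. indicator A t * f (r n) (i, a) t \<partial>?M) =
          (\<integral>t. (\<Sum>a\<in>UNIV. indicator A t * f (r n) (i, a) t) \<partial>?M)"
        by (intro Bochner_Integration.integral_sum[symmetric] ind fi)
      also have "\<dots> = (\<integral>t. indicator A t * 1 \<partial>?M)"
      proof (rule integral_cong_AE)
        show "AE t in ?M. (\<Sum>a\<in>UNIV. indicator A t * f (r n) (i, a) t) = indicator A t * 1"
          by (rule AE_mp[OF AE_discount_measure_nonneg])
            (auto intro!: AE_I2 simp: f_def sum_distrib_left[symmetric] strategy_bounds[OF \<pi>s])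
      qed (use A f in \<open>auto intro!: bM\<close>)
      finally show ?thesis .
    qed
    ultimately have "(\<Sum>a\<in>UNIV. \<integral>t. indicator A t * g (i, a) t \<partial>?M) = (\<integral>t. indicator A t * 1 \<partial>?M)"
      by (simp add: LIMSEQ_const_iff)
    moreover have "(\<Sum>a\<in>UNIV. \<integral>t. indicator A t * g (i, a) t \<partial>?M) = (\<integral>t. indicator A t * (\<Sum>a\<in>UNIV. g (i, a) t) \<partial>?M)"
      unfolding sum_distrib_left by (intro Bochner_Integration.integral_sum[symmetric] ind g)
    ultimately show "(LINT t:A|?M. \<Sum>a\<in>UNIV. g (i, a) t) = (LINT t:A|?M. 1)"
      by (simp add: set_lebesgue_integral_def)
  qed simp
  define a0 where "a0 = (SOME a :: 'a. True)"
  define \<pi> where "\<pi> i t = (\<chi> a. if (\<Sum>a\<in>UNIV. g (i, a) t) = 1 then g (i, a) t else of_bool (a = a0))" for i t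
  have \<pi>_borel: "(\<lambda>t. \<pi> i t $ a) \<in> borel_measurable borel" for i a
    unfolding \<pi>_def using g(1) by simp
  have \<pi>_strategy: "\<pi> \<in> strategies"
    unfolding strategies_def
  proof (intro CollectI allI conjI impI)
    show "\<pi> i \<in> borel_measurable (restrict_space borel {0..})" for i
      by (intro measurable_restrict_space1 borel_measurable_vecI \<pi>_borel)
    show "\<pi> i t \<in> prob_simplex" for i t
    proof (cases "(\<Sum>a\<in>UNIV. g (i, a) t) = 1")
      case True
      then show ?thesis
        using g(2) by (simp add: \<pi>_def prob_simplex_def)
    next
      case False
      have "(\<Sum>a\<in>UNIV. of_bool (a = a0) :: real) = (\<Sum>a\<in>UNIV. if a = a0 then 1 else 0)"
        by (intro sum.cong) auto
      then show ?thesis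
        using False by (simp add: \<pi>_def prob_simplex_def)
    qed
  qed
  have \<pi>_g: "AE t in ?M. \<pi> i t $ a = g (i, a) t" for i a
    by (rule AE_mp[OF sum_g[of i]]) (auto intro!: AE_I2 simp: \<pi>_def)
  have "weakly_converges \<beta> (\<pi>s \<circ> r) \<pi>"
    unfolding weakly_converges_def
  proof (intro allI impI, elim conjE)
    fix i a and H :: "real \<Rightarrow> real"
    assume H: "H \<in> borel_measurable (restrict_space borel {0..})" and bH: "bounded (H ` {0..})"
    define H' where "H' t = indicator {0..} t * H t" for t
    obtain B where B: "\<And>t. 0 \<le> t \<Longrightarrow> \<bar>H t\<bar> \<le> B"
      using bH by (auto simp: bounded_iff)
    have H'_borel: "H' \<in> borel_measurable borel"
      unfolding H'_def[abs_def] by (rule borel_measurable_indicator_times[OF H])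
    have H'_bound: "\<bar>H' t\<bar> \<le> B" for t
      using B[of t] B[of 0] by (auto simp: H'_def indicator_def)
    have "(\<lambda>n. \<integral>t. H' t * f (r n) (i, a) t \<partial>?M) \<longlonglongrightarrow> (\<integral>t. H' t * g (i, a) t \<partial>?M)"
      by (rule weak_limit_bounded_function[OF finite_discount_measure sets_discount_measure f f01 g(3,2,4) H'_borel H'_bound])
    moreover have "(\<integral>t. H' t * g (i, a) t \<partial>?M) = (\<integral>t. H' t * \<pi> i t $ a \<partial>?M)"
    proof (rule integral_cong_AE)
      show "AE t in ?M. H' t * g (i, a) t = H' t * \<pi> i t $ a"
        by (rule AE_mp[OF \<pi>_g[of i a]]) (auto intro!: AE_I2)
    qed (use g(1) \<pi>_borel H'_borel in \<open>auto intro!: bM\<close>)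
    moreover have "(\<integral>t. H' t * \<pi> i t $ a \<partial>?M) = (LINT t:{0..}|lborel. \<pi> i t $ a * H t * exp (- \<beta> * t))"
      unfolding integral_discount_measure[OF borel_measurable_times[OF H'_borel \<pi>_borel]]
      by (auto simp: set_lebesgue_integral_def H'_def intro!: Bochner_Integration.integral_cong split: split_indicator)
    moreover have "(\<integral>t. H' t * f (r n) (i, a) t \<partial>?M) =
        (LINT t:{0..}|lborel. (\<pi>s \<circ> r) n i t $ a * H t * exp (- \<beta> * t))" for n
      unfolding integral_discount_measure[OF borel_measurable_times[OF H'_borel f]]
      by (auto simp: set_lebesgue_integral_def H'_def f_def intro!: Bochner_Integration.integral_cong split: split_indicator)
    ultimately show "(\<lambda>n. LINT t:{0..}|lborel. (\<pi>s \<circ> r) n i t $ a * H t * exp (- \<beta> * t)) \<longlonglongrightarrow>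
        (LINT t:{0..}|lborel. \<pi> i t $ a * H t * exp (- \<beta> * t))"
      by simp
  qed
  with r \<pi>_strategy show ?thesis by blast
qed

end

section \<open>Continuity under weak convergence\<close>

lemma l1_dist_tendsto:
  fixes m :: "real ^ 'n::finite"
  assumes "(\<lambda>n. l1_dist (ms n) m) \<longlonglongrightarrow> 0"
  shows "ms \<longlonglongrightarrow> m"
proof -
  have "(\<lambda>n. dist (ms n) m) \<longlonglongrightarrow> 0"
    by (rule Lim_null_comparison[OF _ assms]) (simp add: dist_le_l1_dist)
  then show ?thesis
    by (simp add: tendsto_dist_iff[symmetric])
qed

context lipschitz_mfg
begin

text \<open>
  On a bounded interval the discount factor can be undone by a bounded test function.
\<close>

lemma weak_integral_limit:
  assumes weak: "weakly_converges \<beta> \<pi>s \<pi>" and \<pi>s: "\<And>n. \<pi>s n \<in> strategies" and \<pi>: "\<pi> \<in> strategies"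
    and w: "bounded_borel_on {0..T} w"
  shows "(\<lambda>n. integral {0..T} (\<lambda>s. w s * \<pi>s n i s $ a)) \<longlonglongrightarrow> integral {0..T} (\<lambda>s. w s * \<pi> i s $ a)"
proof -
  define H where "H t = indicator {0..T} t * (w t * exp (\<beta> * t))" for t
  have we: "bounded_borel_on {0..T} (\<lambda>t. w t * exp (\<beta> * t))"
    by (rule bounded_borel_on_mult[OF w bounded_borel_on_continuous]) (auto intro!: continuous_intros)
  have "(\<lambda>t. indicator {0..T} t *\<^sub>R (w t * exp (\<beta> * t))) \<in> borel_measurable borel"
    using bounded_borel_on_measurable[OF we]
      borel_measurable_restrict_space_iff[of "{0..T}" borel "\<lambda>t. w t * exp (\<beta> * t)"] by simp
  then have "H \<in> borel_measurable (restrict_space borel {0..})"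
    unfolding H_def[abs_def] by (intro measurable_restrict_space1) simp
  moreover have "bounded (H ` {0..})"
  proof -
    obtain K where K: "0 \<le> K" "\<And>t. t \<in> {0..T} \<Longrightarrow> \<bar>w t * exp (\<beta> * t)\<bar> \<le> K"
      by (rule bounded_borel_on_bound[OF we]) blast
    then have "\<bar>H t\<bar> \<le> K" for t
      by (cases "t \<in> {0..T}") (auto simp: H_def)
    then show ?thesis
      by (auto simp: bounded_iff)
  qed
  ultimately have "(\<lambda>n. LINT t:{0..}|lborel. \<pi>s n i t $ a * H t * exp (- \<beta> * t)) \<longlonglongrightarrow>
      (LINT t:{0..}|lborel. \<pi> i t $ a * H t * exp (- \<beta> * t))"
    using weak unfolding weakly_converges_def by blast
  moreover have "(LINT t:{0..}|lborel. \<tau> i t $ a * H t * exp (- \<beta> * t)) = integral {0..T} (\<lambda>s. w s * \<tau> i s $ a)"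
    if \<tau>: "\<tau> \<in> strategies" for \<tau>
  proof -
    have "(LINT t:{0..}|lborel. \<tau> i t $ a * H t * exp (- \<beta> * t)) = (LINT s:{0..T}|lborel. w s * \<tau> i s $ a)"
      unfolding set_lebesgue_integral_def
      by (intro Bochner_Integration.integral_cong)
        (auto simp: H_def exp_minus field_simps split: split_indicator)
    also have "\<dots> = integral {0..T} (\<lambda>s. w s * \<tau> i s $ a)"
      by (intro bounded_borel_on_LINT bounded_borel_on_mult w strategy_bounded_borel \<tau>) auto
    finally show ?thesis .
  qed
  ultimately show ?thesis
    by (simp add: \<pi>s \<pi>)
qed

lemma drift_expand: "drift \<pi> t p j = (\<Sum>l\<in>UNIV. \<Sum>a\<in>UNIV. (p $ l * rate G l j a p) * \<pi> l t $ a)"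
  by (simp add: drift_def drift_rate_def sum_distrib_left mult_ac)

lemma drift_bound:
  assumes "\<pi> \<in> strategies" "0 \<le> t" "p \<in> prob_simplex"
  shows "\<bar>drift \<pi> t p i\<bar> \<le> rate_max"
  unfolding drift_def by (intro abs_sum_weighted_le[OF prob_on_vec_nth] drift_rate_bound assms)

lemma l1_dist_continuous:
  assumes "continuous_on {0..} m" "continuous_on {0..} m'"
  shows "continuous_on {0..T} (\<lambda>t. l1_dist (m t) (m' t))"
  unfolding l1_dist_def
  by (intro continuous_intros continuous_on_component continuous_on_subset[OF assms(1)] continuous_on_subset[OF assms(2)]) auto

text \<open>
  The difference of the two flows is driven by itself and by the term in which only the control
  differs. The latter converges to zero at each time by weak convergence, and this is enough for
  Gronwall's inequality with a time-dependent remainder.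
\<close>

lemma population_flow_limit:
  assumes weak: "weakly_converges \<beta> \<pi>s \<pi>" and \<pi>s: "\<And>n. \<pi>s n \<in> strategies" and \<pi>: "\<pi> \<in> strategies"
    and T: "0 \<le> T"
  shows "(\<lambda>n. l1_dist (population_flow G (\<pi>s n) T) (population_flow G \<pi> T)) \<longlonglongrightarrow> 0"
proof -
  define m where "m = population_flow G \<pi>"
  define mn where "mn n = population_flow G (\<pi>s n)" for n
  have ms: "m t \<in> prob_simplex" if "0 \<le> t" for t
    using that by (simp add: m_def population_flow_simplex \<pi>)
  have mc: "continuous_on {0..} m"
    by (simp add: m_def population_flow_continuous \<pi>)
  have mnc: "continuous_on {0..} (mn n)" for n
    by (simp add: mn_def population_flow_continuous \<pi>s)
  have mns: "mn n t \<in> prob_simplex" if "0 \<le> t" for n t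
    using that by (simp add: mn_def population_flow_simplex \<pi>s)
  define u where "u n t = l1_dist (mn n t) (m t)" for n t
  define diff where "diff n j s = drift (\<pi>s n) s (m s) j - drift \<pi> s (m s) j" for n j s
  define \<rho> where "\<rho> n j t = integral {0..t} (diff n j)" for n j t
  define r where "r n t = (\<Sum>j\<in>UNIV. \<bar>\<rho> n j t\<bar>)" for n t
  define \<kappa> where "\<kappa> = rate_max + rate_lip"
  define L where "L = CARD('e) * \<kappa>"
  have \<kappa>: "0 \<le> \<kappa>"
    using rate_max(1) rate_lip(1) by (simp add: \<kappa>_def)
  have L: "0 \<le> L"
    using \<kappa> by (simp add: L_def)
  have diff_bb: "bounded_borel_on {0..t} (diff n j)" for n j t
    unfolding diff_def[abs_def] by (intro bounded_borel_on_diff drift_bounded_borel \<pi>s \<pi> mc ms)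
  have diff_int: "(diff n j has_integral \<rho> n j t) {0..t}" for n j t
    unfolding \<rho>_def by (intro integrable_integral bounded_borel_on_integrable diff_bb)
  have u_cont: "continuous_on {0..t} (u n)" for n t
    unfolding u_def[abs_def] by (intro l1_dist_continuous mnc mc)
  have main: "u n t \<le> r n t + L * integral {0..t} (u n)" if t: "0 \<le> t" for n t
  proof -
    have "\<bar>mn n t $ j - m t $ j\<bar> \<le> \<bar>\<rho> n j t\<bar> + \<kappa> * integral {0..t} (u n)" for j
    proof -
      have 1: "((\<lambda>s. drift (\<pi>s n) s (mn n s) j) has_integral (mn n t $ j - init G $ j)) {0..t}"
        using population_flow_eq[OF \<pi>s t] by (simp add: drift_def mn_def)
      have 2: "((\<lambda>s. drift \<pi> s (m s) j) has_integral (m t $ j - init G $ j)) {0..t}"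
        using population_flow_eq[OF \<pi> t] by (simp add: drift_def m_def)
      have "\<bar>(mn n t $ j - init G $ j) - (m t $ j - init G $ j) - \<rho> n j t\<bar> \<le> \<kappa> * integral {0..t} (u n)"
      proof (rule has_integral_abs_le[OF has_integral_diff[OF has_integral_diff[OF 1 2] diff_int]])
        show "((\<lambda>s. \<kappa> * u n s) has_integral (\<kappa> * integral {0..t} (u n))) {0..t}"
          by (intro has_integral_mult_right integrable_integral integrable_continuous_interval u_cont)
        fix s assume "s \<in> {0..t}"
        then have s: "0 \<le> s" by simp
        show "\<bar>drift (\<pi>s n) s (mn n s) j - drift \<pi> s (m s) j - diff n j s\<bar> \<le> \<kappa> * u n s"
          using drift_lip[OF \<pi>s s mns[OF s] ms[OF s], of n n j] by (simp add: diff_def u_def \<kappa>_def)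
      qed
      then show ?thesis by linarith
    qed
    then have "u n t \<le> (\<Sum>j\<in>UNIV. \<bar>\<rho> n j t\<bar> + \<kappa> * integral {0..t} (u n))"
      unfolding u_def l1_dist_def by (intro sum_mono)
    then show ?thesis
      by (simp add: r_def L_def sum.distrib mult.assoc)
  qed
  have r_lim: "(\<lambda>n. r n t) \<longlonglongrightarrow> 0" if t: "0 \<le> t" for t
  proof -
    have "(\<lambda>n. \<rho> n j t) \<longlonglongrightarrow> 0" for j
    proof -
      let ?w = "\<lambda>l a s. m s $ l * rate G l j a (m s)"
      have wb: "bounded_borel_on {0..t} (?w l a)" for l a
      proof (rule bounded_borel_on_continuous)
        have sub: "{0..t} \<subseteq> {0..}" by auto
        have "continuous_on {0..t} (\<lambda>s. rate G l j a (m s))"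
          by (rule continuous_on_compose2[OF rate_continuous continuous_on_subset[OF mc sub]]) (use ms in auto)
        then show "continuous_on {0..t} (?w l a)"
          by (intro continuous_on_mult continuous_on_component continuous_on_subset[OF mc sub])
      qed simp
      have wi: "((\<lambda>s. \<Sum>l\<in>UNIV. \<Sum>a\<in>UNIV. ?w l a s * \<tau> l s $ a) has_integral
          (\<Sum>l\<in>UNIV. \<Sum>a\<in>UNIV. integral {0..t} (\<lambda>s. ?w l a s * \<tau> l s $ a))) {0..t}" if "\<tau> \<in> strategies" for \<tau>
        by (intro has_integral_sum integrable_integral bounded_borel_on_integrable
            bounded_borel_on_mult[OF wb strategy_bounded_borel[OF that]]) auto
      have \<rho>_eq: "\<rho> n j t = (\<Sum>l\<in>UNIV. \<Sum>a\<in>UNIV. integral {0..t} (\<lambda>s. ?w l a s * \<pi>s n l s $ a)) -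
          (\<Sum>l\<in>UNIV. \<Sum>a\<in>UNIV. integral {0..t} (\<lambda>s. ?w l a s * \<pi> l s $ a))" for n
        unfolding \<rho>_def diff_def[abs_def] drift_expand
        by (intro integral_unique has_integral_diff wi \<pi>s \<pi>)
      have "(\<lambda>n. \<rho> n j t) \<longlonglongrightarrow> (\<Sum>l\<in>UNIV. \<Sum>a\<in>UNIV. integral {0..t} (\<lambda>s. ?w l a s * \<pi> l s $ a)) -
          (\<Sum>l\<in>UNIV. \<Sum>a\<in>UNIV. integral {0..t} (\<lambda>s. ?w l a s * \<pi> l s $ a))"
        unfolding \<rho>_eq by (intro tendsto_diff tendsto_const tendsto_sum weak_integral_limit[OF weak \<pi>s \<pi>] wb)
      then show ?thesis by simp
    qed
    then have "(\<lambda>n. \<Sum>j\<in>UNIV. \<bar>\<rho> n j t\<bar>) \<longlonglongrightarrow> (\<Sum>j\<in>(UNIV :: 'e set). \<bar>0\<bar>)"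
      by (intro tendsto_sum tendsto_rabs)
    then show ?thesis
      by (simp add: r_def)
  qed
  have r_cont: "continuous_on {0..T} (r n)" for n
    unfolding r_def[abs_def] \<rho>_def
    by (intro continuous_intros indefinite_integral_continuous_1 bounded_borel_on_integrable diff_bb)
  have r_bound: "\<bar>r n t\<bar> \<le> CARD('e) * (2 * rate_max * T)" if t: "t \<in> {0..T}" for n t
  proof -
    have "\<bar>\<rho> n j t\<bar> \<le> 2 * rate_max * T" for j
    proof -
      have "\<bar>\<rho> n j t\<bar> \<le> 2 * rate_max * (t - 0)"
      proof (rule integral_bound_const[OF diff_int])
        fix s assume "s \<in> {0..t}"
        then have s: "0 \<le> s" by simp
        show "\<bar>diff n j s\<bar> \<le> 2 * rate_max"
          using drift_bound[OF \<pi>s s ms[OF s], of n j] drift_bound[OF \<pi> s ms[OF s], of j]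
          unfolding diff_def by linarith
      qed (use t in auto)
      also have "\<dots> \<le> 2 * rate_max * T"
        using t rate_max(1) by (intro mult_left_mono) auto
      finally show ?thesis .
    qed
    then have "r n t \<le> (\<Sum>j\<in>(UNIV :: 'e set). 2 * rate_max * T)"
      unfolding r_def by (intro sum_mono)
    moreover have "0 \<le> r n t"
      unfolding r_def by (intro sum_nonneg) auto
    ultimately show ?thesis by simp
  qed
  have "(\<lambda>n. integral {0..T} (r n)) \<longlonglongrightarrow> integral {0..T} (\<lambda>_. 0)"
  proof (rule dominated_convergence(2))
    show "r n integrable_on {0..T}" for n
      by (intro integrable_continuous_interval r_cont)
    show "norm (r n t) \<le> CARD('e) * (2 * rate_max * T)" if "t \<in> {0..T}" for n t
      using r_bound[OF that] by simp
    show "(\<lambda>n. r n t) \<longlonglongrightarrow> 0" if "t \<in> {0..T}" for t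
      using that by (intro r_lim) auto
  qed auto
  then have "(\<lambda>n. r n T + L * exp (L * (T - 0)) * integral {0..T} (r n)) \<longlonglongrightarrow>
      0 + L * exp (L * (T - 0)) * integral {0..T} (\<lambda>_. 0)"
    by (intro tendsto_intros r_lim T)
  then have lim0: "(\<lambda>n. r n T + L * exp (L * (T - 0)) * integral {0..T} (r n)) \<longlonglongrightarrow> 0"
    by simp
  have "u n T \<le> r n T + L * exp (L * (T - 0)) * integral {0..T} (r n)" for n
  proof (rule gronwall[OF L u_cont _ _ _ T])
    show "r n integrable_on {0..T}"
      by (intro integrable_continuous_interval r_cont)
    show "0 \<le> r n t" for t
      unfolding r_def by (intro sum_nonneg) auto
    show "u n t \<le> r n t + L * integral {0..t} (u n)" if "t \<in> {0..T}" for t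
      using that by (intro main) auto
  qed
  then have "(\<lambda>n. u n T) \<longlonglongrightarrow> 0"
    by (intro tendsto_sandwich[OF _ _ tendsto_const lim0] always_eventually allI) (auto simp: u_def)
  then show ?thesis
    by (simp add: u_def mn_def m_def)
qed

text \<open>
  The control is fixed and the rates are Lipschitz in the population, so the distance of the two flows
  is driven by itself and by the distance of the two populations.
\<close>

lemma player_flow_limit:
  assumes mc: "continuous_on {0..} m" "\<And>n. continuous_on {0..} (mn n)"
    and ms: "\<And>t. 0 \<le> t \<Longrightarrow> m t \<in> prob_simplex" "\<And>n t. 0 \<le> t \<Longrightarrow> mn n t \<in> prob_simplex"
    and lim: "\<And>t. 0 \<le> t \<Longrightarrow> (\<lambda>n. l1_dist (mn n t) (m t)) \<longlonglongrightarrow> 0"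
    and \<pi>: "\<pi> \<in> strategies" and T: "0 \<le> T"
  shows "(\<lambda>n. l1_dist (player_flow G \<pi> (mn n) T) (player_flow G \<pi> m T)) \<longlonglongrightarrow> 0"
proof -
  define x where "x = player_flow G \<pi> m"
  define xn where "xn n = player_flow G \<pi> (mn n)" for n
  have xc1: "continuous_on {0..} x"
    unfolding x_def by (rule player_flow_continuous[OF mc(1) ms(1) \<pi>])
  have xc2: "continuous_on {0..} (xn n)" for n
    unfolding xn_def by (rule player_flow_continuous[OF mc(2) ms(2) \<pi>])
  have xs: "x t \<in> prob_simplex" if "0 \<le> t" for t
    unfolding x_def by (intro player_flow_simplex mc ms \<pi> that)
  define u where "u n t = l1_dist (mn n t) (m t)" for n t
  define e where "e n t = l1_dist (xn n t) (x t)" for n t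
  define c where "c = real CARD('e)"
  have uc: "continuous_on {0..t} (u n)" and ec: "continuous_on {0..t} (e n)" for n t
    unfolding u_def[abs_def] e_def[abs_def] by (intro l1_dist_continuous mc xc1 xc2)+
  have u0: "0 \<le> integral {0..t} (u n)" for n t
    by (rule integral_nonneg_if) (simp add: u_def)
  have bound: "e n T \<le> c * rate_lip * integral {0..T} (u n) * (1 + c * rate_max * T * exp (c * rate_max * T))" for n
  proof (rule gronwall_const[OF _ ec _ T])
    show "0 \<le> c * rate_max"
      using rate_max(1) by (simp add: c_def)
    show "0 \<le> c * rate_lip * integral {0..T} (u n)"
      using rate_lip(1) u0 by (simp add: c_def)
    fix t assume t: "t \<in> {0..T}"
    have "\<bar>xn n t $ j - x t $ j\<bar> \<le> rate_lip * integral {0..t} (u n) + rate_max * integral {0..t} (e n)" for j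
    proof -
      have 1: "((\<lambda>s. \<Sum>i\<in>UNIV. xn n s $ i * drift_rate \<pi> s (mn n s) i j) has_integral (xn n t $ j - init G $ j)) {0..t}"
        unfolding xn_def by (rule player_flow_eq[OF mc(2) ms(2) \<pi>]) (use t in auto)
      have 2: "((\<lambda>s. \<Sum>i\<in>UNIV. x s $ i * drift_rate \<pi> s (m s) i j) has_integral (x t $ j - init G $ j)) {0..t}"
        unfolding x_def by (rule player_flow_eq[OF mc(1) ms(1) \<pi>]) (use t in auto)
      have "\<bar>(xn n t $ j - init G $ j) - (x t $ j - init G $ j)\<bar> \<le>
          rate_lip * integral {0..t} (u n) + rate_max * integral {0..t} (e n)"
      proof (rule has_integral_abs_le[OF has_integral_diff[OF 1 2]])
        show "((\<lambda>s. rate_lip * u n s + rate_max * e n s) has_integral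
            (rate_lip * integral {0..t} (u n) + rate_max * integral {0..t} (e n))) {0..t}"
          by (intro has_integral_add has_integral_mult_right integrable_integral integrable_continuous_interval uc ec)
        fix s assume "s \<in> {0..t}"
        then have s: "0 \<le> s" by simp
        have "(\<Sum>i\<in>UNIV. xn n s $ i * drift_rate \<pi> s (mn n s) i j) - (\<Sum>i\<in>UNIV. x s $ i * drift_rate \<pi> s (m s) i j) =
            (\<Sum>i\<in>UNIV. (xn n s $ i - x s $ i) * drift_rate \<pi> s (mn n s) i j) +
            (\<Sum>i\<in>UNIV. x s $ i * (drift_rate \<pi> s (mn n s) i j - drift_rate \<pi> s (m s) i j))"
          unfolding sum.distrib[symmetric] sum_subtractf[symmetric] by (intro sum.cong) (auto simp: algebra_simps)
        moreover have "\<bar>\<Sum>i\<in>UNIV. (xn n s $ i - x s $ i) * drift_rate \<pi> s (mn n s) i j\<bar> \<le> rate_max * e n s"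
        proof -
          have "\<bar>\<Sum>i\<in>UNIV. (xn n s $ i - x s $ i) * drift_rate \<pi> s (mn n s) i j\<bar> \<le> (\<Sum>i\<in>UNIV. \<bar>xn n s $ i - x s $ i\<bar> * rate_max)"
            by (rule order_trans[OF sum_abs])
              (use drift_rate_bound[OF \<pi> s ms(2)[OF s]] in \<open>auto simp: abs_mult intro!: sum_mono mult_left_mono\<close>)
          then show ?thesis
            by (simp add: e_def l1_dist_def sum_distrib_left mult.commute)
        qed
        moreover have "\<bar>\<Sum>i\<in>UNIV. x s $ i * (drift_rate \<pi> s (mn n s) i j - drift_rate \<pi> s (m s) i j)\<bar> \<le> rate_lip * u n s"
          unfolding u_def
          by (intro abs_sum_weighted_le[OF prob_on_vec_nth] drift_rate_lip xs ms \<pi> s)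
        ultimately show "\<bar>(\<Sum>i\<in>UNIV. xn n s $ i * drift_rate \<pi> s (mn n s) i j) - (\<Sum>i\<in>UNIV. x s $ i * drift_rate \<pi> s (m s) i j)\<bar>
            \<le> rate_lip * u n s + rate_max * e n s"
          by linarith
      qed
      then show ?thesis by simp
    qed
    then have "e n t \<le> (\<Sum>j\<in>(UNIV :: 'e set). rate_lip * integral {0..t} (u n) + rate_max * integral {0..t} (e n))"
      unfolding e_def[of n t] l1_dist_def by (intro sum_mono)
    also have "\<dots> = c * rate_lip * integral {0..t} (u n) + c * rate_max * integral {0..t} (e n)"
      by (simp add: c_def algebra_simps)
    also have "c * rate_lip * integral {0..t} (u n) \<le> c * rate_lip * integral {0..T} (u n)"
      using t rate_lip(1)
      by (intro mult_left_mono integral_subset_le integrable_continuous_interval uc) (auto simp: c_def u_def)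
    finally show "e n t \<le> c * rate_lip * integral {0..T} (u n) + c * rate_max * integral {0..t} (e n)"
      by simp
  qed
  have "(\<lambda>n. integral {0..T} (u n)) \<longlonglongrightarrow> integral {0..T} (\<lambda>_. 0)"
  proof (rule dominated_convergence(2))
    show "u n integrable_on {0..T}" for n
      by (intro integrable_continuous_interval uc)
    show "norm (u n t) \<le> 2" if "t \<in> {0..T}" for n t
      using l1_dist_le_2[OF ms(2) ms(1), of t t n] that by (simp add: u_def)
    show "(\<lambda>n. u n t) \<longlonglongrightarrow> 0" if "t \<in> {0..T}" for t
      unfolding u_def using that by (intro lim) auto
  qed auto
  then have "(\<lambda>n. c * rate_lip * integral {0..T} (u n) * (1 + c * rate_max * T * exp (c * rate_max * T))) \<longlonglongrightarrow>
      c * rate_lip * integral {0..T} (\<lambda>_. 0) * (1 + c * rate_max * T * exp (c * rate_max * T))"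
    by (intro tendsto_intros)
  then have lim0: "(\<lambda>n. c * rate_lip * integral {0..T} (u n) * (1 + c * rate_max * T * exp (c * rate_max * T))) \<longlonglongrightarrow> 0"
    by simp
  have "(\<lambda>n. e n T) \<longlonglongrightarrow> 0"
    using bound by (intro tendsto_sandwich[OF _ _ tendsto_const lim0] always_eventually allI) (auto simp: e_def)
  then show ?thesis
    by (simp add: e_def xn_def x_def)
qed

lemma discounted_limit:
  assumes "\<And>n. F n \<in> borel_measurable (restrict_space borel {0..})" "F0 \<in> borel_measurable (restrict_space borel {0..})"
    and "\<And>n t. 0 \<le> t \<Longrightarrow> \<bar>F n t\<bar> \<le> K" and "\<And>t. 0 \<le> t \<Longrightarrow> (\<lambda>n. F n t) \<longlonglongrightarrow> F0 t"
  shows "(\<lambda>n. LINT t:{0..}|lborel. F n t * exp (- \<beta> * t)) \<longlonglongrightarrow> (LINT t:{0..}|lborel. F0 t * exp (- \<beta> * t))"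
  unfolding set_lebesgue_integral_def
proof (rule integral_dominated_convergence)
  have m: "(\<lambda>t. indicator {0..} t *\<^sub>R (F t * exp (- \<beta> * t))) \<in> borel_measurable lborel"
    if "F \<in> borel_measurable (restrict_space borel {0..})" for F :: "real \<Rightarrow> real"
  proof -
    have "(\<lambda>t. F t * exp (- \<beta> * t)) \<in> borel_measurable (restrict_space borel {0..})"
      by (intro borel_measurable_times that borel_measurable_continuous_on_restrict continuous_intros)
    from borel_measurable_indicator_times[OF this] show ?thesis by simp
  qed
  show "(\<lambda>t. indicator {0..} t *\<^sub>R (F n t * exp (- \<beta> * t))) \<in> borel_measurable lborel" for n
    by (intro m assms)
  show "(\<lambda>t. indicator {0..} t *\<^sub>R (F0 t * exp (- \<beta> * t))) \<in> borel_measurable lborel"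
    by (intro m assms)
  show "integrable lborel (\<lambda>t. K * (indicator {0..} t * exp (- \<beta> * t)))"
    by (intro integrable_mult_right integrable_exp_discount \<beta>_pos)
  show "AE t in lborel. norm (indicator {0..} t *\<^sub>R (F n t * exp (- \<beta> * t))) \<le> K * (indicator {0..} t * exp (- \<beta> * t))" for n
    using assms(3) by (intro AE_I2) (auto simp: abs_mult indicator_def intro!: mult_right_mono)
  show "AE t in lborel. (\<lambda>n. indicator {0..} t *\<^sub>R (F n t * exp (- \<beta> * t))) \<longlonglongrightarrow> indicator {0..} t *\<^sub>R (F0 t * exp (- \<beta> * t))"
  proof (rule AE_I2)
    fix t :: real
    show "(\<lambda>n. indicator {0..} t *\<^sub>R (F n t * exp (- \<beta> * t))) \<longlonglongrightarrow> indicator {0..} t *\<^sub>R (F0 t * exp (- \<beta> * t))"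
      using assms(4)[of t] by (cases "0 \<le> t") (auto intro!: tendsto_intros)
  qed
qed

context
  fixes \<pi>s :: "nat \<Rightarrow> ('e, 'a) strategy" and \<pi> :: "('e, 'a) strategy"
  assumes weak: "weakly_converges \<beta> \<pi>s \<pi>" and \<pi>s: "\<And>n. \<pi>s n \<in> strategies" and \<pi>: "\<pi> \<in> strategies"
begin

lemma population_tendsto: "0 \<le> t \<Longrightarrow> (\<lambda>n. population_flow G (\<pi>s n) t) \<longlonglongrightarrow> population_flow G \<pi> t"
  by (intro l1_dist_tendsto population_flow_limit weak \<pi>s \<pi>)

lemma cost_tendsto: "0 \<le> t \<Longrightarrow> (\<lambda>n. cost G i a (population_flow G (\<pi>s n) t)) \<longlonglongrightarrow> cost G i a (population_flow G \<pi> t)"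
  by (rule continuous_on_tendsto_compose[OF cost_continuous population_tendsto])
    (auto intro!: always_eventually population_flow_simplex \<pi> \<pi>s)

lemma mf_value_limit_fixed_player:
  assumes \<tau>: "\<tau> \<in> strategies"
  shows "(\<lambda>n. mf_value G \<tau> (\<pi>s n)) \<longlonglongrightarrow> mf_value G \<tau> \<pi>"
  unfolding mf_value_eq
proof (rule discounted_limit)
  note flows = population_flow_continuous[OF \<pi>] population_flow_simplex[OF \<pi>]
    population_flow_continuous[OF \<pi>s] population_flow_simplex[OF \<pi>s]
  let ?x = "\<lambda>\<pi>. player_flow G \<tau> (population_flow G \<pi>)"
  show "flow_cost \<tau> (population_flow G (\<pi>s n)) (?x (\<pi>s n)) \<in> borel_measurable (restrict_space borel {0..})" for n
    by (intro flow_cost_measurable \<tau> flows player_flow_continuous)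
  show "flow_cost \<tau> (population_flow G \<pi>) (?x \<pi>) \<in> borel_measurable (restrict_space borel {0..})"
    by (intro flow_cost_measurable \<tau> flows player_flow_continuous)
  show "\<bar>flow_cost \<tau> (population_flow G (\<pi>s n)) (?x (\<pi>s n)) t\<bar> \<le> cost_max" if "0 \<le> t" for n t
    by (intro flow_cost_bound \<tau> that flows player_flow_simplex)
  fix t :: real assume t: "0 \<le> t"
  have "(\<lambda>n. l1_dist (?x (\<pi>s n) t) (?x \<pi> t)) \<longlonglongrightarrow> 0"
    by (intro player_flow_limit flows population_flow_limit weak \<pi>s \<pi> \<tau> t)
  then have "(\<lambda>n. ?x (\<pi>s n) t) \<longlonglongrightarrow> ?x \<pi> t"
    by (rule l1_dist_tendsto)
  then show "(\<lambda>n. flow_cost \<tau> (population_flow G (\<pi>s n)) (?x (\<pi>s n)) t) \<longlonglongrightarrow> flow_cost \<tau> (population_flow G \<pi>) (?x \<pi>) t"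
    unfolding flow_cost_def by (intro tendsto_intros cost_tendsto t)
qed

lemma mf_value_self:
  assumes "\<tau> \<in> strategies"
  shows "mf_value G \<tau> \<tau> = (LINT t:{0..}|lborel. flow_cost \<tau> (population_flow G \<tau>) (population_flow G \<tau>) t * exp (- \<beta> * t))"
  unfolding mf_value_eq set_lebesgue_integral_def
  by (intro Bochner_Integration.integral_cong)
    (auto simp: flow_cost_def player_flow_population assms split: split_indicator)

text \<open>
  Here the controls multiply the costs and converge only weakly. The states are replaced by their
  limits first, which changes the value by a dominated sequence that tends to zero.
\<close>

lemma mf_value_limit_self: "(\<lambda>n. mf_value G (\<pi>s n) (\<pi>s n)) \<longlonglongrightarrow> mf_value G \<pi> \<pi>"
proof -
  define m where "m = population_flow G \<pi>"
  define mn where "mn n = population_flow G (\<pi>s n)" for n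
  have mc: "continuous_on {0..} m" "continuous_on {0..} (mn n)" for n
    by (simp_all add: m_def mn_def population_flow_continuous \<pi> \<pi>s)
  have ms: "m t \<in> prob_simplex" "mn n t \<in> prob_simplex" if "0 \<le> t" for n t
    using that by (simp_all add: m_def mn_def population_flow_simplex \<pi> \<pi>s)
  have i1: "set_integrable lborel {0..} (\<lambda>t. flow_cost (\<pi>s n) (mn n) (mn n) t * exp (- \<beta> * t))" for n
    by (intro discounted_integrable[of _ cost_max] flow_cost_measurable flow_cost_bound mc ms \<pi>s)
  have i2: "set_integrable lborel {0..} (\<lambda>t. flow_cost \<tau> m m t * exp (- \<beta> * t))" if "\<tau> \<in> strategies" for \<tau>
    by (intro discounted_integrable[of _ cost_max] flow_cost_measurable flow_cost_bound mc ms that)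
  have "(\<lambda>n. LINT t:{0..}|lborel. (flow_cost (\<pi>s n) (mn n) (mn n) t - flow_cost (\<pi>s n) m m t) * exp (- \<beta> * t)) \<longlonglongrightarrow>
      (LINT t:{0..}|lborel. 0 * exp (- \<beta> * t))"
  proof (rule discounted_limit)
    show "(\<lambda>t. flow_cost (\<pi>s n) (mn n) (mn n) t - flow_cost (\<pi>s n) m m t) \<in> borel_measurable (restrict_space borel {0..})" for n
      by (intro borel_measurable_diff flow_cost_measurable mc ms \<pi>s)
    show "\<bar>flow_cost (\<pi>s n) (mn n) (mn n) t - flow_cost (\<pi>s n) m m t\<bar> \<le> 2 * cost_max" if "0 \<le> t" for n t
    proof -
      have "\<bar>flow_cost (\<pi>s n) (mn n) (mn n) t\<bar> \<le> cost_max" "\<bar>flow_cost (\<pi>s n) m m t\<bar> \<le> cost_max"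
        by (intro flow_cost_bound \<pi>s ms that)+
      then show ?thesis by linarith
    qed
    fix t :: real assume t: "0 \<le> t"
    define d where "d i a n = mn n t $ i * cost G i a (mn n t) - m t $ i * cost G i a (m t)" for i a n
    have d: "(\<lambda>n. d i a n) \<longlonglongrightarrow> 0" for i a
    proof -
      have "(\<lambda>n. d i a n) \<longlonglongrightarrow> m t $ i * cost G i a (m t) - m t $ i * cost G i a (m t)"
        unfolding d_def m_def mn_def by (intro tendsto_intros population_tendsto cost_tendsto t)
      then show ?thesis by simp
    qed
    have "(\<lambda>n. \<Sum>i\<in>UNIV. \<Sum>a\<in>UNIV. \<bar>d i a n\<bar>) \<longlonglongrightarrow> (\<Sum>i\<in>(UNIV :: 'e set). \<Sum>a\<in>(UNIV :: 'a set). \<bar>0\<bar>)"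
      by (intro tendsto_sum tendsto_rabs d)
    then have dl: "(\<lambda>n. \<Sum>i\<in>UNIV. \<Sum>a\<in>UNIV. \<bar>d i a n\<bar>) \<longlonglongrightarrow> 0"
      by simp
    show "(\<lambda>n. flow_cost (\<pi>s n) (mn n) (mn n) t - flow_cost (\<pi>s n) m m t) \<longlonglongrightarrow> 0"
    proof (rule Lim_null_comparison[OF always_eventually dl], rule allI)
      fix n
      have "flow_cost (\<pi>s n) (mn n) (mn n) t - flow_cost (\<pi>s n) m m t = (\<Sum>i\<in>UNIV. \<Sum>a\<in>UNIV. d i a n * \<pi>s n i t $ a)"
        unfolding flow_cost_def d_def sum_subtractf[symmetric] left_diff_distrib ..
      also have "norm \<dots> \<le> (\<Sum>i\<in>UNIV. \<Sum>a\<in>UNIV. \<bar>d i a n\<bar>)"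
        unfolding real_norm_def
      proof (rule order_trans[OF sum_abs], rule sum_mono, rule order_trans[OF sum_abs], rule sum_mono)
        fix i a
        show "\<bar>d i a n * \<pi>s n i t $ a\<bar> \<le> \<bar>d i a n\<bar>"
          using strategy_bounds(1,2)[OF \<pi>s[of n] t, of i a] by (simp add: abs_mult mult_left_le)
      qed
      finally show "norm (flow_cost (\<pi>s n) (mn n) (mn n) t - flow_cost (\<pi>s n) m m t) \<le> (\<Sum>i\<in>UNIV. \<Sum>a\<in>UNIV. \<bar>d i a n\<bar>)" .
    qed
  qed simp
  then have diff: "(\<lambda>n. (LINT t:{0..}|lborel. flow_cost (\<pi>s n) (mn n) (mn n) t * exp (- \<beta> * t)) -
      (LINT t:{0..}|lborel. flow_cost (\<pi>s n) m m t * exp (- \<beta> * t))) \<longlonglongrightarrow> 0"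
    unfolding left_diff_distrib set_integral_diff(2)[OF i1 i2[OF \<pi>s]] by (simp add: set_lebesgue_integral_def)
  have split: "(LINT t:{0..}|lborel. flow_cost \<tau> m m t * exp (- \<beta> * t)) =
      (\<Sum>i\<in>UNIV. \<Sum>a\<in>UNIV. LINT t:{0..}|lborel. \<tau> i t $ a * (m t $ i * cost G i a (m t)) * exp (- \<beta> * t))"
    if \<tau>: "\<tau> \<in> strategies" for \<tau>
  proof -
    have ii: "set_integrable lborel {0..} (\<lambda>t. \<tau> i t $ a * (m t $ i * cost G i a (m t)) * exp (- \<beta> * t))" for i a
    proof (rule discounted_integrable[of _ cost_max])
      show "(\<lambda>t. \<tau> i t $ a * (m t $ i * cost G i a (m t))) \<in> borel_measurable (restrict_space borel {0..})"
        by (intro borel_measurable_times strategy_measurable \<tau> measurable_along cost_continuous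
            borel_measurable_continuous_on_restrict continuous_on_component mc) (use ms in auto)
      fix t :: real assume t: "0 \<le> t"
      have "\<bar>\<tau> i t $ a\<bar> * (\<bar>m t $ i\<bar> * \<bar>cost G i a (m t)\<bar>) \<le> 1 * (1 * cost_max)"
        using strategy_bounds(1,2)[OF \<tau> t, of i a] prob_simplex_bounds[OF ms(1)[OF t], of i] cost_max(2)[OF ms(1)[OF t], of i a]
        by (intro mult_mono) auto
      then show "\<bar>\<tau> i t $ a * (m t $ i * cost G i a (m t))\<bar> \<le> cost_max"
        by (simp add: abs_mult)
    qed
    have "(LINT t:{0..}|lborel. flow_cost \<tau> m m t * exp (- \<beta> * t)) =
        (\<integral>t. (\<Sum>i\<in>UNIV. \<Sum>a\<in>UNIV. indicator {0..} t *\<^sub>R (\<tau> i t $ a * (m t $ i * cost G i a (m t)) * exp (- \<beta> * t))) \<partial>lborel)"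
      unfolding set_lebesgue_integral_def flow_cost_def
      by (intro Bochner_Integration.integral_cong) (simp_all add: sum_distrib_left sum_distrib_right mult_ac)
    also have "\<dots> = (\<Sum>i\<in>UNIV. \<Sum>a\<in>UNIV. \<integral>t. indicator {0..} t *\<^sub>R (\<tau> i t $ a * (m t $ i * cost G i a (m t)) * exp (- \<beta> * t)) \<partial>lborel)"
    proof -
      have i: "integrable lborel (\<lambda>t. indicator {0..} t *\<^sub>R (\<tau> i t $ a * (m t $ i * cost G i a (m t)) * exp (- \<beta> * t)))" for i a
        using ii[of i a] by (simp add: set_integrable_def)
      show ?thesis
        by (subst Bochner_Integration.integral_sum, intro Bochner_Integration.integrable_sum i)
          (intro sum.cong refl Bochner_Integration.integral_sum i)
    qed
    finally show ?thesis
      by (simp add: set_lebesgue_integral_def)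
  qed
  have "(\<lambda>n. LINT t:{0..}|lborel. flow_cost (\<pi>s n) m m t * exp (- \<beta> * t)) \<longlonglongrightarrow> (LINT t:{0..}|lborel. flow_cost \<pi> m m t * exp (- \<beta> * t))"
    unfolding split[OF \<pi>s] split[OF \<pi>]
  proof (intro tendsto_sum)
    fix i a
    have "(\<lambda>t. m t $ i * cost G i a (m t)) \<in> borel_measurable (restrict_space borel {0..})"
      by (intro borel_measurable_times measurable_along cost_continuous
          borel_measurable_continuous_on_restrict continuous_on_component mc) (use ms in auto)
    moreover have "bounded ((\<lambda>t. m t $ i * cost G i a (m t)) ` {0..})"
    proof -
      have "\<bar>m t $ i * cost G i a (m t)\<bar> \<le> 1 * cost_max" if t: "0 \<le> t" for t
        unfolding abs_mult using prob_simplex_bounds[OF ms(1)[OF t], of i] cost_max(2)[OF ms(1)[OF t], of i a]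
        by (intro mult_mono) auto
      then show ?thesis
        by (auto simp: bounded_iff)
    qed
    ultimately show "(\<lambda>n. LINT t:{0..}|lborel. \<pi>s n i t $ a * (m t $ i * cost G i a (m t)) * exp (- \<beta> * t)) \<longlonglongrightarrow>
        (LINT t:{0..}|lborel. \<pi> i t $ a * (m t $ i * cost G i a (m t)) * exp (- \<beta> * t))"
      using weak unfolding weakly_converges_def by blast
  qed
  from tendsto_add[OF diff this] show ?thesis
    by (simp add: mf_value_self \<pi> \<pi>s m_def mn_def)
qed

end

lemma mean_field_equilibrium_is_local:
  assumes eq: "mean_field_equilibrium G \<pi>" and \<epsilon>: "0 < \<epsilon>"
  shows "\<exists>N0. \<forall>N\<ge>N0. local_equilibrium G N \<epsilon> \<pi>"
proof -
  have \<pi>: "\<pi> \<in> strategies" and opt: "\<And>\<tau>. \<tau> \<in> strategies \<Longrightarrow> mf_value G \<pi> \<pi> \<le> mf_value G \<tau> \<pi>"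
    using eq by (auto simp: mean_field_equilibrium_def)
  obtain N0 where N0: "\<forall>N\<ge>N0. \<forall>n<N. \<forall>\<pi>\<in>strategies. \<forall>\<pi>'\<in>strategies.
      \<bar>nplayer_value G N n \<pi>' \<pi> - mf_value G \<pi>' \<pi>\<bar> \<le> \<epsilon> / 2"
    using value_limit[of "\<epsilon> / 2"] \<epsilon> by auto
  have "local_equilibrium G N \<epsilon> \<pi>" if N: "N0 \<le> N" for N
    unfolding local_equilibrium_def
  proof (intro conjI allI impI ballI \<pi>)
    fix n and \<tau> :: "('e, 'a) strategy" assume n: "n < N" and \<tau>: "\<tau> \<in> strategies"
    have "\<bar>nplayer_value G N n \<pi> \<pi> - mf_value G \<pi> \<pi>\<bar> \<le> \<epsilon> / 2"
      by (rule N0[rule_format, OF N n \<pi> \<pi>])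
    moreover have "\<bar>nplayer_value G N n \<tau> \<pi> - mf_value G \<tau> \<pi>\<bar> \<le> \<epsilon> / 2"
      by (rule N0[rule_format, OF N n \<pi> \<tau>])
    ultimately show "nplayer_value G N n \<pi> \<pi> \<le> nplayer_value G N n \<tau> \<pi> + \<epsilon>"
      using opt[OF \<tau>] by linarith
  qed
  then show ?thesis by blast
qed

text \<open>
  Against a fixed competitor \<open>\<tau>\<close>, the inequality of the \<open>N\<close>-player game transfers to the mean field
  values with an error \<open>\<delta>\<close> for large \<open>N\<close>, and both sides converge.
\<close>

lemma limit_of_local_equilibria:
  fixes \<pi>s :: "nat \<Rightarrow> ('e, 'a) strategy"
  assumes eq: "\<And>k. local_equilibrium G (Ns k) (\<epsilon> k) (\<pi>s k)" and Ns: "\<And>k. 1 \<le> Ns k"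
    and lims: "filterlim Ns at_top sequentially" "\<epsilon> \<longlonglongrightarrow> 0"
    and weak: "weakly_converges \<beta> \<pi>s \<pi>" and \<pi>: "\<pi> \<in> strategies"
  shows "mean_field_equilibrium G \<pi>"
  unfolding mean_field_equilibrium_def
proof (intro conjI ballI \<pi>)
  have \<pi>s: "\<pi>s k \<in> strategies" for k
    using eq by (simp add: local_equilibrium_def)
  fix \<tau> :: "('e, 'a) strategy" assume \<tau>: "\<tau> \<in> strategies"
  show "mf_value G \<pi> \<pi> \<le> mf_value G \<tau> \<pi>"
  proof (rule field_le_epsilon)
    fix \<delta> :: real assume \<delta>: "0 < \<delta>"
    obtain N0 where N0: "\<forall>N\<ge>N0. \<forall>n<N. \<forall>\<pi>\<in>strategies. \<forall>\<pi>'\<in>strategies.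
        \<bar>nplayer_value G N n \<pi>' \<pi> - mf_value G \<pi>' \<pi>\<bar> \<le> \<delta> / 2"
      using value_limit[of "\<delta> / 2"] \<delta> by auto
    have "\<forall>\<^sub>F k in sequentially. N0 \<le> Ns k"
      using lims(1) by (simp add: filterlim_at_top)
    then have le: "\<forall>\<^sub>F k in sequentially. mf_value G (\<pi>s k) (\<pi>s k) \<le> mf_value G \<tau> (\<pi>s k) + \<epsilon> k + \<delta>"
    proof eventually_elim
      case (elim k)
      have n: "0 < Ns k"
        using Ns[of k] by simp
      have "\<bar>nplayer_value G (Ns k) 0 (\<pi>s k) (\<pi>s k) - mf_value G (\<pi>s k) (\<pi>s k)\<bar> \<le> \<delta> / 2"
        by (rule N0[rule_format, OF elim n \<pi>s \<pi>s])
      moreover have "\<bar>nplayer_value G (Ns k) 0 \<tau> (\<pi>s k) - mf_value G \<tau> (\<pi>s k)\<bar> \<le> \<delta> / 2"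
        by (rule N0[rule_format, OF elim n \<pi>s \<tau>])
      moreover have "nplayer_value G (Ns k) 0 (\<pi>s k) (\<pi>s k) \<le> nplayer_value G (Ns k) 0 \<tau> (\<pi>s k) + \<epsilon> k"
        using eq[of k] n \<tau> by (simp add: local_equilibrium_def)
      ultimately show ?case by linarith
    qed
    have "(\<lambda>k. mf_value G \<tau> (\<pi>s k) + \<epsilon> k + \<delta>) \<longlonglongrightarrow> mf_value G \<tau> \<pi> + 0 + \<delta>"
      by (intro tendsto_intros mf_value_limit_fixed_player weak \<pi>s \<pi> \<tau> lims)
    from tendsto_le[OF _ this mf_value_limit_self[OF weak \<pi>s \<pi>] le]
    show "mf_value G \<pi> \<pi> \<le> mf_value G \<tau> \<pi> + \<delta>"
      by simp
  qed
qed

end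

theorem theorem2:
  fixes G :: "('e::finite, 'a::finite) mfg"
  assumes "mean_field_game G"
    and "\<And>i j a. \<exists>L. L-lipschitz_on prob_simplex (rate G i j a)"
    and "\<And>i a. continuous_on prob_simplex (cost G i a)"
  shows "(\<forall>\<pi>. mean_field_equilibrium G \<pi> \<longrightarrow>
            (\<forall>\<epsilon>>0. \<exists>N0. \<forall>N\<ge>N0. local_equilibrium G N \<epsilon> \<pi>)) \<and>
         (\<forall>(\<pi>s :: nat \<Rightarrow> ('e, 'a) strategy) (\<epsilon> :: nat \<Rightarrow> real).
            (\<forall>N\<ge>1. 0 \<le> \<epsilon> N \<and> local_equilibrium G N (\<epsilon> N) (\<pi>s N)) \<and> \<epsilon> \<longlonglongrightarrow> 0 \<longrightarrow>
            (\<forall>r :: nat \<Rightarrow> nat. strict_mono r \<longrightarrow>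
               (\<exists>(r' :: nat \<Rightarrow> nat) \<pi>. strict_mono r' \<and> mean_field_equilibrium G \<pi> \<and>
                  weakly_converges (discount G) (\<pi>s \<circ> r \<circ> r') \<pi>)))"
proof -
  interpret lipschitz_mfg G
    by standard (fact assms)+
  show ?thesis
  proof (intro conjI allI impI, goal_cases)
    case (1 \<pi> \<epsilon>)
    then show ?case
      by (rule mean_field_equilibrium_is_local)
  next
    case (2 \<pi>s \<epsilon> r)
    then have eq: "\<And>N. 1 \<le> N \<Longrightarrow> local_equilibrium G N (\<epsilon> N) (\<pi>s N)" and \<epsilon>: "\<epsilon> \<longlonglongrightarrow> 0"
      and r: "strict_mono r"
      by auto
    (* index 0 is skipped: nothing is known about the strategy with number 0 *)
    have pos: "1 \<le> r (Suc k)" for k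
      using strict_mono_imp_increasing[OF r, of "Suc k"] by simp
    have "(\<pi>s \<circ> r \<circ> Suc) k \<in> strategies" for k
      using eq[OF pos[of k]] by (simp add: local_equilibrium_def)
    then obtain s \<pi> where s: "strict_mono (s :: nat \<Rightarrow> nat)" and \<pi>: "\<pi> \<in> strategies"
      and weak: "weakly_converges \<beta> ((\<pi>s \<circ> r \<circ> Suc) \<circ> s) \<pi>"
      using strategies_weakly_compact by blast
    have Ns: "strict_mono (\<lambda>k. r (Suc (s k)))"
      using r s by (simp add: strict_mono_def)
    have "mean_field_equilibrium G \<pi>"
    proof (rule limit_of_local_equilibria[OF _ _ _ _ weak \<pi>])
      show "local_equilibrium G (r (Suc (s k))) (\<epsilon> (r (Suc (s k)))) (((\<pi>s \<circ> r \<circ> Suc) \<circ> s) k)" for k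
        using eq[OF pos] by simp
      show "filterlim (\<lambda>k. r (Suc (s k))) at_top sequentially"
        by (rule filterlim_subseq[OF Ns])
      show "(\<lambda>k. \<epsilon> (r (Suc (s k)))) \<longlonglongrightarrow> 0"
        using LIMSEQ_subseq_LIMSEQ[OF \<epsilon> Ns] by (simp add: o_def)
    qed (rule pos)
    moreover have "strict_mono (Suc \<circ> s)"
      using s by (simp add: strict_mono_def)
    ultimately show ?case
      using weak by (intro exI[of _ "Suc \<circ> s"] exI[of _ \<pi>]) (simp add: o_assoc)
  qed
qed

end
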